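(* Let $\rho>0$ and let $\delta_\rho$ be the hyperbolic metric on a Harnack part $\Delta$ of $[\mathcal C_\rho]^{\prec0}$. Then the following properties hold: (i) $\delta_\rho$ is complete on $\Delta$; (ii) the $\delta_\rho$-topology is stronger than the $d_K$-topology on $\Delta$; (iii) the $\delta_\rho$-topology, the $d_K$-topology, and the operator norm topology coincide on $[\mathcal C_\rho]_{<1}$; (iv) $[\mathcal C_\rho]_{<1}$ is complete relative to the hyperbolic metric, but not complete with respect to the Carathéodory metric $d_K$ and not complete with respect to the operator norm metric.
   Context: Let $n\ge1$ and let $\mathcal H$ and $\mathcal K$ be infinite-dimensional complex Hilbert spaces. $\mathbb F_n^+$ is the unital free semigroup on generators $g_1,\ldots,g_n$ with identity $g_0$; $|\alpha|$ is the length of $\alpha$. $X_\alpha:=X_{i_1}\cdots X_{i_k}$ if $\alpha=g_{i_1}\cdots g_{i_k}$, $X_{g_0}:=I$. $\mathcal C_\rho\subset B(\mathcal H)^n$ is the set of $T$ for which there exist a Hilbert space $\mathcal G\supseteq\mathcal H$ and isometries $V_1,\ldots,V_n\in B(\mathcal G)$ with mutually orthogonal ranges such that $T_\alpha=\rho P_{\mathcal H}V_\alpha|_{\mathcal H}$ for all $\alpha\ne g_0$. $\omega_\rho(T):=\inf\{t>0:\frac1tT\in\mathcal C_\rho\}$, $[\mathcal C_\rho]_{<1}:=\{X\in B(\mathcal H)^n:\omega_\rho(X)<1\}$. The joint spectral radius is $r(X):=\lim_{k\to\infty}\|\sum_{|\alpha|=k}X_\alpha X_\alpha^*\|^{1/2k}$;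 $[\mathcal C_\infty]_{<1}:=\{X\in B(\mathcal H)^n:r(X)<1\}$, and $[\mathcal C_\rho]^{\prec0}:=\mathcal C_\rho\cap[\mathcal C_\infty]_{<1}$. The operator norm on $B(\mathcal H)^n$ is $\|X\|=\|\sum_iX_iX_i^*\|^{1/2}$. Call a noncommutative polynomial $p\in\mathbb C[X_1,\ldots,X_n]\otimes M_m$ ($m\in\mathbb N$) satisfying $\Re p(X):=\frac12(p(X)^*+p(X))\ge0$ for all $X\in B(\mathcal K)^n$ with $\|\sum_iX_iX_i^*\|<1$ a polynomial with $\Re p\ge0$; $p(A)=\sum_\alpha A_\alpha\otimes M_\alpha$ for $p=\sum_\alpha X_\alpha\otimes M_\alpha$. Harnack domination: for $A,B\in\mathcal C_\rho$ and $c>0$, $A\overset{H}{\underset c\prec}B$ means $\Re p(A)+(\rho-1)\Re p(0)\le c^2[\Re p(B)+(\rho-1)\Re p(0)]$ for every polynomial with $\Re p\ge0$. $A\overset{H}{\underset c\sim}B$ means $A\overset{H}{\underset c\prec}B$ and $B\overset{H}{\underset c\prec}A$; $A\overset{H}{\sim}B$ means this holds for some $c\ge1$. Equivalence classes of $\overset{H}{\sim}$ in $\mathcal C_\rho$ are the Harnack parts; a Harnack part of $[\mathcal C_\rho]^{\prec0}$ is one contained in $[\mathcal C_\rho]^{\prec0}$ (this set is a union of Harnack parts, and $[\mathcal C_\rho]_{<1}\subset[\mathcal C_\rho]^{\prec0}$ is the Harnack part containing $0$). The hyperbolic metric on a Harnack part is $\delta_\rho(A,B):=\ln\inf\{c>1:A\overset{H}{\underset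 c\sim}B\}$. The Carathéodory metric on $[\mathcal C_\infty]_{<1}$ is $d_K(A,B):=\sup_p\|\Re p(A)-\Re p(B)\|$, the supremum over all polynomials with $\Re p\ge0$ and $\Re p(0)=I$. "Stronger" means finer (not necessarily strictly). *)

theory Defs
  imports "HOL-Analysis.Analysis"
begin

section \<open>Complex Hilbert spaces\<close>

text \<open>The class extends \<^class>\<open>real_inner\<close>, so that the norm, the topology and the bounded
  operators of the library are available; the real inner product is the real part of the complex
  one, which is linear in its first argument.\<close>

class complex_inner_space = real_inner +
  fixes scaleC :: "complex \<Rightarrow> 'a \<Rightarrow> 'a"  (infixr "*\<^sub>C" 75)
    and cinner :: "'a \<Rightarrow> 'a \<Rightarrow> complex"
  assumes scaleC_add_right: "c *\<^sub>C (x + y) = c *\<^sub>C x + c *\<^sub>C y"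
    and scaleC_add_left: "(c + d) *\<^sub>C x = c *\<^sub>C x + d *\<^sub>C x"
    and scaleC_scaleC: "c *\<^sub>C (d *\<^sub>C x) = (c * d) *\<^sub>C x"
    and scaleC_of_real: "complex_of_real t *\<^sub>C x = t *\<^sub>R x"
    and cinner_commute: "cinner x y = cnj (cinner y x)"
    and cinner_add_left: "cinner (x + y) z = cinner x z + cinner y z"
    and cinner_scaleC_left: "cinner (c *\<^sub>C x) y = c * cinner x y"
    and inner_eq_Re_cinner: "inner x y = Re (cinner x y)"

class complex_hilbert_space = complex_inner_space + complete_space

instance complex_hilbert_space \<subseteq> banach ..

definition infinite_dimensional :: "'h::complex_inner_space itself \<Rightarrow> bool" where
  "infinite_dimensional _ \<longleftrightarrow>
     (\<nexists>B :: 'h set. finite B \<and> module.span scaleC B = UNIV)"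

lemma vector_space_scaleC: "vector_space (scaleC :: complex \<Rightarrow> 'h::complex_inner_space \<Rightarrow> 'h)"
proof
  fix x :: 'h
  show "1 *\<^sub>C x = x"
    using scaleC_of_real[of 1 x] by simp
qed (simp_all add: scaleC_add_right scaleC_add_left scaleC_scaleC)

lemma cinner_add_right:
  "cinner x (y + z) = cinner x y + cinner x (z :: 'h::complex_inner_space)"
  by (metis cinner_add_left cinner_commute complex_cnj_add)

lemma cinner_scaleC_right:
  "cinner x (c *\<^sub>C y) = cnj c * cinner x (y :: 'h::complex_inner_space)"
  by (metis cinner_scaleC_left cinner_commute complex_cnj_mult)

lemma cinner_self: "cinner x x = complex_of_real ((norm (x :: 'h::complex_inner_space))\<^sup>2)"
proof (rule complex_eqI)
  show "Re (cinner x x) = Re (complex_of_real ((norm x)\<^sup>2))"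
    by (simp add: inner_eq_Re_cinner[symmetric] power2_norm_eq_inner)
  have "Im (cinner x x) = - Im (cinner x x)"
    using arg_cong[OF cinner_commute[of x x], of Im] by simp
  then show "Im (cinner x x) = Im (complex_of_real ((norm x)\<^sup>2))"
    by simp
qed

lemma norm_scaleC: "norm (c *\<^sub>C x) = cmod c * norm (x :: 'h::complex_inner_space)"
proof -
  have "complex_of_real ((norm (c *\<^sub>C x))\<^sup>2) = complex_of_real ((cmod c * norm x)\<^sup>2)"
    unfolding cinner_self[symmetric] cinner_scaleC_left cinner_scaleC_right
    by (simp only: cinner_self power_mult_distrib of_real_mult complex_norm_square mult_ac)
  then have "(norm (c *\<^sub>C x))\<^sup>2 = (cmod c * norm x)\<^sup>2"
    using of_real_eq_iff by blast
  then show ?thesis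
    by (simp add: power2_eq_iff_nonneg)
qed

lemma scaleC_minus1: "(-1) *\<^sub>C x = - (x :: 'h::complex_inner_space)"
  using scaleC_of_real[of "-1" x] by simp

lemma cinner_minus_left: "cinner (- x) y = - cinner x (y :: 'h::complex_inner_space)"
  using cinner_scaleC_left[of "-1" x y] by (simp add: scaleC_minus1)

lemma cinner_diff_left: "cinner (x - z) y = cinner x y - cinner z (y :: 'h::complex_inner_space)"
  using cinner_add_left[of x "- z" y] by (simp add: cinner_minus_left)

lemma cinner_minus_right: "cinner y (- x) = - cinner y (x :: 'h::complex_inner_space)"
  by (metis cinner_commute cinner_minus_left complex_cnj_minus)

lemma cinner_diff_right: "cinner y (x - z) = cinner y x - cinner y (z :: 'h::complex_inner_space)"
  using cinner_add_right[of y x "- z"] by (simp add: cinner_minus_right)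

lemma cinner_ext:
  assumes "\<And>z. cinner z x = cinner z (y :: 'h::complex_inner_space)"
  shows "x = y"
proof -
  have "cinner (x - y) (x - y) = 0"
    using assms[of "x - y"] by (simp add: cinner_diff_right)
  then show ?thesis
    by (simp add: cinner_self)
qed

lemma bounded_linear_scaleC: "bounded_linear (\<lambda>x :: 'h::complex_inner_space. c *\<^sub>C x)"
proof (rule bounded_linear_intro[where K = "cmod c"])
  show "c *\<^sub>C (r *\<^sub>R x) = r *\<^sub>R (c *\<^sub>C x)" for r and x :: 'h
    unfolding scaleC_of_real[symmetric] scaleC_scaleC by (simp add: mult.commute)
qed (simp_all add: scaleC_add_right norm_scaleC mult.commute)


section \<open>Bounded operators and adjoints\<close>

text \<open>The type of bounded linear functions of the library consists of the real linear ones.\<close>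

definition complex_linear :: "('h::complex_inner_space \<Rightarrow>\<^sub>L 'h) \<Rightarrow> bool" where
  "complex_linear A \<longleftrightarrow> (\<forall>c x. A (c *\<^sub>C x) = c *\<^sub>C A x)"

definition BH :: "('n \<Rightarrow> ('h::complex_inner_space \<Rightarrow>\<^sub>L 'h)) set" where
  "BH = {X. \<forall>i. complex_linear (X i)}"

lift_definition scaleC_op ::
  "complex \<Rightarrow> ('h::complex_inner_space \<Rightarrow>\<^sub>L 'h) \<Rightarrow> ('h \<Rightarrow>\<^sub>L 'h)"
  is "\<lambda>c A x. c *\<^sub>C A x"
  by (rule bounded_linear_compose[OF bounded_linear_scaleC])

definition adj :: "('h::complex_hilbert_space \<Rightarrow>\<^sub>L 'h) \<Rightarrow> ('h \<Rightarrow>\<^sub>L 'h)" where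
  "adj A = (THE B :: 'h \<Rightarrow>\<^sub>L 'h. \<forall>x y. cinner (A x) y = cinner x (B y))"

lemma riesz_real:
  fixes f :: "'h::{real_inner,complete_space} \<Rightarrow> real"
  assumes "bounded_linear f"
  shows "\<exists>z. \<forall>x. f x = inner x z"
proof -
  interpret f: bounded_linear f by fact
  obtain K where K: "K > 0" "\<And>x. norm (f x) \<le> norm x * K"
    using f.pos_bounded by auto
  define q where "q = (\<lambda>x. (norm x)\<^sup>2 - 2 * f x)"
  have q_lower: "- (K\<^sup>2) \<le> q x" for x
  proof -
    have "f x \<le> norm x * K" using K(2)[of x] by auto
    moreover have "0 \<le> (norm x - K)\<^sup>2" by simp
    ultimately show ?thesis
      unfolding q_def by (simp add: power2_diff)
  qed
  define d where "d = Inf (range q)"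
  have bdd: "bdd_below (range q)"
    using q_lower by (intro bdd_belowI[of _ "- (K\<^sup>2)"]) auto
  have d_le: "d \<le> q x" for x
    unfolding d_def using bdd by (simp add: cInf_lower)
  have "\<exists>x. q x < d + inverse (real (Suc n))" for n
  proof (rule ccontr)
    assume "\<nexists>x. q x < d + inverse (real (Suc n))"
    then have "d + inverse (real (Suc n)) \<le> Inf (range q)"
      by (intro cInf_greatest) (auto simp: not_less)
    then show False unfolding d_def by simp
  qed
  then obtain s where s: "\<And>n. q (s n) < d + inverse (real (Suc n))"
    by metis
  have par: "(norm (x - y))\<^sup>2 = 2 * q x + 2 * q y - 4 * q ((1/2) *\<^sub>R (x + y))" for x y
    unfolding q_def power2_norm_eq_inner
    by (simp add: f.add f.scaleR inner_add_left inner_add_right inner_diff_left inner_diff_right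
        inner_commute algebra_simps)
  have close: "(norm (s m - s n))\<^sup>2 < 2 * inverse (real (Suc m)) + 2 * inverse (real (Suc n))" for m n
    using par[of "s m" "s n"] s[of m] s[of n] d_le[of "(1/2) *\<^sub>R (s m + s n)"] by linarith
  have "Cauchy s"
  proof (rule metric_CauchyI)
    fix e :: real assume e: "e > 0"
    obtain N where N: "inverse (real (Suc N)) < e\<^sup>2 / 4"
      using reals_Archimedean[of "e\<^sup>2 / 4"] e by auto
    show "\<exists>M. \<forall>m\<ge>M. \<forall>n\<ge>M. dist (s m) (s n) < e"
    proof (intro exI allI impI)
      fix m n assume "m \<ge> N" "n \<ge> N"
      then have "inverse (real (Suc m)) \<le> inverse (real (Suc N))"
        "inverse (real (Suc n)) \<le> inverse (real (Suc N))"
        by (simp_all add: le_imp_inverse_le)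
      then have "(norm (s m - s n))\<^sup>2 < e\<^sup>2"
        using close[of m n] N by linarith
      then show "dist (s m) (s n) < e"
        using e by (simp add: dist_norm power_less_imp_less_base)
    qed
  qed
  then obtain z where z: "s \<longlonglongrightarrow> z"
    using Cauchy_convergent convergent_def by blast
  have "(\<lambda>n. q (s n)) \<longlonglongrightarrow> q z"
    unfolding q_def by (intro tendsto_intros f.tendsto z)
  moreover have "(\<lambda>n. d + inverse (real (Suc n))) \<longlonglongrightarrow> d + 0"
    by (intro tendsto_intros LIMSEQ_inverse_real_of_nat)
  ultimately have "q z \<le> d + 0"
    by (rule LIMSEQ_le) (use s in \<open>auto intro: less_imp_le\<close>)
  then have qz: "q z \<le> d" by simp
  have "f x = inner x z" for x
  proof -
    define b where "b = inner x z - f x"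
    have *: "0 \<le> t\<^sup>2 * (norm x)\<^sup>2 + 2 * t * b" for t
    proof -
      have "q z \<le> q (z + t *\<^sub>R x)"
        using qz d_le order_trans by blast
      then show ?thesis
        unfolding q_def b_def power2_norm_eq_inner
        by (simp add: f.add f.scaleR inner_add_left inner_add_right inner_commute
            power2_eq_square algebra_simps)
    qed
    show ?thesis
    proof (cases "x = 0")
      case False
      define N where "N = (norm x)\<^sup>2"
      have n: "N > 0" using False by (simp add: N_def)
      have "(- b / N)\<^sup>2 * N + 2 * (- b / N) * b = - (b\<^sup>2 / N)"
        using n by (simp add: power2_eq_square field_simps)
      then have "b\<^sup>2 / N \<le> 0"
        using *[of "- b / N"] by (simp add: N_def)
      then have "b = 0"
        using n by (simp add: divide_le_0_iff)
      then show ?thesis unfolding b_def by simp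
    qed (simp add: f.zero)
  qed
  then show ?thesis by blast
qed

lemma riesz_complex:
  fixes f :: "'h::complex_hilbert_space \<Rightarrow> complex"
  assumes f: "bounded_linear f" and fC: "\<And>c x. f (c *\<^sub>C x) = c * f x"
  shows "\<exists>z. \<forall>x. f x = cinner x z"
proof -
  have "bounded_linear (\<lambda>x. Re (f x))"
    by (rule bounded_linear_compose[OF bounded_linear_Re f])
  then obtain z where z: "\<And>x. Re (f x) = inner x z"
    using riesz_real by blast
  have "f x = cinner x z" for x
  proof (rule complex_eqI)
    show "Re (f x) = Re (cinner x z)"
      using z by (simp add: inner_eq_Re_cinner)
    show "Im (f x) = Im (cinner x z)"
      using z[of "\<i> *\<^sub>C x"] by (simp add: inner_eq_Re_cinner fC cinner_scaleC_left)
  qed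
  then show ?thesis by blast
qed

lemma adj_eq:
  fixes A :: "'h::complex_hilbert_space \<Rightarrow>\<^sub>L 'h"
  assumes "complex_linear A"
  shows "cinner (A x) y = cinner x (adj A y)"
proof -
  have ex: "\<exists>z. \<forall>x. cinner (A x) y = cinner x z" for y
  proof (rule riesz_complex)
    show "bounded_linear (\<lambda>x. cinner (A x) y)"
    proof (rule bounded_linear_intro[where K = "norm A * norm y"])
      fix x
      have cs: "cmod (cinner u v) \<le> norm u * norm v" for u v :: 'h
      proof -
        obtain c where c: "cmod c = 1" "c * cinner u v = complex_of_real (cmod (cinner u v))"
        proof (cases "cinner u v = 0")
          case True then show ?thesis using that[of 1] by simp
        next
          case False
          let ?c = "cnj (cinner u v) / complex_of_real (cmod (cinner u v))"
          have "cmod ?c = 1" using False by (simp add: norm_divide)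
          moreover have "?c * cinner u v = complex_of_real (cmod (cinner u v))"
            using False
            by (simp add: complex_norm_square[symmetric] power2_eq_square mult.commute)
          ultimately show ?thesis using that by blast
        qed
        have "cmod (cinner u v) = inner (c *\<^sub>C u) v"
          by (simp add: inner_eq_Re_cinner cinner_scaleC_left c(2))
        also have "\<dots> \<le> norm (c *\<^sub>C u) * norm v"
          by (rule norm_cauchy_schwarz)
        finally show ?thesis by (simp add: norm_scaleC c(1))
      qed
      have "cmod (cinner (A x) y) \<le> norm (A x) * norm y" by (rule cs)
      also have "\<dots> \<le> (norm A * norm x) * norm y"
        by (intro mult_right_mono norm_blinfun) simp
      finally show "norm (cinner (A x) y) \<le> norm x * (norm A * norm y)"
        by (simp add: mult_ac)
    next
      fix r :: real and x
      show "cinner (A (r *\<^sub>R x)) y = r *\<^sub>R cinner (A x) y"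
        unfolding blinfun.scaleR_right unfolding scaleC_of_real[symmetric] cinner_scaleC_left
        by (simp add: scaleR_conv_of_real)
    qed (simp add: blinfun.add_right cinner_add_left)
    show "cinner (A (c *\<^sub>C x)) y = c * cinner (A x) y" for c x
      using assms by (simp add: complex_linear_def cinner_scaleC_left)
  qed
  then obtain B where B: "\<And>x y. cinner (A x) y = cinner x (B y)"
    by metis
  have "bounded_linear B"
  proof (rule bounded_linear_intro[where K = "norm A"])
    show "B (y + z) = B y + B z" for y z
      by (rule cinner_ext) (simp add: B[symmetric] cinner_add_right)
    show "B (r *\<^sub>R y) = r *\<^sub>R B y" for r y
      by (rule cinner_ext)
        (simp add: B[symmetric] scaleC_of_real[symmetric] cinner_scaleC_right)
    show "norm (B y) \<le> norm y * norm A" for y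
    proof (cases "B y = 0")
      case False
      have "(norm (B y))\<^sup>2 = inner (A (B y)) y"
        by (simp add: inner_eq_Re_cinner B power2_norm_eq_inner)
      also have "\<dots> \<le> norm (A (B y)) * norm y" by (rule norm_cauchy_schwarz)
      also have "\<dots> \<le> (norm A * norm (B y)) * norm y"
        by (intro mult_right_mono norm_blinfun) simp
      finally have "norm (B y) * norm (B y) \<le> norm (B y) * (norm y * norm A)"
        by (simp add: power2_eq_square mult_ac)
      then show ?thesis using False by simp
    qed simp
  qed
  then have B': "\<forall>x y. cinner (A x) y = cinner x (Blinfun B y)"
    by (simp add: B bounded_linear_Blinfun_apply)
  have "\<forall>x y. cinner (A x) y = cinner x (adj A y)"
    unfolding adj_def
  proof (rule theI[where P = "\<lambda>B :: 'h \<Rightarrow>\<^sub>L 'h. \<forall>x y. cinner (A x) y = cinner x (B y)", OF B'])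
    fix C :: "'h \<Rightarrow>\<^sub>L 'h" assume "\<forall>x y. cinner (A x) y = cinner x (C y)"
    then show "C = Blinfun B"
      using B' by (intro blinfun_eqI cinner_ext) metis
  qed
  then show ?thesis by blast
qed


section \<open>Tuples of operators\<close>

text \<open>The index type \<open>'n\<close> has \<open>n\<close> elements, and words over \<open>'n\<close> form the free
  semigroup on the \<open>n\<close> generators, with the empty word as identity.\<close>

definition word_op :: "('n \<Rightarrow> ('h::real_normed_vector \<Rightarrow>\<^sub>L 'h)) \<Rightarrow> 'n list \<Rightarrow> ('h \<Rightarrow>\<^sub>L 'h)" where
  "word_op X \<alpha> = foldr (\<lambda>i Y. X i o\<^sub>L Y) \<alpha> id_blinfun"

definition row_norm :: "('n::finite \<Rightarrow> ('h::complex_hilbert_space \<Rightarrow>\<^sub>L 'h)) \<Rightarrow> real" where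
  "row_norm X = sqrt (norm (\<Sum>i\<in>UNIV. X i o\<^sub>L adj (X i)))"

definition row_dist ::
  "('n::finite \<Rightarrow> ('h::complex_hilbert_space \<Rightarrow>\<^sub>L 'h)) \<Rightarrow> ('n \<Rightarrow> ('h \<Rightarrow>\<^sub>L 'h)) \<Rightarrow> real" where
  "row_dist X Y = row_norm (\<lambda>i. X i - Y i)"

definition joint_spectral_radius ::
  "('n::finite \<Rightarrow> ('h::complex_hilbert_space \<Rightarrow>\<^sub>L 'h)) \<Rightarrow> real" where
  "joint_spectral_radius X =
     lim (\<lambda>k. root (2 * k) (norm (\<Sum>\<alpha> | length \<alpha> = k. word_op X \<alpha> o\<^sub>L adj (word_op X \<alpha>))))"

definition C_infinity :: "('n::finite \<Rightarrow> ('h::complex_hilbert_space \<Rightarrow>\<^sub>L 'h)) set" where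
  "C_infinity = {X \<in> BH. joint_spectral_radius X < 1}"


section \<open>The classes \<open>C\<^sub>\<rho>\<close>\<close>

text \<open>Hilbert spaces whose elements are complex functions on \<open>'s\<close>, with pointwise
  operations and an arbitrary inner product.\<close>

locale hilbert_function_space =
  fixes G :: "('s \<Rightarrow> complex) set"
    and ip :: "('s \<Rightarrow> complex) \<Rightarrow> ('s \<Rightarrow> complex) \<Rightarrow> complex"
  assumes zero_mem: "(\<lambda>s. 0) \<in> G"
    and add_mem: "f \<in> G \<Longrightarrow> g \<in> G \<Longrightarrow> (\<lambda>s. f s + g s) \<in> G"
    and scale_mem: "f \<in> G \<Longrightarrow> (\<lambda>s. c * f s) \<in> G"
    and ip_commute: "f \<in> G \<Longrightarrow> g \<in> G \<Longrightarrow> ip f g = cnj (ip g f)"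
    and ip_add_left: "f \<in> G \<Longrightarrow> g \<in> G \<Longrightarrow> h \<in> G \<Longrightarrow> ip (\<lambda>s. f s + g s) h = ip f h + ip g h"
    and ip_scale_left: "f \<in> G \<Longrightarrow> g \<in> G \<Longrightarrow> ip (\<lambda>s. c * f s) g = c * ip f g"
    and ip_pos: "f \<in> G \<Longrightarrow> f \<noteq> (\<lambda>s. 0) \<Longrightarrow> 0 < Re (ip f f)"
    and complete:
      "(\<And>n. \<sigma> n \<in> G) \<Longrightarrow>
       (\<And>e. e > 0 \<Longrightarrow> \<exists>N. \<forall>k\<ge>N. \<forall>l\<ge>N.
          sqrt (Re (ip (\<lambda>s. \<sigma> k s - \<sigma> l s) (\<lambda>s. \<sigma> k s - \<sigma> l s))) < e) \<Longrightarrow>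
       \<exists>f\<in>G. (\<lambda>k. sqrt (Re (ip (\<lambda>s. \<sigma> k s - f s) (\<lambda>s. \<sigma> k s - f s)))) \<longlonglongrightarrow> 0"

text \<open>\<open>V\<close> is a tuple of isometries with mutually orthogonal ranges on \<open>G\<close>, \<open>J\<close> is the
  (isometric) inclusion of \<open>'h\<close> into \<open>G\<close>, and \<open>P\<close>, the adjoint of \<open>J\<close>, is the orthogonal
  projection of \<open>G\<close> onto \<open>'h\<close>.\<close>

definition isometric_dilation ::
  "real \<Rightarrow> ('n \<Rightarrow> ('h::complex_hilbert_space \<Rightarrow>\<^sub>L 'h)) \<Rightarrow>
   ('s \<Rightarrow> complex) set \<Rightarrow> (('s \<Rightarrow> complex) \<Rightarrow> ('s \<Rightarrow> complex) \<Rightarrow> complex) \<Rightarrow>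
   ('h \<Rightarrow> ('s \<Rightarrow> complex)) \<Rightarrow> (('s \<Rightarrow> complex) \<Rightarrow> 'h) \<Rightarrow>
   ('n \<Rightarrow> ('s \<Rightarrow> complex) \<Rightarrow> ('s \<Rightarrow> complex)) \<Rightarrow> bool" where
  "isometric_dilation \<rho> T G ip J P V \<longleftrightarrow>
     hilbert_function_space G ip \<and>
     (\<forall>x. J x \<in> G) \<and>
     (\<forall>x y. J (x + y) = (\<lambda>s. J x s + J y s)) \<and>
     (\<forall>c x. J (c *\<^sub>C x) = (\<lambda>s. c * J x s)) \<and>
     (\<forall>x y. ip (J x) (J y) = cinner x y) \<and>
     (\<forall>f\<in>G. \<forall>x. cinner (P f) x = ip f (J x)) \<and>
     (\<forall>i. \<forall>f\<in>G. V i f \<in> G) \<and>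
     (\<forall>i. \<forall>f\<in>G. \<forall>g\<in>G. V i (\<lambda>s. f s + g s) = (\<lambda>s. V i f s + V i g s)) \<and>
     (\<forall>i c. \<forall>f\<in>G. V i (\<lambda>s. c * f s) = (\<lambda>s. c * V i f s)) \<and>
     (\<forall>i. \<forall>f\<in>G. \<forall>g\<in>G. ip (V i f) (V i g) = ip f g) \<and>
     (\<forall>i j. i \<noteq> j \<longrightarrow> (\<forall>f\<in>G. \<forall>g\<in>G. ip (V i f) (V j g) = 0)) \<and>
     (\<forall>\<alpha>. \<alpha> \<noteq> [] \<longrightarrow> (\<forall>x. word_op T \<alpha> x = \<rho> *\<^sub>R P (foldr V \<alpha> (J x))))"

text \<open>The dilation space cannot range over all types. Taking it among the spaces of functions on
  \<open>'n list \<times> 'h\<close> loses nothing: the lemma \<open>C_class_intro\<close> below shows that a dilation on a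
  Hilbert space of any other type yields one of this form, by restricting it to the closed span of
  the vectors \<open>V\<^sub>\<alpha> x\<close> and identifying \<open>g\<close> with the function
  \<open>(\<alpha>, x) \<mapsto> \<langle>g, V\<^sub>\<alpha> x\<rangle>\<close>.\<close>

definition C_class :: "real \<Rightarrow> ('n \<Rightarrow> ('h::complex_hilbert_space \<Rightarrow>\<^sub>L 'h)) set" where
  "C_class \<rho> =
     {T \<in> BH. \<exists>(G :: ('n list \<times> 'h \<Rightarrow> complex) set) ip J P V. isometric_dilation \<rho> T G ip J P V}"

lemma C_class_intro:
  fixes T :: "'n \<Rightarrow> ('h::complex_hilbert_space \<Rightarrow>\<^sub>L 'h)"
    and J :: "'h \<Rightarrow> 'g::complex_hilbert_space" and P :: "'g \<Rightarrow> 'h" and V :: "'n \<Rightarrow> ('g \<Rightarrow>\<^sub>L 'g)"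
  assumes T: "T \<in> BH"
    and J_add: "\<And>x y. J (x + y) = J x + J y"
    and J_scale: "\<And>c x. J (c *\<^sub>C x) = c *\<^sub>C J x"
    and J_iso: "\<And>x y. cinner (J x) (J y) = cinner x y"
    and P: "\<And>g x. cinner (P g) x = cinner g (J x)"
    and V: "V \<in> BH"
    and V_iso: "\<And>i f g. cinner (V i f) (V i g) = cinner f g"
    and V_orth: "\<And>i j f g. i \<noteq> j \<Longrightarrow> cinner (V i f) (V j g) = 0"
    and dil: "\<And>\<alpha> x. \<alpha> \<noteq> [] \<Longrightarrow> word_op T \<alpha> x = \<rho> *\<^sub>R P (word_op V \<alpha> (J x))"
  shows "T \<in> C_class \<rho>"
proof -
  define S where "S = {word_op V \<alpha> (J x) | \<alpha> x. True}"
  define G0 where "G0 = {g. \<forall>y. (\<forall>s\<in>S. cinner y s = 0) \<longrightarrow> cinner g y = 0}"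
  define \<phi> where "\<phi> = (\<lambda>g (\<alpha>, x). cinner g (word_op V \<alpha> (J x)))"
  have \<phi>_add: "\<phi> (f + g) = (\<lambda>s. \<phi> f s + \<phi> g s)" for f g
    by (auto simp: \<phi>_def cinner_add_left)
  have \<phi>_scale: "\<phi> (c *\<^sub>C f) = (\<lambda>s. c * \<phi> f s)" for c f
    by (auto simp: \<phi>_def cinner_scaleC_left)
  have \<phi>_diff: "\<phi> (f - g) = (\<lambda>s. \<phi> f s - \<phi> g s)" for f g
    by (auto simp: \<phi>_def cinner_diff_left)
  have G0_add: "f + g \<in> G0" if "f \<in> G0" "g \<in> G0" for f g
    using that by (auto simp: G0_def cinner_add_left)
  have G0_diff: "f - g \<in> G0" if "f \<in> G0" "g \<in> G0" for f g
    using that by (auto simp: G0_def cinner_diff_left)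
  have G0_scale: "c *\<^sub>C f \<in> G0" if "f \<in> G0" for c f
    using that by (auto simp: G0_def cinner_scaleC_left)
  have cz: "cinner 0 (y::'g) = 0" for y
    using cinner_diff_left[of 0 0 y] by simp
  have G0_0: "0 \<in> G0"
    by (auto simp: G0_def cz)
  have S_G0: "s \<in> G0" if "s \<in> S" for s
    unfolding G0_def using that cinner_commute[of s] by simp
  have J_G0: "J x \<in> G0" for x
    by (rule S_G0) (auto simp: S_def word_op_def intro!: exI[of _ "[]"])
  have V_S: "V i s \<in> S" if s: "s \<in> S" for i s
  proof -
    obtain \<alpha> x where "s = word_op V \<alpha> (J x)" using s by (auto simp: S_def)
    then have "V i s = word_op V (i # \<alpha>) (J x)" by (simp add: word_op_def)
    then show ?thesis unfolding S_def by blast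
  qed
  have V_G0: "V i g \<in> G0" if g: "g \<in> G0" for i g
    unfolding G0_def
  proof safe
    fix y assume y: "\<forall>s\<in>S. cinner y s = 0"
    have VC: "complex_linear (V i)" using V by (simp add: BH_def)
    have "cinner (adj (V i) y) s = 0" if "s \<in> S" for s
      using adj_eq[OF VC, of s y] y V_S[OF that, of i] cinner_commute[of "V i s" y]
        cinner_commute[of "adj (V i) y" s] by simp
    then have "cinner g (adj (V i) y) = 0" using g by (auto simp: G0_def)
    then show "cinner (V i g) y = 0" by (simp add: adj_eq[OF VC])
  qed
  have \<phi>_0: "g = 0" if "g \<in> G0" "\<phi> g = (\<lambda>s. 0)" for g
  proof -
    have "cinner g (word_op V \<alpha> (J x)) = 0" for \<alpha> x
      using fun_cong[OF that(2), of "(\<alpha>, x)"] by (simp add: \<phi>_def)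
    then have "\<forall>s\<in>S. cinner g s = 0" by (auto simp: S_def)
    then have "cinner g g = 0" using that(1) by (auto simp: G0_def)
    then show ?thesis by (simp add: cinner_self)
  qed
  have inj: "inj_on \<phi> G0"
  proof (rule inj_onI)
    fix f g assume "f \<in> G0" "g \<in> G0" "\<phi> f = \<phi> g"
    then have "f - g = 0" by (intro \<phi>_0 G0_diff) (auto simp: \<phi>_diff)
    then show "f = g" by simp
  qed
  define \<psi> where "\<psi> = inv_into G0 \<phi>"
  have \<psi>\<phi>: "\<psi> (\<phi> g) = g" if "g \<in> G0" for g
    using that inj by (simp add: \<psi>_def)
  define G where "G = \<phi> ` G0"
  define ip where "ip = (\<lambda>f g. cinner (\<psi> f) (\<psi> g))"
  have ip\<phi>: "ip (\<phi> f) (\<phi> g) = cinner f g" if "f \<in> G0" "g \<in> G0" for f g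
    using that by (simp add: ip_def \<psi>\<phi>)
  have \<phi>zero: "\<phi> 0 = (\<lambda>s. 0)" using \<phi>_diff[of 0 0] by simp
  have nrm: "sqrt (Re (ip (\<lambda>s. \<phi> f s - \<phi> g s) (\<lambda>s. \<phi> f s - \<phi> g s))) = dist f g"
    if "f \<in> G0" "g \<in> G0" for f g
    using that by (simp add: \<phi>_diff[symmetric] ip\<phi> G0_diff cinner_self dist_norm)
  have hfs: "hilbert_function_space G ip"
  proof
    show "(\<lambda>s. 0) \<in> G" unfolding G_def using G0_0 \<phi>zero by (metis image_eqI)
    show "(\<lambda>s. f s + g s) \<in> G" if "f \<in> G" "g \<in> G" for f g
      using that unfolding G_def by (auto simp: \<phi>_add[symmetric] G0_add)
    show "(\<lambda>s. c * f s) \<in> G" if "f \<in> G" for f c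
      using that unfolding G_def by (auto simp: \<phi>_scale[symmetric] G0_scale)
    show "ip f g = cnj (ip g f)" for f g
      unfolding ip_def by (rule cinner_commute)
    show "ip (\<lambda>s. f s + g s) h = ip f h + ip g h" if "f \<in> G" "g \<in> G" "h \<in> G" for f g h
      using that unfolding G_def by (auto simp: \<phi>_add[symmetric] ip\<phi> G0_add cinner_add_left)
    show "ip (\<lambda>s. c * f s) g = c * ip f g" if "f \<in> G" "g \<in> G" for f g c
      using that unfolding G_def by (auto simp: \<phi>_scale[symmetric] ip\<phi> G0_scale cinner_scaleC_left)
    show "0 < Re (ip f f)" if "f \<in> G" "f \<noteq> (\<lambda>s. 0)" for f
      using that \<phi>zero unfolding G_def by (auto simp: ip\<phi> cinner_self)
    fix \<sigma> :: "nat \<Rightarrow> 'n list \<times> 'h \<Rightarrow> complex"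
    assume \<sigma>: "\<And>n. \<sigma> n \<in> G"
      and C: "\<And>e. e > 0 \<Longrightarrow> \<exists>N. \<forall>k\<ge>N. \<forall>l\<ge>N.
          sqrt (Re (ip (\<lambda>s. \<sigma> k s - \<sigma> l s) (\<lambda>s. \<sigma> k s - \<sigma> l s))) < e"
    have "\<forall>n. \<exists>t\<in>G0. \<sigma> n = \<phi> t" using \<sigma> by (auto simp: G_def)
    then obtain \<tau> where \<tau>: "\<And>n. \<tau> n \<in> G0" "\<And>n. \<sigma> n = \<phi> (\<tau> n)" by metis
    have "Cauchy \<tau>"
      using C by (intro metric_CauchyI) (simp add: \<tau> nrm)
    then obtain t where t: "\<tau> \<longlonglongrightarrow> t"
      using Cauchy_convergent convergent_def by blast
    have "t \<in> G0"
      unfolding G0_def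
    proof safe
      fix y assume y: "\<forall>s\<in>S. cinner y s = 0"
      have z: "inner (\<tau> n) (c *\<^sub>C y) = 0" for n c
        using \<tau>(1)[of n] y by (simp add: G0_def inner_eq_Re_cinner cinner_scaleC_right)
      have "(\<lambda>n. inner (\<tau> n) (c *\<^sub>C y)) \<longlonglongrightarrow> inner t (c *\<^sub>C y)" for c
        by (intro tendsto_intros t)
      then have "inner t (c *\<^sub>C y) = 0" for c
        unfolding z by (simp add: LIMSEQ_const_iff)
      then have "Re (cnj c * cinner t y) = 0" for c
        by (simp add: inner_eq_Re_cinner cinner_scaleC_right)
      from this[of 1] this[of \<i>] show "cinner t y = 0"
        by (simp add: complex_eq_iff)
    qed
    moreover have "(\<lambda>k. dist (\<tau> k) t) \<longlonglongrightarrow> 0"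
      using t tendsto_dist_iff by blast
    ultimately show
      "\<exists>f\<in>G. (\<lambda>k. sqrt (Re (ip (\<lambda>s. \<sigma> k s - f s) (\<lambda>s. \<sigma> k s - f s)))) \<longlonglongrightarrow> 0"
      unfolding G_def by (intro bexI[of _ "\<phi> t"]) (auto simp: \<tau> nrm)
  qed
  define W where "W = (\<lambda>i f. \<phi> (V i (\<psi> f)))"
  have W\<phi>: "W i (\<phi> g) = \<phi> (V i g)" if "g \<in> G0" for i g
    using that by (simp add: W_def \<psi>\<phi>)
  have WV: "word_op V \<alpha> (J x) \<in> G0 \<and> foldr W \<alpha> (\<phi> (J x)) = \<phi> (word_op V \<alpha> (J x))" for \<alpha> x
    by (induction \<alpha>) (auto simp: word_op_def J_G0 W\<phi> V_G0)
  have VC: "V i (c *\<^sub>C g) = c *\<^sub>C V i g" for i c g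
    using V by (simp add: BH_def complex_linear_def)
  have "isometric_dilation \<rho> T G ip (\<lambda>x. \<phi> (J x)) (\<lambda>f. P (\<psi> f)) W"
    unfolding isometric_dilation_def
  proof (intro conjI allI ballI impI)
    show "hilbert_function_space G ip" by (rule hfs)
    show "\<phi> (J x) \<in> G" for x unfolding G_def using J_G0 by simp
    show "\<phi> (J (x + y)) = (\<lambda>s. \<phi> (J x) s + \<phi> (J y) s)" for x y
      by (simp add: J_add \<phi>_add)
    show "\<phi> (J (c *\<^sub>C x)) = (\<lambda>s. c * \<phi> (J x) s)" for c x
      by (simp add: J_scale \<phi>_scale)
    show "ip (\<phi> (J x)) (\<phi> (J y)) = cinner x y" for x y
      by (simp add: ip\<phi> J_G0 J_iso)
    show "cinner (P (\<psi> f)) x = ip f (\<phi> (J x))" for f x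
      by (simp add: P ip_def \<psi>\<phi> J_G0)
    show "W i f \<in> G" if "f \<in> G" for i f
      using that unfolding G_def by (auto simp: W\<phi> V_G0)
    show "W i (\<lambda>s. f s + g s) = (\<lambda>s. W i f s + W i g s)" if "f \<in> G" "g \<in> G" for i f g
      using that unfolding G_def
      by (auto simp: W\<phi> \<phi>_add[symmetric] G0_add blinfun.add_right)
    show "W i (\<lambda>s. c * f s) = (\<lambda>s. c * W i f s)" if "f \<in> G" for i c f
      using that unfolding G_def by (auto simp: W\<phi> \<phi>_scale[symmetric] G0_scale VC)
    show "ip (W i f) (W i g) = ip f g" if "f \<in> G" "g \<in> G" for i f g
      using that unfolding G_def by (auto simp: W\<phi> ip\<phi> V_G0 V_iso)
    show "ip (W i f) (W j g) = 0" if "i \<noteq> j" "f \<in> G" "g \<in> G" for i j f g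
      using that unfolding G_def by (auto simp: W\<phi> ip\<phi> V_G0 V_orth)
    show "word_op T \<alpha> x = \<rho> *\<^sub>R P (\<psi> (foldr W \<alpha> (\<phi> (J x))))" if "\<alpha> \<noteq> []" for \<alpha> x
      using WV[of \<alpha> x] dil[OF that, of x] by (simp add: \<psi>\<phi>)
  qed
  then show ?thesis
    unfolding C_class_def using T by blast
qed

text \<open>The infimum is taken in the extended reals, so that it is \<open>\<infinity>\<close> for the empty set.\<close>

definition omega :: "real \<Rightarrow> ('n \<Rightarrow> ('h::complex_hilbert_space \<Rightarrow>\<^sub>L 'h)) \<Rightarrow> ereal" where
  "omega \<rho> T = Inf {ereal t | t. t > 0 \<and> (\<lambda>i. (1 / t) *\<^sub>R T i) \<in> C_class \<rho>}"

definition C_ball :: "real \<Rightarrow> ('n \<Rightarrow> ('h::complex_hilbert_space \<Rightarrow>\<^sub>L 'h)) set" where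
  "C_ball \<rho> = {X \<in> BH. omega \<rho> X < 1}"

definition C_prec0 :: "real \<Rightarrow> ('n::finite \<Rightarrow> ('h::complex_hilbert_space \<Rightarrow>\<^sub>L 'h)) set" where
  "C_prec0 \<rho> = C_class \<rho> \<inter> C_infinity"


section \<open>Noncommutative polynomials with matrix coefficients\<close>

text \<open>A polynomial with coefficients in the \<open>m \<times> m\<close> matrices is given by its coefficient matrices,
  \<open>p \<alpha> i j\<close> being the entry at \<open>i, j < m\<close> of the coefficient of \<open>X\<^sub>\<alpha>\<close>; entries outside this range
  are ignored. Operators on \<open>'h \<otimes> \<complex>\<^sup>m\<close>, the direct sum of \<open>m\<close> copies of \<open>'h\<close>,
  are \<open>m \<times> m\<close> block matrices of operators, and its vectors are functions \<open>nat \<Rightarrow> 'h\<close>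
  restricted to \<open>{..<m}\<close>.\<close>

type_synonym 'n ncpoly = "'n list \<Rightarrow> nat \<Rightarrow> nat \<Rightarrow> complex"
type_synonym 'h block_op = "nat \<Rightarrow> nat \<Rightarrow> ('h \<Rightarrow>\<^sub>L 'h)"

definition is_ncpoly :: "nat \<Rightarrow> 'n ncpoly \<Rightarrow> bool" where
  "is_ncpoly m p \<longleftrightarrow> finite {\<alpha>. \<exists>i<m. \<exists>j<m. p \<alpha> i j \<noteq> 0}"

definition poly_op ::
  "'n ncpoly \<Rightarrow> ('n \<Rightarrow> ('h::complex_inner_space \<Rightarrow>\<^sub>L 'h)) \<Rightarrow> 'h block_op" where
  "poly_op p X = (\<lambda>i j. \<Sum>\<alpha> | p \<alpha> i j \<noteq> 0. scaleC_op (p \<alpha> i j) (word_op X \<alpha>))"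

definition block_apply :: "nat \<Rightarrow> 'h::real_normed_vector block_op \<Rightarrow> (nat \<Rightarrow> 'h) \<Rightarrow> nat \<Rightarrow> 'h" where
  "block_apply m P x = (\<lambda>i. \<Sum>j<m. P i j (x j))"

definition block_adj :: "'h::complex_hilbert_space block_op \<Rightarrow> 'h block_op" where
  "block_adj P = (\<lambda>i j. adj (P j i))"

definition block_Re :: "'h::complex_hilbert_space block_op \<Rightarrow> 'h block_op" where
  "block_Re P = (\<lambda>i j. (1 / 2) *\<^sub>R (block_adj P i j + P i j))"

definition block_nonneg :: "nat \<Rightarrow> 'h::complex_inner_space block_op \<Rightarrow> bool" where
  "block_nonneg m P \<longleftrightarrow> (\<forall>x. (\<Sum>i<m. cinner (block_apply m P x i) (x i)) \<in> \<real>\<^sub>\<ge>\<^sub>0)"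

definition block_norm :: "nat \<Rightarrow> 'h::real_normed_vector block_op \<Rightarrow> real" where
  "block_norm m P =
     (SUP x \<in> {x. L2_set (\<lambda>j. norm (x j)) {..<m} \<le> 1}. L2_set (\<lambda>i. norm (block_apply m P x i)) {..<m})"

definition re_nonneg_poly :: "'k::complex_hilbert_space itself \<Rightarrow> nat \<Rightarrow> 'n::finite ncpoly \<Rightarrow> bool" where
  "re_nonneg_poly _ m p \<longleftrightarrow> 1 \<le> m \<and> is_ncpoly m p \<and>
     (\<forall>X :: 'n \<Rightarrow> ('k \<Rightarrow>\<^sub>L 'k). X \<in> BH \<longrightarrow> norm (\<Sum>i\<in>UNIV. X i o\<^sub>L adj (X i)) < 1 \<longrightarrow>
        block_nonneg m (block_Re (poly_op p X)))"

text \<open>In the definitions below, \<open>K\<close> stands for the Hilbert space on which positivity of the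
  polynomials is tested.\<close>


section \<open>Harnack domination, hyperbolic and Caratheodory metrics\<close>

definition harnack_dom ::
  "'k::complex_hilbert_space itself \<Rightarrow> real \<Rightarrow> real \<Rightarrow>
   ('n::finite \<Rightarrow> ('h::complex_hilbert_space \<Rightarrow>\<^sub>L 'h)) \<Rightarrow> ('n \<Rightarrow> ('h \<Rightarrow>\<^sub>L 'h)) \<Rightarrow> bool" where
  "harnack_dom K \<rho> c A B \<longleftrightarrow>
     (\<forall>m p. re_nonneg_poly K m p \<longrightarrow>
        block_nonneg m (\<lambda>i j.
          c\<^sup>2 *\<^sub>R (block_Re (poly_op p B) i j + (\<rho> - 1) *\<^sub>R block_Re (poly_op p (\<lambda>_. 0 :: 'h \<Rightarrow>\<^sub>L 'h)) i j) -
          (block_Re (poly_op p A) i j + (\<rho> - 1) *\<^sub>R block_Re (poly_op p (\<lambda>_. 0 :: 'h \<Rightarrow>\<^sub>L 'h)) i j)))"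

definition harnack_equiv ::
  "'k::complex_hilbert_space itself \<Rightarrow> real \<Rightarrow> real \<Rightarrow>
   ('n::finite \<Rightarrow> ('h::complex_hilbert_space \<Rightarrow>\<^sub>L 'h)) \<Rightarrow> ('n \<Rightarrow> ('h \<Rightarrow>\<^sub>L 'h)) \<Rightarrow> bool" where
  "harnack_equiv K \<rho> c A B \<longleftrightarrow> harnack_dom K \<rho> c A B \<and> harnack_dom K \<rho> c B A"

definition harnack_rel ::
  "'k::complex_hilbert_space itself \<Rightarrow> real \<Rightarrow> ('n::finite \<Rightarrow> ('h::complex_hilbert_space \<Rightarrow>\<^sub>L 'h)) rel" where
  "harnack_rel K \<rho> =
     {(A, B). A \<in> C_class \<rho> \<and> B \<in> C_class \<rho> \<and> (\<exists>c\<ge>1. harnack_equiv K \<rho> c A B)}"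

definition harnack_parts ::
  "'k::complex_hilbert_space itself \<Rightarrow> real \<Rightarrow> ('n::finite \<Rightarrow> ('h::complex_hilbert_space \<Rightarrow>\<^sub>L 'h)) set set" where
  "harnack_parts K \<rho> = C_class \<rho> // harnack_rel K \<rho>"

definition hyperbolic_dist ::
  "'k::complex_hilbert_space itself \<Rightarrow> real \<Rightarrow>
   ('n::finite \<Rightarrow> ('h::complex_hilbert_space \<Rightarrow>\<^sub>L 'h)) \<Rightarrow> ('n \<Rightarrow> ('h \<Rightarrow>\<^sub>L 'h)) \<Rightarrow> real" where
  "hyperbolic_dist K \<rho> A B = ln (Inf {c. c > 1 \<and> harnack_equiv K \<rho> c A B})"

definition caratheodory_dist ::
  "'k::complex_hilbert_space itself \<Rightarrow>
   ('n::finite \<Rightarrow> ('h::complex_hilbert_space \<Rightarrow>\<^sub>L 'h)) \<Rightarrow> ('n \<Rightarrow> ('h \<Rightarrow>\<^sub>L 'h)) \<Rightarrow> real" where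
  "caratheodory_dist K A B =
     Sup {block_norm m (\<lambda>i j. block_Re (poly_op p A) i j - block_Re (poly_op p B) i j) | m p.
       re_nonneg_poly K m p \<and>
       (\<forall>i<m. \<forall>j<m. block_Re (poly_op p (\<lambda>_. 0 :: 'h \<Rightarrow>\<^sub>L 'h)) i j = (if i = j then id_blinfun else 0))}"


section \<open>Topology and completeness of a metric on a set\<close>

text \<open>The locale \<^locale>\<open>Metric_space\<close> asks for nonnegativity and symmetry also outside the
  carrier, where the distances above carry no meaning; they are therefore set to zero there.\<close>

definition dist_on :: "'a set \<Rightarrow> ('a \<Rightarrow> 'a \<Rightarrow> real) \<Rightarrow> 'a \<Rightarrow> 'a \<Rightarrow> real" where
  "dist_on M d x y = (if x \<in> M \<and> y \<in> M then d x y else 0)"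

definition metric_on :: "'a set \<Rightarrow> ('a \<Rightarrow> 'a \<Rightarrow> real) \<Rightarrow> bool" where
  "metric_on M d \<longleftrightarrow> Metric_space M (dist_on M d)"

definition complete_on :: "'a set \<Rightarrow> ('a \<Rightarrow> 'a \<Rightarrow> real) \<Rightarrow> bool" where
  "complete_on M d \<longleftrightarrow> Metric_space.mcomplete M (dist_on M d)"

definition topology_on :: "'a set \<Rightarrow> ('a \<Rightarrow> 'a \<Rightarrow> real) \<Rightarrow> 'a topology" where
  "topology_on M d = Metric_space.mtopology M (dist_on M d)"

lemma metric_on_iff:
  "metric_on M d \<longleftrightarrow>
     (\<forall>x\<in>M. \<forall>y\<in>M. 0 \<le> d x y \<and> d x y = d y x \<and> (d x y = 0 \<longleftrightarrow> x = y)) \<and>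
     (\<forall>x\<in>M. \<forall>y\<in>M. \<forall>z\<in>M. d x z \<le> d x y + d y z)"
  unfolding metric_on_def Metric_space_def dist_on_def by (auto split: if_splits)

end

theory Submission
  imports Defs "HOL-Complex_Analysis.Complex_Analysis" "HOL-Library.Sublist"
begin

text \<open>To a tuple \<open>A\<close> belongs the multi-Toeplitz kernel on words with entry \<open>A\<^sub>\<gamma>\<close> at \<open>(\<alpha>, \<alpha>\<gamma>)\<close>, \<open>\<rho>\<close> on
  the diagonal, and adjoints below it. Membership in \<open>C\<^sub>\<rho>\<close> is positivity of this kernel (by its
  reproducing kernel space), and Harnack domination with constant \<open>c\<close> is the inequality of kernels
  with factor \<open>c\<^sup>2\<close>: truncated kernels are values of positive polynomials, and conversely a finite
  section of a positive kernel is realised by a row contraction on the test space, to which the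
  positivity of a polynomial applies. All metric statements become estimates of quadratic forms.

  If \<open>y\<close> solves \<open>x = (I - T) y\<close> with the backward shift \<open>T\<close> built from \<open>A\<close>, the form of the kernel is
  \<open>(\<rho> - 2) \<parallel>x\<parallel>\<^sup>2 + 2 Re \<langle>y, x\<rangle>\<close>. An upper bound of the form bounds \<open>y\<close> by \<open>x\<close>, so the form depends
  continuously on \<open>A\<close> in norm; together with the scalar Harnack inequality this identifies the open
  ball with the Harnack part of \<open>0\<close> and makes norm and hyperbolic topology agree there. A
  \<open>\<delta>\<close>-Cauchy sequence converges in norm, and kernel inequalities pass to the limit. For the
  incompleteness, the line through a square zero operator of norm \<open>\<rho>\<close> leaves the ball.\<close>

section \<open>Operators on complex Hilbert spaces\<close>

text \<open>The obstacle is uniformity in the truncation length \<open>N\<close>. On families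
  supported in \<open>words N\<close> the backward shift is nilpotent, so every resolvent exists,
  but its norm may grow with \<open>N\<close>. All estimates therefore carry constants independent
  of \<open>N\<close>, and these come from an upper bound of the form: on
  \<open>C_prec0 \<rho>\<close> the spectral radius gives it, by geometric decay in the word length,
  and on the ball Harnack's inequality does. The lower bound by a positive multiple of
  \<open>sqnorm\<close> is what singles out the ball; it turns additive estimates into the
  multiplicative ones of the hyperbolic metric. Infinite dimension makes room for Gram vectors of
  finite sections of any rank: in the test space to build the row contraction, in \<open>'h\<close>
  to obtain the inequalities behind the reproducing kernel space. One kernel polynomial serves all
  \<rho>, because \<rho> enters only the diagonal of the kernel, and that is what the terms with
  \<open>p(0)\<close> contribute.\<close>

lemma scaleC_1 [simp]: "1 *\<^sub>C (x :: 'h::complex_inner_space) = x"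
  using scaleC_of_real[of 1 x] by simp

lemma scaleC_0_left [simp]: "0 *\<^sub>C (x :: 'h::complex_inner_space) = 0"
  using scaleC_of_real[of 0 x] by simp

lemma scaleC_0_right [simp]: "c *\<^sub>C (0 :: 'h::complex_inner_space) = 0"
  using scaleC_add_right[of c 0 0] by simp

lemma scaleC_diff_right: "c *\<^sub>C (x - y) = c *\<^sub>C x - c *\<^sub>C (y :: 'h::complex_inner_space)"
  using scaleC_add_right[of c "x - y" y] by simp

lemma scaleC_sum_right: "c *\<^sub>C (\<Sum>a\<in>S. f a) = (\<Sum>a\<in>S. c *\<^sub>C (f a :: 'h::complex_inner_space))"
  by (induction S rule: infinite_finite_induct) (auto simp: scaleC_add_right)

lemma scaleC_sum_left: "(\<Sum>a\<in>S. f a) *\<^sub>C x = (\<Sum>a\<in>S. f a *\<^sub>C (x :: 'h::complex_inner_space))"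
  by (induction S rule: infinite_finite_induct) (auto simp: scaleC_add_left)

lemma scaleC_scaleR: "c *\<^sub>C (r *\<^sub>R x) = r *\<^sub>R (c *\<^sub>C (x :: 'h::complex_inner_space))"
  by (metis scaleC_of_real scaleC_scaleC mult.commute)

lemma cinner_0_left [simp]: "cinner 0 (x :: 'h::complex_inner_space) = 0"
  using cinner_add_left[of 0 0 x] by simp

lemma cinner_0_right [simp]: "cinner (x :: 'h::complex_inner_space) 0 = 0"
  using cinner_add_right[of x 0 0] by simp

lemma cinner_sum_left: "cinner (\<Sum>a\<in>S. f a) x = (\<Sum>a\<in>S. cinner (f a) (x :: 'h::complex_inner_space))"
  by (induction S rule: infinite_finite_induct) (auto simp: cinner_add_left)

lemma cinner_sum_right: "cinner x (\<Sum>a\<in>S. f a) = (\<Sum>a\<in>S. cinner (x :: 'h::complex_inner_space) (f a))"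
  by (induction S rule: infinite_finite_induct) (auto simp: cinner_add_right)

lemma cinner_scaleR_left: "cinner (r *\<^sub>R x) y = r * cinner x (y :: 'h::complex_inner_space)"
  by (metis cinner_scaleC_left scaleC_of_real)

lemma cinner_scaleR_right: "cinner x (r *\<^sub>R y) = r * cinner x (y :: 'h::complex_inner_space)"
  by (metis cinner_scaleC_right complex_cnj_complex_of_real scaleC_of_real)

text \<open>A phase factor makes the complex inner product real and nonnegative, where the real
  Cauchy-Schwarz inequality applies.\<close>

lemma cinner_Cauchy_Schwarz: "cmod (cinner x y) \<le> norm x * norm (y :: 'h::complex_inner_space)"
proof -
  obtain c where c: "cmod c = 1" "c * cinner x y = complex_of_real (cmod (cinner x y))"
  proof (cases "cinner x y = 0")
    case True then show ?thesis using that[of 1] by simp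
  next
    case False
    let ?c = "cnj (cinner x y) / complex_of_real (cmod (cinner x y))"
    have "cmod ?c = 1" using False by (simp add: norm_divide)
    moreover have "?c * cinner x y = complex_of_real (cmod (cinner x y))"
      using False by (simp add: complex_norm_square[symmetric] power2_eq_square mult.commute)
    ultimately show ?thesis using that by blast
  qed
  have "cmod (cinner x y) = inner (c *\<^sub>C x) y"
    by (simp add: inner_eq_Re_cinner cinner_scaleC_left c(2))
  also have "\<dots> \<le> norm (c *\<^sub>C x) * norm y"
    by (rule norm_cauchy_schwarz)
  finally show ?thesis by (simp add: norm_scaleC c(1))
qed

lemma tendsto_cinner:
  fixes x :: "'h::complex_inner_space"
  assumes f: "(f \<longlongrightarrow> x) F" and g: "(g \<longlongrightarrow> y) F"
  shows "((\<lambda>n. cinner (f n) (g n)) \<longlongrightarrow> cinner x y) F"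
proof -
  \<comment> \<open>Both parts are real inner products, the imaginary one after multiplying an
    argument by the imaginary unit, so real limit rules suffice.\<close>
  have e: "cinner u v = Complex (inner u v) (- inner (\<i> *\<^sub>C u) v)" for u v :: 'h
    by (simp add: inner_eq_Re_cinner cinner_scaleC_left complex_eq_iff)
  have f': "((\<lambda>n. \<i> *\<^sub>C f n) \<longlongrightarrow> \<i> *\<^sub>C x) F"
    by (rule bounded_linear.tendsto[OF bounded_linear_scaleC f])
  show ?thesis unfolding e by (intro tendsto_intros f g f')
qed

lemma complex_linearD: "complex_linear A \<Longrightarrow> A (c *\<^sub>C x) = c *\<^sub>C A x"
  by (simp add: complex_linear_def)

lemma complex_linear_id [simp]: "complex_linear id_blinfun"
  by (simp add: complex_linear_def)

lemma complex_linear_0 [simp]: "complex_linear 0"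
  by (simp add: complex_linear_def)

lemma complex_linear_add: "complex_linear A \<Longrightarrow> complex_linear B \<Longrightarrow> complex_linear (A + B)"
  by (simp add: complex_linear_def blinfun.add_left scaleC_add_right)

lemma complex_linear_diff: "complex_linear A \<Longrightarrow> complex_linear B \<Longrightarrow> complex_linear (A - B)"
  by (simp add: complex_linear_def blinfun.diff_left scaleC_diff_right)

lemma complex_linear_scaleR: "complex_linear A \<Longrightarrow> complex_linear (r *\<^sub>R A)"
  by (simp add: complex_linear_def blinfun.scaleR_left scaleC_scaleR)

lemma scaleC_op_apply [simp]: "scaleC_op c A x = c *\<^sub>C A x"
  by (transfer) simp

lemma complex_linear_scaleC_op: "complex_linear A \<Longrightarrow> complex_linear (scaleC_op c A)"
  by (simp add: complex_linear_def scaleC_scaleC mult.commute)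

lemma complex_linear_compose: "complex_linear A \<Longrightarrow> complex_linear B \<Longrightarrow> complex_linear (A o\<^sub>L B)"
  by (simp add: complex_linear_def)

lemma complex_linear_sum: "(\<And>a. a \<in> S \<Longrightarrow> complex_linear (f a)) \<Longrightarrow> complex_linear (\<Sum>a\<in>S. f a)"
  by (induction S rule: infinite_finite_induct) (auto intro: complex_linear_add)

lemma blinfun_sum_apply: "blinfun_apply (\<Sum>a\<in>S. f a) x = (\<Sum>a\<in>S. blinfun_apply (f a) x)"
  by (rule blinfun.sum_left)

lemma word_op_Nil [simp]: "word_op X [] = id_blinfun"
  and word_op_Cons [simp]: "word_op X (i # \<alpha>) = X i o\<^sub>L word_op X \<alpha>"
  by (simp_all add: word_op_def)

lemma word_op_append: "word_op X (\<alpha> @ \<beta>) = word_op X \<alpha> o\<^sub>L word_op X \<beta>"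
  by (induction \<alpha>) (auto intro!: blinfun_eqI)

lemma word_op_zero: "word_op (\<lambda>_. 0) \<alpha> = (if \<alpha> = [] then id_blinfun else 0)"
  by (cases \<alpha>) (auto intro: blinfun_eqI)

lemma BH_D: "X \<in> BH \<Longrightarrow> complex_linear (X i)"
  by (simp add: BH_def)

lemma complex_linear_word_op: "X \<in> BH \<Longrightarrow> complex_linear (word_op X \<alpha>)"
  by (induction \<alpha>) (auto intro: complex_linear_compose BH_D)

lemma word_op_scaleC: "X \<in> BH \<Longrightarrow> word_op (\<lambda>i. scaleC_op c (X i)) \<alpha> = scaleC_op (c ^ length \<alpha>) (word_op X \<alpha>)"
  by (induction \<alpha>)
    (auto intro!: blinfun_eqI simp: scaleC_scaleC BH_D complex_linearD mult.commute)

lemma scaleC_op_of_real: "scaleC_op (complex_of_real r) A = r *\<^sub>R A"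
  by (rule blinfun_eqI) (simp add: scaleC_of_real blinfun.scaleR_left)

lemma BH_zero [simp]: "(\<lambda>_. 0) \<in> BH"
  and BH_scaleC: "X \<in> BH \<Longrightarrow> (\<lambda>i. scaleC_op c (X i)) \<in> BH"
  and BH_scaleR: "X \<in> BH \<Longrightarrow> (\<lambda>i. r *\<^sub>R X i) \<in> BH"
  and BH_diff: "X \<in> BH \<Longrightarrow> Y \<in> BH \<Longrightarrow> (\<lambda>i. X i - Y i) \<in> BH"
  by (simp_all add: BH_def complex_linear_scaleC_op complex_linear_scaleR complex_linear_diff)

lemma adj_eq': "complex_linear A \<Longrightarrow> cinner (adj A x) y = cinner x (A y)"
  for A :: "'h::complex_hilbert_space \<Rightarrow>\<^sub>L 'h"
  by (metis adj_eq cinner_commute)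

lemma adj_unique:
  fixes A B :: "'h::complex_hilbert_space \<Rightarrow>\<^sub>L 'h"
  assumes "complex_linear A" "\<And>x y. cinner (A x) y = cinner x (B y)"
  shows "adj A = B"
  by (intro blinfun_eqI cinner_ext) (metis assms adj_eq)

lemma adj_diff:
  fixes A :: "'h::complex_hilbert_space \<Rightarrow>\<^sub>L 'h"
  assumes "complex_linear A" "complex_linear B"
  shows "adj (A - B) = adj A - adj B"
  by (rule adj_unique)
    (simp_all add: assms complex_linear_diff blinfun.diff_left cinner_diff_left cinner_diff_right adj_eq)

lemma adj_scaleR:
  fixes A :: "'h::complex_hilbert_space \<Rightarrow>\<^sub>L 'h"
  assumes "complex_linear A"
  shows "adj (r *\<^sub>R A) = r *\<^sub>R adj A"
  by (rule adj_unique)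
    (simp_all add: assms complex_linear_scaleR blinfun.scaleR_left cinner_scaleR_left cinner_scaleR_right adj_eq)

lemma adj_compose:
  fixes A :: "'h::complex_hilbert_space \<Rightarrow>\<^sub>L 'h"
  assumes "complex_linear A" "complex_linear B"
  shows "adj (A o\<^sub>L B) = adj B o\<^sub>L adj A"
  by (rule adj_unique) (simp_all add: assms complex_linear_compose adj_eq)

lemma norm_square_cinner: "(norm x)\<^sup>2 = Re (cinner x (x :: 'h::complex_inner_space))"
  by (simp add: cinner_self)

section \<open>Norms of adjoints and of row operators\<close>

lemma norm_adj_le: "complex_linear A \<Longrightarrow> norm (adj A x) \<le> norm A * norm x"
  for A :: "'h::complex_hilbert_space \<Rightarrow>\<^sub>L 'h"
proof -
  assume A: "complex_linear A"
  have "(norm (adj A x))\<^sup>2 = Re (cinner x (A (adj A x)))"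
    by (simp add: norm_square_cinner adj_eq' A)
  also have "\<dots> \<le> norm x * norm (A (adj A x))"
    using complex_Re_le_cmod cinner_Cauchy_Schwarz order_trans by blast
  also have "\<dots> \<le> norm x * (norm A * norm (adj A x))"
    by (intro mult_left_mono norm_blinfun) simp
  finally show ?thesis
    by (cases "norm (adj A x) = 0") (auto simp: power2_eq_square mult_ac)
qed

text \<open>With \<open>P\<close> the sum, the square of \<open>norm (P h)\<close> is a pairing of
  the columns of adjoints at \<open>h\<close> and at \<open>P h\<close>; Cauchy-Schwarz bounds it by
  \<open>c * norm h\<close> times \<open>c * norm (P h)\<close>, and one factor cancels. The index
  set is arbitrary because the lemma is also applied to all words of a given length.\<close>

lemma row_norm_le:
  fixes X :: "'i \<Rightarrow> ('h::complex_hilbert_space \<Rightarrow>\<^sub>L 'h)"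
  assumes X: "\<And>i. i \<in> I \<Longrightarrow> complex_linear (X i)" and c: "0 \<le> c"
    and le: "\<And>h. (\<Sum>i\<in>I. (norm (adj (X i) h))\<^sup>2) \<le> c\<^sup>2 * (norm h)\<^sup>2"
  shows "norm (\<Sum>i\<in>I. X i o\<^sub>L adj (X i)) \<le> c\<^sup>2"
proof (rule norm_blinfun_bound)
  fix h
  let ?P = "(\<Sum>i\<in>I. X i o\<^sub>L adj (X i))"
  have "(norm (?P h))\<^sup>2 = Re (\<Sum>i\<in>I. cinner (adj (X i) h) (adj (X i) (?P h)))"
    by (simp add: norm_square_cinner blinfun_sum_apply cinner_sum_left adj_eq[OF X])
  also have "\<dots> \<le> (\<Sum>i\<in>I. norm (adj (X i) h) * norm (adj (X i) (?P h)))"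
    unfolding Re_sum
    by (intro sum_mono) (use complex_Re_le_cmod cinner_Cauchy_Schwarz order_trans in blast)
  also have "\<dots> \<le> L2_set (\<lambda>i. norm (adj (X i) h)) I * L2_set (\<lambda>i. norm (adj (X i) (?P h))) I"
    using L2_set_mult_ineq[of "\<lambda>i. norm (adj (X i) h)" "\<lambda>i. norm (adj (X i) (?P h))" I] by simp
  also have "\<dots> \<le> (c * norm h) * (c * norm (?P h))"
    by (intro mult_mono L2_set_nonneg real_le_lsqrt[of _ "c * norm _", folded L2_set_def])
      (use le c in \<open>auto simp: L2_set_def power_mult_distrib intro!: real_le_lsqrt sum_nonneg\<close>)
  finally have "norm (?P h) * norm (?P h) \<le> c\<^sup>2 * norm h * norm (?P h)"
    by (simp add: power2_eq_square mult_ac)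
  then show "norm (?P h) \<le> c\<^sup>2 * norm h"
    by (cases "norm (?P h) = 0") (auto simp: mult_le_cancel_right)
qed (use c in simp)

lemma row_adj_le:
  fixes X :: "'i \<Rightarrow> ('h::complex_hilbert_space \<Rightarrow>\<^sub>L 'h)"
  assumes X: "\<And>i. i \<in> I \<Longrightarrow> complex_linear (X i)"
  shows "(\<Sum>i\<in>I. (norm (adj (X i) h))\<^sup>2) \<le> norm (\<Sum>i\<in>I. X i o\<^sub>L adj (X i)) * (norm h)\<^sup>2"
proof -
  let ?P = "(\<Sum>i\<in>I. X i o\<^sub>L adj (X i))"
  have "(\<Sum>i\<in>I. (norm (adj (X i) h))\<^sup>2) = Re (cinner (?P h) h)"
    by (simp add: norm_square_cinner blinfun_sum_apply cinner_sum_left adj_eq[OF X])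
  also have "\<dots> \<le> norm (?P h) * norm h"
    using complex_Re_le_cmod cinner_Cauchy_Schwarz order_trans by blast
  also have "\<dots> \<le> norm ?P * norm h * norm h"
    by (intro mult_right_mono norm_blinfun) simp
  finally show ?thesis by (simp add: power2_eq_square mult_ac)
qed

text \<open>The row acts as an operator on the direct sum. Pairing its value \<open>v\<close> with
  itself moves the operators to the column of adjoints at \<open>v\<close>, which has norm at most
  \<open>c * norm v\<close>; one factor \<open>norm v\<close> cancels.\<close>

lemma row_apply_le:
  fixes X :: "'i \<Rightarrow> ('h::complex_hilbert_space \<Rightarrow>\<^sub>L 'h)"
  assumes X: "\<And>i. i \<in> I \<Longrightarrow> complex_linear (X i)" and c: "0 \<le> c"
    and le: "norm (\<Sum>i\<in>I. X i o\<^sub>L adj (X i)) \<le> c\<^sup>2"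
  shows "(norm (\<Sum>i\<in>I. X i (k i)))\<^sup>2 \<le> c\<^sup>2 * (\<Sum>i\<in>I. (norm (k i))\<^sup>2)"
proof -
  let ?P = "(\<Sum>i\<in>I. X i o\<^sub>L adj (X i))" and ?v = "\<Sum>i\<in>I. X i (k i)"
  have "(\<Sum>i\<in>I. (norm (adj (X i) ?v))\<^sup>2) = Re (cinner (?P ?v) ?v)"
    by (simp add: norm_square_cinner blinfun_sum_apply cinner_sum_left[of _ I "?v"] adj_eq[OF X])
  also have "\<dots> \<le> norm (?P ?v) * norm ?v"
    using complex_Re_le_cmod cinner_Cauchy_Schwarz order_trans by blast
  also have "\<dots> \<le> norm ?P * norm ?v * norm ?v"
    by (intro mult_right_mono norm_blinfun) simp
  also have "\<dots> \<le> c\<^sup>2 * norm ?v * norm ?v"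
    by (intro mult_right_mono le) simp_all
  finally have 1: "(\<Sum>i\<in>I. (norm (adj (X i) ?v))\<^sup>2) \<le> (c * norm ?v)\<^sup>2"
    by (simp add: power2_eq_square mult_ac)
  have "(norm ?v)\<^sup>2 = Re (\<Sum>i\<in>I. cinner (k i) (adj (X i) ?v))"
    by (simp add: norm_square_cinner cinner_sum_left[of _ I "?v"] adj_eq[OF X])
  also have "\<dots> \<le> (\<Sum>i\<in>I. norm (k i) * norm (adj (X i) ?v))"
    unfolding Re_sum
    by (intro sum_mono) (use complex_Re_le_cmod cinner_Cauchy_Schwarz order_trans in blast)
  also have "\<dots> \<le> L2_set (\<lambda>i. norm (k i)) I * L2_set (\<lambda>i. norm (adj (X i) ?v)) I"
    using L2_set_mult_ineq[of "\<lambda>i. norm (k i)" "\<lambda>i. norm (adj (X i) ?v)" I] by simp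
  also have "\<dots> \<le> L2_set (\<lambda>i. norm (k i)) I * (c * norm ?v)"
    using 1 c by (intro mult_left_mono L2_set_nonneg) (auto simp: L2_set_def intro!: real_le_lsqrt sum_nonneg)
  finally have "norm ?v * norm ?v \<le> (c * L2_set (\<lambda>i. norm (k i)) I) * norm ?v"
    by (simp add: power2_eq_square mult_ac)
  then have "norm ?v \<le> c * L2_set (\<lambda>i. norm (k i)) I"
    using c by (cases "norm ?v = 0") (auto simp: L2_set_nonneg)
  then have "(norm ?v)\<^sup>2 \<le> (c * L2_set (\<lambda>i. norm (k i)) I)\<^sup>2"
    by (intro power_mono) auto
  then show ?thesis
    by (simp add: power_mult_distrib L2_set_def sum_nonneg)
qed

lemma row_norm_nonneg [simp]: "0 \<le> row_norm X"
  by (simp add: row_norm_def)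

lemma row_norm_square: "norm (\<Sum>i\<in>UNIV. X i o\<^sub>L adj (X i)) = (row_norm X)\<^sup>2"
  by (simp add: row_norm_def)

lemma row_norm_leI:
  fixes X :: "'n::finite \<Rightarrow> ('h::complex_hilbert_space \<Rightarrow>\<^sub>L 'h)"
  assumes "X \<in> BH" "0 \<le> c"
    and "\<And>h. (\<Sum>i\<in>UNIV. (norm (adj (X i) h))\<^sup>2) \<le> c\<^sup>2 * (norm h)\<^sup>2"
  shows "row_norm X \<le> c"
  using row_norm_le[where X = X, OF BH_D[OF assms(1)] assms(2,3)] assms(2) by (simp add: row_norm_def real_le_lsqrt)

lemma norm_le_row_norm:
  fixes X :: "'n::finite \<Rightarrow> ('h::complex_hilbert_space \<Rightarrow>\<^sub>L 'h)"
  assumes X: "X \<in> BH"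
  shows "norm (X i) \<le> row_norm X"
proof (rule norm_blinfun_bound)
  fix h
  \<comment> \<open>The row is applied to the vector with \<open>h\<close> in slot \<open>i\<close>
    and 0 elsewhere.\<close>
  have "(norm (\<Sum>j\<in>UNIV. X j (if j = i then h else 0)))\<^sup>2
      \<le> (row_norm X)\<^sup>2 * (\<Sum>j\<in>UNIV. (norm (if j = i then h else 0))\<^sup>2)"
    by (rule row_apply_le) (simp_all add: BH_D[OF X] row_norm_square)
  moreover have "(\<Sum>j\<in>UNIV. X j (if j = i then h else 0)) = X i h"
    by (subst sum.remove[of _ i]) (auto simp: blinfun.zero_right)
  moreover have "(\<Sum>j\<in>UNIV. (norm (if j = i then h else 0))\<^sup>2) = (norm h)\<^sup>2"
    by (subst sum.remove[of _ i]) (auto)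
  ultimately have "(norm (X i h))\<^sup>2 \<le> (row_norm X * norm h)\<^sup>2"
    by (simp add: power_mult_distrib)
  then show "norm (X i h) \<le> row_norm X * norm h"
    by (rule power2_le_imp_le) simp
qed simp

lemma row_norm_le_sum:
  fixes X :: "'n::finite \<Rightarrow> ('h::complex_hilbert_space \<Rightarrow>\<^sub>L 'h)"
  assumes X: "X \<in> BH"
  shows "row_norm X \<le> (\<Sum>i\<in>UNIV. norm (X i))"
proof (rule row_norm_leI[OF X])
  fix h
  have "(\<Sum>i\<in>UNIV. (norm (adj (X i) h))\<^sup>2) \<le> (\<Sum>i\<in>UNIV. norm (adj (X i) h))\<^sup>2"
    using L2_set_le_sum[of UNIV "\<lambda>i. norm (adj (X i) h)"]
    by (simp add: L2_set_def sqrt_le_D)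
  also have "\<dots> \<le> (\<Sum>i\<in>UNIV. norm (X i) * norm h)\<^sup>2"
    by (intro power_mono sum_mono norm_adj_le BH_D[OF X] sum_nonneg) auto
  finally show "(\<Sum>i\<in>UNIV. (norm (adj (X i) h))\<^sup>2) \<le> (\<Sum>i\<in>UNIV. norm (X i))\<^sup>2 * (norm h)\<^sup>2"
    by (simp add: sum_distrib_right[symmetric] power_mult_distrib)
qed (simp add: sum_nonneg)

text \<open>Minkowski's inequality for the columns \<open>adj (X i - Y i) h\<close>, at each fixed
  \<open>h\<close>.\<close>

lemma row_dist_triangle:
  fixes X :: "'n::finite \<Rightarrow> ('h::complex_hilbert_space \<Rightarrow>\<^sub>L 'h)"
  assumes X: "X \<in> BH" and Y: "Y \<in> BH" and Z: "Z \<in> BH"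
  shows "row_dist X Z \<le> row_dist X Y + row_dist Y Z"
  unfolding row_dist_def
proof (rule row_norm_leI)
  fix h
  let ?L = "\<lambda>A B :: 'n \<Rightarrow> ('h \<Rightarrow>\<^sub>L 'h). L2_set (\<lambda>i. norm (adj (A i - B i) h)) UNIV"
  have L: "?L A B \<le> row_norm (\<lambda>i. A i - B i) * norm h" if "A \<in> BH" "B \<in> BH"
    for A B :: "'n \<Rightarrow> ('h \<Rightarrow>\<^sub>L 'h)"
    using row_adj_le[where I = UNIV and h = h and X = "\<lambda>i. A i - B i", OF BH_D[OF BH_diff[OF that]]]
    by (auto simp: L2_set_def row_norm_square power_mult_distrib intro!: real_le_lsqrt sum_nonneg)
  have "?L X Z \<le> L2_set (\<lambda>i. norm (adj (X i - Y i) h) + norm (adj (Y i - Z i) h)) UNIV"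
  proof (rule L2_set_mono)
    fix i
    have "adj (X i - Z i) h = adj (X i - Y i) h + adj (Y i - Z i) h"
      by (simp add: adj_diff BH_D[OF X] BH_D[OF Y] BH_D[OF Z] blinfun.diff_left)
    then show "norm (adj (X i - Z i) h) \<le> norm (adj (X i - Y i) h) + norm (adj (Y i - Z i) h)"
      by (simp add: norm_triangle_ineq)
  qed simp
  also have "\<dots> \<le> ?L X Y + ?L Y Z"
    by (rule L2_set_triangle_ineq)
  also have "\<dots> \<le> (row_norm (\<lambda>i. X i - Y i) + row_norm (\<lambda>i. Y i - Z i)) * norm h"
    using L[OF X Y] L[OF Y Z] by (simp add: algebra_simps)
  finally have "?L X Z ^ 2 \<le> ((row_norm (\<lambda>i. X i - Y i) + row_norm (\<lambda>i. Y i - Z i)) * norm h)\<^sup>2"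
    by (intro power_mono) (auto simp: L2_set_nonneg)
  then show "(\<Sum>i\<in>UNIV. (norm (adj (X i - Z i) h))\<^sup>2)
      \<le> (row_norm (\<lambda>i. X i - Y i) + row_norm (\<lambda>i. Y i - Z i))\<^sup>2 * (norm h)\<^sup>2"
    by (simp add: L2_set_def sum_nonneg power_mult_distrib)
qed (simp_all add: BH_diff X Z)

lemma metric_on_row_dist:
  assumes "M \<subseteq> BH"
  shows "metric_on M (row_dist :: ('n::finite \<Rightarrow> ('h::complex_hilbert_space \<Rightarrow>\<^sub>L 'h)) \<Rightarrow> _)"
  unfolding metric_on_iff
proof (intro conjI ballI)
  fix X Y :: "'n \<Rightarrow> ('h \<Rightarrow>\<^sub>L 'h)"
  assume XY: "X \<in> M" "Y \<in> M"
  then have B: "X \<in> BH" "Y \<in> BH" using assms by auto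
  show "0 \<le> row_dist X Y" by (simp add: row_dist_def)
  have "(\<lambda>i. X i - Y i) = (\<lambda>i. (-1) *\<^sub>R (Y i - X i))" by auto
  then have "(X i - Y i) o\<^sub>L adj (X i - Y i) = (Y i - X i) o\<^sub>L adj (Y i - X i)" for i
    using adj_scaleR[OF BH_D[OF BH_diff[OF B(2,1)], of i], of "-1"]
    by (auto intro!: blinfun_eqI simp: fun_eq_iff blinfun.diff_left blinfun.minus_left blinfun.minus_right blinfun.diff_right)
  then show "row_dist X Y = row_dist Y X"
    by (simp add: row_dist_def row_norm_def)
  show "row_dist X Y = 0 \<longleftrightarrow> X = Y"
  proof
    assume "row_dist X Y = 0"
    then have "norm (X i - Y i) \<le> 0" for i
      using norm_le_row_norm[OF BH_diff[OF B], of i] by (simp add: row_dist_def)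
    then show "X = Y" by (intro ext) simp
  next
    assume "X = Y"
    then show "row_dist X Y = 0"
      using bounded_bilinear.zero_left[OF bounded_bilinear_blinfun_compose]
      by (simp add: row_dist_def row_norm_def)
  qed
next
  fix X Y Z assume "X \<in> M" "Y \<in> M" "Z \<in> M"
  then show "row_dist X Z \<le> row_dist X Y + row_dist Y Z"
    using assms by (intro row_dist_triangle) auto
qed

section \<open>Kernel forms and polynomials\<close>

definition words :: "nat \<Rightarrow> 'n list set" where
  "words N = {\<alpha>. length \<alpha> \<le> N}"

lemma finite_words [simp]: "finite (words N :: 'n::finite list set)"
  using finite_lists_length_le[of "UNIV :: 'n set" N] by (simp add: words_def)

lemma words_iff: "\<alpha> \<in> words N \<longleftrightarrow> length \<alpha> \<le> N"
  by (simp add: words_def)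

lemma Nil_in_words [simp]: "[] \<in> words N"
  by (simp add: words_def)

text \<open>Families are total functions that vanish on long words, so sums over
  \<open>\<alpha> @ \<gamma>\<close> may run past length \<open>N\<close> without boundary
  terms.\<close>

definition supported :: "nat \<Rightarrow> ('n list \<Rightarrow> 'h::zero) \<Rightarrow> bool" where
  "supported N x \<longleftrightarrow> (\<forall>\<alpha>. N < length \<alpha> \<longrightarrow> x \<alpha> = 0)"

definition sqnorm :: "nat \<Rightarrow> ('n list \<Rightarrow> 'h::real_normed_vector) \<Rightarrow> real" where
  "sqnorm N x = (\<Sum>\<alpha>\<in>words N. (norm (x \<alpha>))\<^sup>2)"

text \<open>The quadratic form of the multi-Toeplitz kernel whose entry at \<open>(\<alpha>, \<alpha>\<gamma>)\<close> is \<open>\<Phi>\<^sub>\<gamma>\<close>, whose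
  entries below the diagonal are the adjoints of those above it, and which vanishes at words
  neither of which is a prefix of the other.\<close>

definition toeplitz_form ::
  "('n list \<Rightarrow> ('h::complex_inner_space \<Rightarrow>\<^sub>L 'h)) \<Rightarrow> nat \<Rightarrow> ('n list \<Rightarrow> 'h) \<Rightarrow> real" where
  "toeplitz_form \<Phi> N x = Re (\<Sum>\<alpha>\<in>words N.
     2 * (\<Sum>\<gamma>\<in>words N. cinner (\<Phi> \<gamma> (x (\<alpha> @ \<gamma>))) (x \<alpha>)) - cinner (\<Phi> [] (x \<alpha>)) (x \<alpha>))"

definition symbol :: "real \<Rightarrow> ('n \<Rightarrow> ('h::complex_inner_space \<Rightarrow>\<^sub>L 'h)) \<Rightarrow> 'n list \<Rightarrow> ('h \<Rightarrow>\<^sub>L 'h)" where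
  "symbol \<rho> A \<gamma> = (if \<gamma> = [] then \<rho> *\<^sub>R id_blinfun else word_op A \<gamma>)"

abbreviation kernel_form ::
  "real \<Rightarrow> ('n \<Rightarrow> ('h::complex_inner_space \<Rightarrow>\<^sub>L 'h)) \<Rightarrow> nat \<Rightarrow> ('n list \<Rightarrow> 'h) \<Rightarrow> real" where
  "kernel_form \<rho> A \<equiv> toeplitz_form (symbol \<rho> A)"

text \<open>\<open>y = resolvent A N x\<close> solves \<open>x\<^sub>\<alpha> = y\<^sub>\<alpha> - (\<Sum>i. A\<^sub>i y\<^bsub>\<alpha>i\<^esub>)\<close>.\<close>

definition resolvent ::
  "('n \<Rightarrow> ('h::complex_inner_space \<Rightarrow>\<^sub>L 'h)) \<Rightarrow> nat \<Rightarrow> ('n list \<Rightarrow> 'h) \<Rightarrow> 'n list \<Rightarrow> 'h" where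
  "resolvent A N x \<alpha> = (\<Sum>\<gamma>\<in>words N. word_op A \<gamma> (x (\<alpha> @ \<gamma>)))"

definition backshift ::
  "('n::finite \<Rightarrow> ('h::complex_inner_space \<Rightarrow>\<^sub>L 'h)) \<Rightarrow> ('n list \<Rightarrow> 'h) \<Rightarrow> 'n list \<Rightarrow> 'h" where
  "backshift A y \<alpha> = (\<Sum>i\<in>UNIV. A i (y (\<alpha> @ [i])))"

lemma toeplitz_form_diff: "toeplitz_form (\<lambda>\<gamma>. \<Phi> \<gamma> - \<Psi> \<gamma>) N x = toeplitz_form \<Phi> N x - toeplitz_form \<Psi> N x"
  by (simp add: toeplitz_form_def blinfun.diff_left cinner_diff_left sum_subtractf
      sum.distrib sum_distrib_left algebra_simps)

lemma toeplitz_form_scaleR: "toeplitz_form (\<lambda>\<gamma>. r *\<^sub>R \<Phi> \<gamma>) N x = r * toeplitz_form \<Phi> N x"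
proof -
  have "toeplitz_form (\<lambda>\<gamma>. r *\<^sub>R \<Phi> \<gamma>) N x = Re (of_real r * (\<Sum>\<alpha>\<in>words N.
     2 * (\<Sum>\<gamma>\<in>words N. cinner (\<Phi> \<gamma> (x (\<alpha> @ \<gamma>))) (x \<alpha>)) - cinner (\<Phi> [] (x \<alpha>)) (x \<alpha>)))"
    unfolding toeplitz_form_def
    by (simp only: blinfun.scaleR_left cinner_scaleR_left sum_distrib_left[symmetric]
        right_diff_distrib[symmetric] mult.left_commute[of 2])
  then show ?thesis by (simp add: toeplitz_form_def)
qed

text \<open>The symbol differs from \<open>word_op A\<close> only at the empty word, by \<rho> - 1.
  Doubling this and removing the diagonal entry \<rho> once leaves the coefficient \<rho> -
  2.\<close>

lemma kernel_form_eq: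
  fixes A :: "'n::finite \<Rightarrow> ('h::complex_inner_space \<Rightarrow>\<^sub>L 'h)"
  shows "kernel_form \<rho> A N x =
    (\<rho> - 2) * sqnorm N x + 2 * Re (\<Sum>\<alpha>\<in>words N. cinner (resolvent A N x \<alpha>) (x \<alpha>))"
proof -
  have "2 * (\<Sum>\<gamma>\<in>words N. cinner (symbol \<rho> A \<gamma> (x (\<alpha> @ \<gamma>))) (x \<alpha>)) - cinner (symbol \<rho> A [] (x \<alpha>)) (x \<alpha>)
      = of_real ((\<rho> - 2) * (norm (x \<alpha>))\<^sup>2) + 2 * cinner (resolvent A N x \<alpha>) (x \<alpha>)" for \<alpha>
  proof -
    have "(\<Sum>\<gamma>\<in>words N. cinner (symbol \<rho> A \<gamma> (x (\<alpha> @ \<gamma>))) (x \<alpha>))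
      = (\<Sum>\<gamma>\<in>words N. cinner (word_op A \<gamma> (x (\<alpha> @ \<gamma>))) (x \<alpha>) +
          (if \<gamma> = [] then of_real (\<rho> - 1) * cinner (x \<alpha>) (x \<alpha>) else 0))"
      by (intro sum.cong)
        (auto simp: symbol_def blinfun.scaleR_left cinner_scaleR_left algebra_simps)
    also have "\<dots> = cinner (resolvent A N x \<alpha>) (x \<alpha>) + of_real (\<rho> - 1) * cinner (x \<alpha>) (x \<alpha>)"
      by (simp add: sum.distrib resolvent_def cinner_sum_left)
    finally have S: "(\<Sum>\<gamma>\<in>words N. cinner (symbol \<rho> A \<gamma> (x (\<alpha> @ \<gamma>))) (x \<alpha>))
      = cinner (resolvent A N x \<alpha>) (x \<alpha>) + of_real (\<rho> - 1) * cinner (x \<alpha>) (x \<alpha>)" .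
    show ?thesis unfolding S
      by (simp add: symbol_def blinfun.scaleR_left cinner_scaleR_left cinner_self algebra_simps)
  qed
  then show ?thesis
    by (simp add: toeplitz_form_def sqnorm_def sum.distrib sum_distrib_left)
qed

lemma words_Suc: "words (Suc N) = insert [] ((\<lambda>(i, \<gamma>). i # \<gamma>) ` (UNIV \<times> words N))"
proof (rule set_eqI)
  fix \<alpha> :: "'a list"
  show "\<alpha> \<in> words (Suc N) \<longleftrightarrow> \<alpha> \<in> insert [] ((\<lambda>(i, \<gamma>). i # \<gamma>) ` (UNIV \<times> words N))"
    by (cases \<alpha>) (auto simp: words_iff image_iff)
qed

text \<open>Nonempty words are split at their first letter, as in a Neumann series
  \<open>y = x + T y\<close>.\<close>

lemma resolvent_rec:
  fixes A :: "'n::finite \<Rightarrow> ('h::complex_inner_space \<Rightarrow>\<^sub>L 'h)"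
  assumes x: "supported N x"
  shows "resolvent A N x \<alpha> = x \<alpha> + backshift A (resolvent A N x) \<alpha>"
proof (cases N)
  case 0
  then have "words N = {[] :: 'n list}" by (auto simp: words_def)
  moreover have "x (\<alpha> @ [i]) = 0" for i using x 0 by (simp add: supported_def)
  ultimately show ?thesis by (simp add: resolvent_def backshift_def blinfun.zero_right)
next
  case (Suc M)
  have inj: "inj_on (\<lambda>(i :: 'n, \<gamma>). i # \<gamma>) (UNIV \<times> words M)" by (auto simp: inj_on_def)
  have "resolvent A N x \<alpha> = x \<alpha> + (\<Sum>\<gamma>\<in>(\<lambda>(i, \<gamma>). i # \<gamma>) ` (UNIV \<times> words M). word_op A \<gamma> (x (\<alpha> @ \<gamma>)))"
    unfolding resolvent_def Suc words_Suc by (subst sum.insert) auto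
  also have "\<dots> = x \<alpha> + (\<Sum>i\<in>UNIV. A i (\<Sum>\<gamma>\<in>words M. word_op A \<gamma> (x (\<alpha> @ i # \<gamma>))))"
    by (subst sum.reindex[OF inj])
      (simp add: case_prod_unfold sum.cartesian_product blinfun.sum_right)
  also have "\<dots> = x \<alpha> + backshift A (resolvent A N x) \<alpha>"
  proof -
    \<comment> \<open>Words \<gamma> of the full length \<open>N\<close> may be added on the right:
      after the letter \<open>i\<close> they lie outside the support of \<open>x\<close>.\<close>
    have "(\<Sum>\<gamma>\<in>words M. word_op A \<gamma> (x (\<alpha> @ i # \<gamma>))) = resolvent A N x (\<alpha> @ [i])" for i
      unfolding resolvent_def
      by (rule sum.mono_neutral_cong_left)
        (use x Suc in \<open>auto simp: words_iff supported_def blinfun.zero_right\<close>)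
    then show ?thesis by (simp add: backshift_def)
  qed
  finally show ?thesis .
qed

lemma supported_resolvent: "supported N x \<Longrightarrow> supported N (resolvent A N x)"
  by (auto simp: supported_def resolvent_def blinfun.zero_right)

lemma supported_backshift: "supported N y \<Longrightarrow> supported N (backshift A y)"
  by (auto simp: supported_def backshift_def blinfun.zero_right)

text \<open>The backward shift reads only longer words, hence is nilpotent on supported families.
  The equation determines \<open>y\<close> from the longest words downwards, which is the direction
  of the induction.\<close>

lemma resolvent_unique:
  fixes A :: "'n::finite \<Rightarrow> ('h::complex_inner_space \<Rightarrow>\<^sub>L 'h)"
  assumes x: "supported N x" and y: "supported N y"
    and eq: "\<And>\<alpha>. y \<alpha> = x \<alpha> + backshift A y \<alpha>"
  shows "resolvent A N x = y"
proof (rule ext)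
  fix \<alpha>
  show "resolvent A N x \<alpha> = y \<alpha>"
  proof (induction "Suc N - length \<alpha>" arbitrary: \<alpha>)
    case 0
    then show ?case using y supported_resolvent[OF x, of A] by (simp add: supported_def)
  next
    case (Suc k)
    then have "resolvent A N x (\<alpha> @ [i]) = y (\<alpha> @ [i])" for i by simp
    then show ?case using eq[of \<alpha>] resolvent_rec[OF x, of A \<alpha>] by (simp add: backshift_def)
  qed
qed

lemma sqnorm_nonneg [simp]: "0 \<le> sqnorm N x"
  by (simp add: sqnorm_def sum_nonneg)

text \<open>All suffixes have the same length, so a word is of the form
  \<open>\<alpha> @ \<gamma>\<close> in at most one way and no term is counted twice.\<close>

lemma sum_append_le:
  fixes g :: "'n::finite list \<Rightarrow> real"
  assumes g: "\<And>\<alpha>. 0 \<le> g \<alpha>" "\<And>\<alpha>. N < length \<alpha> \<Longrightarrow> g \<alpha> = 0" and B: "\<And>\<gamma>. \<gamma> \<in> B \<Longrightarrow> length \<gamma> = k"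
    and fB: "finite B"
  shows "(\<Sum>\<alpha>\<in>words N. \<Sum>\<gamma>\<in>B. g (\<alpha> @ \<gamma>)) \<le> (\<Sum>\<alpha>\<in>words N. g \<alpha>)"
proof -
  have inj: "inj_on (\<lambda>(\<alpha>, \<gamma>). \<alpha> @ \<gamma>) (words N \<times> B)"
    by (auto simp: inj_on_def B)
  have "(\<Sum>\<alpha>\<in>words N. \<Sum>\<gamma>\<in>B. g (\<alpha> @ \<gamma>)) = (\<Sum>\<beta>\<in>(\<lambda>(\<alpha>, \<gamma>). \<alpha> @ \<gamma>) ` (words N \<times> B). g \<beta>)"
    by (subst sum.reindex[OF inj]) (simp add: case_prod_unfold sum.cartesian_product)
  also have "\<dots> \<le> (\<Sum>\<beta>\<in>words (N + k). g \<beta>)"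
    by (intro sum_mono2) (use B g(1) in \<open>auto simp: words_iff\<close>)
  also have "\<dots> = (\<Sum>\<alpha>\<in>words N. g \<alpha>)"
    by (rule sum.mono_neutral_right) (use g(2) in \<open>auto simp: words_iff\<close>)
  finally show ?thesis .
qed

lemma sqnorm_backshift_le:
  fixes A :: "'n::finite \<Rightarrow> ('h::complex_hilbert_space \<Rightarrow>\<^sub>L 'h)"
  assumes A: "A \<in> BH" and y: "supported N y"
  shows "sqnorm N (backshift A y) \<le> (row_norm A)\<^sup>2 * sqnorm N y"
proof -
  have "sqnorm N (backshift A y) \<le> (\<Sum>\<alpha>\<in>words N. (row_norm A)\<^sup>2 * (\<Sum>i\<in>UNIV. (norm (y (\<alpha> @ [i])))\<^sup>2))"
    unfolding sqnorm_def backshift_def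
    by (intro sum_mono row_apply_le) (simp_all add: BH_D[OF A] row_norm_square)
  also have "\<dots> = (row_norm A)\<^sup>2 * (\<Sum>\<alpha>\<in>words N. \<Sum>\<gamma>\<in>range (\<lambda>i. [i]). (norm (y (\<alpha> @ \<gamma>)))\<^sup>2)"
    by (simp add: sum_distrib_left[symmetric] sum.reindex inj_on_def)
  also have "\<dots> \<le> (row_norm A)\<^sup>2 * sqnorm N y"
    unfolding sqnorm_def
    by (intro mult_left_mono sum_append_le[where k = 1]) (use y in \<open>auto simp: supported_def\<close>)
  finally show ?thesis .
qed

text \<open>For \<rho> = 1 and \<open>x = y - T y\<close> the form is
  \<open>sqnorm y - sqnorm (T y)\<close>, and \<open>T\<close> is a contraction because the row is
  one. This is the source of positive polynomials.\<close>

lemma row_contraction_kernel_nonneg: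
  fixes A :: "'n::finite \<Rightarrow> ('h::complex_hilbert_space \<Rightarrow>\<^sub>L 'h)"
  assumes A: "A \<in> BH" "row_norm A \<le> 1" and x: "supported N x"
  shows "0 \<le> kernel_form 1 A N x"
proof -
  let ?y = "resolvent A N x"
  have x_eq: "x \<alpha> = ?y \<alpha> - backshift A ?y \<alpha>" for \<alpha>
    using resolvent_rec[OF x, of A \<alpha>] by simp
  have "2 * Re (cinner (?y \<alpha>) (x \<alpha>)) - (norm (x \<alpha>))\<^sup>2 = (norm (?y \<alpha>))\<^sup>2 - (norm (backshift A ?y \<alpha>))\<^sup>2" for \<alpha>
    unfolding x_eq[of \<alpha>] inner_eq_Re_cinner[symmetric] power2_norm_eq_inner
    by (simp add: inner_diff_left inner_diff_right inner_commute)
  note eq = this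
  have "kernel_form 1 A N x = (\<Sum>\<alpha>\<in>words N. 2 * Re (cinner (?y \<alpha>) (x \<alpha>)) - (norm (x \<alpha>))\<^sup>2)"
    by (simp add: kernel_form_eq sqnorm_def sum_distrib_left sum_subtractf sum_negf)
  also have "\<dots> = sqnorm N ?y - sqnorm N (backshift A ?y)"
    by (simp only: eq sqnorm_def sum_subtractf)
  finally have "kernel_form 1 A N x = sqnorm N ?y - sqnorm N (backshift A ?y)" .
  moreover have "sqnorm N (backshift A ?y) \<le> sqnorm N ?y"
    using sqnorm_backshift_le[OF A(1) supported_resolvent[OF x], of A]
      mult_right_mono[OF power_le_one[OF row_norm_nonneg A(2), of 2] sqnorm_nonneg[of N ?y]]
    by simp
  ultimately show ?thesis by simp
qed

section \<open>Polynomials evaluated at symbols, and truncated kernels as polynomials\<close>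

definition poly_form ::
  "nat \<Rightarrow> 'n ncpoly \<Rightarrow> ('n list \<Rightarrow> ('h::complex_inner_space \<Rightarrow>\<^sub>L 'h)) \<Rightarrow> (nat \<Rightarrow> 'h) \<Rightarrow> real" where
  "poly_form m p \<Phi> x = Re (\<Sum>i<m. \<Sum>j<m. \<Sum>\<alpha> | p \<alpha> i j \<noteq> 0. p \<alpha> i j * cinner (\<Phi> \<alpha> (x j)) (x i))"

text \<open>Linearity in the symbol is the reason for evaluating at arbitrary \<Phi>: differences of
  symbols belong to no tuple of operators.\<close>

lemma poly_form_diff: "poly_form m p (\<lambda>\<gamma>. \<Phi> \<gamma> - \<Psi> \<gamma>) x = poly_form m p \<Phi> x - poly_form m p \<Psi> x"
  by (simp add: poly_form_def blinfun.diff_left cinner_diff_left right_diff_distrib sum_subtractf)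

lemma poly_form_scaleR: "poly_form m p (\<lambda>\<gamma>. r *\<^sub>R \<Phi> \<gamma>) x = r * poly_form m p \<Phi> x"
proof -
  have "poly_form m p (\<lambda>\<gamma>. r *\<^sub>R \<Phi> \<gamma>) x =
    Re (of_real r * (\<Sum>i<m. \<Sum>j<m. \<Sum>\<alpha> | p \<alpha> i j \<noteq> 0. p \<alpha> i j * cinner (\<Phi> \<alpha> (x j)) (x i)))"
    unfolding poly_form_def
    by (simp only: blinfun.scaleR_left cinner_scaleR_left sum_distrib_left mult.left_commute)
  then show ?thesis by (simp add: poly_form_def)
qed

lemma is_ncpoly_degree:
  assumes "is_ncpoly m p"
  shows "\<exists>N. \<forall>\<alpha> i j. i < m \<longrightarrow> j < m \<longrightarrow> p \<alpha> i j \<noteq> 0 \<longrightarrow> length \<alpha> \<le> N"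
proof -
  let ?S = "{\<alpha>. \<exists>i<m. \<exists>j<m. p \<alpha> i j \<noteq> 0}"
  have "length \<alpha> \<le> Max (length ` ?S)" if "i < m" "j < m" "p \<alpha> i j \<noteq> 0" for \<alpha> i j
    by (rule Max_ge) (use that assms in \<open>auto simp: is_ncpoly_def\<close>)
  then show ?thesis by blast
qed

lemma poly_form_words:
  fixes p :: "'n::finite ncpoly"
  assumes "\<And>\<alpha> i j. i < m \<Longrightarrow> j < m \<Longrightarrow> p \<alpha> i j \<noteq> 0 \<Longrightarrow> length \<alpha> \<le> N"
  shows "poly_form m p \<Phi> x = Re (\<Sum>i<m. \<Sum>j<m. \<Sum>\<alpha>\<in>words N. p \<alpha> i j * cinner (\<Phi> \<alpha> (x j)) (x i))"
proof -
  have "(\<Sum>\<alpha> | p \<alpha> i j \<noteq> 0. p \<alpha> i j * cinner (\<Phi> \<alpha> (x j)) (x i))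
     = (\<Sum>\<alpha>\<in>words N. p \<alpha> i j * cinner (\<Phi> \<alpha> (x j)) (x i))" if "i < m" "j < m" for i j
    by (rule sum.mono_neutral_left) (use assms that in \<open>auto simp: words_iff\<close>)
  then show ?thesis by (simp add: poly_form_def)
qed

definition block_form :: "nat \<Rightarrow> 'h::complex_inner_space block_op \<Rightarrow> (nat \<Rightarrow> 'h) \<Rightarrow> complex" where
  "block_form m P x = (\<Sum>i<m. cinner (block_apply m P x i) (x i))"

lemma block_nonneg_iff: "block_nonneg m P \<longleftrightarrow> (\<forall>x. block_form m P x \<in> \<real>\<^sub>\<ge>\<^sub>0)"
  by (simp add: block_nonneg_def block_form_def)

lemma block_form_diff: "block_form m (\<lambda>i j. P i j - Q i j) x = block_form m P x - block_form m Q x"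
  and block_form_add: "block_form m (\<lambda>i j. P i j + Q i j) x = block_form m P x + block_form m Q x"
  and block_form_scaleR: "block_form m (\<lambda>i j. r *\<^sub>R P i j) x = of_real r * block_form m P x"
  by (simp_all add: block_form_def block_apply_def blinfun.diff_left blinfun.add_left
      blinfun.scaleR_left cinner_sum_left cinner_diff_left cinner_add_left cinner_scaleR_left
      sum_subtractf sum.distrib sum_distrib_left)

text \<open>The adjoint block matrix has the conjugate form, so the form of the real part is real.
  This reduces \<open>block_nonneg\<close>, a statement on complex values, to a real
  inequality.\<close>

lemma block_form_Re_poly:
  fixes X :: "'n \<Rightarrow> ('h::complex_hilbert_space \<Rightarrow>\<^sub>L 'h)"
  assumes X: "X \<in> BH"
  shows "block_form m (block_Re (poly_op p X)) x = of_real (poly_form m p (word_op X) x)"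
proof -
  let ?P = "poly_op p X"
  define q where "q = (\<Sum>i<m. \<Sum>j<m. cinner (?P i j (x j)) (x i))"
  have cl: "complex_linear (?P i j)" for i j
    unfolding poly_op_def by (intro complex_linear_sum complex_linear_scaleC_op complex_linear_word_op X)
  have "block_form m (block_adj ?P) x = (\<Sum>i<m. \<Sum>j<m. cnj (cinner (?P j i (x i)) (x j)))"
    unfolding block_form_def block_apply_def block_adj_def
    by (simp add: cinner_sum_left adj_eq'[OF cl] cinner_commute[symmetric])
  also have "\<dots> = cnj q"
    unfolding q_def cnj_sum by (rule sum.swap)
  finally have 1: "block_form m (block_adj ?P) x = cnj q" .
  have 2: "block_form m ?P x = q"
    by (simp add: block_form_def block_apply_def q_def cinner_sum_left)
  have "block_form m (block_Re ?P) x = of_real (1/2) * (cnj q + q)"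
    unfolding block_Re_def block_form_scaleR block_form_add using 1 2 by simp
  also have "\<dots> = of_real (Re q)"
    by (simp add: complex_eq_iff)
  also have "Re q = poly_form m p (word_op X) x"
    by (simp add: q_def poly_form_def poly_op_def blinfun_sum_apply cinner_sum_left cinner_scaleC_left)
  finally show ?thesis .
qed

lemma re_nonneg_poly_iff:
  "re_nonneg_poly TYPE('k::complex_hilbert_space) m (p :: 'n::finite ncpoly) \<longleftrightarrow>
     1 \<le> m \<and> is_ncpoly m p \<and>
     (\<forall>X :: 'n \<Rightarrow> ('k \<Rightarrow>\<^sub>L 'k). X \<in> BH \<longrightarrow> norm (\<Sum>i\<in>UNIV. X i o\<^sub>L adj (X i)) < 1 \<longrightarrow>
        (\<forall>x. 0 \<le> poly_form m p (word_op X) x))"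
  by (auto simp: re_nonneg_poly_def block_nonneg_iff block_form_Re_poly)

text \<open>Evaluation at the zero tuple keeps only the empty word, so
  \<open>p(A) + (\<rho> - 1) p(0)\<close> is the evaluation at the tuple with its empty word
  rescaled to \<rho>.\<close>

lemma poly_form_symbol:
  "poly_form m p (symbol \<rho> A) x = poly_form m p (word_op A) x + (\<rho> - 1) * poly_form m p (word_op (\<lambda>_. 0)) x"
proof -
  have "symbol \<rho> A = (\<lambda>\<gamma>. word_op A \<gamma> - (1 - \<rho>) *\<^sub>R word_op (\<lambda>_. 0) \<gamma>)"
    by (auto simp: fun_eq_iff symbol_def word_op_zero algebra_simps)
  then show ?thesis
    by (simp only: poly_form_diff poly_form_scaleR) (simp add: algebra_simps)
qed

lemma harnack_dom_iff_poly_form: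
  fixes A B :: "'n::finite \<Rightarrow> ('h::complex_hilbert_space \<Rightarrow>\<^sub>L 'h)"
  assumes "A \<in> BH" "B \<in> BH"
  shows "harnack_dom K \<rho> c A B \<longleftrightarrow> (\<forall>m p. re_nonneg_poly K m p \<longrightarrow>
     (\<forall>x. poly_form m p (symbol \<rho> A) x \<le> c\<^sup>2 * poly_form m p (symbol \<rho> B) x))"
proof -
  have "block_form m (\<lambda>i j. c\<^sup>2 *\<^sub>R (block_Re (poly_op p B) i j +
          (\<rho> - 1) *\<^sub>R block_Re (poly_op p (\<lambda>_. 0 :: 'h \<Rightarrow>\<^sub>L 'h)) i j) -
        (block_Re (poly_op p A) i j + (\<rho> - 1) *\<^sub>R block_Re (poly_op p (\<lambda>_. 0 :: 'h \<Rightarrow>\<^sub>L 'h)) i j)) x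
      = of_real (c\<^sup>2 * poly_form m p (symbol \<rho> B) x - poly_form m p (symbol \<rho> A) x)" for m p x
    by (simp only: block_form_diff block_form_add block_form_scaleR block_form_Re_poly assms BH_zero
        poly_form_symbol of_real_mult of_real_add of_real_diff)
  then show ?thesis
    by (simp only: harnack_dom_def block_nonneg_iff nonneg_Reals_of_real_iff) simp
qed

text \<open>The values of this polynomial at a tuple are the truncations of the kernel of that tuple.\<close>

definition kernel_poly :: "(nat \<Rightarrow> 'n list) \<Rightarrow> 'n ncpoly" where
  "kernel_poly e \<gamma> i j = (if e j = e i @ \<gamma> then 2 else 0) - (if \<gamma> = [] \<and> i = j then 1 else 0)"

text \<open>The enumeration \<open>e\<close> turns matrix indices into words. Entry
  \<open>(i, j)\<close> sees only the \<gamma> with \<open>e j = e i @ \<gamma>\<close>; the factor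
  2 compensates the halving in the real part, and the correction at the empty word leaves
  coefficient 1 on the diagonal.\<close>

lemma
  fixes e :: "nat \<Rightarrow> 'n::finite list"
  assumes e: "bij_betw e {..<m} (words N)"
  shows is_ncpoly_kernel_poly: "is_ncpoly m (kernel_poly e)"
    and poly_form_kernel_poly: "supported N x \<Longrightarrow>
      poly_form m (kernel_poly e) \<Phi> (\<lambda>j. x (e j)) = toeplitz_form \<Phi> N x"
proof -
  have eN: "length (e j) \<le> N" if "j < m" for j
    using bij_betwE[OF e] that by (auto simp: words_iff)
  have deg: "length \<gamma> \<le> N" if "i < m" "j < m" "kernel_poly e \<gamma> i j \<noteq> 0" for \<gamma> i j
    using that eN[of j] by (auto simp: kernel_poly_def split: if_splits)
  have "{\<gamma>. \<exists>i<m. \<exists>j<m. kernel_poly e \<gamma> i j \<noteq> 0} \<subseteq> words N"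
    using deg by (auto simp: words_iff)
  then show "is_ncpoly m (kernel_poly e)"
    unfolding is_ncpoly_def using finite_words finite_subset by blast
  assume x: "supported N x"
  have inner: "(\<Sum>j<m. \<Sum>\<gamma>\<in>words N. kernel_poly e \<gamma> i j * cinner (\<Phi> \<gamma> (x (e j))) (x (e i)))
     = 2 * (\<Sum>\<gamma>\<in>words N. cinner (\<Phi> \<gamma> (x (e i @ \<gamma>))) (x (e i))) - cinner (\<Phi> [] (x (e i))) (x (e i))"
    if i: "i < m" for i
  proof -
    have "(\<Sum>j<m. \<Sum>\<gamma>\<in>words N. (if e j = e i @ \<gamma> then 2 else 0) * cinner (\<Phi> \<gamma> (x (e j))) (x (e i)))
      = (\<Sum>\<beta>\<in>words N. \<Sum>\<gamma>\<in>words N. (if \<beta> = e i @ \<gamma> then 2 else 0) * cinner (\<Phi> \<gamma> (x \<beta>)) (x (e i)))"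
      by (rule sum.reindex_bij_betw[OF e])
    also have "\<dots> = (\<Sum>\<gamma>\<in>words N. \<Sum>\<beta>\<in>words N. if \<beta> = e i @ \<gamma> then 2 * cinner (\<Phi> \<gamma> (x (e i @ \<gamma>))) (x (e i)) else 0)"
      by (subst sum.swap) (intro sum.cong, auto)
    also have "\<dots> = (\<Sum>\<gamma>\<in>words N. 2 * cinner (\<Phi> \<gamma> (x (e i @ \<gamma>))) (x (e i)))"
      by (intro sum.cong) (use x in \<open>auto simp: words_iff supported_def blinfun.zero_right\<close>)
    finally have 1: "(\<Sum>j<m. \<Sum>\<gamma>\<in>words N. (if e j = e i @ \<gamma> then 2 else 0) * cinner (\<Phi> \<gamma> (x (e j))) (x (e i)))
      = 2 * (\<Sum>\<gamma>\<in>words N. cinner (\<Phi> \<gamma> (x (e i @ \<gamma>))) (x (e i)))"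
      by (simp add: sum_distrib_left)
    have "(\<Sum>j<m. \<Sum>\<gamma>\<in>words N. (if \<gamma> = [] \<and> i = j then 1 else 0) * cinner (\<Phi> \<gamma> (x (e j))) (x (e i)))
      = (\<Sum>j<m. if j = i then cinner (\<Phi> [] (x (e i))) (x (e i)) else 0)"
    proof (rule sum.cong)
      fix j
      show "(\<Sum>\<gamma>\<in>words N. (if \<gamma> = [] \<and> i = j then 1 else 0) * cinner (\<Phi> \<gamma> (x (e j))) (x (e i)))
        = (if j = i then cinner (\<Phi> [] (x (e i))) (x (e i)) else 0)"
        by (subst sum.remove[OF finite_words Nil_in_words]) (auto intro!: sum.neutral)
    qed simp
    also have "\<dots> = cinner (\<Phi> [] (x (e i))) (x (e i))"
      using i by simp
    finally show ?thesis
      using 1 by (simp add: kernel_poly_def left_diff_distrib sum_subtractf)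
  qed
  have "poly_form m (kernel_poly e) \<Phi> (\<lambda>j. x (e j)) =
    Re (\<Sum>i<m. 2 * (\<Sum>\<gamma>\<in>words N. cinner (\<Phi> \<gamma> (x (e i @ \<gamma>))) (x (e i))) - cinner (\<Phi> [] (x (e i))) (x (e i)))"
    by (subst poly_form_words[OF deg]) (simp_all add: inner)
  also have "\<dots> = toeplitz_form \<Phi> N x"
    unfolding toeplitz_form_def by (subst sum.reindex_bij_betw[OF e]) (rule refl)
  finally show "poly_form m (kernel_poly e) \<Phi> (\<lambda>j. x (e j)) = toeplitz_form \<Phi> N x" .
qed

lemma symbol_1: "symbol 1 A = word_op A"
  by (auto simp: symbol_def fun_eq_iff)

text \<open>At a row contraction this polynomial gives the truncated kernel with \<rho> = 1, which
  is positive. The size \<open>m\<close> is nonzero since the empty word is enumerated.\<close>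

lemma obtain_kernel_poly:
  obtains m and e :: "nat \<Rightarrow> 'n::finite list" where "bij_betw e {..<m} (words N)"
    "re_nonneg_poly TYPE('k::complex_hilbert_space) m (kernel_poly e)"
proof -
  obtain e :: "nat \<Rightarrow> 'n list" and m where e: "bij_betw e {..<m} (words N)"
    using ex_bij_betw_nat_finite[OF finite_words[where 'n = 'n and N = N]]
    by (metis atLeast0LessThan)
  have "[] \<in> e ` {..<m}" using e by (simp add: bij_betw_def)
  then have "m \<noteq> 0" by auto
  moreover have "0 \<le> poly_form m (kernel_poly e) (word_op X) \<xi>"
    if X: "X \<in> BH" "norm (\<Sum>i\<in>UNIV. X i o\<^sub>L adj (X i)) < 1"
    for X :: "'n \<Rightarrow> ('k \<Rightarrow>\<^sub>L 'k)" and \<xi>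
  proof -
    define x where "x = (\<lambda>\<alpha>. if \<alpha> \<in> words N then \<xi> (inv_into {..<m} e \<alpha>) else 0)"
    have x: "supported N x" by (auto simp: supported_def x_def words_iff)
    have "x (e j) = \<xi> j" if "j < m" for j
      using e that by (auto simp: x_def bij_betw_def)
    then have "poly_form m (kernel_poly e) (word_op X) \<xi> = poly_form m (kernel_poly e) (word_op X) (\<lambda>j. x (e j))"
      by (simp add: poly_form_def)
    also have "\<dots> = kernel_form 1 X N x"
      by (simp add: poly_form_kernel_poly[OF e x] symbol_1)
    also have "\<dots> \<ge> 0"
      by (rule row_contraction_kernel_nonneg[OF X(1) _ x])
        (use X(2) in \<open>simp add: row_norm_def real_le_lsqrt\<close>)
    finally show ?thesis .
  qed
  ultimately have "re_nonneg_poly TYPE('k) m (kernel_poly e)"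
    by (simp add: re_nonneg_poly_iff is_ncpoly_kernel_poly[OF e])
  then show ?thesis using that e by blast
qed

text \<open>The easy half of the passage from polynomials to kernels: the domination is tested on a
  kernel polynomial.\<close>

lemma harnack_dom_imp_kernel_le:
  fixes A B :: "'n::finite \<Rightarrow> ('h::complex_hilbert_space \<Rightarrow>\<^sub>L 'h)"
  assumes "A \<in> BH" "B \<in> BH" "harnack_dom TYPE('k::complex_hilbert_space) \<rho> c A B" "supported N x"
  shows "kernel_form \<rho> A N x \<le> c\<^sup>2 * kernel_form \<rho> B N x"
proof -
  obtain m and e :: "nat \<Rightarrow> 'n list" where e: "bij_betw e {..<m} (words N)"
    "re_nonneg_poly TYPE('k) m (kernel_poly e)"
    using obtain_kernel_poly by blast
  then have "poly_form m (kernel_poly e) (symbol \<rho> A) (\<lambda>j. x (e j))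
      \<le> c\<^sup>2 * poly_form m (kernel_poly e) (symbol \<rho> B) (\<lambda>j. x (e j))"
    using assms by (auto simp: harnack_dom_iff_poly_form)
  then show ?thesis by (simp add: poly_form_kernel_poly[OF e(1) assms(4)])
qed

section \<open>Positive kernels against positive polynomials\<close>

text \<open>Letting vectors be part of the index makes the operator kernel a scalar kernel on pairs
  of a word and a vector, to which Gram vectors and reproducing kernels apply. It is linear in
  \<open>v\<close> and conjugate linear in \<open>u\<close>.\<close>

definition kernel_entry ::
  "('n list \<Rightarrow> ('h::complex_inner_space \<Rightarrow>\<^sub>L 'h)) \<Rightarrow> 'n list \<Rightarrow> 'h \<Rightarrow> 'n list \<Rightarrow> 'h \<Rightarrow> complex" where
  "kernel_entry \<Phi> \<alpha> u \<beta> v =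
     (if prefix \<alpha> \<beta> then cinner (\<Phi> (drop (length \<alpha>) \<beta>) v) u
      else if prefix \<beta> \<alpha> then cnj (cinner (\<Phi> (drop (length \<beta>) \<alpha>) u) v) else 0)"

lemma kernel_entry_Nil [simp]: "kernel_entry \<Phi> [] u \<gamma> v = cinner (\<Phi> \<gamma> v) u"
  by (simp add: kernel_entry_def)

text \<open>The multi-Toeplitz property. Equal first letters cancel and distinct ones give 0, so
  prefixing a letter acts as an isometry, with orthogonal ranges for different letters.\<close>

lemma kernel_entry_Cons: "kernel_entry \<Phi> (i # \<alpha>) u (j # \<beta>) v = (if i = j then kernel_entry \<Phi> \<alpha> u \<beta> v else 0)"
  by (simp add: kernel_entry_def)

lemma kernel_entry_commute:
  assumes "\<Phi> [] = t *\<^sub>R id_blinfun"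
  shows "kernel_entry \<Phi> \<beta> v \<alpha> u = cnj (kernel_entry \<Phi> \<alpha> u \<beta> v)"
proof (cases "\<alpha> = \<beta>")
  case True
  then show ?thesis
    by (simp add: kernel_entry_def assms blinfun.scaleR_left cinner_scaleR_left cinner_commute[of v u])
next
  case False
  then show ?thesis by (auto simp: kernel_entry_def dest: prefix_order.antisym)
qed

lemma kernel_entry_scale_left: "(\<And>\<gamma>. complex_linear (\<Phi> \<gamma>)) \<Longrightarrow> kernel_entry \<Phi> \<alpha> (c *\<^sub>C u) \<beta> v = cnj c * kernel_entry \<Phi> \<alpha> u \<beta> v"
  and kernel_entry_scale_right: "(\<And>\<gamma>. complex_linear (\<Phi> \<gamma>)) \<Longrightarrow> kernel_entry \<Phi> \<alpha> u \<beta> (c *\<^sub>C v) = c * kernel_entry \<Phi> \<alpha> u \<beta> v"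
  by (simp_all add: kernel_entry_def complex_linearD cinner_scaleC_left cinner_scaleC_right)

lemma kernel_entry_sum_left: "kernel_entry \<Phi> \<alpha> (\<Sum>a\<in>S. u a) \<beta> v = (\<Sum>a\<in>S. kernel_entry \<Phi> \<alpha> (u a) \<beta> v)"
  and kernel_entry_sum_right: "kernel_entry \<Phi> \<alpha> w \<beta> (\<Sum>a\<in>S. u a) = (\<Sum>a\<in>S. kernel_entry \<Phi> \<alpha> w \<beta> (u a))"
  by (simp_all add: kernel_entry_def blinfun.sum_right cinner_sum_left cinner_sum_right)

text \<open>The upper triangle plus its conjugate counts the diagonal twice, which the correction in
  \<open>toeplitz_form\<close> removes. The diagonal is real because \<open>\<Phi> []\<close> is a
  real scalar.\<close>

lemma sum_kap:
  fixes x :: "'n::finite list \<Rightarrow> 'h::complex_inner_space"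
  assumes t: "\<Phi> [] = t *\<^sub>R id_blinfun" and x: "supported N x"
  shows "(\<Sum>\<alpha>\<in>words N. \<Sum>\<beta>\<in>words N. kernel_entry \<Phi> \<alpha> (x \<alpha>) \<beta> (x \<beta>)) = of_real (toeplitz_form \<Phi> N x)"
proof -
  define U where "U = (\<lambda>\<alpha> \<beta>. if prefix \<alpha> \<beta> then cinner (\<Phi> (drop (length \<alpha>) \<beta>) (x \<beta>)) (x \<alpha>) else 0)"
  define D where "D = (\<lambda>\<alpha>. cinner (\<Phi> [] (x \<alpha>)) (x \<alpha>))"
  define S where "S = (\<Sum>\<alpha>\<in>words N. \<Sum>\<beta>\<in>words N. U \<alpha> \<beta>)"
  have D: "D \<alpha> = of_real (t * (norm (x \<alpha>))\<^sup>2)" for \<alpha>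
    by (simp add: D_def t blinfun.scaleR_left cinner_scaleR_left cinner_self)
  have k: "kernel_entry \<Phi> \<alpha> (x \<alpha>) \<beta> (x \<beta>) = U \<alpha> \<beta> + cnj (U \<beta> \<alpha>) - (if \<alpha> = \<beta> then D \<alpha> else 0)" for \<alpha> \<beta>
  proof (cases "\<alpha> = \<beta>")
    case True
    then have "U \<alpha> \<beta> = D \<alpha>" "U \<beta> \<alpha> = D \<alpha>" by (simp_all add: U_def D_def)
    moreover have "cnj (D \<alpha>) = D \<alpha>" by (simp add: D)
    moreover have "kernel_entry \<Phi> \<alpha> (x \<alpha>) \<beta> (x \<beta>) = D \<alpha>" using True by (simp add: kernel_entry_def D_def)
    ultimately show ?thesis using True by simp
  next
    case False
    then show ?thesis by (auto simp: kernel_entry_def U_def dest: prefix_order.antisym)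
  qed
  \<comment> \<open>Summing over extensions \<beta> of \<alpha> is summing over suffixes; suffixes
    that lead beyond length \<open>N\<close> contribute 0.\<close>
  have U: "(\<Sum>\<beta>\<in>words N. U \<alpha> \<beta>) = (\<Sum>\<gamma>\<in>words N. cinner (\<Phi> \<gamma> (x (\<alpha> @ \<gamma>))) (x \<alpha>))" for \<alpha>
  proof -
    have "U \<alpha> \<beta> = (\<Sum>\<gamma>\<in>words N. if \<beta> = \<alpha> @ \<gamma> then cinner (\<Phi> \<gamma> (x (\<alpha> @ \<gamma>))) (x \<alpha>) else 0)"
      if "\<beta> \<in> words N" for \<beta>
    proof (cases "prefix \<alpha> \<beta>")
      case True
      then obtain \<gamma> where g: "\<beta> = \<alpha> @ \<gamma>" by (auto simp: prefix_def)
      then have "(\<Sum>\<delta>\<in>words N. if \<beta> = \<alpha> @ \<delta> then cinner (\<Phi> \<delta> (x (\<alpha> @ \<delta>))) (x \<alpha>) else 0)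
        = (\<Sum>\<delta>\<in>words N. if \<delta> = \<gamma> then cinner (\<Phi> \<gamma> (x (\<alpha> @ \<gamma>))) (x \<alpha>) else 0)"
        by (intro sum.cong) auto
      also have "\<dots> = cinner (\<Phi> \<gamma> (x (\<alpha> @ \<gamma>))) (x \<alpha>)"
        using that g by (simp add: words_iff)
      finally show ?thesis using g by (simp add: U_def)
    next
      case False
      then have "(\<Sum>\<gamma>\<in>words N. if \<beta> = \<alpha> @ \<gamma> then cinner (\<Phi> \<gamma> (x (\<alpha> @ \<gamma>))) (x \<alpha>) else 0) = 0"
        by (intro sum.neutral) auto
      then show ?thesis using False by (simp add: U_def)
    qed
    then have "(\<Sum>\<beta>\<in>words N. U \<alpha> \<beta>) =
       (\<Sum>\<beta>\<in>words N. \<Sum>\<gamma>\<in>words N. if \<beta> = \<alpha> @ \<gamma> then cinner (\<Phi> \<gamma> (x (\<alpha> @ \<gamma>))) (x \<alpha>) else 0)"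
      by simp
    also have "\<dots> = (\<Sum>\<gamma>\<in>words N. \<Sum>\<beta>\<in>words N. if \<beta> = \<alpha> @ \<gamma> then cinner (\<Phi> \<gamma> (x (\<alpha> @ \<gamma>))) (x \<alpha>) else 0)"
      by (rule sum.swap)
    also have "\<dots> = (\<Sum>\<gamma>\<in>words N. cinner (\<Phi> \<gamma> (x (\<alpha> @ \<gamma>))) (x \<alpha>))"
      by (intro sum.cong) (use x in \<open>auto simp: words_iff supported_def blinfun.zero_right\<close>)
    finally show ?thesis .
  qed
  have "(\<Sum>\<alpha>\<in>words N. \<Sum>\<beta>\<in>words N. cnj (U \<beta> \<alpha>)) = cnj S"
    unfolding S_def cnj_sum by (rule sum.swap)
  then have "(\<Sum>\<alpha>\<in>words N. \<Sum>\<beta>\<in>words N. kernel_entry \<Phi> \<alpha> (x \<alpha>) \<beta> (x \<beta>)) = S + cnj S - (\<Sum>\<alpha>\<in>words N. D \<alpha>)"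
    by (simp add: k sum.distrib sum_subtractf S_def)
  also have "\<dots> = of_real (Re (2 * S - (\<Sum>\<alpha>\<in>words N. D \<alpha>)))"
    by (simp add: complex_eq_iff D)
  also have "2 * S - (\<Sum>\<alpha>\<in>words N. D \<alpha>) = (\<Sum>\<alpha>\<in>words N.
     2 * (\<Sum>\<gamma>\<in>words N. cinner (\<Phi> \<gamma> (x (\<alpha> @ \<gamma>))) (x \<alpha>)) - cinner (\<Phi> [] (x \<alpha>)) (x \<alpha>))"
    by (simp add: S_def U D_def sum_subtractf sum_distrib_left)
  finally show ?thesis by (simp add: toeplitz_form_def)
qed

section \<open>Gram vectors by Cholesky and Gram-Schmidt\<close>

lemma sum_single:
  "finite S \<Longrightarrow> a \<in> S \<Longrightarrow> (\<And>b. b \<in> S \<Longrightarrow> b \<noteq> a \<Longrightarrow> f b = 0) \<Longrightarrow> sum f S = f a"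
  for f :: "'a \<Rightarrow> 'b::comm_monoid_add"
  by (subst sum.remove[of S a]) (auto intro: sum.neutral)

lemma scaleC_minus_left: "(- c) *\<^sub>C x = - (c *\<^sub>C (x :: 'h::complex_inner_space))"
  by (metis mult_minus1 scaleC_minus1 scaleC_scaleC)

text \<open>Cholesky decomposition: one step splits off the rank one kernel through the row of \<open>s\<close> and
  leaves its Schur complement.\<close>

lemma psd_rank_one_sum:
  fixes g :: "'a \<Rightarrow> 'a \<Rightarrow> complex"
  assumes "finite S"
    and "\<And>a b. a \<in> S \<Longrightarrow> b \<in> S \<Longrightarrow> g b a = cnj (g a b)"
    and "\<And>c. 0 \<le> Re (\<Sum>a\<in>S. \<Sum>b\<in>S. c a * cnj (c b) * g a b)"
  shows "\<exists>(n::nat) f. \<forall>a\<in>S. \<forall>b\<in>S. g a b = (\<Sum>l<n. f l a * cnj (f l b))"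
  using assms
proof (induction S arbitrary: g)
  case empty
  then show ?case by auto
next
  case (insert s S)
  define d where "d = Re (g s s)"
  have gss: "g s s = of_real d"
    using insert.prems(1)[of s s] by (simp add: d_def complex_eq_iff)
  have split: "(\<Sum>a\<in>insert s S. \<Sum>b\<in>insert s S. c a * cnj (c b) * g a b) =
      (\<Sum>a\<in>S. \<Sum>b\<in>S. c a * cnj (c b) * g a b) + cnj (c s) * (\<Sum>a\<in>S. c a * g a s)
      + c s * cnj (\<Sum>a\<in>S. c a * g a s) + c s * cnj (c s) * of_real d" for c
  proof -
    have "(\<Sum>b\<in>S. c s * cnj (c b) * g s b) = c s * cnj (\<Sum>a\<in>S. c a * g a s)"
      unfolding sum_distrib_left cnj_sum
      by (intro sum.cong) (use insert.prems(1)[of _ s] in \<open>auto simp: mult_ac\<close>)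
    then show ?thesis
      using insert.hyps by (simp add: gss sum.distrib sum_distrib_left algebra_simps)
  qed
  have d0: "0 \<le> d"
  proof -
    have "0 \<le> Re (\<Sum>a\<in>insert s S. \<Sum>b\<in>insert s S. (if a = s then 1 else 0) * cnj (if b = s then 1 else 0) * g a b)"
      by (rule insert.prems(2))
    also have "(\<Sum>a\<in>insert s S. \<Sum>b\<in>insert s S. (if a = s then 1 else 0) * cnj (if b = s then 1 else 0) * g a b) = of_real d"
      using insert.hyps unfolding split by (subst (1 2 3) sum.neutral) (auto intro!: sum.neutral)
    finally show ?thesis by simp
  qed
  have S_psd: "0 \<le> Re (\<Sum>a\<in>S. \<Sum>b\<in>S. c a * cnj (c b) * g a b)" for c
  proof -
    have "(\<Sum>a\<in>insert s S. \<Sum>b\<in>insert s S. (c(s := 0)) a * cnj ((c(s := 0)) b) * g a b) =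
       (\<Sum>a\<in>S. \<Sum>b\<in>S. c a * cnj (c b) * g a b)"
      unfolding split using insert.hyps by (auto intro!: sum.cong)
    then show ?thesis using insert.prems(2)[of "c(s := 0)"] by simp
  qed
  show ?case
  proof (cases "d = 0")
    case True
    have z: "g a s = 0" if a: "a \<in> S" for a
    proof (rule ccontr)
      assume nz: "g a s \<noteq> 0"
      \<comment> \<open>With zero pivot the form is affine in the coefficient at \<open>s\<close>.
        This \<open>T\<close> makes its value at \<open>c\<close> equal to
        \<open>- Re (g a a) - 2\<close>, against positivity at \<open>a\<close>.\<close>
      define T where "T = (Re (g a a) + 1) / (cmod (g a s))\<^sup>2"
      define c where "c = (\<lambda>b. if b = a then 1 else if b = s then - of_real T * g a s else 0)"
      have as: "a \<noteq> s" using a insert.hyps by auto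
      have "(\<Sum>b\<in>S. c b * g b s) = (\<Sum>b\<in>S. if b = a then g a s else 0)"
        using insert.hyps by (intro sum.cong) (auto simp: c_def)
      then have 1: "(\<Sum>b\<in>S. c b * g b s) = g a s" using a insert.hyps by simp
      have c0: "c b = 0" if "b \<in> S" "b \<noteq> a" for b
        using that insert.hyps by (auto simp: c_def)
      have "(\<Sum>b\<in>S. \<Sum>b'\<in>S. c b * cnj (c b') * g b b') = (\<Sum>b'\<in>S. c a * cnj (c b') * g a b')"
        using insert.hyps(1) a by (rule sum_single) (simp add: c0)
      also have "\<dots> = c a * cnj (c a) * g a a"
        using insert.hyps(1) a by (rule sum_single) (simp add: c0)
      finally have 2: "(\<Sum>b\<in>S. \<Sum>b'\<in>S. c b * cnj (c b') * g b b') = g a a"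
        by (simp add: c_def)
      have cs: "c s = - of_real T * g a s" using as by (simp add: c_def)
      have "0 \<le> Re (g a a + cnj (c s) * g a s + c s * cnj (g a s))"
        using insert.prems(2)[of c] unfolding split 1 2 True by simp
      also have "g a a + cnj (c s) * g a s + c s * cnj (g a s) = g a a - of_real (2 * T * (cmod (g a s))\<^sup>2)"
        unfolding cs of_real_mult complex_norm_square by (simp add: algebra_simps)
      also have "Re \<dots> = Re (g a a) - 2 * (Re (g a a) + 1)"
        using nz by (simp add: T_def)
      finally have "Re (g a a) \<le> - 2" by simp
      moreover have "0 \<le> Re (g a a)"
      proof -
        have "(\<Sum>b\<in>S. \<Sum>b'\<in>S. (if b = a then 1 else 0) * cnj (if b' = a then 1 else 0) * g b b')
          = (\<Sum>b'\<in>S. cnj (if b' = a then 1 else 0) * g a b')"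
          using insert.hyps(1) a by (subst sum_single[of S a]) simp_all
        also have "\<dots> = g a a"
          using insert.hyps(1) a by (subst sum_single[of S a]) simp_all
        finally show ?thesis using S_psd[of "\<lambda>b. if b = a then 1 else 0"] by simp
      qed
      ultimately show False by simp
    qed
    obtain n f where nf: "\<forall>a\<in>S. \<forall>b\<in>S. g a b = (\<Sum>l<(n::nat). f l a * cnj (f l b))"
      using insert.IH[OF insert.prems(1) S_psd] by blast
    have z': "g s a = 0" if "a \<in> S" for a
      using insert.prems(1)[of a s] z[OF that] that by simp
    have "g a b = (\<Sum>l<n. ((f l)(s := 0)) a * cnj (((f l)(s := 0)) b))" if "a \<in> insert s S" "b \<in> insert s S" for a b
    proof (cases "a = s \<or> b = s")
      case True
      moreover have "g a b = 0" using True that z z' gss \<open>d = 0\<close> by (metis insertE of_real_0)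
      moreover have "(\<Sum>l<n. ((f l)(s := 0)) a * cnj (((f l)(s := 0)) b)) = 0"
        using True by (intro sum.neutral) auto
      ultimately show ?thesis by simp
    next
      case False
      then show ?thesis using nf that by simp
    qed
    then show ?thesis by (intro exI[of _ n] exI[of _ "\<lambda>l. (f l)(s := 0)"] ballI)
  next
    case False
    then have d: "0 < d" using d0 by simp
    define g' where "g' = (\<lambda>a b. g a b - g a s * g s b / of_real d)"
    have herm: "g' b a = cnj (g' a b)" if "a \<in> S" "b \<in> S" for a b
    proof -
      have e: "g b a = cnj (g a b)" "g b s = cnj (g s b)" "g s a = cnj (g a s)"
        using that insert.prems(1) by blast+
      show ?thesis unfolding g'_def e by (simp add: mult.commute)
    qed
    have psd: "0 \<le> Re (\<Sum>a\<in>S. \<Sum>b\<in>S. c a * cnj (c b) * g' a b)" for c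
    proof -
      define P where "P = (\<Sum>a\<in>S. c a * g a s)"
      \<comment> \<open>The coefficient at \<open>s\<close> that minimises the form; completing the
        square leaves the Schur complement \<open>g'\<close>.\<close>
      define c' where "c' = c(s := - P / of_real d)"
      have eqc: "c' a = c a" if "a \<in> S" for a using that insert.hyps by (auto simp: c'_def)
      have "(\<Sum>a\<in>S. \<Sum>b\<in>S. c a * cnj (c b) * (g a s * g s b / of_real d))
          = (\<Sum>a\<in>S. \<Sum>b\<in>S. (c a * g a s) * cnj (c b * g b s) / of_real d)"
        by (intro sum.cong) (use insert.prems(1)[of _ s] in \<open>auto simp: mult_ac\<close>)
      also have "\<dots> = P * cnj P / of_real d"
        unfolding P_def cnj_sum sum_product by (simp add: sum_divide_distrib)
      finally have 1: "(\<Sum>a\<in>S. \<Sum>b\<in>S. c a * cnj (c b) * g' a b)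
          = (\<Sum>a\<in>S. \<Sum>b\<in>S. c a * cnj (c b) * g a b) - P * cnj P / of_real d"
        by (simp add: g'_def right_diff_distrib sum_subtractf)
      have "0 \<le> Re (\<Sum>a\<in>insert s S. \<Sum>b\<in>insert s S. c' a * cnj (c' b) * g a b)"
        by (rule insert.prems(2))
      also have "(\<Sum>a\<in>insert s S. \<Sum>b\<in>insert s S. c' a * cnj (c' b) * g a b)
        = (\<Sum>a\<in>S. \<Sum>b\<in>S. c a * cnj (c b) * g a b) + cnj (c' s) * P + c' s * cnj P + c' s * cnj (c' s) * of_real d"
        unfolding split by (simp add: eqc P_def cong: sum.cong)
      also have "\<dots> = (\<Sum>a\<in>S. \<Sum>b\<in>S. c a * cnj (c b) * g a b) - P * cnj P / of_real d"
        using d by (simp add: c'_def field_simps)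
      finally show ?thesis using 1 by simp
    qed
    obtain n f where nf: "\<forall>a\<in>S. \<forall>b\<in>S. g' a b = (\<Sum>l<(n::nat). f l a * cnj (f l b))"
      using insert.IH[OF herm psd] by blast
    \<comment> \<open>The vectors for the Schur complement are extended by 0 at \<open>s\<close>,
      and the last one is the column of \<open>s\<close> over the root of the pivot.\<close>
    define f' where "f' = (\<lambda>l a. if l < n then if a = s then 0 else f l a else g a s / of_real (sqrt d))"
    have last: "f' n a * cnj (f' n b) = g a s * g s b / of_real d" if "b \<in> insert s S" for a b
      using that d insert.prems(1)[of b s]
      by (simp add: f'_def flip: of_real_mult)
    have "g a b = (\<Sum>l<Suc n. f' l a * cnj (f' l b))" if ab: "a \<in> insert s S" "b \<in> insert s S" for a b
    proof (cases "a = s \<or> b = s")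
      case True
      then have "(\<Sum>l<n. f' l a * cnj (f' l b)) = 0"
        by (intro sum.neutral) (auto simp: f'_def)
      then show ?thesis
        using True d gss by (auto simp: last[OF ab(2)])
    next
      case False
      then have S: "a \<in> S" "b \<in> S" using ab by auto
      have "(\<Sum>l<n. f' l a * cnj (f' l b)) = g' a b"
        using nf S False by (simp add: f'_def)
      then show ?thesis by (simp add: last[OF ab(2)] g'_def)
    qed
    then show ?thesis by (intro exI[of _ "Suc n"] exI[of _ f'] ballI)
  qed
qed

definition orthonormal_on :: "'a set \<Rightarrow> ('a \<Rightarrow> 'h::complex_inner_space) \<Rightarrow> bool" where
  "orthonormal_on I v \<longleftrightarrow> (\<forall>a\<in>I. \<forall>b\<in>I. cinner (v a) (v b) = (if a = b then 1 else 0))"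

lemma cinner_orthonormal:
  assumes "orthonormal_on I v" "finite I"
  shows "cinner (\<Sum>a\<in>I. c a *\<^sub>C v a) (\<Sum>a\<in>I. d a *\<^sub>C v a) = (\<Sum>a\<in>I. c a * cnj (d a))"
proof -
  have "cinner (\<Sum>a\<in>I. c a *\<^sub>C v a) (\<Sum>a\<in>I. d a *\<^sub>C v a)
    = (\<Sum>a\<in>I. \<Sum>b\<in>I. c a * (cnj (d b) * cinner (v a) (v b)))"
    unfolding cinner_sum_left cinner_scaleC_left
    unfolding cinner_sum_right cinner_scaleC_right sum_distrib_left by simp
  also have "\<dots> = (\<Sum>a\<in>I. \<Sum>b\<in>I. if b = a then c a * cnj (d a) else 0)"
    by (intro sum.cong) (use assms(1) in \<open>auto simp: orthonormal_on_def\<close>)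
  finally show ?thesis using assms(2) by simp
qed

lemma cinner_orthonormal_single:
  assumes "orthonormal_on I v" "finite I" "b \<in> I"
  shows "cinner (\<Sum>a\<in>I. c a *\<^sub>C v a) (v b) = c b"
proof -
  have "cinner (\<Sum>a\<in>I. c a *\<^sub>C v a) (v b) = (\<Sum>a\<in>I. if a = b then c b else 0)"
    unfolding cinner_sum_left
    by (intro sum.cong) (use assms in \<open>auto simp: orthonormal_on_def cinner_scaleC_left\<close>)
  then show ?thesis using assms by simp
qed

lemma bessel:
  assumes v: "orthonormal_on I v" "finite I"
  shows "(\<Sum>a\<in>I. (cmod (cinner h (v a)))\<^sup>2) \<le> (norm h)\<^sup>2"
proof -
  let ?s = "\<Sum>a\<in>I. cinner h (v a) *\<^sub>C v a" and ?S = "\<Sum>a\<in>I. (cmod (cinner h (v a)))\<^sup>2"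
  have 1: "cinner ?s ?s = of_real ?S"
    by (simp add: cinner_orthonormal[OF v] complex_norm_square del: of_real_power)
  have 2: "cinner h ?s = of_real ?S"
    by (simp add: cinner_sum_right cinner_scaleC_right complex_norm_square mult.commute del: of_real_power)
  have 3: "cinner ?s h = of_real ?S"
    using 2 cinner_commute[of ?s h] by simp
  have "(norm (h - ?s))\<^sup>2 = Re (cinner h h - cinner h ?s - cinner ?s h + cinner ?s ?s)"
    unfolding norm_square_cinner by (simp add: cinner_diff_left cinner_diff_right)
  also have "\<dots> = (norm h)\<^sup>2 - ?S"
    unfolding 1 2 3 by (simp add: cinner_self)
  finally have "(norm h)\<^sup>2 - ?S = (norm (h - ?s))\<^sup>2" by simp
  moreover have "0 \<le> (norm (h - ?s))\<^sup>2" by simp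
  ultimately show ?thesis by linarith
qed

lemma gram_schmidt_step:
  assumes u: "orthonormal_on {..<n::nat} u" and nz: "v \<noteq> (\<Sum>l<n. cinner v (u l) *\<^sub>C u l)"
  defines "w \<equiv> v - (\<Sum>l<n. cinner v (u l) *\<^sub>C u l)"
  shows "orthonormal_on {..<Suc n} (u(n := (1 / norm w) *\<^sub>R w))"
    and "v = (\<Sum>l<n. cinner v (u l) *\<^sub>C u l) + cinner v ((1 / norm w) *\<^sub>R w) *\<^sub>C ((1 / norm w) *\<^sub>R w)"
proof -
  let ?s = "\<Sum>l<n. cinner v (u l) *\<^sub>C u l" and ?u = "(1 / norm w) *\<^sub>R w"
  have w0: "norm w \<noteq> 0" using nz by (simp add: w_def)
  have wu: "cinner w (u l) = 0" if "l < n" for l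
    using cinner_orthonormal_single[OF u, of l "\<lambda>l. cinner v (u l)"] that
    by (simp add: w_def cinner_diff_left)
  have uw: "cinner (u l) w = 0" if "l < n" for l
    using wu[OF that] cinner_commute[of "u l" w] by simp
  have uu: "cinner ?u ?u = 1"
    using w0 by (simp add: cinner_scaleR_left cinner_scaleR_right cinner_self power2_eq_square)
  show "orthonormal_on {..<Suc n} (u(n := ?u))"
    using u uu wu uw unfolding orthonormal_on_def
    by (auto simp: less_Suc_eq cinner_scaleR_left cinner_scaleR_right)
  have "cinner ?s w = 0"
    by (simp add: cinner_sum_left cinner_scaleC_left uw)
  then have "cinner v w = cinner w w"
    by (simp add: w_def cinner_diff_left)
  then have "cinner v ?u = of_real (norm w)"
    using w0 by (simp add: cinner_scaleR_right cinner_self power2_eq_square)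
  then have "cinner v ?u *\<^sub>C ?u = w" using w0 by (simp add: scaleC_of_real)
  then show "v = ?s + cinner v ?u *\<^sub>C ?u" by (simp add: w_def)
qed

text \<open>The coefficients expressing the \<open>u l\<close> through the \<open>w a\<close> are
  recorded because they are applied later to shifted copies of the vectors. A dependent
  \<open>w s\<close> adds no new \<open>u\<close>, so no linear independence is assumed.\<close>

lemma gram_schmidt:
  fixes w :: "'a \<Rightarrow> 'h::complex_inner_space"
  assumes "finite S"
  shows "\<exists>(n::nat) u c. (\<forall>l<n. u l = (\<Sum>a\<in>S. c l a *\<^sub>C w a)) \<and> orthonormal_on {..<n} u \<and>
    (\<forall>a\<in>S. w a = (\<Sum>l<n. cinner (w a) (u l) *\<^sub>C u l))"
  using assms
proof (induction S)
  case empty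
  then show ?case by (auto simp: orthonormal_on_def intro!: exI[of _ 0])
next
  case (insert s S)
  obtain n :: nat and u c where u: "\<And>l. l < n \<Longrightarrow> u l = (\<Sum>a\<in>S. c l a *\<^sub>C w a)"
    "orthonormal_on {..<n} u" "\<And>a. a \<in> S \<Longrightarrow> w a = (\<Sum>l<n. cinner (w a) (u l) *\<^sub>C u l)"
    using insert.IH by blast
  show ?case
  proof (cases "w s = (\<Sum>l<n. cinner (w s) (u l) *\<^sub>C u l)")
    case True
    have "u l = (\<Sum>a\<in>insert s S. ((c l)(s := 0)) a *\<^sub>C w a)" if "l < n" for l
    proof -
      have "(\<Sum>a\<in>S. ((c l)(s := 0)) a *\<^sub>C w a) = (\<Sum>a\<in>S. c l a *\<^sub>C w a)"
        using insert.hyps by (intro sum.cong) auto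
      then show ?thesis using u(1)[OF that] insert.hyps by simp
    qed
    then show ?thesis
      using u(2,3) True by (intro exI[of _ n] exI[of _ u] exI[of _ "\<lambda>l. (c l)(s := 0)"]) auto
  next
    case False
    define v where "v = w s - (\<Sum>l<n. cinner (w s) (u l) *\<^sub>C u l)"
    define u' where "u' = u(n := (1 / norm v) *\<^sub>R v)"
    note step = gram_schmidt_step[OF u(2) False, folded v_def]
    \<comment> \<open>For the new vector, the projection onto the old \<open>u l\<close> is
      rewritten in terms of the \<open>w a\<close> and everything is divided by the norm of the
      remainder.\<close>
    define c' where "c' = (\<lambda>l a. if l < n then if a = s then 0 else c l a
       else of_real (1 / norm v) * (if a = s then 1 else - (\<Sum>l<n. cinner (w s) (u l) * c l a)))"
    have "u' l = (\<Sum>a\<in>insert s S. c' l a *\<^sub>C w a)" if l: "l < Suc n" for l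
    proof (cases "l < n")
      case True
      have "(\<Sum>a\<in>S. c' l a *\<^sub>C w a) = (\<Sum>a\<in>S. c l a *\<^sub>C w a)"
        using insert.hyps True by (intro sum.cong) (auto simp: c'_def)
      then show ?thesis using u(1)[OF True] insert.hyps True by (simp add: c'_def u'_def)
    next
      case False
      then have ln: "l = n" using l by simp
      have "(\<Sum>l<n. cinner (w s) (u l) *\<^sub>C u l) = (\<Sum>l<n. \<Sum>a\<in>S. (cinner (w s) (u l) * c l a) *\<^sub>C w a)"
        by (intro sum.cong) (auto simp: u(1) scaleC_sum_right scaleC_scaleC)
      also have "\<dots> = (\<Sum>a\<in>S. (\<Sum>l<n. cinner (w s) (u l) * c l a) *\<^sub>C w a)"
        by (subst sum.swap) (simp add: scaleC_sum_left)
      finally have v: "v = w s + (\<Sum>a\<in>S. (- (\<Sum>l<n. cinner (w s) (u l) * c l a)) *\<^sub>C w a)"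
        by (simp only: v_def scaleC_minus_left sum_negf) simp
      have "(\<Sum>a\<in>S. c' l a *\<^sub>C w a)
        = of_real (1 / norm v) *\<^sub>C (\<Sum>a\<in>S. (- (\<Sum>l<n. cinner (w s) (u l) * c l a)) *\<^sub>C w a)"
        unfolding scaleC_sum_right scaleC_scaleC
        by (intro sum.cong) (use insert.hyps ln in \<open>auto simp: c'_def\<close>)
      moreover have "c' l s *\<^sub>C w s = of_real (1 / norm v) *\<^sub>C w s" by (simp add: c'_def ln)
      ultimately have "(\<Sum>a\<in>insert s S. c' l a *\<^sub>C w a) = of_real (1 / norm v) *\<^sub>C v"
        using insert.hyps by (subst v) (simp add: scaleC_add_right)
      then show ?thesis by (simp only: ln u'_def scaleC_of_real) simp
    qed
    moreover have "orthonormal_on {..<Suc n} u'" using step(1) by (simp add: u'_def)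
    moreover have "w a = (\<Sum>l<Suc n. cinner (w a) (u' l) *\<^sub>C u' l)" if a: "a \<in> insert s S" for a
    proof (cases "a = s")
      case True
      then show ?thesis using step(2) by (simp add: u'_def)
    next
      case False
      then have aS: "a \<in> S" using a by simp
      have "cinner (w a) v = 0"
      proof -
        have "cinner (u l) ((1 / norm v) *\<^sub>R v) = 0" if "l < n" for l
        proof -
          have "l \<in> {..<Suc n}" "n \<in> {..<Suc n}" using that by auto
          then have "cinner ((u(n := (1 / norm v) *\<^sub>R v)) l) ((u(n := (1 / norm v) *\<^sub>R v)) n) = (if l = n then 1 else 0)"
            using step(1) unfolding orthonormal_on_def by blast
          then show ?thesis using that by simp
        qed
        then have "cinner (u l) v = 0" if "l < n" for l
          using that \<open>w s \<noteq> _\<close> by (auto simp: cinner_scaleR_right v_def)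
        then show ?thesis by (subst u(3)[OF aS]) (simp add: cinner_sum_left cinner_scaleC_left)
      qed
      then show ?thesis using u(3)[OF aS] by (simp add: u'_def cinner_scaleR_right)
    qed
    ultimately show ?thesis by blast
  qed
qed

text \<open>Finitely many vectors never span, so some vector lies outside and one Gram-Schmidt step
  enlarges the system.\<close>

lemma infinite_dimensional_orthonormal:
  assumes "infinite_dimensional TYPE('k::complex_inner_space)"
  shows "\<exists>e :: nat \<Rightarrow> 'k. orthonormal_on {..<n} e"
proof (induction n)
  case 0
  then show ?case by (simp add: orthonormal_on_def)
next
  case (Suc n)
  then obtain e :: "nat \<Rightarrow> 'k" where e: "orthonormal_on {..<n} e" by blast
  interpret vector_space "scaleC :: complex \<Rightarrow> 'k \<Rightarrow> 'k" by (rule vector_space_scaleC)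
  have "span (e ` {..<n}) \<noteq> UNIV"
    using assms unfolding infinite_dimensional_def by (metis finite_imageI finite_lessThan)
  then obtain v where v: "v \<notin> span (e ` {..<n})" by auto
  have "(\<Sum>l<n. cinner v (e l) *\<^sub>C e l) \<in> span (e ` {..<n})"
    by (intro span_sum span_scale span_base) auto
  then have "v \<noteq> (\<Sum>l<n. cinner v (e l) *\<^sub>C e l)" using v by auto
  then show ?case using gram_schmidt_step(1)[OF e] by blast
qed

text \<open>The rank one terms become coordinates in an orthonormal system. Their number depends on
  the matrix, and infinite dimension provides systems of every size.\<close>

lemma psd_gram_vectors:
  fixes g :: "'a \<Rightarrow> 'a \<Rightarrow> complex"
  assumes "infinite_dimensional TYPE('k::complex_inner_space)" "finite S"
    and "\<And>a b. a \<in> S \<Longrightarrow> b \<in> S \<Longrightarrow> g b a = cnj (g a b)"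
    and "\<And>c. 0 \<le> Re (\<Sum>a\<in>S. \<Sum>b\<in>S. c a * cnj (c b) * g a b)"
  shows "\<exists>w :: 'a \<Rightarrow> 'k. \<forall>a\<in>S. \<forall>b\<in>S. cinner (w a) (w b) = g a b"
proof -
  obtain n f where nf: "\<forall>a\<in>S. \<forall>b\<in>S. g a b = (\<Sum>l<(n::nat). f l a * cnj (f l b))"
    using psd_rank_one_sum[OF assms(2-4)] by blast
  obtain e :: "nat \<Rightarrow> 'k" where e: "orthonormal_on {..<n} e"
    using infinite_dimensional_orthonormal[OF assms(1)] by blast
  show ?thesis
    using nf by (intro exI[of _ "\<lambda>a. \<Sum>l<n. f l a *\<^sub>C e l"]) (simp add: cinner_orthonormal[OF e])
qed

section \<open>Realisation of finite sections by row contractions\<close>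

lift_definition rank_one :: "'h::complex_inner_space \<Rightarrow> 'h \<Rightarrow> ('h \<Rightarrow>\<^sub>L 'h)"
  is "\<lambda>u v k. cinner k u *\<^sub>C v"
proof -
  fix u v :: 'h
  show "bounded_linear (\<lambda>k. cinner k u *\<^sub>C v)"
  proof (rule bounded_linear_intro[where K = "norm u * norm v"])
    show "norm (cinner x u *\<^sub>C v) \<le> norm x * (norm u * norm v)" for x
      using mult_right_mono[OF cinner_Cauchy_Schwarz[of x u] norm_ge_zero[of v]]
      by (simp add: norm_scaleC mult.assoc)
    show "cinner (r *\<^sub>R x) u *\<^sub>C v = r *\<^sub>R (cinner x u *\<^sub>C v)" for r x
      by (metis cinner_scaleR_left scaleC_of_real scaleC_scaleC)
  qed (simp add: cinner_add_left scaleC_add_left)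
qed

lemma rank_one_apply [simp]: "rank_one u v k = cinner k u *\<^sub>C v"
  by transfer simp

lemma complex_linear_rank_one: "complex_linear (rank_one u v)"
  by (simp add: complex_linear_def cinner_scaleC_left scaleC_scaleC)

lemma adj_sum_rank_one:
  fixes u v :: "'a \<Rightarrow> 'h::complex_hilbert_space"
  shows "adj (\<Sum>a\<in>I. rank_one (u a) (v a)) = (\<Sum>a\<in>I. rank_one (v a) (u a))"
proof (rule adj_unique)
  show "complex_linear (\<Sum>a\<in>I. rank_one (u a) (v a))"
    by (intro complex_linear_sum complex_linear_rank_one)
  fix x y
  show "cinner ((\<Sum>a\<in>I. rank_one (u a) (v a)) x) y = cinner x ((\<Sum>a\<in>I. rank_one (v a) (u a)) y)"
    unfolding blinfun_sum_apply rank_one_apply cinner_sum_left cinner_sum_right cinner_scaleC_left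
      cinner_scaleC_right
    by (intro sum.cong) (metis cinner_commute mult.commute)+
qed

lemma word_op_scaleR: "word_op (\<lambda>i. r *\<^sub>R X i) \<alpha> = r ^ length \<alpha> *\<^sub>R word_op X \<alpha>"
  by (induction \<alpha>) (auto intro!: blinfun_eqI simp: blinfun.scaleR_left blinfun.scaleR_right)


text \<open>The finite sections of the kernel are Gram matrices of vectors \<open>w\<^bsub>\<alpha>,j\<^esub>\<close> of the test space, on
  which prefixing a letter to \<open>\<alpha>\<close> acts by partial isometries with orthogonal ranges.\<close>

lemma poly_form_nonneg:
  fixes \<Phi> :: "'n::finite list \<Rightarrow> ('h::complex_inner_space \<Rightarrow>\<^sub>L 'h)"
  assumes inf: "infinite_dimensional TYPE('k::complex_hilbert_space)"
    and t: "\<Phi> [] = t *\<^sub>R id_blinfun" and lin: "\<And>\<gamma>. complex_linear (\<Phi> \<gamma>)"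
    and pos: "\<And>N x. supported N x \<Longrightarrow> 0 \<le> toeplitz_form \<Phi> N x"
    and p: "re_nonneg_poly TYPE('k) m p"
  shows "0 \<le> poly_form m p \<Phi> x"
proof -
  obtain N where N: "\<And>\<alpha> i j. i < m \<Longrightarrow> j < m \<Longrightarrow> p \<alpha> i j \<noteq> 0 \<Longrightarrow> length \<alpha> \<le> N"
    using is_ncpoly_degree[of m p] p unfolding re_nonneg_poly_def by blast
  define S where "S = (words N :: 'n list set) \<times> {..<m}"
  \<comment> \<open>The arguments are transposed so that \<open>g\<close>, like
    \<open>cinner\<close>, is linear in its first index.\<close>
  define g where "g = (\<lambda>(\<beta>, j) (\<alpha>, i). kernel_entry \<Phi> \<alpha> (x i) \<beta> (x j))"
  have fS: "finite S" by (simp add: S_def)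
  have g_psd: "0 \<le> Re (\<Sum>a\<in>S. \<Sum>b\<in>S. c a * cnj (c b) * g a b)" for c
  proof -
    \<comment> \<open>Coefficients sharing a word are absorbed into one vector, so the scalar form
      of \<open>g\<close> becomes the form of \<Phi> at a supported family.\<close>
    define \<xi> where "\<xi> = (\<lambda>\<alpha>. if \<alpha> \<in> words N then \<Sum>i<m. c (\<alpha>, i) *\<^sub>C x i else 0)"
    have "supported N \<xi>" by (auto simp: supported_def \<xi>_def words_iff)
    have "(\<Sum>a\<in>S. \<Sum>b\<in>S. c a * cnj (c b) * g a b) = (\<Sum>\<beta>\<in>words N. \<Sum>\<alpha>\<in>words N. kernel_entry \<Phi> \<alpha> (\<xi> \<alpha>) \<beta> (\<xi> \<beta>))"
    proof -
      have "(\<Sum>a\<in>S. \<Sum>b\<in>S. c a * cnj (c b) * g a b)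
        = (\<Sum>\<beta>\<in>words N. \<Sum>j<m. \<Sum>\<alpha>\<in>words N. \<Sum>i<m. c (\<beta>, j) * cnj (c (\<alpha>, i)) * kernel_entry \<Phi> \<alpha> (x i) \<beta> (x j))"
        by (simp only: S_def g_def sum.cartesian_product' case_prod_conv)
      also have "\<dots> = (\<Sum>\<beta>\<in>words N. \<Sum>\<alpha>\<in>words N. \<Sum>j<m. \<Sum>i<m. c (\<beta>, j) * cnj (c (\<alpha>, i)) * kernel_entry \<Phi> \<alpha> (x i) \<beta> (x j))"
        by (intro sum.cong refl, rule sum.swap)
      also have "\<dots> = (\<Sum>\<beta>\<in>words N. \<Sum>\<alpha>\<in>words N. kernel_entry \<Phi> \<alpha> (\<xi> \<alpha>) \<beta> (\<xi> \<beta>))"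
      proof (intro sum.cong refl)
        fix \<alpha> \<beta> :: "'n list"
        assume "\<beta> \<in> words N" "\<alpha> \<in> words N"
        then have "kernel_entry \<Phi> \<alpha> (\<xi> \<alpha>) \<beta> (\<xi> \<beta>)
          = kernel_entry \<Phi> \<alpha> (\<Sum>i<m. c (\<alpha>, i) *\<^sub>C x i) \<beta> (\<Sum>j<m. c (\<beta>, j) *\<^sub>C x j)"
          by (simp add: \<xi>_def)
        also have "\<dots> = (\<Sum>j<m. kernel_entry \<Phi> \<alpha> (\<Sum>i<m. c (\<alpha>, i) *\<^sub>C x i) \<beta> (c (\<beta>, j) *\<^sub>C x j))"
          by (rule kernel_entry_sum_right)
        also have "\<dots> = (\<Sum>j<m. \<Sum>i<m. c (\<beta>, j) * cnj (c (\<alpha>, i)) * kernel_entry \<Phi> \<alpha> (x i) \<beta> (x j))"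
          by (simp only: kernel_entry_sum_left kernel_entry_scale_left[OF lin] kernel_entry_scale_right[OF lin] sum_distrib_left mult_ac)
        finally show "(\<Sum>j<m. \<Sum>i<m. c (\<beta>, j) * cnj (c (\<alpha>, i)) * kernel_entry \<Phi> \<alpha> (x i) \<beta> (x j))
          = kernel_entry \<Phi> \<alpha> (\<xi> \<alpha>) \<beta> (\<xi> \<beta>)" by simp
      qed
      finally show ?thesis .
    qed
    also have "\<dots> = of_real (toeplitz_form \<Phi> N \<xi>)"
      by (subst sum.swap) (rule sum_kap[where \<Phi> = \<Phi>, OF t \<open>supported N \<xi>\<close>])
    finally show ?thesis using pos[OF \<open>supported N \<xi>\<close>] by simp
  qed
  obtain w :: "'n list \<times> nat \<Rightarrow> 'k" where w: "\<And>a b. a \<in> S \<Longrightarrow> b \<in> S \<Longrightarrow> cinner (w a) (w b) = g a b"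
  proof -
    have "g b a = cnj (g a b)" for a b
      unfolding g_def case_prod_unfold by (rule kernel_entry_commute[where \<Phi> = \<Phi>, OF t])
    then have "\<exists>w :: 'n list \<times> nat \<Rightarrow> 'k. \<forall>a\<in>S. \<forall>b\<in>S. cinner (w a) (w b) = g a b"
      by (rule psd_gram_vectors[OF inf fS _ g_psd])
    then show ?thesis using that by blast
  qed
  \<comment> \<open>Strictly shorter words, so that one more letter stays inside the
    section.\<close>
  define S0 where "S0 = {\<alpha> :: 'n list. length \<alpha> < N} \<times> {..<m}"
  have S0S: "S0 \<subseteq> S" by (auto simp: S_def S0_def words_iff)
  have fS0: "finite S0" using S0S fS finite_subset by blast
  define sh where "sh = (\<lambda>(i :: 'n) (a :: 'n list \<times> nat). (i # fst a, snd a))"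
  have shS: "sh i a \<in> S" if "a \<in> S0" for i a
    using that by (auto simp: S_def S0_def sh_def words_iff)
  have g_sh: "g (sh i a) (sh j b) = (if i = j then g a b else 0)" for i j a b
    by (auto simp: g_def sh_def kernel_entry_Cons case_prod_unfold)
  obtain n :: nat and u c where u: "\<And>l. l < n \<Longrightarrow> u l = (\<Sum>a\<in>S0. c l a *\<^sub>C w a)"
    "orthonormal_on {..<n} u" "\<And>a. a \<in> S0 \<Longrightarrow> w a = (\<Sum>l<n. cinner (w a) (u l) *\<^sub>C u l)"
    using gram_schmidt[OF fS0, of w] by blast
  have comb: "cinner (\<Sum>a\<in>S0. d a *\<^sub>C w (sh i a)) (\<Sum>a\<in>S0. d' a *\<^sub>C w (sh j a))
      = (if i = j then cinner (\<Sum>a\<in>S0. d a *\<^sub>C w a) (\<Sum>a\<in>S0. d' a *\<^sub>C w a) else 0)" for i j d d'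
  proof -
    have 1: "cinner (w (sh i a)) (w (sh j b)) = (if i = j then cinner (w a) (w b) else 0)"
      if "a \<in> S0" "b \<in> S0" for a b
    proof -
      have "a \<in> S" "b \<in> S" using that S0S by blast+
      then show ?thesis using that by (simp add: w shS g_sh)
    qed
    show ?thesis
      unfolding cinner_sum_left cinner_scaleC_left cinner_sum_right cinner_scaleC_right
      by (simp add: 1 cong: sum.cong)
  qed
  \<comment> \<open>The images of the orthonormal \<open>u l\<close> under prefixing
    \<open>i\<close>, formed with the same coefficients; by \<open>comb\<close> they are orthonormal
    in both indices jointly.\<close>
  define U where "U = (\<lambda>(i, l). \<Sum>a\<in>S0. c l a *\<^sub>C w (sh i a))"
  have U: "orthonormal_on (UNIV \<times> {..<n}) U"
    using u(2) unfolding orthonormal_on_def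
    by (auto simp: U_def comb u(1)[symmetric])
  define X where "X = (\<lambda>i. \<Sum>l<n. rank_one (u l) (U (i, l)))"
  have XBH: "X \<in> BH"
    by (auto simp: BH_def X_def intro!: complex_linear_sum complex_linear_rank_one)
  have Xw: "X i (w a) = w (sh i a)" if a: "a \<in> S0" for i a
  proof -
    \<comment> \<open>These coefficients express that \<open>w a\<close> minus its expansion in the
      \<open>u l\<close> vanishes. Shifting preserves inner products of combinations, so the shifted
      combination vanishes too, which is the claim.\<close>
    define d where "d = (\<lambda>b. (if b = a then 1 else 0) - (\<Sum>l<n. cinner (w a) (u l) * c l b))"
    have d: "(\<Sum>b\<in>S0. d b *\<^sub>C v b) = v a - (\<Sum>l<n. cinner (w a) (u l) *\<^sub>C (\<Sum>b\<in>S0. c l b *\<^sub>C v b))"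
      for v :: "_ \<Rightarrow> 'k"
    proof -
      have "(\<Sum>b\<in>S0. d b *\<^sub>C v b) = (\<Sum>b\<in>S0. (if b = a then v a else 0)
          - (\<Sum>l<n. (cinner (w a) (u l) * c l b) *\<^sub>C v b))"
        by (intro sum.cong refl) (auto simp: d_def diff_conv_add_uminus scaleC_add_left
            scaleC_minus_left scaleC_sum_left simp del: add_uminus_conv_diff)
      also have "\<dots> = v a - (\<Sum>b\<in>S0. \<Sum>l<n. (cinner (w a) (u l) * c l b) *\<^sub>C v b)"
        using a fS0 by (simp add: sum_subtractf)
      also have "(\<Sum>b\<in>S0. \<Sum>l<n. (cinner (w a) (u l) * c l b) *\<^sub>C v b)
          = (\<Sum>l<n. cinner (w a) (u l) *\<^sub>C (\<Sum>b\<in>S0. c l b *\<^sub>C v b))"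
        by (subst sum.swap) (simp add: scaleC_sum_right scaleC_scaleC)
      finally show ?thesis .
    qed
    have "(\<Sum>b\<in>S0. d b *\<^sub>C w b) = w a - (\<Sum>l<n. cinner (w a) (u l) *\<^sub>C u l)"
      unfolding d by (simp add: u(1))
    also have "\<dots> = 0" using u(3)[OF a] by simp
    finally have z: "(\<Sum>b\<in>S0. d b *\<^sub>C w b) = 0" .
    have "cinner (\<Sum>b\<in>S0. d b *\<^sub>C w (sh i b)) (\<Sum>b\<in>S0. d b *\<^sub>C w (sh i b)) = 0"
      unfolding comb z by simp
    then have "(\<Sum>b\<in>S0. d b *\<^sub>C w (sh i b)) = 0"
      by (simp add: cinner_self)
    then show ?thesis unfolding d by (simp add: X_def U_def blinfun_sum_apply)
  qed
  have Xword: "word_op X \<gamma> (w ([], j)) = w (\<gamma>, j)" if "length \<gamma> \<le> N" "j < m" for \<gamma> j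
    using that
  proof (induction \<gamma>)
    case (Cons i \<gamma>)
    then have "X i (w (\<gamma>, j)) = w (sh i (\<gamma>, j))" by (intro Xw) (simp add: S0_def)
    then show ?case using Cons by (simp add: sh_def)
  qed simp
  have row: "norm (\<Sum>i\<in>UNIV. X i o\<^sub>L adj (X i)) \<le> 1\<^sup>2"
  proof (rule row_norm_le[where X = X, OF BH_D[OF XBH]])
    fix h
    have "(norm (adj (X i) h))\<^sup>2 = (\<Sum>l<n. (cmod (cinner h (U (i, l))))\<^sup>2)" for i
    proof -
      have "adj (X i) h = (\<Sum>l<n. cinner h (U (i, l)) *\<^sub>C u l)"
        unfolding X_def adj_sum_rank_one by (simp add: blinfun_sum_apply)
      then have "cinner (adj (X i) h) (adj (X i) h) = (\<Sum>l<n. cinner h (U (i, l)) * cnj (cinner h (U (i, l))))"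
        using cinner_orthonormal[OF u(2)] by simp
      also have "\<dots> = of_real (\<Sum>l<n. (cmod (cinner h (U (i, l))))\<^sup>2)"
        by (simp add: complex_norm_square del: of_real_power)
      finally show ?thesis by (simp only: cinner_self of_real_eq_iff)
    qed
    then show "(\<Sum>i\<in>UNIV. (norm (adj (X i) h))\<^sup>2) \<le> 1\<^sup>2 * (norm h)\<^sup>2"
      using bessel[OF U, of h] by (simp add: sum.cartesian_product case_prod_unfold)
  qed simp
  \<comment> \<open>Positivity is granted on strict row contractions only, whereas \<open>X\<close>
    may have row norm 1. Hence \<open>r * X\<close> with \<open>r < 1\<close> is tested and
    \<open>r\<close> tends to 1; the value is a polynomial in \<open>r\<close>.\<close>
  define f where "f = (\<lambda>r::real. Re (\<Sum>i<m. \<Sum>j<m. \<Sum>\<gamma>\<in>words N. p \<gamma> i j * of_real (r ^ length \<gamma>) * cinner (\<Phi> \<gamma> (x j)) (x i)))"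
  have f_nonneg: "0 \<le> f r" if r: "0 \<le> r" "r < 1" for r
  proof -
    have "(r *\<^sub>R X i) o\<^sub>L adj (r *\<^sub>R X i) = r\<^sup>2 *\<^sub>R (X i o\<^sub>L adj (X i))" for i
      by (intro blinfun_eqI)
        (simp add: adj_scaleR BH_D[OF XBH] blinfun.scaleR_left blinfun.scaleR_right power2_eq_square)
    then have "norm (\<Sum>i\<in>UNIV. (r *\<^sub>R X i) o\<^sub>L adj (r *\<^sub>R X i)) = r\<^sup>2 * norm (\<Sum>i\<in>UNIV. X i o\<^sub>L adj (X i))"
      by (simp flip: scaleR_sum_right)
    also have "\<dots> \<le> r\<^sup>2" using mult_left_mono[OF row, of "r\<^sup>2"] by simp
    also have "\<dots> < 1" using r by (simp add: power_less_one_iff)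
    finally have "0 \<le> poly_form m p (word_op (\<lambda>i. r *\<^sub>R X i)) (\<lambda>j. w ([], j))"
      using p BH_scaleR[OF XBH, of r] by (simp add: re_nonneg_poly_iff)
    also have "\<dots> = f r"
    proof -
      have "cinner (w (\<gamma>, j)) (w ([], i)) = cinner (\<Phi> \<gamma> (x j)) (x i)"
        if "i < m" "j < m" "\<gamma> \<in> words N" for i j \<gamma>
        using that by (subst w) (auto simp: S_def g_def)
      then show ?thesis
        unfolding f_def by (subst poly_form_words[OF N])
          (auto intro!: arg_cong[where f = Re] sum.cong
            simp: word_op_scaleR blinfun.scaleR_left cinner_scaleR_left Xword words_iff)
    qed
    finally show ?thesis .
  qed
  have "(f \<longlongrightarrow> f 1) (at_left 1)"
    unfolding f_def by (intro tendsto_intros)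
  moreover have "\<forall>\<^sub>F r in at_left (1::real). 0 \<le> f r"
    using eventually_at_left_real[of 0 "1::real"] by (auto elim!: eventually_mono intro: f_nonneg)
  ultimately have "0 \<le> f 1"
    by (intro tendsto_lowerbound) auto
  also have "f 1 = poly_form m p \<Phi> x"
    unfolding f_def by (subst poly_form_words[OF N]) simp_all
  finally show ?thesis .
qed

section \<open>Dilations and reproducing kernel spaces\<close>

context hilbert_function_space
begin

lemma sum_mem: "(\<And>a. a \<in> A \<Longrightarrow> F a \<in> G) \<Longrightarrow> (\<lambda>s. \<Sum>a\<in>A. F a s) \<in> G"
  by (induction A rule: infinite_finite_induct) (auto intro: zero_mem add_mem)

lemma ip_zero_left: "g \<in> G \<Longrightarrow> ip (\<lambda>s. 0) g = 0"
  using ip_scale_left[OF zero_mem, of g 0] by simp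

lemma ip_sum_left:
  "(\<And>a. a \<in> A \<Longrightarrow> F a \<in> G) \<Longrightarrow> g \<in> G \<Longrightarrow> ip (\<lambda>s. \<Sum>a\<in>A. F a s) g = (\<Sum>a\<in>A. ip (F a) g)"
  by (induction A rule: infinite_finite_induct) (auto simp: ip_zero_left ip_add_left sum_mem)

lemma ip_sum_right:
  assumes "\<And>a. a \<in> A \<Longrightarrow> F a \<in> G" "g \<in> G"
  shows "ip g (\<lambda>s. \<Sum>a\<in>A. F a s) = (\<Sum>a\<in>A. ip g (F a))"
proof -
  have "ip g (\<lambda>s. \<Sum>a\<in>A. F a s) = cnj (ip (\<lambda>s. \<Sum>a\<in>A. F a s) g)"
    by (intro ip_commute assms sum_mem)
  also have "\<dots> = (\<Sum>a\<in>A. cnj (ip (F a) g))"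
    by (simp add: ip_sum_left assms)
  also have "\<dots> = (\<Sum>a\<in>A. ip g (F a))"
    by (intro sum.cong) (auto simp: ip_commute[of g] assms)
  finally show ?thesis .
qed

lemma ip_nonneg: "f \<in> G \<Longrightarrow> 0 \<le> Re (ip f f)"
  using ip_pos[of f] ip_zero_left[OF zero_mem] by (cases "f = (\<lambda>s. 0)") auto

end

section \<open>From dilations to positive kernels\<close>

lemma symbol_Nil: "symbol \<rho> A [] = \<rho> *\<^sub>R id_blinfun"
  by (simp add: symbol_def)

lemma complex_linear_symbol: "A \<in> BH \<Longrightarrow> complex_linear (symbol \<rho> A \<gamma>)"
  by (simp add: symbol_def complex_linear_scaleR complex_linear_word_op)

lemma C_class_BH: "A \<in> C_class \<rho> \<Longrightarrow> A \<in> BH"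
  by (simp add: C_class_def)

text \<open>The vectors \<open>v \<alpha> u\<close>, obtained from \<open>J u\<close> by the
  isometries, have the kernel over \<rho> as Gram matrix: common letters cancel, distinct letters
  give 0, and against an empty word the dilation formula applies. The form is then \<rho> times a
  squared norm.\<close>

lemma C_class_kernel_nonneg:
  fixes A :: "'n::finite \<Rightarrow> ('h::complex_hilbert_space \<Rightarrow>\<^sub>L 'h)"
  assumes A: "A \<in> C_class \<rho>" and \<rho>: "0 < \<rho>" and x: "supported N x"
  shows "0 \<le> kernel_form \<rho> A N x"
proof -
  obtain G :: "('n list \<times> 'h \<Rightarrow> complex) set" and ip J P V
    where D: "isometric_dilation \<rho> A G ip J P V"
    using A by (auto simp: C_class_def)
  interpret hilbert_function_space G ip using D by (simp add: isometric_dilation_def)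
  have J: "J u \<in> G" "ip (J u) (J w) = cinner u w" for u w
    using D by (simp_all add: isometric_dilation_def)
  have P: "f \<in> G \<Longrightarrow> ip f (J u) = cinner (P f) u" for f u
    using D by (simp add: isometric_dilation_def)
  have V: "f \<in> G \<Longrightarrow> V i f \<in> G"
    "f \<in> G \<Longrightarrow> g \<in> G \<Longrightarrow> ip (V i f) (V j g) = (if i = j then ip f g else 0)" for f g i j
    using D by (auto simp: isometric_dilation_def)
  have dil: "\<alpha> \<noteq> [] \<Longrightarrow> word_op A \<alpha> u = \<rho> *\<^sub>R P (foldr V \<alpha> (J u))" for \<alpha> u
    using D by (auto simp: isometric_dilation_def)
  define v where "v = (\<lambda>\<alpha> u. foldr V \<alpha> (J u))"
  have vG: "v \<alpha> u \<in> G" for \<alpha> u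
    by (induction \<alpha>) (auto simp: v_def J V)
  have base: "\<rho> * ip (v \<beta> w) (J u) = kernel_entry (symbol \<rho> A) [] u \<beta> w" for \<beta> u w
  proof (cases "\<beta> = []")
    case True
    then show ?thesis by (simp add: v_def J symbol_def blinfun.scaleR_left cinner_scaleR_left)
  next
    case False
    have "foldr V \<beta> (J w) = v \<beta> w" by (simp add: v_def)
    then show ?thesis using False dil[OF False, of w]
      by (simp add: P vG symbol_def cinner_scaleR_left)
  qed
  have kernel_entry: "\<rho> * ip (v \<beta> w) (v \<alpha> u) = kernel_entry (symbol \<rho> A) \<alpha> u \<beta> w" for \<alpha> \<beta> u w
  proof (induction \<alpha> arbitrary: \<beta>)
    case Nil
    have "v [] u = J u" by (simp add: v_def)
    then show ?case using base[of \<beta> w u] by simp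
  next
    case (Cons i \<alpha>)
    show ?case
    proof (cases \<beta>)
      case Nil
      have e: "v [] w = J w" by (simp add: v_def)
      have "of_real \<rho> * ip (v [] w) (v (i # \<alpha>) u) = cnj (of_real \<rho> * ip (v (i # \<alpha>) u) (J w))"
        unfolding e using ip_commute[OF J(1) vG, of w "i # \<alpha>" u] by simp
      also have "\<dots> = cnj (kernel_entry (symbol \<rho> A) [] w (i # \<alpha>) u)"
        using base[of "i # \<alpha>" u w] by simp
      also have "\<dots> = kernel_entry (symbol \<rho> A) (i # \<alpha>) u [] w"
        by (rule kernel_entry_commute[where \<Phi> = "symbol \<rho> A", OF symbol_Nil, symmetric])
      finally show ?thesis by (simp add: Nil)
    next
      case (Cons j \<beta>')
      have "v (i # \<alpha>) u = V i (v \<alpha> u)" "v (j # \<beta>') w = V j (v \<beta>' w)" by (simp_all add: v_def)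
      then show ?thesis using Cons.IH Cons by (auto simp: V vG kernel_entry_Cons)
    qed
  qed
  define F where "F = (\<lambda>s. \<Sum>\<alpha>\<in>words N. v \<alpha> (x \<alpha>) s)"
  have "ip F F = (\<Sum>\<beta>\<in>words N. \<Sum>\<alpha>\<in>words N. ip (v \<beta> (x \<beta>)) (v \<alpha> (x \<alpha>)))"
    unfolding F_def by (simp add: ip_sum_left ip_sum_right vG sum_mem)
  then have "\<rho> * ip F F = (\<Sum>\<beta>\<in>words N. \<Sum>\<alpha>\<in>words N. kernel_entry (symbol \<rho> A) \<alpha> (x \<alpha>) \<beta> (x \<beta>))"
    by (simp add: sum_distrib_left kernel_entry)
  also have "\<dots> = of_real (kernel_form \<rho> A N x)"
    by (subst sum.swap) (rule sum_kap[where \<Phi> = "symbol \<rho> A", OF symbol_Nil x])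
  finally have "kernel_form \<rho> A N x = Re (\<rho> * ip F F)" by simp
  moreover have "F \<in> G" unfolding F_def by (intro sum_mem vG)
  ultimately show ?thesis using ip_nonneg \<rho> by simp
qed

text \<open>The reproducing kernel Hilbert space of a positive definite kernel, realised as the pointwise
  limits of Cauchy sequences of finite combinations of kernel functions. Positivity is expressed by
  the existence of Gram vectors for the finite sections, which transfers the elementary
  inequalities from an inner product space.\<close>

locale gram_kernel =
  fixes k :: "'s \<Rightarrow> 's \<Rightarrow> complex" and ty :: "'h::complex_inner_space itself"
  assumes gram: "finite S \<Longrightarrow> \<exists>w :: 's \<Rightarrow> 'h. \<forall>a\<in>S. \<forall>b\<in>S. cinner (w a) (w b) = k a b"
begin

definition supp :: "('s \<Rightarrow> complex) \<Rightarrow> 's set" where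
  "supp c = {s. c s \<noteq> 0}"

definition F :: "('s \<Rightarrow> complex) set" where
  "F = {c. finite (supp c)}"

definition L :: "('s \<Rightarrow> complex) \<Rightarrow> ('s \<Rightarrow> complex) \<Rightarrow> complex" where
  "L c d = (\<Sum>s\<in>supp c. \<Sum>t\<in>supp d. c s * cnj (d t) * k s t)"

text \<open>Only a seminorm: different coefficients may represent the same function
  \<open>\<phi> c\<close>.\<close>

definition nq :: "('s \<Rightarrow> complex) \<Rightarrow> real" where
  "nq c = sqrt (Re (L c c))"

definition delta :: "'s \<Rightarrow> 's \<Rightarrow> complex" where
  "delta s t = (if t = s then 1 else 0)"

definition \<phi> :: "('s \<Rightarrow> complex) \<Rightarrow> 's \<Rightarrow> complex" where
  "\<phi> c t = L c (delta t)"

lemma L_realize: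
  assumes "finite S"
  obtains e :: "('s \<Rightarrow> complex) \<Rightarrow> 'h" where
    "\<And>c d. supp c \<subseteq> S \<Longrightarrow> supp d \<subseteq> S \<Longrightarrow> L c d = cinner (e c) (e d)"
    "\<And>c d. e (\<lambda>s. c s + d s) = e c + e d"
    "\<And>c d. e (\<lambda>s. c s - d s) = e c - e d"
    "\<And>c a. e (\<lambda>s. a * c s) = a *\<^sub>C e c"
proof -
  obtain w :: "'s \<Rightarrow> 'h" where w: "\<And>a b. a \<in> S \<Longrightarrow> b \<in> S \<Longrightarrow> cinner (w a) (w b) = k a b"
    using gram[OF assms] by blast
  define e where "e = (\<lambda>c. \<Sum>s\<in>S. c s *\<^sub>C w s)"
  show ?thesis
  proof (rule that)
    show "L c d = cinner (e c) (e d)" if "supp c \<subseteq> S" "supp d \<subseteq> S" for c d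
    proof -
      have "cinner (e c) (e d) = (\<Sum>s\<in>S. \<Sum>t\<in>S. c s * cnj (d t) * k s t)"
        unfolding e_def cinner_sum_left cinner_scaleC_left
        unfolding cinner_sum_right cinner_scaleC_right sum_distrib_left
        by (intro sum.cong refl) (simp add: w)
      also have "\<dots> = (\<Sum>s\<in>supp c. \<Sum>t\<in>S. c s * cnj (d t) * k s t)"
        by (rule sum.mono_neutral_right) (use assms that in \<open>auto simp: supp_def\<close>)
      also have "\<dots> = L c d"
        unfolding L_def by (intro sum.cong refl sum.mono_neutral_right)
          (use assms that in \<open>auto simp: supp_def\<close>)
      finally show ?thesis by simp
    qed
    show "e (\<lambda>s. c s + d s) = e c + e d" for c d
      by (simp add: e_def scaleC_add_left sum.distrib)
    show "e (\<lambda>s. a * c s) = a *\<^sub>C e c" for a c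
      by (simp add: e_def scaleC_sum_right scaleC_scaleC)
    show "e (\<lambda>s. c s - d s) = e c - e d" for c d
      by (simp add: e_def diff_conv_add_uminus scaleC_add_left scaleC_minus_left sum.distrib sum_negf
          del: add_uminus_conv_diff)
  qed
qed

lemma F_add: "c \<in> F \<Longrightarrow> d \<in> F \<Longrightarrow> (\<lambda>s. c s + d s) \<in> F"
  unfolding F_def mem_Collect_eq
  by (rule finite_subset[OF _ finite_UnI[of "supp c" "supp d"]]) (auto simp: supp_def)

lemma F_diff: "c \<in> F \<Longrightarrow> d \<in> F \<Longrightarrow> (\<lambda>s. c s - d s) \<in> F"
  unfolding F_def mem_Collect_eq
  by (rule finite_subset[OF _ finite_UnI[of "supp c" "supp d"]]) (auto simp: supp_def)

lemma F_scale: "c \<in> F \<Longrightarrow> (\<lambda>s. a * c s) \<in> F"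
  unfolding F_def mem_Collect_eq
  by (rule finite_subset[of _ "supp c", rotated]) (auto simp: supp_def)

lemma F_delta: "delta t \<in> F"
  by (simp add: F_def supp_def delta_def)

lemma supp_combine:
  shows "supp (\<lambda>s. c s + d s) \<subseteq> supp c \<union> supp d"
    and "supp (\<lambda>s. c s - d s) \<subseteq> supp c \<union> supp d"
    and "supp (\<lambda>s. a * c s) \<subseteq> supp c"
  by (auto simp: supp_def)

text \<open>A finite set carrying up to four coefficient functions, on which \<open>L\<close> is an
  honest inner product. It is stable under the linear operations, so each inequality for
  \<open>L\<close> and \<open>nq\<close> below is an inequality between vectors.\<close>

lemma L_realize4:
  assumes "c \<in> F" "d \<in> F" "c' \<in> F" "d' \<in> F"
  obtains S and e :: "('s \<Rightarrow> complex) \<Rightarrow> 'h" where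
    "\<And>c d. supp c \<subseteq> S \<Longrightarrow> supp d \<subseteq> S \<Longrightarrow> L c d = cinner (e c) (e d)"
    "\<And>c d. e (\<lambda>s. c s + d s) = e c + e d"
    "\<And>c d. e (\<lambda>s. c s - d s) = e c - e d"
    "\<And>c a. e (\<lambda>s. a * c s) = a *\<^sub>C e c"
    "supp c \<subseteq> S" "supp d \<subseteq> S" "supp c' \<subseteq> S" "supp d' \<subseteq> S"
    "\<And>c d. supp c \<subseteq> S \<Longrightarrow> supp d \<subseteq> S \<Longrightarrow> supp (\<lambda>s. c s + d s) \<subseteq> S"
    "\<And>c d. supp c \<subseteq> S \<Longrightarrow> supp d \<subseteq> S \<Longrightarrow> supp (\<lambda>s. c s - d s) \<subseteq> S"
    "\<And>c a. supp c \<subseteq> S \<Longrightarrow> supp (\<lambda>s. a * c s) \<subseteq> S"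
    "\<And>c. supp c \<subseteq> S \<Longrightarrow> nq c = norm (e c)"
proof -
  have fin: "finite (supp c \<union> supp d \<union> supp c' \<union> supp d')" using assms by (simp add: F_def)
  let ?S = "supp c \<union> supp d \<union> supp c' \<union> supp d'"
  show ?thesis
  proof (rule L_realize[OF fin])
    fix e :: "('s \<Rightarrow> complex) \<Rightarrow> 'h"
    assume e: "\<And>c d. supp c \<subseteq> ?S \<Longrightarrow> supp d \<subseteq> ?S \<Longrightarrow> L c d = cinner (e c) (e d)"
      "\<And>c d. e (\<lambda>s. c s + d s) = e c + e d"
      "\<And>c d. e (\<lambda>s. c s - d s) = e c - e d"
      "\<And>c a. e (\<lambda>s. a * c s) = a *\<^sub>C e c"
    show ?thesis
    proof (rule that[of ?S e, OF e])
      show "nq a = norm (e a)" if "supp a \<subseteq> ?S" for a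
        by (simp add: nq_def e(1)[OF that that] cinner_self)
    qed (use supp_combine in \<open>blast+\<close>)
  qed
qed

lemma L_add_left: "c \<in> F \<Longrightarrow> d \<in> F \<Longrightarrow> b \<in> F \<Longrightarrow> L (\<lambda>s. c s + d s) b = L c b + L d b"
  by (rule L_realize4[of c d b b]) (auto simp: cinner_add_left)

lemma L_diff_left: "c \<in> F \<Longrightarrow> d \<in> F \<Longrightarrow> b \<in> F \<Longrightarrow> L (\<lambda>s. c s - d s) b = L c b - L d b"
  by (rule L_realize4[of c d b b]) (auto simp: cinner_diff_left)

lemma L_scale_left: "c \<in> F \<Longrightarrow> b \<in> F \<Longrightarrow> L (\<lambda>s. a * c s) b = a * L c b"
  by (rule L_realize4[of c c b b]) (auto simp: cinner_scaleC_left)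

lemma L_commute: "c \<in> F \<Longrightarrow> b \<in> F \<Longrightarrow> L c b = cnj (L b c)"
  by (rule L_realize4[of c c b b]) (auto simp: cinner_commute[symmetric])

text \<open>Joint continuity of \<open>L\<close>, by changing one argument at a time.\<close>

lemma L_bound:
  assumes "c \<in> F" "d \<in> F" "c' \<in> F" "d' \<in> F"
  shows "cmod (L c d - L c' d') \<le> nq (\<lambda>s. c s - c' s) * nq d + nq c' * nq (\<lambda>s. d s - d' s)"
proof (rule L_realize4[OF assms])
  fix S and e :: "('s \<Rightarrow> complex) \<Rightarrow> 'h"
  assume e: "\<And>c d. supp c \<subseteq> S \<Longrightarrow> supp d \<subseteq> S \<Longrightarrow> L c d = cinner (e c) (e d)"
    "\<And>c d. e (\<lambda>s. c s - d s) = e c - e d"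
    "supp c \<subseteq> S" "supp d \<subseteq> S" "supp c' \<subseteq> S" "supp d' \<subseteq> S"
    "\<And>c d. supp c \<subseteq> S \<Longrightarrow> supp d \<subseteq> S \<Longrightarrow> supp (\<lambda>s. c s - d s) \<subseteq> S"
    "\<And>c. supp c \<subseteq> S \<Longrightarrow> nq c = norm (e c)"
  have "L c d - L c' d' = cinner (e c - e c') (e d) + cinner (e c') (e d - e d')"
    by (simp add: e cinner_diff_left cinner_diff_right)
  then have "cmod (L c d - L c' d') \<le> cmod (cinner (e c - e c') (e d)) + cmod (cinner (e c') (e d - e d'))"
    by (simp add: norm_triangle_ineq)
  also have "\<dots> \<le> norm (e c - e c') * norm (e d) + norm (e c') * norm (e d - e d')"
    by (intro add_mono cinner_Cauchy_Schwarz)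
  finally show ?thesis by (simp add: e)
qed

lemma nq_nonneg: "c \<in> F \<Longrightarrow> 0 \<le> nq c"
  by (rule L_realize4[of c c c c]) auto

lemma nq_square: "c \<in> F \<Longrightarrow> L c c = of_real ((nq c)\<^sup>2)"
  by (rule L_realize4[of c c c c]) (auto simp: cinner_self)

lemma L_Cauchy_Schwarz: "c \<in> F \<Longrightarrow> d \<in> F \<Longrightarrow> cmod (L c d) \<le> nq c * nq d"
  by (rule L_realize4[of c c d d]) (auto simp: cinner_Cauchy_Schwarz)

lemma nq_triangle: "c \<in> F \<Longrightarrow> d \<in> F \<Longrightarrow> nq (\<lambda>s. c s + d s) \<le> nq c + nq d"
  by (rule L_realize4[of c c d d]) (auto simp: norm_triangle_ineq)

lemma nq_minus_commute: "c \<in> F \<Longrightarrow> d \<in> F \<Longrightarrow> nq (\<lambda>s. c s - d s) = nq (\<lambda>s. d s - c s)"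
  by (rule L_realize4[of c c d d]) (auto simp: norm_minus_commute)

lemma nq_triangle3: "c \<in> F \<Longrightarrow> d \<in> F \<Longrightarrow> \<bar>nq c - nq d\<bar> \<le> nq (\<lambda>s. c s - d s)"
  by (rule L_realize4[of c c d d]) (auto simp: norm_triangle_ineq3)

lemma \<phi>_eq: "\<phi> c t = (\<Sum>s\<in>supp c. c s * k s t)"
proof -
  have "supp (delta t) = {t}" by (auto simp: supp_def delta_def)
  then show ?thesis by (simp add: \<phi>_def L_def delta_def)
qed

lemma L_\<phi>: "L c d = (\<Sum>t\<in>supp d. cnj (d t) * \<phi> c t)"
  unfolding \<phi>_eq L_def sum_distrib_left by (subst sum.swap) (simp add: mult_ac)

definition cau :: "(nat \<Rightarrow> 's \<Rightarrow> complex) \<Rightarrow> bool" where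
  "cau \<sigma> \<longleftrightarrow> (\<forall>n. \<sigma> n \<in> F) \<and> (\<forall>e>0. \<exists>N. \<forall>m\<ge>N. \<forall>n\<ge>N. nq (\<lambda>s. \<sigma> m s - \<sigma> n s) < e)"

text \<open>Elements of the completion are represented by their pointwise limits instead of
  equivalence classes of Cauchy sequences, which keeps the space a space of functions.\<close>

definition rep :: "('s \<Rightarrow> complex) \<Rightarrow> (nat \<Rightarrow> 's \<Rightarrow> complex) \<Rightarrow> bool" where
  "rep f \<sigma> \<longleftrightarrow> cau \<sigma> \<and> (\<forall>t. (\<lambda>n. \<phi> (\<sigma> n) t) \<longlonglongrightarrow> f t)"

lemma cau_F: "cau \<sigma> \<Longrightarrow> \<sigma> n \<in> F"
  by (simp add: cau_def)

lemma cau_D: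
  assumes "cau \<sigma>" "0 < e"
  obtains N where "\<And>m n. m \<ge> N \<Longrightarrow> n \<ge> N \<Longrightarrow> nq (\<lambda>s. \<sigma> m s - \<sigma> n s) < e"
proof -
  have "\<exists>N. \<forall>m\<ge>N. \<forall>n\<ge>N. nq (\<lambda>s. \<sigma> m s - \<sigma> n s) < e" using assms unfolding cau_def by simp
  then show ?thesis using that by blast
qed

lemma cau_const: "c \<in> F \<Longrightarrow> cau (\<lambda>_. c)"
  using nq_square[OF F_scale[of c 0]] L_scale_left[of c "\<lambda>s. 0 * c s" 0]
  by (auto simp: cau_def nq_def L_def supp_def)

lemma nq_convergent:
  assumes "cau \<sigma>"
  shows "convergent (\<lambda>n. nq (\<sigma> n))"
proof -
  have "Cauchy (\<lambda>n. nq (\<sigma> n))"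
  proof (rule metric_CauchyI)
    fix e :: real assume "0 < e"
    then obtain N where N: "\<And>m n. m \<ge> N \<Longrightarrow> n \<ge> N \<Longrightarrow> nq (\<lambda>s. \<sigma> m s - \<sigma> n s) < e"
      using cau_D[OF assms] by blast
    have "dist (nq (\<sigma> m)) (nq (\<sigma> n)) < e" if "m \<ge> N" "n \<ge> N" for m n
      using N[OF that] nq_triangle3[OF cau_F[OF assms] cau_F[OF assms], of m n]
      by (simp add: dist_real_def)
    then show "\<exists>M. \<forall>m\<ge>M. \<forall>n\<ge>M. dist (nq (\<sigma> m)) (nq (\<sigma> n)) < e" by blast
  qed
  then show ?thesis by (simp add: Cauchy_convergent)
qed

lemma cau_bounded:
  assumes "cau \<sigma>"
  obtains M where "0 < M" "\<And>n. nq (\<sigma> n) \<le> M"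
proof -
  obtain M where "0 < M" "\<And>n. norm (nq (\<sigma> n)) \<le> M"
    using BseqE[OF convergent_imp_Bseq[OF nq_convergent[OF assms]]] by blast
  then have "nq (\<sigma> n) \<le> M" for n using abs_le_D1[of "nq (\<sigma> n)" M] by simp
  then show ?thesis using that \<open>0 < M\<close> by blast
qed

lemma L_convergent:
  assumes \<sigma>: "cau \<sigma>" and \<tau>: "cau \<tau>"
  shows "convergent (\<lambda>n. L (\<sigma> n) (\<tau> n))"
proof -
  obtain M where M: "0 < M" "\<And>n. nq (\<sigma> n) \<le> M" using cau_bounded[OF \<sigma>] by blast
  obtain K where K: "0 < K" "\<And>n. nq (\<tau> n) \<le> K" using cau_bounded[OF \<tau>] by blast
  have "Cauchy (\<lambda>n. L (\<sigma> n) (\<tau> n))"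
  proof (rule metric_CauchyI)
    fix e :: real assume e: "0 < e"
    have "0 < e / (2 * K)" "0 < e / (2 * M)" using e K(1) M(1) by simp_all
    obtain N1 where N1: "\<And>m n. m \<ge> N1 \<Longrightarrow> n \<ge> N1 \<Longrightarrow> nq (\<lambda>s. \<sigma> m s - \<sigma> n s) < e / (2 * K)"
      using cau_D[OF \<sigma> \<open>0 < e / (2 * K)\<close>] by blast
    obtain N2 where N2: "\<And>m n. m \<ge> N2 \<Longrightarrow> n \<ge> N2 \<Longrightarrow> nq (\<lambda>s. \<tau> m s - \<tau> n s) < e / (2 * M)"
      using cau_D[OF \<tau> \<open>0 < e / (2 * M)\<close>] by blast
    have "dist (L (\<sigma> m) (\<tau> m)) (L (\<sigma> n) (\<tau> n)) < e" if "m \<ge> max N1 N2" "n \<ge> max N1 N2" for m n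
    proof -
      have "dist (L (\<sigma> m) (\<tau> m)) (L (\<sigma> n) (\<tau> n))
        \<le> nq (\<lambda>s. \<sigma> m s - \<sigma> n s) * nq (\<tau> m) + nq (\<sigma> n) * nq (\<lambda>s. \<tau> m s - \<tau> n s)"
        unfolding dist_norm by (intro L_bound cau_F \<sigma> \<tau>)
      also have "\<dots> \<le> nq (\<lambda>s. \<sigma> m s - \<sigma> n s) * K + M * nq (\<lambda>s. \<tau> m s - \<tau> n s)"
        by (intro add_mono mult_mono M K nq_nonneg F_diff cau_F \<sigma> \<tau> order_refl less_imp_le[OF M(1)])
      also have "\<dots> < e / (2 * K) * K + M * (e / (2 * M))"
        using N1 N2 that M(1) K(1) by (intro add_strict_mono mult_strict_right_mono mult_strict_left_mono) auto
      also have "\<dots> = e" using M(1) K(1) by simp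
      finally show ?thesis .
    qed
    then show "\<exists>N. \<forall>m\<ge>N. \<forall>n\<ge>N. dist (L (\<sigma> m) (\<tau> m)) (L (\<sigma> n) (\<tau> n)) < e" by blast
  qed
  then show ?thesis by (simp add: Cauchy_convergent)
qed

lemma cau_rep: "cau \<sigma> \<Longrightarrow> \<exists>f. rep f \<sigma>"
proof -
  assume \<sigma>: "cau \<sigma>"
  have "(\<lambda>n. \<phi> (\<sigma> n) t) \<longlonglongrightarrow> lim (\<lambda>n. \<phi> (\<sigma> n) t)" for t
    using L_convergent[OF \<sigma> cau_const[OF F_delta[of t]]]
    by (simp add: \<phi>_def convergent_LIMSEQ_iff)
  then show ?thesis using \<sigma> unfolding rep_def
    by (intro exI[of _ "\<lambda>t. lim (\<lambda>n. \<phi> (\<sigma> n) t)"]) simp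
qed

text \<open>This makes the passage to pointwise limits injective. Against a fixed finite combination
  \<open>\<sigma> N\<close> the pairing tends to 0 by pointwise convergence, and
  \<open>nq (\<sigma> n)\<close> squared differs from \<open>L (\<sigma> n) (\<sigma> N)\<close> by
  at most \<open>M * nq (\<sigma> n - \<sigma> N)\<close>, which the Cauchy property makes
  small.\<close>

lemma rep_null:
  assumes "rep (\<lambda>s. 0) \<sigma>"
  shows "(\<lambda>n. nq (\<sigma> n)) \<longlonglongrightarrow> 0"
proof -
  have \<sigma>: "cau \<sigma>" and \<phi>: "\<And>t. (\<lambda>n. \<phi> (\<sigma> n) t) \<longlonglongrightarrow> 0" using assms by (auto simp: rep_def)
  obtain M where M: "0 < M" "\<And>n. nq (\<sigma> n) \<le> M" using cau_bounded[OF \<sigma>] by blast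
  have "(\<lambda>n. (nq (\<sigma> n))\<^sup>2) \<longlonglongrightarrow> 0"
  proof (rule LIMSEQ_I)
    fix e :: real assume e: "0 < e"
    have "0 < e / (2 * M)" using e M(1) by simp
    then obtain N where N: "\<And>m n. m \<ge> N \<Longrightarrow> n \<ge> N \<Longrightarrow> nq (\<lambda>s. \<sigma> m s - \<sigma> n s) < e / (2 * M)"
      using cau_D[OF \<sigma>] by blast
    have "(\<lambda>n. L (\<sigma> n) (\<sigma> N)) \<longlonglongrightarrow> (\<Sum>t\<in>supp (\<sigma> N). cnj (\<sigma> N t) * 0)"
      unfolding L_\<phi> by (intro tendsto_intros \<phi>)
    then have "(\<lambda>n. L (\<sigma> n) (\<sigma> N)) \<longlonglongrightarrow> 0" by simp
    then obtain N' where N': "\<forall>n\<ge>N'. cmod (L (\<sigma> n) (\<sigma> N)) < e / 2"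
      using LIMSEQ_D[of _ 0 "e / 2"] e by auto
    have "norm ((nq (\<sigma> n))\<^sup>2 - 0) < e" if "n \<ge> max N N'" for n
    proof -
      have z: "nq (\<lambda>s. 0) = 0" by (simp add: nq_def L_def supp_def)
      have "(nq (\<sigma> n))\<^sup>2 = cmod (L (\<sigma> n) (\<sigma> n))"
        by (simp add: nq_square cau_F[OF \<sigma>] del: of_real_power)
      also have "\<dots> \<le> cmod (L (\<sigma> n) (\<sigma> n) - L (\<sigma> n) (\<sigma> N)) + cmod (L (\<sigma> n) (\<sigma> N))"
        by (metis add.commute diff_add_cancel norm_triangle_ineq)
      also have "\<dots> \<le> nq (\<sigma> n) * nq (\<lambda>s. \<sigma> n s - \<sigma> N s) + cmod (L (\<sigma> n) (\<sigma> N))"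
        using L_bound[OF cau_F[OF \<sigma>, of n] cau_F[OF \<sigma>, of n] cau_F[OF \<sigma>, of n] cau_F[OF \<sigma>, of N]]
        by (simp add: z)
      also have "\<dots> \<le> M * nq (\<lambda>s. \<sigma> n s - \<sigma> N s) + cmod (L (\<sigma> n) (\<sigma> N))"
        by (intro add_right_mono mult_right_mono M nq_nonneg F_diff cau_F \<sigma>)
      also have "\<dots> < M * (e / (2 * M)) + e / 2"
        using N N' that M(1) by (intro add_strict_mono mult_strict_left_mono) auto
      also have "\<dots> = e" using M(1) by simp
      finally show ?thesis by simp
    qed
    then show "\<exists>N. \<forall>n\<ge>N. norm ((nq (\<sigma> n))\<^sup>2 - 0) < e" by blast
  qed
  from tendsto_real_sqrt[OF this] show ?thesis
    by (simp add: nq_nonneg cau_F[OF \<sigma>])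
qed

lemma cau_add:
  assumes \<sigma>: "cau \<sigma>" and \<tau>: "cau \<tau>"
  shows "cau (\<lambda>n s. \<sigma> n s + \<tau> n s)"
  unfolding cau_def
proof (intro conjI allI impI)
  show "(\<lambda>s. \<sigma> n s + \<tau> n s) \<in> F" for n by (intro F_add cau_F \<sigma> \<tau>)
  fix e :: real assume "0 < e"
  then have e: "0 < e / 2" by simp
  obtain N1 where N1: "\<And>m n. m \<ge> N1 \<Longrightarrow> n \<ge> N1 \<Longrightarrow> nq (\<lambda>s. \<sigma> m s - \<sigma> n s) < e / 2"
    using cau_D[OF \<sigma> e] by blast
  obtain N2 where N2: "\<And>m n. m \<ge> N2 \<Longrightarrow> n \<ge> N2 \<Longrightarrow> nq (\<lambda>s. \<tau> m s - \<tau> n s) < e / 2"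
    using cau_D[OF \<tau> e] by blast
  have "nq (\<lambda>s. \<sigma> m s + \<tau> m s - (\<sigma> n s + \<tau> n s)) < e" if "m \<ge> max N1 N2" "n \<ge> max N1 N2" for m n
  proof -
    have "nq (\<lambda>s. (\<sigma> m s - \<sigma> n s) + (\<tau> m s - \<tau> n s))
      \<le> nq (\<lambda>s. \<sigma> m s - \<sigma> n s) + nq (\<lambda>s. \<tau> m s - \<tau> n s)"
      by (intro nq_triangle F_diff cau_F \<sigma> \<tau>)
    also have "\<dots> < e / 2 + e / 2" using N1 N2 that by (intro add_strict_mono) auto
    finally show ?thesis by (simp add: algebra_simps)
  qed
  then show "\<exists>N. \<forall>m\<ge>N. \<forall>n\<ge>N. nq (\<lambda>s. \<sigma> m s + \<tau> m s - (\<sigma> n s + \<tau> n s)) < e" by blast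
qed

lemma nq_scale: "c \<in> F \<Longrightarrow> nq (\<lambda>s. a * c s) = cmod a * nq c"
  by (rule L_realize4[of c c c c]) (auto simp: norm_scaleC)

lemma cau_scale:
  assumes "cau \<sigma>"
  shows "cau (\<lambda>n s. a * \<sigma> n s)"
  unfolding cau_def
proof (intro conjI allI impI)
  show "(\<lambda>s. a * \<sigma> n s) \<in> F" for n using assms by (simp add: F_scale cau_F)
  fix e :: real assume e: "0 < e"
  have a: "0 < cmod a + 1" by (simp add: add_nonneg_pos)
  then have "0 < e / (cmod a + 1)" using e by simp
  then obtain N where N: "\<And>m n. m \<ge> N \<Longrightarrow> n \<ge> N \<Longrightarrow> nq (\<lambda>s. \<sigma> m s - \<sigma> n s) < e / (cmod a + 1)"
    using cau_D[OF assms] by blast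
  have "nq (\<lambda>s. a * \<sigma> m s - a * \<sigma> n s) < e" if "m \<ge> N" "n \<ge> N" for m n
  proof -
    have "nq (\<lambda>s. a * \<sigma> m s - a * \<sigma> n s) = cmod a * nq (\<lambda>s. \<sigma> m s - \<sigma> n s)"
      using nq_scale[OF F_diff[OF cau_F[OF assms] cau_F[OF assms]]] by (simp add: right_diff_distrib)
    also have "\<dots> \<le> (cmod a + 1) * nq (\<lambda>s. \<sigma> m s - \<sigma> n s)"
      by (intro mult_right_mono nq_nonneg F_diff cau_F assms) simp
    also have "\<dots> < (cmod a + 1) * (e / (cmod a + 1))"
      using N that a by (intro mult_strict_left_mono) auto
    finally show ?thesis using a by simp
  qed
  then show "\<exists>N. \<forall>m\<ge>N. \<forall>n\<ge>N. nq (\<lambda>s. a * \<sigma> m s - a * \<sigma> n s) < e" by blast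
qed

lemma rep_add: "rep f \<sigma> \<Longrightarrow> rep g \<tau> \<Longrightarrow> rep (\<lambda>s. f s + g s) (\<lambda>n s. \<sigma> n s + \<tau> n s)"
  unfolding rep_def \<phi>_def
  by (auto simp: cau_add L_add_left cau_F F_delta intro: tendsto_add)

lemma rep_scale: "rep f \<sigma> \<Longrightarrow> rep (\<lambda>s. a * f s) (\<lambda>n s. a * \<sigma> n s)"
  unfolding rep_def \<phi>_def
  by (auto simp: cau_scale L_scale_left cau_F F_delta intro: tendsto_mult_left)

lemma rep_diff: "rep f \<sigma> \<Longrightarrow> rep g \<tau> \<Longrightarrow> rep (\<lambda>s. f s - g s) (\<lambda>n s. \<sigma> n s - \<tau> n s)"
  using rep_add[of f \<sigma> "\<lambda>s. -1 * g s" "\<lambda>n s. -1 * \<tau> n s"] rep_scale[of g \<tau> "-1"] by simp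

lemma rep_const: "c \<in> F \<Longrightarrow> rep (\<phi> c) (\<lambda>_. c)"
  by (simp add: rep_def cau_const)

lemma rep_unique_null:
  assumes "rep f \<sigma>" "rep f \<tau>"
  shows "(\<lambda>n. nq (\<lambda>s. \<sigma> n s - \<tau> n s)) \<longlonglongrightarrow> 0"
  using rep_null[of "\<lambda>n s. \<sigma> n s - \<tau> n s"] rep_diff[OF assms] by simp

definition G :: "('s \<Rightarrow> complex) set" where
  "G = {f. \<exists>\<sigma>. rep f \<sigma>}"

definition rp :: "('s \<Rightarrow> complex) \<Rightarrow> nat \<Rightarrow> 's \<Rightarrow> complex" where
  "rp f = (SOME \<sigma>. rep f \<sigma>)"

definition ip :: "('s \<Rightarrow> complex) \<Rightarrow> ('s \<Rightarrow> complex) \<Rightarrow> complex" where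
  "ip f g = lim (\<lambda>n. L (rp f n) (rp g n))"

lemma rep_rp: "f \<in> G \<Longrightarrow> rep f (rp f)"
  unfolding G_def rp_def using someI_ex[of "rep f"] by simp

lemma GI: "rep f \<sigma> \<Longrightarrow> f \<in> G"
  by (auto simp: G_def)

lemma rep_cau: "rep f \<sigma> \<Longrightarrow> cau \<sigma>"
  by (simp add: rep_def)

lemma rep_F: "rep f \<sigma> \<Longrightarrow> \<sigma> n \<in> F"
  by (simp add: rep_def cau_F)

text \<open>Independence of the representatives chosen by \<open>rp\<close>: two representatives of
  one function differ by a null sequence.\<close>

lemma ip_tendsto:
  assumes f: "rep f \<sigma>" and g: "rep g \<tau>"
  shows "(\<lambda>n. L (\<sigma> n) (\<tau> n)) \<longlonglongrightarrow> ip f g"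
proof -
  have f': "rep f (rp f)" and g': "rep g (rp g)" using f g by (auto intro: rep_rp GI)
  have 1: "(\<lambda>n. L (rp f n) (rp g n)) \<longlonglongrightarrow> ip f g"
    using L_convergent[OF rep_cau[OF f'] rep_cau[OF g']] by (simp add: ip_def convergent_LIMSEQ_iff)
  obtain a where a: "(\<lambda>n. nq (\<tau> n)) \<longlonglongrightarrow> a"
    using nq_convergent[OF rep_cau[OF g]] by (auto simp: convergent_def)
  obtain b where b: "(\<lambda>n. nq (rp f n)) \<longlonglongrightarrow> b"
    using nq_convergent[OF rep_cau[OF f']] by (auto simp: convergent_def)
  have "(\<lambda>n. nq (\<lambda>s. \<sigma> n s - rp f n s) * nq (\<tau> n) + nq (rp f n) * nq (\<lambda>s. \<tau> n s - rp g n s)) \<longlonglongrightarrow> 0 * a + b * 0"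
    by (intro tendsto_intros rep_unique_null[OF f f'] rep_unique_null[OF g g'] a b)
  then have "(\<lambda>n. nq (\<lambda>s. \<sigma> n s - rp f n s) * nq (\<tau> n) + nq (rp f n) * nq (\<lambda>s. \<tau> n s - rp g n s)) \<longlonglongrightarrow> 0"
    by simp
  then have "(\<lambda>n. L (\<sigma> n) (\<tau> n) - L (rp f n) (rp g n)) \<longlonglongrightarrow> 0"
    by (rule Lim_null_comparison[rotated])
      (intro always_eventually allI L_bound rep_F[OF f] rep_F[OF g] rep_F[OF f'] rep_F[OF g'])
  from tendsto_add[OF this 1] show ?thesis by simp
qed

lemma nq_tendsto:
  assumes "rep f \<sigma>"
  shows "(\<lambda>n. nq (\<sigma> n)) \<longlonglongrightarrow> sqrt (Re (ip f f))"
  unfolding nq_def by (intro tendsto_intros ip_tendsto assms)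

lemma kernel_fun_rep: "rep (k s) (\<lambda>_. delta s)"
proof -
  have "\<phi> (delta s) = k s"
  proof
    fix t
    have "supp (delta s) = {s}" by (auto simp: supp_def delta_def)
    then show "\<phi> (delta s) t = k s t" by (simp add: \<phi>_eq delta_def)
  qed
  then show ?thesis using rep_const[OF F_delta[of s]] by simp
qed

lemma kernel_fun_in_G: "k s \<in> G"
  by (rule GI[OF kernel_fun_rep])

lemma reproducing: "f \<in> G \<Longrightarrow> ip f (k s) = f s"
proof -
  assume "f \<in> G"
  then have r: "rep f (rp f)" by (rule rep_rp)
  show ?thesis
    using LIMSEQ_unique[OF ip_tendsto[OF r kernel_fun_rep[of s]], of "f s"] r
    by (simp add: rep_def \<phi>_def)
qed

lemma ip_unique: "rep f \<sigma> \<Longrightarrow> rep g \<tau> \<Longrightarrow> (\<lambda>n. L (\<sigma> n) (\<tau> n)) \<longlonglongrightarrow> c \<Longrightarrow> ip f g = c"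
  using ip_tendsto LIMSEQ_unique by blast

lemma gn_triangle:
  assumes f: "f \<in> G" and g: "g \<in> G"
  shows "sqrt (Re (ip (\<lambda>s. f s + g s) (\<lambda>s. f s + g s))) \<le> sqrt (Re (ip f f)) + sqrt (Re (ip g g))"
proof (rule LIMSEQ_le)
  note rf = rep_rp[OF f] and rg = rep_rp[OF g]
  show "(\<lambda>n. nq (\<lambda>s. rp f n s + rp g n s)) \<longlonglongrightarrow> sqrt (Re (ip (\<lambda>s. f s + g s) (\<lambda>s. f s + g s)))"
    by (intro nq_tendsto rep_add rf rg)
  show "(\<lambda>n. nq (rp f n) + nq (rp g n)) \<longlonglongrightarrow> sqrt (Re (ip f f)) + sqrt (Re (ip g g))"
    by (intro tendsto_intros nq_tendsto rf rg)
  show "\<exists>N. \<forall>n\<ge>N. nq (\<lambda>s. rp f n s + rp g n s) \<le> nq (rp f n) + nq (rp g n)"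
    using nq_triangle rep_F[OF rf] rep_F[OF rg] by blast
qed

abbreviation gd :: "('s \<Rightarrow> complex) \<Rightarrow> ('s \<Rightarrow> complex) \<Rightarrow> real" where
  "gd f g \<equiv> sqrt (Re (ip (\<lambda>s. f s - g s) (\<lambda>s. f s - g s)))"

lemma G_diff: "f \<in> G \<Longrightarrow> g \<in> G \<Longrightarrow> (\<lambda>s. f s - g s) \<in> G"
  using rep_diff[OF rep_rp rep_rp] GI by blast

lemma gd_triangle: "f \<in> G \<Longrightarrow> g \<in> G \<Longrightarrow> h \<in> G \<Longrightarrow> gd f h \<le> gd f g + gd g h"
  using gn_triangle[OF G_diff[of f g] G_diff[of g h]] by simp

lemma gd_approx:
  assumes f: "rep f \<sigma>" and c: "c \<in> F" and le: "\<And>n. n \<ge> N \<Longrightarrow> nq (\<lambda>s. \<sigma> n s - c s) \<le> e"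
  shows "gd f (\<phi> c) \<le> e" "gd (\<phi> c) f \<le> e"
proof -
  have "(\<lambda>n. nq (\<lambda>s. \<sigma> n s - c s)) \<longlonglongrightarrow> gd f (\<phi> c)"
    by (intro nq_tendsto rep_diff f rep_const c)
  then show "gd f (\<phi> c) \<le> e"
    by (rule LIMSEQ_le_const2) (use le in blast)
  have "(\<lambda>n. nq (\<lambda>s. c s - \<sigma> n s)) \<longlonglongrightarrow> gd (\<phi> c) f"
    by (intro nq_tendsto rep_diff f rep_const c)
  then show "gd (\<phi> c) f \<le> e"
    by (rule LIMSEQ_le_const2) (use le nq_minus_commute[OF c rep_F[OF f]] in auto)
qed

lemma gd_const: "c \<in> F \<Longrightarrow> d \<in> F \<Longrightarrow> gd (\<phi> c) (\<phi> d) = nq (\<lambda>s. c s - d s)"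
  using nq_tendsto[OF rep_diff[OF rep_const rep_const, of c d]] LIMSEQ_unique tendsto_const by blast

sublocale hilbert_function_space G ip
proof
  show "(\<lambda>s. 0) \<in> G"
    using GI[OF rep_scale[OF kernel_fun_rep, of 0]] by simp
  show "(\<lambda>s. f s + g s) \<in> G" if "f \<in> G" "g \<in> G" for f g
    using GI[OF rep_add[OF rep_rp rep_rp]] that by blast
  show "(\<lambda>s. c * f s) \<in> G" if "f \<in> G" for c f
    using GI[OF rep_scale[OF rep_rp]] that by blast
  show "ip f g = cnj (ip g f)" if "f \<in> G" "g \<in> G" for f g
  proof (rule ip_unique[OF rep_rp rep_rp, OF that])
    have "(\<lambda>n. cnj (L (rp g n) (rp f n))) \<longlonglongrightarrow> cnj (ip g f)"
      by (intro tendsto_intros ip_tendsto rep_rp that)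
    then show "(\<lambda>n. L (rp f n) (rp g n)) \<longlonglongrightarrow> cnj (ip g f)"
      by (simp add: L_commute[of "rp f _" "rp g _"] rep_F[OF rep_rp] that)
  qed
  show "ip (\<lambda>s. f s + g s) h = ip f h + ip g h" if "f \<in> G" "g \<in> G" "h \<in> G" for f g h
  proof (rule ip_unique[OF rep_add[OF rep_rp rep_rp] rep_rp, OF that])
    have "(\<lambda>n. L (rp f n) (rp h n) + L (rp g n) (rp h n)) \<longlonglongrightarrow> ip f h + ip g h"
      by (intro tendsto_intros ip_tendsto rep_rp that)
    then show "(\<lambda>n. L (\<lambda>s. rp f n s + rp g n s) (rp h n)) \<longlonglongrightarrow> ip f h + ip g h"
      by (simp add: L_add_left rep_F[OF rep_rp] that)
  qed
  show "ip (\<lambda>s. c * f s) g = c * ip f g" if "f \<in> G" "g \<in> G" for f g c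
  proof (rule ip_unique[OF rep_scale[OF rep_rp] rep_rp, OF that])
    have "(\<lambda>n. c * L (rp f n) (rp g n)) \<longlonglongrightarrow> c * ip f g"
      by (intro tendsto_intros ip_tendsto rep_rp that)
    then show "(\<lambda>n. L (\<lambda>s. c * rp f n s) (rp g n)) \<longlonglongrightarrow> c * ip f g"
      by (simp add: L_scale_left rep_F[OF rep_rp] that)
  qed
  show "0 < Re (ip f f)" if f: "f \<in> G" "f \<noteq> (\<lambda>s. 0)" for f
  proof (rule ccontr)
    note r = rep_rp[OF f(1)]
    assume "\<not> 0 < Re (ip f f)"
    moreover have "0 \<le> sqrt (Re (ip f f))"
      by (rule LIMSEQ_le_const[OF nq_tendsto[OF r]]) (use nq_nonneg rep_F[OF r] in blast)
    ultimately have "(\<lambda>n. nq (rp f n)) \<longlonglongrightarrow> 0" using nq_tendsto[OF r] by simp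
    then have lim: "(\<lambda>n. nq (rp f n) * nq (delta t)) \<longlonglongrightarrow> 0" for t
      using tendsto_mult_left_zero by blast
    have "(\<lambda>n. \<phi> (rp f n) t) \<longlonglongrightarrow> 0" for t
      by (rule Lim_null_comparison[OF _ lim[of t]])
        (auto simp: \<phi>_def intro!: always_eventually L_Cauchy_Schwarz rep_F[OF r] F_delta)
    moreover have "(\<lambda>n. \<phi> (rp f n) t) \<longlonglongrightarrow> f t" for t using r by (simp add: rep_def)
    ultimately have "f t = 0" for t using LIMSEQ_unique by blast
    then show False using f(2) by auto
  qed
  fix \<sigma> :: "nat \<Rightarrow> 's \<Rightarrow> complex"
  assume \<sigma>: "\<And>n. \<sigma> n \<in> G"
    and C: "\<And>e. e > 0 \<Longrightarrow> \<exists>N. \<forall>k\<ge>N. \<forall>l\<ge>N. gd (\<sigma> k) (\<sigma> l) < e"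
  \<comment> \<open>Completeness by diagonal choice: each member is replaced by a finite combination
    within \<open>1 / (n + 1)\<close>. These combinations form a Cauchy sequence of coefficients,
    whose pointwise limit is the limit sought.\<close>
  have ex: "\<exists>c. c \<in> F \<and> gd (\<sigma> n) (\<phi> c) \<le> inverse (real (Suc n)) \<and> gd (\<phi> c) (\<sigma> n) \<le> inverse (real (Suc n))" for n
  proof -
    note r = rep_rp[OF \<sigma>[of n]]
    have "0 < inverse (real (Suc n))" by simp
    then obtain N where "\<And>m l. m \<ge> N \<Longrightarrow> l \<ge> N \<Longrightarrow>
        nq (\<lambda>s. rp (\<sigma> n) m s - rp (\<sigma> n) l s) < inverse (real (Suc n))"
      using cau_D[OF rep_cau[OF r]] by blast
    then have le: "m \<ge> N \<Longrightarrow> nq (\<lambda>s. rp (\<sigma> n) m s - rp (\<sigma> n) N s) \<le> inverse (real (Suc n))" for m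
      using less_imp_le order_refl by blast
    show ?thesis
      using gd_approx[OF r rep_F[OF r, of N] le] rep_F[OF r, of N]
      by (intro exI[of _ "rp (\<sigma> n) N"] conjI)
  qed
  from choice[OF allI[OF ex]] obtain c where "\<forall>n. c n \<in> F \<and> gd (\<sigma> n) (\<phi> (c n)) \<le> inverse (real (Suc n)) \<and>
      gd (\<phi> (c n)) (\<sigma> n) \<le> inverse (real (Suc n))" ..
  then have c: "\<And>n. c n \<in> F" "\<And>n. gd (\<sigma> n) (\<phi> (c n)) \<le> inverse (real (Suc n))"
    "\<And>n. gd (\<phi> (c n)) (\<sigma> n) \<le> inverse (real (Suc n))"
    by simp_all
  have cG: "\<phi> (c n) \<in> G" for n using GI[OF rep_const[OF c(1)]] .
  have inv: "\<exists>N. \<forall>n\<ge>N. inverse (real (Suc n)) < e" if e: "0 < e" for e :: real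
  proof -
    obtain N where N: "inverse (real (Suc N)) < e" using reals_Archimedean[OF e] by blast
    have "inverse (real (Suc n)) \<le> inverse (real (Suc N))" if "n \<ge> N" for n
      using that by (simp add: le_imp_inverse_le)
    then show ?thesis using N by (meson order_le_less_trans)
  qed
  have "cau c"
    unfolding cau_def
  proof (intro conjI allI impI)
    show "c n \<in> F" for n by (rule c)
    fix e :: real assume e: "0 < e"
    obtain N1 where N1: "\<forall>n\<ge>N1. inverse (real (Suc n)) < e / 3" using inv[of "e / 3"] e by auto
    obtain N2 where N2: "\<forall>k\<ge>N2. \<forall>l\<ge>N2. gd (\<sigma> k) (\<sigma> l) < e / 3" using C[of "e / 3"] e by auto
    have "nq (\<lambda>s. c m s - c n s) < e" if mn: "m \<ge> max N1 N2" "n \<ge> max N1 N2" for m n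
    proof -
      have "nq (\<lambda>s. c m s - c n s) = gd (\<phi> (c m)) (\<phi> (c n))" by (simp add: gd_const c)
      also have "\<dots> \<le> gd (\<phi> (c m)) (\<sigma> m) + gd (\<sigma> m) (\<phi> (c n))"
        by (intro gd_triangle cG \<sigma>)
      also have "gd (\<sigma> m) (\<phi> (c n)) \<le> gd (\<sigma> m) (\<sigma> n) + gd (\<sigma> n) (\<phi> (c n))"
        by (intro gd_triangle cG \<sigma>)
      finally show ?thesis
        using c(2)[of n] c(3)[of m] N1[rule_format, of m] N1[rule_format, of n]
          N2[rule_format, of m n] mn by simp
    qed
    then show "\<exists>N. \<forall>m\<ge>N. \<forall>n\<ge>N. nq (\<lambda>s. c m s - c n s) < e" by blast
  qed
  then obtain f where f: "rep f c" using cau_rep by blast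
  have fG: "f \<in> G" using GI[OF f] .
  have "(\<lambda>n. gd (\<sigma> n) f) \<longlonglongrightarrow> 0"
  proof (rule LIMSEQ_I)
    fix e :: real assume e: "0 < e"
    obtain N1 where N1: "\<forall>n\<ge>N1. inverse (real (Suc n)) < e / 2" using inv[of "e / 2"] e by auto
    have "0 < e / 2" using e by simp
    then obtain N2 where N2: "\<And>m n. m \<ge> N2 \<Longrightarrow> n \<ge> N2 \<Longrightarrow> nq (\<lambda>s. c m s - c n s) < e / 2"
      using cau_D[OF \<open>cau c\<close>] by blast
    have "norm (gd (\<sigma> n) f - 0) < e" if n: "n \<ge> max N1 N2" for n
    proof -
      have "gd (\<phi> (c n)) f \<le> e / 2"
        by (rule gd_approx(2)[OF f c(1), where N = N2]) (use N2 n in \<open>auto intro: less_imp_le\<close>)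
      moreover have "gd (\<sigma> n) f \<le> gd (\<sigma> n) (\<phi> (c n)) + gd (\<phi> (c n)) f"
        by (intro gd_triangle cG \<sigma> fG)
      moreover have "gd (\<sigma> n) (\<phi> (c n)) < e / 2"
        using c(2)[of n] N1 n by (meson max.boundedE order_le_less_trans)
      moreover have "0 \<le> gd (\<sigma> n) f"
        by (rule LIMSEQ_le_const[OF nq_tendsto[OF rep_diff[OF rep_rp[OF \<sigma>[of n]] f]]])
          (use nq_nonneg F_diff rep_F[OF rep_rp[OF \<sigma>[of n]]] rep_F[OF f] in blast)
      ultimately show ?thesis by simp
    qed
    then show "\<exists>N. \<forall>n\<ge>N. norm (gd (\<sigma> n) f - 0) < e" by blast
  qed
  then show "\<exists>f\<in>G. (\<lambda>k. gd (\<sigma> k) f) \<longlonglongrightarrow> 0"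
    using fG by blast
qed

section \<open>Isometries of the space induced by injections of the index set\<close>

definition push :: "('s \<Rightarrow> 's) \<Rightarrow> ('s \<Rightarrow> complex) \<Rightarrow> 's \<Rightarrow> complex" where
  "push \<theta> c t = (if t \<in> range \<theta> then c (inv \<theta> t) else 0)"

text \<open>The linear extension of \<open>k s \<mapsto> k (\<theta> s)\<close> to the completion,
  defined through the representative of \<open>f\<close>.\<close>

definition lift_map :: "('s \<Rightarrow> 's) \<Rightarrow> ('s \<Rightarrow> complex) \<Rightarrow> 's \<Rightarrow> complex" where
  "lift_map \<theta> f = (SOME g. rep g (\<lambda>n. push \<theta> (rp f n)))"

lemma push_image [simp]: "inj \<theta> \<Longrightarrow> push \<theta> c (\<theta> s) = c s"
  by (simp add: push_def inv_f_f)

lemma push_outside: "t \<notin> range \<theta> \<Longrightarrow> push \<theta> c t = 0"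
  by (simp add: push_def)

lemma supp_push: "inj \<theta> \<Longrightarrow> supp (push \<theta> c) = \<theta> ` supp c"
proof (rule set_eqI)
  fix t
  assume inj: "inj \<theta>"
  show "t \<in> supp (push \<theta> c) \<longleftrightarrow> t \<in> \<theta> ` supp c"
  proof (cases "t \<in> range \<theta>")
    case True
    then obtain s where "t = \<theta> s" by blast
    then show ?thesis using inj by (simp add: supp_def inj_image_mem_iff)
  next
    case False
    then show ?thesis by (auto simp: supp_def push_outside)
  qed
qed

lemma push_F: "inj \<theta> \<Longrightarrow> c \<in> F \<Longrightarrow> push \<theta> c \<in> F"
  by (simp add: F_def supp_push)

text \<open>The factor \<open>b\<close> treats both cases at once: \<open>b = 1\<close> for one
  injection yields an isometry, \<open>b = 0\<close> for two yields orthogonal ranges.\<close>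

lemma L_push:
  assumes "inj \<theta>" "inj \<theta>'" and k: "\<And>s t. k (\<theta> s) (\<theta>' t) = b * k s t"
  shows "L (push \<theta> c) (push \<theta>' d) = b * L c d"
  unfolding L_def supp_push[OF assms(1)] supp_push[OF assms(2)]
  by (simp add: sum.reindex inj_on_subset[OF assms(1)] inj_on_subset[OF assms(2)]
      push_image[OF assms(1)] push_image[OF assms(2)] k sum_distrib_left mult_ac)

lemma push_diff: "push \<theta> (\<lambda>s. c s - d s) = (\<lambda>s. push \<theta> c s - push \<theta> d s)"
  and push_add: "push \<theta> (\<lambda>s. c s + d s) = (\<lambda>s. push \<theta> c s + push \<theta> d s)"
  and push_scale: "push \<theta> (\<lambda>s. a * c s) = (\<lambda>s. a * push \<theta> c s)"
  by (auto simp: push_def fun_eq_iff)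

lemma push_delta: "inj \<theta> \<Longrightarrow> push \<theta> (delta s) = delta (\<theta> s)"
  by (auto simp: push_def delta_def fun_eq_iff inv_f_f)

context
  fixes \<theta> :: "'s \<Rightarrow> 's"
  assumes inj: "inj \<theta>" and iso: "\<And>s t. k (\<theta> s) (\<theta> t) = k s t"
begin

lemma nq_push: "nq (push \<theta> c) = nq c"
  unfolding nq_def using L_push[OF inj inj, of 1 c c] iso by simp

lemma cau_push: "cau \<sigma> \<Longrightarrow> cau (\<lambda>n. push \<theta> (\<sigma> n))"
  by (simp add: cau_def push_F[OF inj] nq_push flip: push_diff)

text \<open>\<open>push\<close> preserves the seminorm, so null sequences stay null and any
  representative of \<open>f\<close> may replace the chosen one.\<close>

lemma lift_map_rep:
  assumes "rep f \<sigma>"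
  shows "rep (lift_map \<theta> f) (\<lambda>n. push \<theta> (\<sigma> n))"
proof -
  have r: "rep f (rp f)" using rep_rp[OF GI[OF assms]] .
  have 1: "rep (lift_map \<theta> f) (\<lambda>n. push \<theta> (rp f n))"
    unfolding lift_map_def by (rule someI_ex[OF cau_rep[OF cau_push[OF rep_cau[OF r]]]])
  have "(\<lambda>n. nq (push \<theta> (\<lambda>s. \<sigma> n s - rp f n s))) \<longlonglongrightarrow> 0"
    unfolding nq_push by (rule rep_unique_null[OF assms r])
  then have lim: "(\<lambda>n. nq (\<lambda>s. push \<theta> (\<sigma> n) s - push \<theta> (rp f n) s) * nq (delta t)) \<longlonglongrightarrow> 0" for t
    unfolding push_diff using tendsto_mult_left_zero by blast
  have "(\<lambda>n. \<phi> (push \<theta> (\<sigma> n)) t) \<longlonglongrightarrow> lift_map \<theta> f t" for t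
  proof -
    have "(\<lambda>n. L (\<lambda>s. push \<theta> (\<sigma> n) s - push \<theta> (rp f n) s) (delta t)) \<longlonglongrightarrow> 0"
      by (rule Lim_null_comparison[OF _ lim[of t]])
        (intro always_eventually allI L_Cauchy_Schwarz F_diff push_F inj F_delta rep_F[OF r] rep_F[OF assms])
    then have "(\<lambda>n. \<phi> (push \<theta> (\<sigma> n)) t - \<phi> (push \<theta> (rp f n)) t) \<longlonglongrightarrow> 0"
      by (simp add: \<phi>_def L_diff_left push_F inj F_delta rep_F[OF r] rep_F[OF assms])
    from tendsto_add[OF this, of "\<lambda>n. \<phi> (push \<theta> (rp f n)) t"] 1 show ?thesis
      by (simp add: rep_def)
  qed
  then show ?thesis using cau_push[OF rep_cau[OF assms]] by (simp add: rep_def)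
qed

lemma rep_fun_unique: "rep f \<sigma> \<Longrightarrow> rep g \<sigma> \<Longrightarrow> f = g"
  unfolding rep_def using LIMSEQ_unique by blast

lemma lift_map_in_G: "f \<in> G \<Longrightarrow> lift_map \<theta> f \<in> G"
  using GI[OF lift_map_rep[OF rep_rp]] .

lemma lift_map_add: "f \<in> G \<Longrightarrow> g \<in> G \<Longrightarrow>
    lift_map \<theta> (\<lambda>s. f s + g s) = (\<lambda>s. lift_map \<theta> f s + lift_map \<theta> g s)"
  using rep_fun_unique[OF lift_map_rep[OF rep_add[OF rep_rp rep_rp], unfolded push_add]
      rep_add[OF lift_map_rep[OF rep_rp] lift_map_rep[OF rep_rp]]] .

lemma lift_map_scale: "f \<in> G \<Longrightarrow> lift_map \<theta> (\<lambda>s. a * f s) = (\<lambda>s. a * lift_map \<theta> f s)"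
  using rep_fun_unique[OF lift_map_rep[OF rep_scale[OF rep_rp], unfolded push_scale]
      rep_scale[OF lift_map_rep[OF rep_rp]]] .

lemma lift_map_kernel: "lift_map \<theta> (k s) = k (\<theta> s)"
  using rep_fun_unique[OF lift_map_rep[OF kernel_fun_rep, unfolded push_delta[OF inj]] kernel_fun_rep] .

end

lemma ip_lift_map:
  assumes "inj \<theta>" "\<And>s t. k (\<theta> s) (\<theta> t) = k s t" "inj \<theta>'" "\<And>s t. k (\<theta>' s) (\<theta>' t) = k s t"
    and k: "\<And>s t. k (\<theta> s) (\<theta>' t) = b * k s t" and f: "f \<in> G" and g: "g \<in> G"
  shows "ip (lift_map \<theta> f) (lift_map \<theta>' g) = b * ip f g"
proof (rule ip_unique[OF lift_map_rep lift_map_rep, OF assms(1,2) rep_rp[OF f] assms(3,4) rep_rp[OF g]])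
  show "(\<lambda>n. L (push \<theta> (rp f n)) (push \<theta>' (rp g n))) \<longlonglongrightarrow> b * ip f g"
    unfolding L_push[OF assms(1,3) k] by (intro tendsto_intros ip_tendsto rep_rp f g)
qed

end

section \<open>Construction of the dilation from a positive kernel\<close>

lemma kernel_entry_add_right: "kernel_entry \<Phi> \<alpha> u \<beta> (v + w) = kernel_entry \<Phi> \<alpha> u \<beta> v + kernel_entry \<Phi> \<alpha> u \<beta> w"
  by (simp add: kernel_entry_def blinfun.add_right cinner_add_left cinner_add_right)

lemma cinner_ext_left: "(\<And>z. cinner x z = cinner y z) \<Longrightarrow> x = (y :: 'h::complex_inner_space)"
  by (rule cinner_ext) (metis cinner_commute)

text \<open>Division by \<rho> makes the entry for the empty words equal to \<open>cinner\<close>,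
  so that \<open>x\<close> embeds isometrically. Positivity of the scalar kernel reduces to that of
  the form, since pairs with the same word merge by linearity.\<close>

lemma kernel_nonneg_gram:
  fixes A :: "'n::finite \<Rightarrow> ('h::complex_hilbert_space \<Rightarrow>\<^sub>L 'h)"
  assumes inf: "infinite_dimensional TYPE('h)" and A: "A \<in> BH" and \<rho>: "0 < \<rho>"
    and pos: "\<And>N x. supported N x \<Longrightarrow> 0 \<le> kernel_form \<rho> A N x" and S: "finite S"
  shows "\<exists>w :: 'n list \<times> 'h \<Rightarrow> 'h. \<forall>a\<in>S. \<forall>b\<in>S. cinner (w a) (w b) =
    kernel_entry (symbol \<rho> A) (fst b) (snd b) (fst a) (snd a) / of_real \<rho>"
proof (rule psd_gram_vectors[OF inf S])
  let ?k = "\<lambda>a b. kernel_entry (symbol \<rho> A) (fst b) (snd b) (fst a) (snd a)"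
  show "?k b a / of_real \<rho> = cnj (?k a b / of_real \<rho>)" for a b
    by (simp add: kernel_entry_commute[where \<Phi> = "symbol \<rho> A", OF symbol_Nil, of "fst a" "snd a"])
  fix c :: "'n list \<times> 'h \<Rightarrow> complex"
  define N where "N = Max (insert 0 ((length \<circ> fst) ` S))"
  have N: "fst ` S \<subseteq> words N"
  proof clarify
    fix \<alpha> u assume "(\<alpha>, u) \<in> S"
    then have "length \<alpha> \<in> insert 0 ((length \<circ> fst) ` S)" by force
    then have "length \<alpha> \<le> N" unfolding N_def using S by (intro Max_ge) auto
    then show "fst (\<alpha>, u) \<in> words N" by (simp add: words_iff)
  qed
  \<comment> \<open>All pairs of \<open>S\<close> with first component \<alpha> are combined into
    one vector.\<close>
  define \<xi> where "\<xi> = (\<lambda>\<alpha>. \<Sum>a\<in>{a \<in> S. fst a = \<alpha>}. c a *\<^sub>C snd a)"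
  have x: "supported N \<xi>"
  proof -
    have e: "{a \<in> S. fst a = \<alpha>} = {}" if "N < length \<alpha>" for \<alpha>
      using N that by (auto simp: words_iff)
    show ?thesis
      unfolding supported_def \<xi>_def by (intro allI impI) (simp only: e sum.empty)
  qed
  have lin: "complex_linear (symbol \<rho> A \<gamma>)" for \<gamma> by (rule complex_linear_symbol[OF A])
  have "(\<Sum>a\<in>S. \<Sum>b\<in>S. c a * cnj (c b) * ?k a b)
     = (\<Sum>a\<in>S. \<Sum>b\<in>S. kernel_entry (symbol \<rho> A) (fst b) (c b *\<^sub>C snd b) (fst a) (c a *\<^sub>C snd a))"
    by (simp add: kernel_entry_scale_left[OF lin] kernel_entry_scale_right[OF lin] mult_ac)
  also have "\<dots> = (\<Sum>\<beta>\<in>words N. \<Sum>a\<in>{a \<in> S. fst a = \<beta>}. \<Sum>\<alpha>\<in>words N. \<Sum>b\<in>{b \<in> S. fst b = \<alpha>}.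
      kernel_entry (symbol \<rho> A) (fst b) (c b *\<^sub>C snd b) (fst a) (c a *\<^sub>C snd a))"
    by (simp only: sum.group[OF S finite_words N])
  also have "\<dots> = (\<Sum>\<beta>\<in>words N. \<Sum>\<alpha>\<in>words N. \<Sum>a\<in>{a \<in> S. fst a = \<beta>}. \<Sum>b\<in>{b \<in> S. fst b = \<alpha>}.
      kernel_entry (symbol \<rho> A) (fst b) (c b *\<^sub>C snd b) (fst a) (c a *\<^sub>C snd a))"
    by (intro sum.cong refl, rule sum.swap)
  also have "\<dots> = (\<Sum>\<beta>\<in>words N. \<Sum>\<alpha>\<in>words N. \<Sum>a\<in>{a \<in> S. fst a = \<beta>}. \<Sum>b\<in>{b \<in> S. fst b = \<alpha>}.
      kernel_entry (symbol \<rho> A) \<alpha> (c b *\<^sub>C snd b) \<beta> (c a *\<^sub>C snd a))"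
    by (intro sum.cong refl) auto
  also have "\<dots> = (\<Sum>\<beta>\<in>words N. \<Sum>\<alpha>\<in>words N. kernel_entry (symbol \<rho> A) \<alpha> (\<xi> \<alpha>) \<beta> (\<xi> \<beta>))"
    unfolding \<xi>_def kernel_entry_sum_right by (simp only: kernel_entry_sum_left)
  also have "\<dots> = of_real (kernel_form \<rho> A N \<xi>)"
    by (subst sum.swap) (rule sum_kap[where \<Phi> = "symbol \<rho> A", OF symbol_Nil x])
  finally have "(\<Sum>a\<in>S. \<Sum>b\<in>S. c a * cnj (c b) * (?k a b / of_real \<rho>)) = of_real (kernel_form \<rho> A N \<xi> / \<rho>)"
    by (simp flip: sum_divide_distrib)
  then show "0 \<le> Re (\<Sum>a\<in>S. \<Sum>b\<in>S. c a * cnj (c b) * (?k a b / of_real \<rho>))"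
    using pos[OF x] \<rho> by simp
qed

text \<open>\<open>J x\<close> is the kernel function at the empty word and \<open>x\<close>, and
  \<open>V i\<close> is induced by prefixing \<open>i\<close>. By \<open>kernel_entry_Cons\<close>
  the \<open>V i\<close> are isometries with orthogonal ranges, and \<open>V\<close> along \<alpha>
  maps \<open>J x\<close> to the kernel function at \<open>(\<alpha>, x)\<close>, whose value at
  \<open>([], y)\<close> is the required compression.\<close>

lemma kernel_nonneg_C_class:
  fixes A :: "'n::finite \<Rightarrow> ('h::complex_hilbert_space \<Rightarrow>\<^sub>L 'h)"
  assumes inf: "infinite_dimensional TYPE('h)" and A: "A \<in> BH" and \<rho>: "0 < \<rho>"
    and pos: "\<And>N x. supported N x \<Longrightarrow> 0 \<le> kernel_form \<rho> A N x"
  shows "A \<in> C_class \<rho>"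
proof -
  define k where "k = (\<lambda>a b. kernel_entry (symbol \<rho> A) (fst b) (snd b) (fst a) (snd a) / complex_of_real \<rho>)"
  interpret gram_kernel k "TYPE('h)"
    by standard (use kernel_nonneg_gram[OF assms] in \<open>simp add: k_def\<close>)
  define J where "J = (\<lambda>x :: 'h. k ([], x))"
  define \<theta> where "\<theta> = (\<lambda>(i :: 'n) a. (i # fst a :: 'n list, snd a :: 'h))"
  define V where "V = (\<lambda>i. lift_map (\<theta> i))"
  have inj: "inj (\<theta> i)" for i by (auto simp: \<theta>_def inj_def)
  have k\<theta>: "k (\<theta> i s) (\<theta> j t) = (if i = j then 1 else 0) * k s t" for i j s t
    by (auto simp: k_def \<theta>_def kernel_entry_Cons)
  have k\<theta>': "k (\<theta> i s) (\<theta> i t) = k s t" for i s t by (simp add: k\<theta>)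
  have lin: "complex_linear (symbol \<rho> A \<gamma>)" for \<gamma> by (rule complex_linear_symbol[OF A])
  have J_add: "J (x + y) = (\<lambda>s. J x s + J y s)" for x y
    by (auto simp: J_def k_def kernel_entry_add_right add_divide_distrib)
  have J_scale: "J (c *\<^sub>C x) = (\<lambda>s. c * J x s)" for c x
    by (auto simp: J_def k_def kernel_entry_scale_right[OF lin])
  have JG: "J x \<in> G" for x by (simp add: J_def kernel_fun_in_G)
  have ipJ: "ip f (J x) = f ([], x)" if "f \<in> G" for f x
    using reproducing[OF that] by (simp add: J_def)
  have J_iso: "ip (J x) (J y) = cinner x y" for x y
    using \<rho> by (simp add: ipJ JG) (simp add: J_def k_def symbol_Nil blinfun.scaleR_left cinner_scaleR_left)
  \<comment> \<open>The projection \<open>P\<close> comes from Riesz representation on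
    \<open>'h\<close>; boundedness in \<open>x\<close> is Cauchy-Schwarz for \<open>L\<close>,
    passed to the limit of a representative of \<open>f\<close>.\<close>
  have "\<exists>z. \<forall>x. ip (J x) f = cinner x z" if f: "f \<in> G" for f
  proof (rule riesz_complex)
    show lin: "ip (J (c *\<^sub>C x)) f = c * ip (J x) f" for c x
      by (simp add: J_scale ip_scale_left JG f)
    obtain M where M: "\<And>n. nq (rp f n) \<le> M"
      using cau_bounded[OF rep_cau[OF rep_rp[OF f]]] by blast
    show "bounded_linear (\<lambda>x. ip (J x) f)"
    proof (rule bounded_linear_intro[where K = M])
      show "ip (J (x + y)) f = ip (J x) f + ip (J y) f" for x y
        by (simp add: J_add ip_add_left JG f)
      show "ip (J (r *\<^sub>R x)) f = r *\<^sub>R ip (J x) f" for r x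
        using lin[of "of_real r" x] by (simp add: scaleC_of_real scaleR_conv_of_real)
      fix x
      have r: "rep (J x) (\<lambda>_. delta ([], x))" by (simp add: J_def kernel_fun_rep)
      have "nq (delta ([], x)) = sqrt (Re (ip (J x) (J x)))"
        using nq_tendsto[OF r] LIMSEQ_unique tendsto_const by blast
      then have nqJ: "nq (delta ([], x)) = norm x" by (simp add: J_iso cinner_self)
      have "(\<lambda>n. norm (L (delta ([], x)) (rp f n))) \<longlonglongrightarrow> norm (ip (J x) f)"
        by (intro tendsto_norm ip_tendsto r rep_rp f)
      then show "norm (ip (J x) f) \<le> norm x * M"
      proof (rule LIMSEQ_le_const2)
        have "norm (L (delta ([], x)) (rp f n)) \<le> norm x * M" for n
        proof -
          have "norm (L (delta ([], x)) (rp f n)) \<le> nq (delta ([], x)) * nq (rp f n)"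
            by (intro L_Cauchy_Schwarz F_delta rep_F[OF rep_rp[OF f]])
          also have "\<dots> \<le> norm x * M"
            unfolding nqJ by (intro mult_left_mono M) simp
          finally show ?thesis .
        qed
        then show "\<exists>N. \<forall>n\<ge>N. norm (L (delta ([], x)) (rp f n)) \<le> norm x * M" by blast
      qed
    qed
  qed
  then obtain P where P: "\<And>f x. f \<in> G \<Longrightarrow> ip (J x) f = cinner x (P f)"
    by metis
  have P': "cinner (P f) x = ip f (J x)" if "f \<in> G" for f x
    using P[OF that, of x] cinner_commute[of "P f" x] ip_commute[OF that JG[of x]] by simp
  have V_word: "foldr V \<alpha> (J x) = k (\<alpha>, x)" for \<alpha> x
  proof (induction \<alpha>)
    case Nil
    then show ?case by (simp add: J_def)
  next
    case (Cons i \<alpha>)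
    then show ?case
      using lift_map_kernel[OF inj k\<theta>', of i "(\<alpha>, x)"] by (simp add: V_def \<theta>_def)
  qed
  have "isometric_dilation \<rho> A G ip J P V"
    unfolding isometric_dilation_def
  proof (intro conjI allI ballI impI)
    show "hilbert_function_space G ip" by (rule hilbert_function_space_axioms)
    show "ip (V i f) (V i g) = ip f g" if "f \<in> G" "g \<in> G" for i f g
      using ip_lift_map[OF inj k\<theta>' inj k\<theta>' k\<theta> that] by (simp add: V_def)
    show "ip (V i f) (V j g) = 0" if "i \<noteq> j" "f \<in> G" "g \<in> G" for i j f g
      using ip_lift_map[OF inj k\<theta>' inj k\<theta>' k\<theta> that(2,3)] that(1) by (simp add: V_def)
    show "word_op A \<alpha> x = \<rho> *\<^sub>R P (foldr V \<alpha> (J x))" if "\<alpha> \<noteq> []" for \<alpha> x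
    proof (rule cinner_ext_left)
      fix y
      have "cinner (P (k (\<alpha>, x))) y = k (\<alpha>, x) ([], y)"
        by (simp add: P' kernel_fun_in_G ipJ)
      also have "\<dots> = cinner (word_op A \<alpha> x) y / of_real \<rho>"
        using that by (simp add: k_def symbol_def)
      finally show "cinner (word_op A \<alpha> x) y = cinner (\<rho> *\<^sub>R P (foldr V \<alpha> (J x))) y"
        using \<rho> by (simp add: V_word cinner_scaleR_left)
    qed
  qed (auto simp: J_add J_scale JG J_iso P' V_def lift_map_in_G[OF inj k\<theta>']
      lift_map_add[OF inj k\<theta>'] lift_map_scale[OF inj k\<theta>'])
  then show ?thesis unfolding C_class_def using A by blast
qed

section \<open>Harnack domination as an inequality of kernels\<close>

lemma poly_form_le:
  fixes A B :: "'n::finite \<Rightarrow> ('h::complex_hilbert_space \<Rightarrow>\<^sub>L 'h)"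
  assumes inf: "infinite_dimensional TYPE('k::complex_hilbert_space)"
    and A: "A \<in> BH" and B: "B \<in> BH" and p: "re_nonneg_poly TYPE('k) m p"
    and le: "\<And>N x. supported N x \<Longrightarrow> kernel_form \<rho> A N x \<le> b * kernel_form \<rho> B N x"
  shows "poly_form m p (symbol \<rho> A) x \<le> b * poly_form m p (symbol \<rho> B) x"
proof -
  \<comment> \<open>The symbol of no tuple, but \<open>poly_form_nonneg\<close> asks only for linear
    coefficients, a real scalar at the empty word, and positivity.\<close>
  let ?\<Phi> = "\<lambda>\<gamma>. b *\<^sub>R symbol \<rho> B \<gamma> - symbol \<rho> A \<gamma>"
  have "0 \<le> poly_form m p ?\<Phi> x"
  proof (rule poly_form_nonneg[OF inf _ _ _ p, where t = "b * \<rho> - \<rho>"])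
    show "?\<Phi> [] = (b * \<rho> - \<rho>) *\<^sub>R id_blinfun" by (simp add: symbol_Nil algebra_simps)
    show "complex_linear (?\<Phi> \<gamma>)" for \<gamma>
      by (intro complex_linear_diff complex_linear_scaleR complex_linear_symbol A B)
    show "0 \<le> toeplitz_form ?\<Phi> N x" if "supported N x" for N x
      using le[OF that] by (simp add: toeplitz_form_diff toeplitz_form_scaleR)
  qed
  then show ?thesis by (simp add: poly_form_diff poly_form_scaleR)
qed

text \<open>One direction tests kernel polynomials, the other realises the positive difference
  kernel on the test space; all later arguments use kernels alone.\<close>

lemma harnack_dom_iff:
  fixes A B :: "'n::finite \<Rightarrow> ('h::complex_hilbert_space \<Rightarrow>\<^sub>L 'h)"
  assumes "infinite_dimensional TYPE('k::complex_hilbert_space)" "A \<in> BH" "B \<in> BH"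
  shows "harnack_dom TYPE('k) \<rho> c A B \<longleftrightarrow>
    (\<forall>N x. supported N x \<longrightarrow> kernel_form \<rho> A N x \<le> c\<^sup>2 * kernel_form \<rho> B N x)"
  using harnack_dom_imp_kernel_le[OF assms(2,3), where 'k = 'k, of \<rho> c]
    poly_form_le[OF assms, of _ _ \<rho> "c\<^sup>2"] harnack_dom_iff_poly_form[OF assms(2,3), of "TYPE('k)" \<rho> c]
  by blast

section \<open>Harnack's inequality on the disc and along rays of tuples\<close>

lemma scalar_harnack:
  fixes a :: "nat \<Rightarrow> complex" and n :: nat
  defines "f \<equiv> \<lambda>z. \<Sum>k\<le>n. a k * z ^ k"
  assumes circle: "\<And>z. cmod z = 1 \<Longrightarrow> 0 \<le> Re (f z)" and a0: "a 0 = of_real A"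
    and t: "0 \<le> t" "t < 1"
  shows "0 \<le> A" and "(1 - t) * A \<le> (1 + t) * Re (f (of_real t))"
    and "(1 - t) * Re (f (of_real t)) \<le> (1 + t) * A"
proof -
  have holo: "f holomorphic_on S" for S
    unfolding f_def by (intro holomorphic_intros)
  have f0: "f 0 = of_real A"
  proof -
    have "f 0 = (\<Sum>k\<le>n. if k = 0 then a 0 else 0)"
      unfolding f_def by (intro sum.cong) auto
    then show ?thesis using a0 by simp
  qed
  have disc: "0 \<le> Re (f z)" if "cmod z \<le> 1" for z
  proof -
    \<comment> \<open>Positivity of the real part passes from the circle to the disc by the maximum
      modulus principle for \<open>exp (- f)\<close>.\<close>
    have "norm (exp (- f z)) \<le> 1"
    proof (rule maximum_modulus_frontier[of "\<lambda>z. exp (- f z)" "cball 0 1"])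
      show "(\<lambda>z. exp (- f z)) holomorphic_on interior (cball 0 1)"
        by (intro holomorphic_intros holo)
      show "continuous_on (closure (cball 0 1)) (\<lambda>z. exp (- f z))"
        by (intro continuous_intros holomorphic_on_imp_continuous_on holo)
    qed (use circle that in \<open>auto simp: frontier_cball\<close>)
    then show ?thesis by simp
  qed
  show A0: "0 \<le> A" using disc[of 0] f0 by simp
  \<comment> \<open>Adding \<open>e > 0\<close> makes the real part strictly positive, so the Cayley
    transform below has no zero denominator; \<open>e\<close> tends to 0 at the end.\<close>
  have key: "(1 - t) * (A + e) \<le> (1 + t) * (Re (f (of_real t)) + e) \<and>
      (1 - t) * (Re (f (of_real t)) + e) \<le> (1 + t) * (A + e)" if e: "0 < e" for e
  proof -
    define h where "h = (\<lambda>z. f z + of_real e)"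
    define h0 where "h0 = A + e"
    have h0: "0 < h0" using A0 e by (simp add: h0_def)
    have Reh: "0 < Re (h z)" if "cmod z \<le> 1" for z
      using disc[OF that] e by (simp add: h_def)
    have lt: "cmod (h z - of_real h0) < cmod (h z + of_real h0)" if "cmod z \<le> 1" for z
    proof -
      have "(cmod (h z - of_real h0))\<^sup>2 < (cmod (h z + of_real h0))\<^sup>2"
        using mult_pos_pos[OF Reh[OF that] h0] unfolding cmod_power2 by (simp add: power2_eq_square algebra_simps)
      then show ?thesis by (rule power_less_imp_less_base) simp
    qed
    \<comment> \<open>The Cayley transform maps the right half plane to the disc and
      \<open>h 0\<close> to 0, so the Schwarz lemma bounds \<open>g\<close> at \<open>t\<close> by
      \<open>t\<close>.\<close>
    define g where "g = (\<lambda>z. (h z - of_real h0) / (h z + of_real h0))"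
    have nz: "h z + of_real h0 \<noteq> 0" if "cmod z \<le> 1" for z
      using lt[OF that] by auto
    have "norm (g (of_real t)) \<le> norm (complex_of_real t)"
    proof (rule Schwarz_Lemma(1))
      show "g holomorphic_on ball 0 1"
        unfolding g_def h_def
        by (intro holomorphic_intros holo) (use nz in \<open>auto simp: h_def\<close>)
      show "g 0 = 0" by (simp add: g_def h_def h0_def f0)
      show "norm (g z) < 1" if "norm z < 1" for z
        using lt[of z] nz[of z] that by (simp add: g_def norm_divide divide_less_eq)
      show "norm (complex_of_real t) < 1" using t by simp
    qed
    then have "cmod (h (of_real t) - of_real h0) \<le> t * cmod (h (of_real t) + of_real h0)"
      using nz[of "of_real t"] t by (simp add: g_def norm_divide divide_le_eq)
    from power_mono[OF this norm_ge_zero, of 2]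
    have "(cmod (h (of_real t) - of_real h0))\<^sup>2 \<le> t\<^sup>2 * (cmod (h (of_real t) + of_real h0))\<^sup>2"
      by (simp add: power_mult_distrib)
    then have "(Re (h (of_real t)) - h0)\<^sup>2 + (Im (h (of_real t)))\<^sup>2
      \<le> t\<^sup>2 * (Re (h (of_real t)) + h0)\<^sup>2 + t\<^sup>2 * (Im (h (of_real t)))\<^sup>2"
      by (simp add: cmod_power2 distrib_left)
    moreover have "t\<^sup>2 * (Im (h (of_real t)))\<^sup>2 \<le> 1 * (Im (h (of_real t)))\<^sup>2"
      using t by (intro mult_right_mono) (auto simp: power_le_one)
    ultimately have "(Re (h (of_real t)) - h0)\<^sup>2 \<le> (t * (Re (h (of_real t)) + h0))\<^sup>2"
      by (simp add: power_mult_distrib)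
    moreover have "0 \<le> t * (Re (h (of_real t)) + h0)"
      using t h0 Reh[of "of_real t"] by simp
    ultimately have "\<bar>Re (h (of_real t)) - h0\<bar> \<le> t * (Re (h (of_real t)) + h0)"
      by (simp add: abs_le_square_iff[symmetric])
    then have "(1 - t) * h0 \<le> (1 + t) * Re (h (of_real t)) \<and> (1 - t) * Re (h (of_real t)) \<le> (1 + t) * h0"
      by (simp add: abs_le_iff algebra_simps)
    then show ?thesis by (simp add: h0_def h_def)
  qed
  let ?R = "Re (f (of_real t))"
  have half: "(1 - t) * (u + e / 2) = (1 - t) * u + e / 2 - t * e / 2"
    "(1 + t) * (u + e / 2) = (1 + t) * u + e / 2 + t * e / 2" for u e :: real
    by (simp_all add: field_simps)
  have te: "t * e \<le> e" if "0 < e" for e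
    using mult_right_mono[of t 1 e] t that by simp
  show "(1 - t) * A \<le> (1 + t) * ?R"
  proof (rule field_le_epsilon)
    fix e :: real assume e: "0 < e"
    then show "(1 - t) * A \<le> (1 + t) * ?R + e"
      using key[of "e / 2"] te[OF e] unfolding half by linarith
  qed
  show "(1 - t) * ?R \<le> (1 + t) * A"
  proof (rule field_le_epsilon)
    fix e :: real assume e: "0 < e"
    then show "(1 - t) * ?R \<le> (1 + t) * A + e"
      using key[of "e / 2"] te[OF e] unfolding half by linarith
  qed
qed

lemma sqnorm_of_real: "(\<Sum>\<alpha>\<in>words N. cinner (x \<alpha>) (x \<alpha>)) = of_real (sqnorm N x)"
  by (simp add: sqnorm_def cinner_self)

text \<open>Scaling the tuple by \<open>z\<close> multiplies the entry of a word by the power of its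
  length, so grouping words by length gives a polynomial in \<open>z\<close>. Only the constant term
  depends on \<rho>.\<close>

lemma kernel_form_symbol_expand:
  fixes A :: "'n::finite \<Rightarrow> ('h::complex_hilbert_space \<Rightarrow>\<^sub>L 'h)"
  assumes A: "A \<in> BH"
  obtains a where "a 0 = of_real (\<rho> * sqnorm N x)"
    "\<And>z. kernel_form \<rho> (\<lambda>i. scaleC_op z (A i)) N x = Re (\<Sum>k\<le>N. a k * z ^ k)"
proof -
  define c where "c = (\<lambda>\<gamma>. if \<gamma> = [] then of_real (\<rho> * sqnorm N x)
    else 2 * (\<Sum>\<alpha>\<in>words N. cinner (word_op A \<gamma> (x (\<alpha> @ \<gamma>))) (x \<alpha>)))"
  define a where "a = (\<lambda>k. \<Sum>\<gamma>\<in>{\<gamma> \<in> words N. length \<gamma> = k}. c \<gamma>)"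
  show ?thesis
  proof (rule that)
    have "{\<gamma> \<in> words N. length \<gamma> = 0} = {[] :: 'n list}" by auto
    then show "a 0 = of_real (\<rho> * sqnorm N x)" by (simp add: a_def c_def)
    fix z
    let ?A = "\<lambda>i. scaleC_op z (A i)"
    have "(\<Sum>k\<le>N. a k * z ^ k) = (\<Sum>k\<le>N. \<Sum>\<gamma>\<in>{\<gamma> \<in> words N. length \<gamma> = k}. c \<gamma> * z ^ length \<gamma>)"
      by (simp add: a_def sum_distrib_right)
    also have "\<dots> = (\<Sum>\<gamma>\<in>words N. c \<gamma> * z ^ length \<gamma>)"
      by (rule sum.group) (auto simp: words_iff)
    also have "\<dots> = (\<Sum>\<alpha>\<in>words N. 2 * (\<Sum>\<gamma>\<in>words N. cinner (symbol \<rho> ?A \<gamma> (x (\<alpha> @ \<gamma>))) (x \<alpha>))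
        - cinner (symbol \<rho> ?A [] (x \<alpha>)) (x \<alpha>))"
    proof -
      have "c \<gamma> * z ^ length \<gamma> = 2 * (\<Sum>\<alpha>\<in>words N. cinner (symbol \<rho> ?A \<gamma> (x (\<alpha> @ \<gamma>))) (x \<alpha>))
        - (if \<gamma> = [] then of_real (\<rho> * sqnorm N x) else 0)" for \<gamma>
        by (simp add: c_def symbol_def word_op_scaleC[OF A] cinner_scaleC_left blinfun.scaleR_left
            cinner_scaleR_left sqnorm_of_real mult.commute flip: sum_distrib_left)
      then have "(\<Sum>\<gamma>\<in>words N. c \<gamma> * z ^ length \<gamma>)
        = 2 * (\<Sum>\<gamma>\<in>words N. \<Sum>\<alpha>\<in>words N. cinner (symbol \<rho> ?A \<gamma> (x (\<alpha> @ \<gamma>))) (x \<alpha>)) - of_real (\<rho> * sqnorm N x)"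
        by (simp add: sum_subtractf sum_distrib_left)
      also have "\<dots> = 2 * (\<Sum>\<alpha>\<in>words N. \<Sum>\<gamma>\<in>words N. cinner (symbol \<rho> ?A \<gamma> (x (\<alpha> @ \<gamma>))) (x \<alpha>)) - of_real (\<rho> * sqnorm N x)"
        by (subst sum.swap) (rule refl)
      also have "of_real (\<rho> * sqnorm N x) = (\<Sum>\<alpha>\<in>words N. cinner (symbol \<rho> ?A [] (x \<alpha>)) (x \<alpha>))"
        by (simp add: symbol_Nil blinfun.scaleR_left cinner_scaleR_left sqnorm_of_real flip: sum_distrib_left)
      finally show ?thesis by (simp add: sum_subtractf sum_distrib_left)
    qed
    finally show "kernel_form \<rho> ?A N x = Re (\<Sum>k\<le>N. a k * z ^ k)"
      by (simp add: toeplitz_form_def)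
  qed
qed

text \<open>Gauge invariance: a unimodular factor on the tuple is absorbed by multiplying
  \<open>x \<alpha>\<close> with its power of exponent \<open>length \<alpha>\<close>, which
  preserves \<open>sqnorm\<close>.\<close>

lemma kernel_form_rotate:
  fixes A :: "'n::finite \<Rightarrow> ('h::complex_hilbert_space \<Rightarrow>\<^sub>L 'h)"
  assumes A: "A \<in> BH" and z: "cmod z = 1"
  shows "kernel_form \<rho> (\<lambda>i. scaleC_op z (A i)) N x = kernel_form \<rho> A N (\<lambda>\<alpha>. z ^ length \<alpha> *\<^sub>C x \<alpha>)"
    and "sqnorm N (\<lambda>\<alpha>. z ^ length \<alpha> *\<^sub>C x \<alpha>) = sqnorm N x"
proof -
  have zz: "z ^ (k + l) * cnj (z ^ k) = z ^ l" for k l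
  proof -
    have "z ^ k * cnj (z ^ k) = 1"
      using z by (simp add: complex_norm_square[symmetric] norm_power del: complex_cnj_power)
    then show ?thesis by (simp add: power_add mult_ac del: complex_cnj_power)
  qed
  have "cinner (symbol \<rho> (\<lambda>i. scaleC_op z (A i)) \<gamma> (x (\<alpha> @ \<gamma>))) (x \<alpha>)
      = cinner (symbol \<rho> A \<gamma> (z ^ length (\<alpha> @ \<gamma>) *\<^sub>C x (\<alpha> @ \<gamma>))) (z ^ length \<alpha> *\<^sub>C x \<alpha>)" for \<alpha> \<gamma>
  proof -
    have "cinner (symbol \<rho> A \<gamma> (z ^ length (\<alpha> @ \<gamma>) *\<^sub>C x (\<alpha> @ \<gamma>))) (z ^ length \<alpha> *\<^sub>C x \<alpha>)
       = (z ^ (length \<alpha> + length \<gamma>) * cnj (z ^ length \<alpha>)) * cinner (symbol \<rho> A \<gamma> (x (\<alpha> @ \<gamma>))) (x \<alpha>)"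
      by (simp add: complex_linearD[OF complex_linear_symbol[OF A]] cinner_scaleC_left
          cinner_scaleC_right mult_ac del: complex_cnj_power)
    also have "\<dots> = cinner (symbol \<rho> (\<lambda>i. scaleC_op z (A i)) \<gamma> (x (\<alpha> @ \<gamma>))) (x \<alpha>)"
      unfolding zz by (simp add: symbol_def word_op_scaleC[OF A] cinner_scaleC_left)
    finally show ?thesis by simp
  qed
  note e = this
  show "kernel_form \<rho> (\<lambda>i. scaleC_op z (A i)) N x = kernel_form \<rho> A N (\<lambda>\<alpha>. z ^ length \<alpha> *\<^sub>C x \<alpha>)"
    unfolding toeplitz_form_def e using e[where \<gamma> = "[]"] by simp
  show "sqnorm N (\<lambda>\<alpha>. z ^ length \<alpha> *\<^sub>C x \<alpha>) = sqnorm N x"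
    using z by (simp add: sqnorm_def norm_scaleC norm_power)
qed

text \<open>By rotation the positivity assumed for \<open>A\<close> holds on the whole circle of
  multiples \<open>z A\<close>, so the scalar inequality compares \<open>t A\<close> with 0. The
  pair \<open>(0, 1)\<close> serves for positive kernels, the pair \<open>(C, -1)\<close> for
  kernels bounded above.\<close>

lemma kernel_form_harnack:
  fixes A :: "'n::finite \<Rightarrow> ('h::complex_hilbert_space \<Rightarrow>\<^sub>L 'h)"
  assumes A: "A \<in> BH" and x: "supported N x" and t: "0 \<le> t" "t < 1"
    and pos: "\<And>x. supported N x \<Longrightarrow> 0 \<le> a * sqnorm N x + b * kernel_form \<rho> A N x"
  defines "S \<equiv> (a + b * \<rho>) * sqnorm N x"
    and "T \<equiv> a * sqnorm N x + b * kernel_form \<rho> (\<lambda>i. t *\<^sub>R A i) N x"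
  shows "0 \<le> S" and "(1 - t) * S \<le> (1 + t) * T" and "(1 - t) * T \<le> (1 + t) * S"
proof -
  obtain c where c: "c 0 = of_real (\<rho> * sqnorm N x)"
    "\<And>z. kernel_form \<rho> (\<lambda>i. scaleC_op z (A i)) N x = Re (\<Sum>k\<le>N. c k * z ^ k)"
    using kernel_form_symbol_expand[OF A] by metis
  define d where "d = (\<lambda>k. (if k = 0 then of_real (a * sqnorm N x) else 0) + of_real b * c k)"
  have d: "Re (\<Sum>k\<le>N. d k * z ^ k) = a * sqnorm N x + b * kernel_form \<rho> (\<lambda>i. scaleC_op z (A i)) N x" for z
  proof -
    have "(\<Sum>k\<le>N. d k * z ^ k) = (\<Sum>k\<le>N. (if k = 0 then of_real (a * sqnorm N x) else 0) + of_real b * (c k * z ^ k))"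
      by (intro sum.cong) (auto simp: d_def algebra_simps)
    also have "\<dots> = of_real (a * sqnorm N x) + of_real b * (\<Sum>k\<le>N. c k * z ^ k)"
      by (simp add: sum.distrib sum_distrib_left)
    finally show ?thesis by (simp add: c(2))
  qed
  have circ: "0 \<le> Re (\<Sum>k\<le>N. d k * z ^ k)" if "cmod z = 1" for z
    unfolding d using pos[of "\<lambda>\<alpha>. z ^ length \<alpha> *\<^sub>C x \<alpha>"] x
    by (simp add: kernel_form_rotate[OF A that] supported_def)
  have d0: "d 0 = of_real S" by (simp add: d_def c S_def algebra_simps)
  have T: "Re (\<Sum>k\<le>N. d k * of_real t ^ k) = T"
    unfolding d by (simp add: T_def scaleC_op_of_real)
  show "0 \<le> S" "(1 - t) * S \<le> (1 + t) * T" "(1 - t) * T \<le> (1 + t) * S"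
    using scalar_harnack[OF circ d0 t] unfolding T by auto
qed

section \<open>Resolvent bounds and the open ball\<close>

lemma two_cinner_le:
  fixes u v :: "'h::complex_inner_space"
  assumes "0 < s"
  shows "2 * \<bar>Re (cinner u v)\<bar> \<le> s * (norm u)\<^sup>2 + 1 / s * (norm v)\<^sup>2"
proof -
  have "2 * (norm u * norm v) \<le> s * (norm u)\<^sup>2 + 1 / s * (norm v)\<^sup>2"
  proof -
    have "0 \<le> (s * norm u - norm v)\<^sup>2 / s" using assms by simp
    also have "\<dots> = s * (norm u)\<^sup>2 + 1 / s * (norm v)\<^sup>2 - 2 * (norm u * norm v)"
      using assms by (simp add: power2_eq_square field_simps)
    finally show ?thesis by simp
  qed
  moreover have "\<bar>Re (cinner u v)\<bar> \<le> norm u * norm v"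
    using abs_Re_le_cmod cinner_Cauchy_Schwarz order_trans by blast
  ultimately show ?thesis by simp
qed

lemma two_sum_cinner_le:
  assumes "0 < s"
  shows "\<bar>2 * Re (\<Sum>\<alpha>\<in>words N. cinner (u \<alpha>) (v \<alpha>))\<bar> \<le> s * sqnorm N u + 1 / s * sqnorm N v"
proof -
  have "\<bar>2 * Re (\<Sum>\<alpha>\<in>words N. cinner (u \<alpha>) (v \<alpha>))\<bar> \<le> (\<Sum>\<alpha>\<in>words N. 2 * \<bar>Re (cinner (u \<alpha>) (v \<alpha>))\<bar>)"
    by (simp add: abs_mult sum_abs flip: sum_distrib_left)
  also have "\<dots> \<le> (\<Sum>\<alpha>\<in>words N. s * (norm (u \<alpha>))\<^sup>2 + 1 / s * (norm (v \<alpha>))\<^sup>2)"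
    by (intro sum_mono two_cinner_le assms)
  also have "\<dots> = s * sqnorm N u + 1 / s * sqnorm N v"
    by (simp add: sum.distrib sum_distrib_left sqnorm_def)
  finally show ?thesis .
qed

lemma sqnorm_add_le: "sqnorm N (\<lambda>\<alpha>. u \<alpha> + v \<alpha>) \<le> 2 * sqnorm N u + 2 * sqnorm N (v :: _ \<Rightarrow> 'h::real_normed_vector)"
proof -
  have "(norm (u \<alpha> + v \<alpha>))\<^sup>2 \<le> 2 * (norm (u \<alpha>))\<^sup>2 + 2 * (norm (v \<alpha>))\<^sup>2" for \<alpha>
  proof -
    have "(norm (u \<alpha> + v \<alpha>))\<^sup>2 \<le> (norm (u \<alpha>) + norm (v \<alpha>))\<^sup>2"
      by (intro power_mono norm_triangle_ineq) simp
    moreover have "0 \<le> (norm (u \<alpha>) - norm (v \<alpha>))\<^sup>2" by simp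
    ultimately show ?thesis by (simp add: power2_eq_square algebra_simps)
  qed
  then have "sqnorm N (\<lambda>\<alpha>. u \<alpha> + v \<alpha>) \<le> (\<Sum>\<alpha>\<in>words N. 2 * (norm (u \<alpha>))\<^sup>2 + 2 * (norm (v \<alpha>))\<^sup>2)"
    unfolding sqnorm_def by (intro sum_mono)
  then show ?thesis by (simp add: sum.distrib sum_distrib_left sqnorm_def)
qed

lemma sqnorm_scaleR: "sqnorm N (\<lambda>\<alpha>. r *\<^sub>R u \<alpha>) = r\<^sup>2 * sqnorm N u"
  by (simp add: sqnorm_def power_mult_distrib sum_distrib_left)

lemma backshift_scaleR: "backshift (\<lambda>i. r *\<^sub>R A i) y \<alpha> = r *\<^sub>R backshift A y \<alpha>"
  and backshift_diff: "backshift (\<lambda>i. A i - B i) y \<alpha> = backshift A y \<alpha> - backshift B y \<alpha>"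
  and backshift_diff_right: "backshift A (\<lambda>\<alpha>. y \<alpha> - y' \<alpha>) \<alpha> = backshift A y \<alpha> - backshift A y' \<alpha>"
  by (simp_all add: backshift_def blinfun.scaleR_left blinfun.diff_left blinfun.diff_right
      scaleR_sum_right sum_subtractf)

text \<open>With \<open>T\<close> the backward shift, \<open>x = (I - T) y\<close> and \<open>r = 1 - s\<close>, one has
  \<open>(I - r T) y = r x + s y\<close>; the bound for \<open>r A\<close> then reads \<open>2 s \<parallel>y\<parallel>\<^sup>2 \<le> O(\<parallel>x\<parallel> \<parallel>y\<parallel> + \<parallel>x\<parallel>\<^sup>2 + s\<^sup>2 \<parallel>y\<parallel>\<^sup>2)\<close>,
  which bounds \<open>\<parallel>y\<parallel>\<close> by \<open>\<parallel>x\<parallel>\<close> once \<open>s\<close> is small.\<close>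

lemma resolvent_bounded:
  fixes A :: "'n::finite \<Rightarrow> ('h::complex_hilbert_space \<Rightarrow>\<^sub>L 'h)"
  assumes A: "A \<in> BH" and upper: "\<And>N x. supported N x \<Longrightarrow> kernel_form \<rho> A N x \<le> C * sqnorm N x"
  obtains K where "0 < K" "\<And>N x. supported N x \<Longrightarrow> sqnorm N (resolvent A N x) \<le> K * sqnorm N x"
proof -
  \<comment> \<open>\<open>D\<close> majorises the coefficient of \<open>sqnorm u\<close> in the
    bound for \<open>2 Re <y, u>\<close>. The choice of \<open>s\<close> gives
    \<open>2 D s^2 = s / 2\<close>, so this term is absorbed and half of \<open>s\<close> times
    \<open>sqnorm y\<close> remains; \<open>K\<close> collects the rest. \<open>D \<ge> 1\<close>
    ensures that \<open>1 - s\<close> is nonnegative.\<close>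
  define D where "D = max 1 (C - \<rho> + 2)"
  define s where "s = 1 / (4 * D)"
  define K where "K = 2 / s * (2 * D + 1 / s)"
  have D: "1 \<le> D" by (simp add: D_def)
  then have s: "0 < s" "s \<le> 1/4" by (auto simp: s_def field_simps)
  have K: "0 < K" using D s by (simp add: K_def add_pos_pos)
  have "sqnorm N (resolvent A N x) \<le> K * sqnorm N x" if x: "supported N x" for N x
  proof -
    let ?y = "resolvent A N x" and ?X = "sqnorm N x" and ?Y = "sqnorm N (resolvent A N x)"
    define r where "r = 1 - s"
    have r: "0 \<le> r" "r < 1" using s by (auto simp: r_def)
    define u where "u = (\<lambda>\<alpha>. r *\<^sub>R x \<alpha> + s *\<^sub>R ?y \<alpha>)"
    have u: "supported N u" using x supported_resolvent[OF x, of A] by (simp add: supported_def u_def)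
    have res: "resolvent (\<lambda>i. r *\<^sub>R A i) N u = ?y"
    proof (rule resolvent_unique[OF u supported_resolvent[OF x]])
      fix \<alpha>
      have "u \<alpha> + backshift (\<lambda>i. r *\<^sub>R A i) ?y \<alpha> = r *\<^sub>R (x \<alpha> + backshift A ?y \<alpha>) + s *\<^sub>R ?y \<alpha>"
        by (simp add: u_def backshift_scaleR algebra_simps)
      also have "\<dots> = ?y \<alpha>"
        unfolding resolvent_rec[OF x, of A \<alpha>, symmetric] by (simp add: r_def flip: scaleR_left_distrib)
      finally show "?y \<alpha> = u \<alpha> + backshift (\<lambda>i. r *\<^sub>R A i) ?y \<alpha>" by simp
    qed
    \<comment> \<open>The upper bound moves from \<open>A\<close> to \<open>r A\<close> by Harnack's
      inequality for the positive form \<open>C sqnorm - kernel_form\<close>.\<close>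
    have up: "kernel_form \<rho> (\<lambda>i. r *\<^sub>R A i) N u \<le> C * sqnorm N u"
    proof -
      have pos: "0 \<le> C * sqnorm N v + (- 1) * kernel_form \<rho> A N v" if "supported N v" for v
        using upper[OF that] by simp
      have "0 \<le> (1 + r) * (C * sqnorm N u + (- 1) * kernel_form \<rho> (\<lambda>i. r *\<^sub>R A i) N u)"
      proof -
        have "0 \<le> (1 - r) * ((C + (- 1) * \<rho>) * sqnorm N u)"
          by (rule mult_nonneg_nonneg[OF _ kernel_form_harnack(1)[OF A u r pos]]) (use r in simp)
        then show ?thesis using kernel_form_harnack(2)[OF A u r pos] by linarith
      qed
      then show ?thesis using r by (simp add: zero_le_mult_iff)
    qed
    have "2 * Re (\<Sum>\<alpha>\<in>words N. cinner (?y \<alpha>) (u \<alpha>)) \<le> (C - \<rho> + 2) * sqnorm N u"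
      using up unfolding kernel_form_eq res by (simp add: algebra_simps)
    also have "\<dots> \<le> D * sqnorm N u" by (intro mult_right_mono) (auto simp: D_def)
    also have "\<dots> \<le> D * (2 * ?X + 2 * s\<^sup>2 * ?Y)"
    proof (intro mult_left_mono)
      have "sqnorm N u \<le> 2 * sqnorm N (\<lambda>\<alpha>. r *\<^sub>R x \<alpha>) + 2 * sqnorm N (\<lambda>\<alpha>. s *\<^sub>R ?y \<alpha>)"
        unfolding u_def by (rule sqnorm_add_le)
      also have "\<dots> = 2 * (r\<^sup>2 * ?X) + 2 * s\<^sup>2 * ?Y" by (simp add: sqnorm_scaleR)
      also have "r\<^sup>2 * ?X \<le> 1 * ?X" using r by (intro mult_right_mono) (auto simp: power_le_one)
      finally show "sqnorm N u \<le> 2 * ?X + 2 * s\<^sup>2 * ?Y" by simp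
    qed (use D in simp)
    finally have 1: "2 * Re (\<Sum>\<alpha>\<in>words N. cinner (?y \<alpha>) (u \<alpha>)) \<le> D * (2 * ?X + 2 * s\<^sup>2 * ?Y)" .
    have "(\<Sum>\<alpha>\<in>words N. cinner (?y \<alpha>) (u \<alpha>)) = r * (\<Sum>\<alpha>\<in>words N. cinner (?y \<alpha>) (x \<alpha>)) + s * (\<Sum>\<alpha>\<in>words N. cinner (?y \<alpha>) (?y \<alpha>))"
      by (simp add: u_def cinner_add_right cinner_scaleR_right sum.distrib sum_distrib_left)
    then have 2: "2 * Re (\<Sum>\<alpha>\<in>words N. cinner (?y \<alpha>) (u \<alpha>)) = r * (2 * Re (\<Sum>\<alpha>\<in>words N. cinner (?y \<alpha>) (x \<alpha>))) + 2 * s * ?Y"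
      by (simp only: sqnorm_of_real) simp
    have 3: "\<bar>2 * Re (\<Sum>\<alpha>\<in>words N. cinner (?y \<alpha>) (x \<alpha>))\<bar> \<le> s * ?Y + 1 / s * ?X"
      by (rule two_sum_cinner_le[OF s(1)])
    have arith: "a \<le> 1 * b \<Longrightarrow> - a \<le> c \<Longrightarrow> d \<le> e \<Longrightarrow> d = c + f \<Longrightarrow> f - b \<le> e" for a b c d e f :: real
      by linarith
    from 3 have "r * \<bar>2 * Re (\<Sum>\<alpha>\<in>words N. cinner (?y \<alpha>) (x \<alpha>))\<bar> \<le> 1 * (s * ?Y + 1 / s * ?X)"
      using r by (intro mult_mono) auto
    moreover have "- (r * \<bar>2 * Re (\<Sum>\<alpha>\<in>words N. cinner (?y \<alpha>) (x \<alpha>))\<bar>) \<le> r * (2 * Re (\<Sum>\<alpha>\<in>words N. cinner (?y \<alpha>) (x \<alpha>)))"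
      using mult_left_mono[OF abs_ge_minus_self[of "2 * Re (\<Sum>\<alpha>\<in>words N. cinner (?y \<alpha>) (x \<alpha>))"] r(1)] by simp
    ultimately have "2 * s * ?Y - (s * ?Y + 1 / s * ?X) \<le> D * (2 * ?X + 2 * s\<^sup>2 * ?Y)"
      using 1 2 arith by blast
    moreover have "D * (2 * ?X + 2 * s\<^sup>2 * ?Y) = 2 * D * ?X + s / 2 * ?Y"
      using D by (simp add: s_def power2_eq_square field_simps)
    ultimately have "2 * s * ?Y - (s * ?Y + 1 / s * ?X) \<le> 2 * D * ?X + s / 2 * ?Y"
      by (simp only:)
    then have "s / 2 * ?Y \<le> (2 * D + 1 / s) * ?X"
      unfolding distrib_right by linarith
    then have "2 / s * (s / 2 * ?Y) \<le> 2 / s * ((2 * D + 1 / s) * ?X)"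
      using s by (intro mult_left_mono) auto
    moreover have "2 / s * (s / 2 * ?Y) = ?Y" using s by simp
    ultimately show ?thesis unfolding K_def by (simp only: mult.assoc)
  qed
  then show ?thesis using that K by blast
qed

text \<open>The difference \<open>w\<close> of the resolvents of \<open>B\<close> and
  \<open>A\<close> is itself the resolvent of \<open>A\<close> at \<open>v\<close>, the shift of
  \<open>B - A\<close> applied to the resolvent of \<open>B\<close>. Hence the bound
  \<open>K\<close> for \<open>A\<close> suffices; the norm of the resolvent of \<open>B\<close> is
  bootstrapped, \<open>4 K \<tau>^2 \<le> 1\<close> absorbing half of it.\<close>

lemma kernel_form_perturb:
  fixes A B :: "'n::finite \<Rightarrow> ('h::complex_hilbert_space \<Rightarrow>\<^sub>L 'h)"
  assumes A: "A \<in> BH" and B: "B \<in> BH" and K: "0 < K"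
    and res: "\<And>N x. supported N x \<Longrightarrow> sqnorm N (resolvent A N x) \<le> K * sqnorm N x"
    and \<tau>: "0 < \<tau>" "row_dist B A \<le> \<tau>" "4 * K * \<tau>\<^sup>2 \<le> 1" and x: "supported N x"
  shows "\<bar>kernel_form \<rho> B N x - kernel_form \<rho> A N x\<bar> \<le> (4 * K\<^sup>2 + 1) * \<tau> * sqnorm N x"
proof -
  let ?y = "resolvent A N x" and ?y' = "resolvent B N x" and ?X = "sqnorm N x"
  define w where "w = (\<lambda>\<alpha>. ?y' \<alpha> - ?y \<alpha>)"
  define v where "v = backshift (\<lambda>i. B i - A i) ?y'"
  have y': "supported N ?y'" and y: "supported N ?y" using supported_resolvent[OF x] by auto
  have w: "supported N w" using y y' by (simp add: w_def supported_def)
  have v: "supported N v" unfolding v_def by (rule supported_backshift[OF y'])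
  have "resolvent A N v = w"
  proof (rule resolvent_unique[OF v w])
    show "w \<alpha> = v \<alpha> + backshift A w \<alpha>" for \<alpha>
      using resolvent_rec[OF x, of A \<alpha>] resolvent_rec[OF x, of B \<alpha>]
      by (simp add: w_def v_def backshift_diff backshift_diff_right)
  qed
  then have "sqnorm N w \<le> K * sqnorm N v" using res[OF v] by simp
  also have "\<dots> \<le> K * ((row_norm (\<lambda>i. B i - A i))\<^sup>2 * sqnorm N ?y')"
    unfolding v_def using K by (intro mult_left_mono sqnorm_backshift_le BH_diff A B y') auto
  also have "\<dots> \<le> K * (\<tau>\<^sup>2 * sqnorm N ?y')"
    using K \<tau> by (intro mult_left_mono mult_right_mono power_mono) (auto simp: row_dist_def)
  finally have w_le: "sqnorm N w \<le> K * \<tau>\<^sup>2 * sqnorm N ?y'" by (simp add: mult.assoc)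
  have "sqnorm N ?y' \<le> 2 * sqnorm N ?y + 2 * sqnorm N w"
    using sqnorm_add_le[of N ?y w] by (simp add: w_def)
  also have "\<dots> \<le> 2 * (K * ?X) + 2 * (K * \<tau>\<^sup>2 * sqnorm N ?y')"
    using res[OF x] w_le by simp
  also have "2 * (K * \<tau>\<^sup>2 * sqnorm N ?y') \<le> 1 / 2 * sqnorm N ?y'"
    using mult_right_mono[OF \<tau>(3) sqnorm_nonneg[of N ?y']] by simp
  finally have "sqnorm N ?y' \<le> 4 * K * ?X" by simp
  then have "K * \<tau>\<^sup>2 * sqnorm N ?y' \<le> K * \<tau>\<^sup>2 * (4 * K * ?X)"
    using K by (intro mult_left_mono) auto
  then have W: "sqnorm N w \<le> 4 * K\<^sup>2 * \<tau>\<^sup>2 * ?X" using w_le by (simp add: power2_eq_square mult_ac)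
  have "kernel_form \<rho> B N x - kernel_form \<rho> A N x = 2 * Re (\<Sum>\<alpha>\<in>words N. cinner (w \<alpha>) (x \<alpha>))"
    by (simp add: kernel_form_eq w_def cinner_diff_left sum_subtractf)
  \<comment> \<open>\<open>sqnorm w\<close> is of order \<open>\<tau>^2\<close>, so the weight
    \<open>1 / \<tau>\<close> balances the two terms and keeps the estimate linear in
    \<tau>.\<close>
  also have "\<bar>\<dots>\<bar> \<le> 1 / \<tau> * sqnorm N w + 1 / (1 / \<tau>) * ?X"
    by (rule two_sum_cinner_le) (use \<tau> in simp)
  also have "1 / \<tau> * sqnorm N w \<le> 1 / \<tau> * (4 * K\<^sup>2 * \<tau>\<^sup>2 * ?X)"
    using W \<tau> by (intro mult_left_mono) auto
  finally show ?thesis using \<tau> by (simp add: power2_eq_square algebra_simps)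
qed

lemma perturbation_radius:
  fixes K \<epsilon> :: real
  assumes K: "0 < K" and \<epsilon>: "0 < \<epsilon>"
  obtains \<tau> where "0 < \<tau>" "4 * K * \<tau>\<^sup>2 \<le> 1" "(4 * K\<^sup>2 + 1) * \<tau> \<le> \<epsilon>"
proof -
  define \<tau> where "\<tau> = min 1 (min (1 / (4 * K)) (\<epsilon> / (4 * K\<^sup>2 + 1)))"
  have L: "0 < 4 * K\<^sup>2 + 1" by (simp add: add_nonneg_pos)
  have \<tau>0: "0 < \<tau>" using K \<epsilon> L by (simp add: \<tau>_def)
  have "\<tau> * \<tau> \<le> \<tau> * 1" using \<tau>0 by (intro mult_left_mono) (auto simp: \<tau>_def)
  then have "4 * K * \<tau>\<^sup>2 \<le> 4 * K * \<tau>" using K by (simp add: power2_eq_square)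
  also have "\<dots> \<le> 4 * K * (1 / (4 * K))" using K by (intro mult_left_mono) (auto simp: \<tau>_def)
  finally have \<tau>1: "4 * K * \<tau>\<^sup>2 \<le> 1" using K by simp
  have "(4 * K\<^sup>2 + 1) * \<tau> \<le> (4 * K\<^sup>2 + 1) * (\<epsilon> / (4 * K\<^sup>2 + 1))"
    using L by (intro mult_left_mono) (auto simp: \<tau>_def)
  then have "(4 * K\<^sup>2 + 1) * \<tau> \<le> \<epsilon>" using L by simp
  then show ?thesis using that \<tau>0 \<tau>1 by blast
qed

lemma kernel_form_zero:
  fixes x :: "'n::finite list \<Rightarrow> 'h::complex_hilbert_space"
  shows "kernel_form \<rho> (\<lambda>_. 0) N x = \<rho> * sqnorm N x"
proof -
  have "resolvent (\<lambda>_. 0) N x \<alpha> = x \<alpha>" for \<alpha>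
  proof -
    have "resolvent (\<lambda>_. 0) N x \<alpha> = (\<Sum>\<gamma>\<in>words N. if \<gamma> = ([] :: 'n list) then x \<alpha> else 0)"
      unfolding resolvent_def by (intro sum.cong) (auto simp: word_op_zero)
    then show ?thesis by simp
  qed
  then show ?thesis by (simp add: kernel_form_eq sqnorm_of_real algebra_simps)
qed

lemma C_ball_iff_C_class:
  fixes A :: "'n::finite \<Rightarrow> ('h::complex_hilbert_space \<Rightarrow>\<^sub>L 'h)"
  shows "A \<in> C_ball \<rho> \<longleftrightarrow> A \<in> BH \<and> (\<exists>t>0. t < 1 \<and> (\<lambda>i. (1 / t) *\<^sub>R A i) \<in> C_class \<rho>)"
  unfolding C_ball_def omega_def by (auto simp: Inf_less_iff)

text \<open>The kernel of \<open>0\<close> is \<open>\<rho>\<close> times the identity, so this says that the open ball is the Harnack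
  part of \<open>0\<close>.\<close>

lemma C_ball_iff_kernel:
  fixes A :: "'n::finite \<Rightarrow> ('h::complex_hilbert_space \<Rightarrow>\<^sub>L 'h)"
  assumes inf: "infinite_dimensional TYPE('h)" and \<rho>: "0 < \<rho>"
  shows "A \<in> C_ball \<rho> \<longleftrightarrow> A \<in> BH \<and> (\<exists>\<epsilon>>0. \<exists>C. \<forall>N x. supported N x \<longrightarrow>
    \<epsilon> * sqnorm N x \<le> kernel_form \<rho> A N x \<and> kernel_form \<rho> A N x \<le> C * sqnorm N x)"
proof
  assume "A \<in> C_ball \<rho>"
  then obtain t where A: "A \<in> BH" and t: "0 < t" "t < 1" and Y: "(\<lambda>i. (1 / t) *\<^sub>R A i) \<in> C_class \<rho>"
    by (auto simp: C_ball_iff_C_class)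
  let ?Y = "\<lambda>i. (1 / t) *\<^sub>R A i"
  have YA: "(\<lambda>i. t *\<^sub>R ?Y i) = A" using t by simp
  \<comment> \<open>Harnack's inequality on the ray through \<open>A / t\<close>, which has a
    positive kernel, between the points 0 and \<open>t\<close>.\<close>
  have "(1 - t) / (1 + t) * \<rho> * sqnorm N x \<le> kernel_form \<rho> A N x \<and>
      kernel_form \<rho> A N x \<le> (1 + t) / (1 - t) * \<rho> * sqnorm N x" if x: "supported N x" for N x
  proof -
    have pos: "0 \<le> 0 * sqnorm N v + 1 * kernel_form \<rho> ?Y N v" if "supported N v" for v
      using C_class_kernel_nonneg[OF Y \<rho> that] by simp
    note h = kernel_form_harnack(2,3)[OF C_class_BH[OF Y] x less_imp_le[OF t(1)] t(2) pos, unfolded YA]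
    show ?thesis
      using h t by (simp add: field_simps)
  qed
  moreover have "0 < (1 - t) / (1 + t) * \<rho>" using t \<rho> by simp
  ultimately show "A \<in> BH \<and> (\<exists>\<epsilon>>0. \<exists>C. \<forall>N x. supported N x \<longrightarrow>
    \<epsilon> * sqnorm N x \<le> kernel_form \<rho> A N x \<and> kernel_form \<rho> A N x \<le> C * sqnorm N x)"
    using A by blast
next
  assume "A \<in> BH \<and> (\<exists>\<epsilon>>0. \<exists>C. \<forall>N x. supported N x \<longrightarrow>
    \<epsilon> * sqnorm N x \<le> kernel_form \<rho> A N x \<and> kernel_form \<rho> A N x \<le> C * sqnorm N x)"
  then obtain \<epsilon> C where A: "A \<in> BH" and \<epsilon>: "0 < \<epsilon>"
    and lower: "\<And>N x. supported N x \<Longrightarrow> \<epsilon> * sqnorm N x \<le> kernel_form \<rho> A N x"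
    and upper: "\<And>N x. supported N x \<Longrightarrow> kernel_form \<rho> A N x \<le> C * sqnorm N x"
    by blast
  obtain K where K: "0 < K" "\<And>N x. supported N x \<Longrightarrow> sqnorm N (resolvent A N x) \<le> K * sqnorm N x"
    using resolvent_bounded[OF A upper] by blast
  obtain \<tau> where \<tau>0: "0 < \<tau>" and \<tau>1: "4 * K * \<tau>\<^sup>2 \<le> 1" and \<tau>2: "(4 * K\<^sup>2 + 1) * \<tau> \<le> \<epsilon>"
    using perturbation_radius[OF K(1) \<epsilon>] by blast
  \<comment> \<open>A dilation factor above 1 that moves \<open>A\<close> by at most \<tau> in row
    norm. If \<open>s A\<close> still has a positive kernel, then \<open>A\<close> is strictly
    inside. The summand 1 in the denominator covers \<open>A = 0\<close>.\<close>
  define s where "s = 1 + \<tau> / (row_norm A + 1)"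
  have rn: "0 < row_norm A + 1" by (simp add: add_nonneg_pos)
  have s: "1 < s" using \<tau>0 rn by (simp add: s_def)
  let ?B = "\<lambda>i. s *\<^sub>R A i"
  have B: "?B \<in> BH" by (rule BH_scaleR[OF A])
  have "row_dist ?B A \<le> \<tau>"
    unfolding row_dist_def
  proof (rule row_norm_leI[OF BH_diff[OF B A]])
    fix h
    have e: "s *\<^sub>R A i - A i = (s - 1) *\<^sub>R A i" for i by (simp add: algebra_simps)
    have "(\<Sum>i\<in>UNIV. (norm (adj (s *\<^sub>R A i - A i) h))\<^sup>2) = (s - 1)\<^sup>2 * (\<Sum>i\<in>UNIV. (norm (adj (A i) h))\<^sup>2)"
      unfolding e by (simp add: adj_scaleR BH_D[OF A] blinfun.scaleR_left power_mult_distrib sum_distrib_left)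
    also have "\<dots> \<le> (s - 1)\<^sup>2 * ((row_norm A)\<^sup>2 * (norm h)\<^sup>2)"
      using row_adj_le[where I = UNIV and h = h and X = A, OF BH_D[OF A]] by (intro mult_left_mono) (auto simp: row_norm_square)
    also have "\<dots> = ((s - 1) * row_norm A)\<^sup>2 * (norm h)\<^sup>2" by (simp add: power_mult_distrib)
    also have "\<dots> \<le> \<tau>\<^sup>2 * (norm h)\<^sup>2"
    proof (intro mult_right_mono power_mono)
      have "\<tau> * row_norm A \<le> \<tau> * (row_norm A + 1)" using \<tau>0 by simp
      then show "(s - 1) * row_norm A \<le> \<tau>" using rn by (simp add: s_def pos_divide_le_eq)
    qed (use s in auto)
    finally show "(\<Sum>i\<in>UNIV. (norm (adj (s *\<^sub>R A i - A i) h))\<^sup>2) \<le> \<tau>\<^sup>2 * (norm h)\<^sup>2" .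
  qed (use \<tau>0 in simp)
  then have pert: "\<bar>kernel_form \<rho> ?B N x - kernel_form \<rho> A N x\<bar> \<le> (4 * K\<^sup>2 + 1) * \<tau> * sqnorm N x"
    if "supported N x" for N x
    using kernel_form_perturb[OF A B K \<tau>0 _ \<tau>1 that] by simp
  have "0 \<le> kernel_form \<rho> ?B N x" if "supported N x" for N x
    using pert[OF that] lower[OF that] mult_right_mono[OF \<tau>2 sqnorm_nonneg[of N x]] by linarith
  then have "?B \<in> C_class \<rho>" by (rule kernel_nonneg_C_class[OF inf B \<rho>])
  then have "0 < 1 / s \<and> 1 / s < 1 \<and> (\<lambda>i. (1 / (1 / s)) *\<^sub>R A i) \<in> C_class \<rho>" using s by simp
  then show "A \<in> C_ball \<rho>" using A unfolding C_ball_iff_C_class by blast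
qed

section \<open>Joint spectral radius and recovery of the tuple from its kernel\<close>

text \<open>Fekete's lemma: the limit is the infimum of the roots. Convergence gives meaning to the
  \<open>lim\<close> in the spectral radius, and the geometric growth bound is how the radius is
  used.\<close>

lemma fekete_submultiplicative:
  fixes n :: "nat \<Rightarrow> real"
  assumes nonneg: "\<And>k. 0 \<le> n k" and sub: "\<And>k l. n (k + l) \<le> n k * n l"
  shows "\<exists>L. (\<lambda>k. root k (n k)) \<longlonglongrightarrow> L \<and> (\<forall>s>L. \<exists>M>0. \<forall>k. n k \<le> M * s ^ k)"
proof -
  define L where "L = Inf ((\<lambda>k. root k (n k)) ` {1..})"
  have bdd: "bdd_below ((\<lambda>k. root k (n k)) ` {1..})"
    by (rule bdd_belowI[of _ 0]) (auto simp: nonneg)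
  have L_le: "L \<le> root k (n k)" if "1 \<le> k" for k
    unfolding L_def by (rule cInf_lower[OF _ bdd]) (use that in auto)
  have L0: "0 \<le> L"
    unfolding L_def by (rule cInf_greatest) (auto simp: nonneg)
  have growth: "\<exists>M>0. \<forall>k. n k \<le> M * s ^ k" if s: "L < s" for s
  proof -
    have s0: "0 < s" using L0 s by simp
    obtain m where m: "1 \<le> m" "root m (n m) < s"
      using cInf_lessD[OF _ s[unfolded L_def]] by auto
    have nm: "n m \<le> s ^ m"
    proof -
      have "root m (n m) ^ m \<le> s ^ m" using m nonneg by (intro power_mono) auto
      then show ?thesis using m nonneg by simp
    qed
    have powers: "n (q * m + r) \<le> s ^ (q * m) * n r" for q r
    proof (induction q)
      case (Suc q)
      have "n (Suc q * m + r) \<le> n m * n (q * m + r)"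
        using sub[of m "q * m + r"] by (simp add: add.assoc)
      also have "\<dots> \<le> s ^ m * (s ^ (q * m) * n r)"
        using nm Suc s0 nonneg by (intro mult_mono) auto
      finally show ?case by (simp add: power_add mult.assoc)
    qed simp
    \<comment> \<open>\<open>M\<close> dominates the finitely many remainders modulo
      \<open>m\<close>; full blocks of length \<open>m\<close> contribute only powers of
      \<open>s\<close>.\<close>
    define M where "M = 1 + (\<Sum>r<m. n r / s ^ r)"
    have M: "n r \<le> M * s ^ r" if "r < m" for r
    proof -
      have "n r / s ^ r \<le> (\<Sum>r<m. n r / s ^ r)"
        by (rule member_le_sum) (use that nonneg s0 in auto)
      then have "n r / s ^ r \<le> M" by (simp add: M_def)
      then show ?thesis using s0 by (simp add: divide_le_eq)
    qed
    have "0 < M" unfolding M_def using nonneg s0 by (intro add_pos_nonneg sum_nonneg) auto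
    moreover have "n k \<le> M * s ^ k" for k
    proof -
      have "n k \<le> s ^ (k div m * m) * n (k mod m)"
        using powers[of "k div m" "k mod m"] by simp
      also have "\<dots> \<le> s ^ (k div m * m) * (M * s ^ (k mod m))"
        using M[of "k mod m"] m s0 by (intro mult_left_mono) auto
      also have "\<dots> = M * s ^ (k div m * m + k mod m)" by (simp only: power_add mult_ac)
      finally show ?thesis by (simp only: div_mult_mod_eq)
    qed
    ultimately show ?thesis by blast
  qed
  have "(\<lambda>k. root k (n k)) \<longlonglongrightarrow> L"
  proof (rule LIMSEQ_I)
    fix e :: real assume e: "0 < e"
    define s where "s = L + e / 2"
    have s: "L < s" "0 < s" using e L0 by (auto simp: s_def)
    obtain M where M: "0 < M" "\<And>k. n k \<le> M * s ^ k" using growth[OF s(1)] by blast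
    have "(\<lambda>k. root k M * s) \<longlonglongrightarrow> 1 * s"
      by (intro tendsto_intros LIMSEQ_root_const M)
    then have "\<forall>\<^sub>F k in sequentially. root k M * s < L + e"
      by (rule order_tendstoD) (use e in \<open>simp add: s_def\<close>)
    then obtain N where N: "\<And>k. k \<ge> N \<Longrightarrow> root k M * s < L + e"
      by (auto simp: eventually_sequentially)
    have "norm (root k (n k) - L) < e" if k: "k \<ge> max 1 N" for k
    proof -
      have "root k (n k) \<le> root k (M * s ^ k)" using k M by simp
      also have "\<dots> = root k M * s"
        using k s by (simp add: real_root_mult real_root_power_cancel)
      also have "\<dots> < L + e" using N k by simp
      finally show ?thesis using L_le[of k] k by simp
    qed
    then show "\<exists>N. \<forall>k\<ge>N. norm (root k (n k) - L) < e" by blast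
  qed
  then show ?thesis using growth by blast
qed

lemma finite_words_of_length: "finite {\<alpha> :: 'n::finite list. length \<alpha> = k}"
  using finite_lists_length_eq[of "UNIV :: 'n set" k] by simp

text \<open>Words of length \<open>k + l\<close> split uniquely into pieces of length
  \<open>k\<close> and \<open>l\<close>, and the adjoint of a product reverses them, so the column
  bounds for the two lengths multiply.\<close>

lemma word_row_submultiplicative:
  fixes A :: "'n::finite \<Rightarrow> ('h::complex_hilbert_space \<Rightarrow>\<^sub>L 'h)"
  assumes A: "A \<in> BH"
  defines "n \<equiv> \<lambda>k. norm (\<Sum>\<alpha> | length \<alpha> = k. word_op A \<alpha> o\<^sub>L adj (word_op A \<alpha>))"
  shows "n (k + l) \<le> n k * n l"
proof -
  let ?W = "\<lambda>k. {\<alpha> :: 'n list. length \<alpha> = k}"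
  have lin: "complex_linear (word_op A \<alpha>)" for \<alpha> by (rule complex_linear_word_op[OF A])
  have n0: "0 \<le> n k" for k by (simp add: n_def)
  have adj_le: "(\<Sum>\<alpha>\<in>?W k. (norm (adj (word_op A \<alpha>) h))\<^sup>2) \<le> n k * (norm h)\<^sup>2" for k h
    unfolding n_def by (rule row_adj_le) (rule lin)
  have "norm (\<Sum>\<alpha>\<in>?W (k + l). word_op A \<alpha> o\<^sub>L adj (word_op A \<alpha>)) \<le> (sqrt (n k * n l))\<^sup>2"
  proof (rule row_norm_le)
    show "0 \<le> sqrt (n k * n l)" using n0 by simp
    fix h
    have "bij_betw (\<lambda>(\<alpha>, \<beta>). \<alpha> @ \<beta>) (?W k \<times> ?W l) (?W (k + l))"
      unfolding bij_betw_def
    proof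
      show "inj_on (\<lambda>(\<alpha>, \<beta>). \<alpha> @ \<beta>) (?W k \<times> ?W l)" by (auto simp: inj_on_def)
      have "\<gamma> \<in> (\<lambda>(\<alpha>, \<beta>). \<alpha> @ \<beta>) ` (?W k \<times> ?W l)" if "length \<gamma> = k + l" for \<gamma> :: "'n list"
        by (rule image_eqI[of _ _ "(take k \<gamma>, drop k \<gamma>)"]) (use that in auto)
      then show "(\<lambda>(\<alpha>, \<beta>). \<alpha> @ \<beta>) ` (?W k \<times> ?W l) = ?W (k + l)" by auto
    qed
    from sum.reindex_bij_betw[OF this, of "\<lambda>\<gamma>. (norm (adj (word_op A \<gamma>) h))\<^sup>2"]
    have "(\<Sum>\<gamma>\<in>?W (k + l). (norm (adj (word_op A \<gamma>) h))\<^sup>2)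
      = (\<Sum>\<alpha>\<in>?W k. \<Sum>\<beta>\<in>?W l. (norm (adj (word_op A (\<alpha> @ \<beta>)) h))\<^sup>2)"
      by (simp add: sum.cartesian_product case_prod_unfold)
    also have "\<dots> = (\<Sum>\<alpha>\<in>?W k. \<Sum>\<beta>\<in>?W l. (norm (adj (word_op A \<beta>) (adj (word_op A \<alpha>) h)))\<^sup>2)"
      by (simp add: word_op_append adj_compose lin)
    also have "\<dots> \<le> (\<Sum>\<alpha>\<in>?W k. n l * (norm (adj (word_op A \<alpha>) h))\<^sup>2)"
      by (intro sum_mono adj_le)
    also have "\<dots> \<le> n l * (n k * (norm h)\<^sup>2)"
      unfolding sum_distrib_left[symmetric] by (intro mult_left_mono adj_le n0)
    finally show "(\<Sum>\<gamma>\<in>?W (k + l). (norm (adj (word_op A \<gamma>) h))\<^sup>2) \<le> (sqrt (n k * n l))\<^sup>2 * (norm h)\<^sup>2"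
      using n0 by (simp add: mult_ac)
  qed (rule lin)
  then have "n (k + l) \<le> (sqrt (n k * n l))\<^sup>2" by (simp only: n_def)
  then show ?thesis using n0 by simp
qed

text \<open>Grouping the resolvent by word length gives pieces whose norm is at most
  \<open>M q^k\<close> times that of \<open>x\<close>. The geometric series bounds their sum
  independently of \<open>N\<close>.\<close>

lemma C_infinity_kernel_bounded:
  fixes A :: "'n::finite \<Rightarrow> ('h::complex_hilbert_space \<Rightarrow>\<^sub>L 'h)"
  assumes "A \<in> C_infinity"
  obtains C where "\<And>N x. supported N x \<Longrightarrow> kernel_form \<rho> A N x \<le> C * sqnorm N x"
proof -
  have A: "A \<in> BH" and r: "joint_spectral_radius A < 1" using assms by (auto simp: C_infinity_def)
  let ?W = "\<lambda>k. {\<alpha> :: 'n list. length \<alpha> = k}"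
  have lin: "complex_linear (word_op A \<alpha>)" for \<alpha> by (rule complex_linear_word_op[OF A])
  define n where "n = (\<lambda>k. norm (\<Sum>\<alpha> | length \<alpha> = k. word_op A \<alpha> o\<^sub>L adj (word_op A \<alpha>)))"
  obtain L where L: "(\<lambda>k. root k (n k)) \<longlonglongrightarrow> L" "\<And>s. L < s \<Longrightarrow> \<exists>M>0. \<forall>k. n k \<le> M * s ^ k"
    using fekete_submultiplicative[of n] word_row_submultiplicative[OF A]
    by (auto simp: n_def)
  have "(\<lambda>k. root 2 (root k (n k))) \<longlonglongrightarrow> root 2 L" by (intro tendsto_intros L)
  then have "joint_spectral_radius A = root 2 L"
    unfolding joint_spectral_radius_def real_root_mult_exp n_def by (rule limI)
  then have "L < 1" using r by (simp add: sqrt_def[symmetric])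
  moreover have "0 \<le> L"
    by (rule LIMSEQ_le_const[OF L(1)], intro exI[of _ 0] allI impI real_root_ge_zero) (simp add: n_def)
  \<comment> \<open>\<open>n k\<close> bounds squared norms of rows, so the ratio for the norms
    themselves is the square root of a number above \<open>L\<close>.\<close>
  ultimately obtain q where q: "0 < q" "q < 1" "L < q\<^sup>2"
  proof -
    have "sqrt L < 1" using \<open>L < 1\<close> by simp
    then obtain q where "sqrt L < q" "q < 1" using dense by blast
    moreover have L: "0 \<le> sqrt L" using \<open>0 \<le> L\<close> by simp
    moreover have "L = (sqrt L)\<^sup>2" using \<open>0 \<le> L\<close> by simp
    ultimately have "0 < q" "q < 1" "L < q\<^sup>2"
      using power_strict_mono[of "sqrt L" q 2] order_le_less_trans[OF L] by (simp_all only: zero_less_numeral)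
    then show ?thesis using that by blast
  qed
  obtain M0 where M0: "0 < M0" "\<And>k. n k \<le> M0 * (q\<^sup>2) ^ k" using L(2)[OF q(3)] by blast
  define M where "M = sqrt M0"
  have M: "0 < M" "n k \<le> (M * q ^ k)\<^sup>2" for k
    using M0 by (auto simp: M_def power_mult_distrib power_mult[symmetric] mult.commute)
  have "kernel_form \<rho> A N x \<le> (\<bar>\<rho> - 2\<bar> + 2 * M * (1 / (1 - q))) * sqnorm N x" if x: "supported N x" for N x
  proof -
    define u where "u = (\<lambda>k \<alpha>. \<Sum>\<gamma>\<in>?W k. word_op A \<gamma> (x (\<alpha> @ \<gamma>)))"
    have u: "sqnorm N (u k) \<le> (M * q ^ k)\<^sup>2 * sqnorm N x" for k
    proof -
      have "sqnorm N (u k) \<le> (\<Sum>\<alpha>\<in>words N. (M * q ^ k)\<^sup>2 * (\<Sum>\<gamma>\<in>?W k. (norm (x (\<alpha> @ \<gamma>)))\<^sup>2))"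
        unfolding sqnorm_def u_def
        by (intro sum_mono row_apply_le lin) (use M(1) M(2)[of k, unfolded n_def] q in auto)
      also have "\<dots> \<le> (M * q ^ k)\<^sup>2 * sqnorm N x"
        unfolding sqnorm_def sum_distrib_left[symmetric]
        by (intro mult_left_mono sum_append_le[where k = k] finite_words_of_length)
          (use x in \<open>auto simp: supported_def\<close>)
      finally show ?thesis .
    qed
    have res: "resolvent A N x \<alpha> = (\<Sum>k\<le>N. u k \<alpha>)" for \<alpha>
    proof -
      have "(\<Sum>k\<le>N. u k \<alpha>) = (\<Sum>k\<le>N. \<Sum>\<gamma>\<in>{\<gamma> \<in> words N. length \<gamma> = k}. word_op A \<gamma> (x (\<alpha> @ \<gamma>)))"
        unfolding u_def by (intro sum.cong) (auto simp: words_iff)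
      also have "\<dots> = resolvent A N x \<alpha>"
        unfolding resolvent_def by (rule sum.group) (auto simp: words_iff)
      finally show ?thesis by simp
    qed
    have summand: "2 * Re (\<Sum>\<alpha>\<in>words N. cinner (u k \<alpha>) (x \<alpha>)) \<le> 2 * M * q ^ k * sqnorm N x" for k
    proof -
      \<comment> \<open>The norm bound of \<open>u k\<close>, used as weight so that both terms of
        the arithmetic-geometric inequality become \<open>b * sqnorm N x\<close>.\<close>
      define b where "b = M * q ^ k"
      have b: "0 < b" using M q by (simp add: b_def)
      have "2 * Re (\<Sum>\<alpha>\<in>words N. cinner (u k \<alpha>) (x \<alpha>)) \<le> 1 / b * sqnorm N (u k) + 1 / (1 / b) * sqnorm N x"
        using two_sum_cinner_le[where s = "1 / b" and N = N and u = "u k" and v = x] b by simp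
      also have "1 / b * sqnorm N (u k) \<le> 1 / b * (b\<^sup>2 * sqnorm N x)"
        using u[of k] b by (intro mult_left_mono) (auto simp: b_def)
      also have "1 / b * (b\<^sup>2 * sqnorm N x) + 1 / (1 / b) * sqnorm N x = 2 * b * sqnorm N x"
        using b by (simp add: power2_eq_square)
      finally show ?thesis by (simp only: b_def mult.assoc)
    qed
    have "2 * Re (\<Sum>\<alpha>\<in>words N. cinner (resolvent A N x \<alpha>) (x \<alpha>))
        = (\<Sum>k\<le>N. 2 * Re (\<Sum>\<alpha>\<in>words N. cinner (u k \<alpha>) (x \<alpha>)))"
      unfolding res cinner_sum_left by (subst sum.swap) (simp add: sum_distrib_left)
    also have "\<dots> \<le> (\<Sum>k\<le>N. 2 * M * q ^ k * sqnorm N x)" by (intro sum_mono summand)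
    also have "\<dots> = 2 * M * (\<Sum>k\<le>N. q ^ k) * sqnorm N x"
      by (simp add: sum_distrib_left sum_distrib_right)
    also have "\<dots> \<le> 2 * M * (1 / (1 - q)) * sqnorm N x"
    proof (intro mult_right_mono mult_left_mono)
      have "(\<Sum>k\<le>N. q ^ k) \<le> (\<Sum>k. q ^ k)"
        using q by (intro sum_le_suminf summable_geometric) auto
      then show "(\<Sum>k\<le>N. q ^ k) \<le> 1 / (1 - q)" using q by (simp add: suminf_geometric)
    qed (use M in auto)
    finally have "2 * Re (\<Sum>\<alpha>\<in>words N. cinner (resolvent A N x \<alpha>) (x \<alpha>)) \<le> 2 * M * (1 / (1 - q)) * sqnorm N x" .
    moreover have "(\<rho> - 2) * sqnorm N x \<le> \<bar>\<rho> - 2\<bar> * sqnorm N x" by (intro mult_right_mono) auto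
    ultimately show ?thesis unfolding kernel_form_eq distrib_right by linarith
  qed
  then show ?thesis using that by blast
qed

section \<open>Recovery of a tuple from words of length at most one\<close>

definition pair_family :: "'n \<Rightarrow> 'h::zero \<Rightarrow> 'h \<Rightarrow> 'n list \<Rightarrow> 'h" where
  "pair_family i g h \<alpha> = (if \<alpha> = [] then h else if \<alpha> = [i] then g else 0)"

lemma supported_pair_family: "supported (Suc 0) (pair_family i g h)"
  by (auto simp: supported_def pair_family_def)

lemma sum_words_1:
  fixes f :: "'n::finite list \<Rightarrow> 'b::comm_monoid_add"
  shows "(\<Sum>\<alpha>\<in>words (Suc 0). f \<alpha>) = f [] + (\<Sum>i\<in>UNIV. f [i])"
proof -
  have 0: "words 0 = {[] :: 'n list}" by (auto simp: words_iff)
  have "words (Suc 0) = insert [] (range (\<lambda>i :: 'n. [i]))"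
    using words_Suc[of 0, where 'a = 'n] unfolding 0 by auto
  then show ?thesis by (simp add: sum.reindex inj_on_def image_iff)
qed

lemma sqnorm_pair_family: "sqnorm (Suc 0) (pair_family i g h) = (norm h)\<^sup>2 + (norm (g :: 'h::real_normed_vector))\<^sup>2"
  for i :: "'n::finite"
proof -
  have "(\<Sum>j\<in>UNIV. (norm (pair_family i g h [j]))\<^sup>2) = (\<Sum>j\<in>UNIV. if j = i then (norm g)\<^sup>2 else 0)"
    by (intro sum.cong) (auto simp: pair_family_def)
  then show ?thesis by (simp add: sqnorm_def sum_words_1) (simp add: pair_family_def)
qed

text \<open>The section at the words \<open>[]\<close> and \<open>[i]\<close> is a two by two block
  with diagonal \<rho> and off-diagonal entry \<open>A i\<close>, so the form exposes
  \<open>A i\<close> as a pairing.\<close>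

lemma kernel_form_pair_family:
  fixes A :: "'n::finite \<Rightarrow> ('h::complex_hilbert_space \<Rightarrow>\<^sub>L 'h)"
  shows "kernel_form \<rho> A (Suc 0) (pair_family i g h) =
    \<rho> * ((norm h)\<^sup>2 + (norm g)\<^sup>2) + 2 * Re (cinner (A i g) h)"
proof -
  let ?x = "pair_family i g h"
  have 2: "resolvent A (Suc 0) ?x (\<alpha>) = 0" if "Suc 0 < length \<alpha>" for \<alpha>
    using supported_resolvent[OF supported_pair_family, of A i g h] that by (simp add: supported_def)
  have 1: "resolvent A (Suc 0) ?x [j] = ?x [j]" for j
    using resolvent_rec[OF supported_pair_family, of A i g h "[j]"]
    by (simp add: backshift_def 2 blinfun.zero_right)
  have s: "(\<Sum>j\<in>UNIV. f (?x [j]) j) = f g i + (\<Sum>j\<in>UNIV - {i}. f 0 j)" for f :: "'h \<Rightarrow> 'n \<Rightarrow> 'b::comm_monoid_add"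
  proof -
    have "(\<Sum>j\<in>UNIV. f (?x [j]) j) = f (?x [i]) i + (\<Sum>j\<in>UNIV - {i}. f (?x [j]) j)"
      by (rule sum.remove) auto
    also have "(\<Sum>j\<in>UNIV - {i}. f (?x [j]) j) = (\<Sum>j\<in>UNIV - {i}. f 0 j)"
      by (intro sum.cong) (auto simp: pair_family_def)
    finally show ?thesis by (simp add: pair_family_def)
  qed
  have 0: "resolvent A (Suc 0) ?x [] = h + A i g"
    using resolvent_rec[OF supported_pair_family, of A i g h "[]"] s[of "\<lambda>v j. A j v"]
    by (simp add: backshift_def 1) (simp add: pair_family_def blinfun.zero_right)
  have "(\<Sum>\<alpha>\<in>words (Suc 0). cinner (resolvent A (Suc 0) ?x \<alpha>) (?x \<alpha>)) = cinner (h + A i g) h + cinner g g"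
    unfolding sum_words_1 0 1 using s[of "\<lambda>v j. cinner v v"] by (simp add: pair_family_def)
  then show ?thesis
    unfolding kernel_form_eq sqnorm_pair_family
    by (simp add: cinner_add_left cinner_self algebra_simps)
qed

lemma norm_le_of_pairing:
  fixes D :: "'h::complex_hilbert_space \<Rightarrow>\<^sub>L 'h"
  assumes le: "\<And>g h. (norm h)\<^sup>2 + (norm g)\<^sup>2 \<le> 1 \<Longrightarrow> 2 * Re (cinner (D g) h) \<le> \<eta>"
  shows "norm D \<le> 2 * \<eta>"
proof (rule norm_blinfun_bound)
  show \<eta>: "0 \<le> 2 * \<eta>" using le[of 0 0] by simp
  fix g
  show "norm (D g) \<le> 2 * \<eta> * norm g"
  proof (cases "D g = 0")
    case False
    then have g: "norm g \<noteq> 0" by (auto simp: blinfun.zero_right)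
    \<comment> \<open>Both vectors get norm 1/2, so the sum of their squares stays below 1;
      \<open>h\<close> points along \<open>D g\<close>, which makes the pairing a norm.\<close>
    define g' where "g' = (1 / (2 * norm g)) *\<^sub>R g"
    define h where "h = (1 / (2 * norm (D g))) *\<^sub>R D g"
    have n: "norm g' = 1 / 2" "norm h = 1 / 2" using False g by (auto simp: g'_def h_def)
    have "2 * Re (cinner (D g') h) \<le> \<eta>" by (rule le) (simp add: n power2_eq_square)
    moreover have "2 * Re (cinner (D g') h) = norm (D g) / (2 * norm g)"
      using False g
      by (simp add: g'_def h_def blinfun.scaleR_right cinner_scaleR_left cinner_scaleR_right
          cinner_self power2_eq_square)
    ultimately show ?thesis using g by (simp add: field_simps)
  qed (use \<eta> in simp)
qed

text \<open>The diagonal terms cancel between \<open>A\<close> and \<open>B\<close>. A one-sided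
  bound suffices because the sign of \<open>h\<close> is free.\<close>

lemma norm_diff_le_of_kernel_form:
  fixes A B :: "'n::finite \<Rightarrow> ('h::complex_hilbert_space \<Rightarrow>\<^sub>L 'h)"
  assumes "\<And>x. supported (Suc 0) x \<Longrightarrow> sqnorm (Suc 0) x \<le> 1 \<Longrightarrow> kernel_form \<rho> A (Suc 0) x - kernel_form \<rho> B (Suc 0) x \<le> \<eta>"
  shows "norm (A i - B i) \<le> 2 * \<eta>"
proof (rule norm_le_of_pairing)
  fix g h :: 'h assume "(norm h)\<^sup>2 + (norm g)\<^sup>2 \<le> 1"
  then have "kernel_form \<rho> A (Suc 0) (pair_family i g h) - kernel_form \<rho> B (Suc 0) (pair_family i g h) \<le> \<eta>"
    by (intro assms supported_pair_family) (simp add: sqnorm_pair_family)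
  then show "2 * Re (cinner ((A i - B i) g) h) \<le> \<eta>"
    by (simp add: kernel_form_pair_family blinfun.diff_left cinner_diff_left)
qed

lemma kernel_form_eq_imp_eq:
  fixes A B :: "'n::finite \<Rightarrow> ('h::complex_hilbert_space \<Rightarrow>\<^sub>L 'h)"
  assumes "\<And>x. supported (Suc 0) x \<Longrightarrow> kernel_form \<rho> A (Suc 0) x = kernel_form \<rho> B (Suc 0) x"
  shows "A = B"
proof
  fix i
  have "norm (A i - B i) \<le> 2 * 0"
    by (rule norm_diff_le_of_kernel_form[of \<rho>]) (simp add: assms)
  then show "A i = B i" by simp
qed

text \<open>On words of length at most one the backward shift applied twice to \<open>x\<close> is
  0, so the resolvent is \<open>x + T x\<close> and the row norm bounds it. Completeness of an
  arbitrary part rests on this bound.\<close>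

lemma kernel_form_bound_1:
  fixes A :: "'n::finite \<Rightarrow> ('h::complex_hilbert_space \<Rightarrow>\<^sub>L 'h)"
  assumes "A \<in> BH"
  obtains C where "0 \<le> C" "\<And>x. supported (Suc 0) x \<Longrightarrow> kernel_form \<rho> A (Suc 0) x \<le> C * sqnorm (Suc 0) x"
proof -
  let ?a = "row_norm A"
  have "kernel_form \<rho> A (Suc 0) x \<le> (\<bar>\<rho> - 2\<bar> + (4 * (1 + ?a\<^sup>2) + 1)) * sqnorm (Suc 0) x" if x: "supported (Suc 0) x" for x
  proof -
    let ?y = "resolvent A (Suc 0) x"
    have y: "sqnorm (Suc 0) ?y \<le> 4 * (1 + ?a\<^sup>2) * sqnorm (Suc 0) x"
    proof -
      have e: "backshift A ?y \<alpha> = backshift A x \<alpha>" for \<alpha>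
      proof (cases \<alpha>)
        case Nil
        have "?y [j] = x [j]" for j
        proof -
          have "?y [j, i] = 0" for i using supported_resolvent[OF x, of A] by (simp add: supported_def)
          then show ?thesis using resolvent_rec[OF x, of A "[j]"] by (simp add: backshift_def blinfun.zero_right)
        qed
        then show ?thesis by (simp add: Nil backshift_def)
      next
        case (Cons j \<beta>)
        have "?y (\<alpha> @ [i]) = 0" "x (\<alpha> @ [i]) = 0" for i
          using supported_resolvent[OF x, of A] x Cons by (simp_all add: supported_def)
        then show ?thesis by (simp add: backshift_def)
      qed
      have "?y = (\<lambda>\<alpha>. x \<alpha> + backshift A x \<alpha>)"
        using resolvent_rec[OF x, of A] e by auto
      then have "sqnorm (Suc 0) ?y \<le> 2 * sqnorm (Suc 0) x + 2 * sqnorm (Suc 0) (backshift A x)"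
        using sqnorm_add_le[of "Suc 0" x "backshift A x"] by simp
      also have "\<dots> \<le> 2 * sqnorm (Suc 0) x + 2 * (?a\<^sup>2 * sqnorm (Suc 0) x)"
        using sqnorm_backshift_le[OF assms x] by simp
      also have "\<dots> = 2 * (1 + ?a\<^sup>2) * sqnorm (Suc 0) x" by (simp add: algebra_simps)
      also have "\<dots> \<le> 4 * (1 + ?a\<^sup>2) * sqnorm (Suc 0) x" by (intro mult_right_mono) auto
      finally show ?thesis .
    qed
    have "2 * Re (\<Sum>\<alpha>\<in>words (Suc 0). cinner (?y \<alpha>) (x \<alpha>)) \<le> 1 * sqnorm (Suc 0) ?y + 1 / 1 * sqnorm (Suc 0) x"
      using two_sum_cinner_le[where s = 1 and N = "Suc 0" and u = ?y and v = x] by simp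
    moreover have "(\<rho> - 2) * sqnorm (Suc 0) x \<le> \<bar>\<rho> - 2\<bar> * sqnorm (Suc 0) x" by (intro mult_right_mono) auto
    ultimately show ?thesis using y unfolding kernel_form_eq distrib_right by linarith
  qed
  moreover have "0 \<le> \<bar>\<rho> - 2\<bar> + (4 * (1 + ?a\<^sup>2) + 1)"
    by (simp add: add_nonneg_nonneg)
  ultimately show ?thesis using that by blast
qed

lemma kernel_form_tendsto:
  fixes A :: "nat \<Rightarrow> 'n::finite \<Rightarrow> ('h::complex_hilbert_space \<Rightarrow>\<^sub>L 'h)"
  assumes "\<And>i. (\<lambda>k. A k i) \<longlonglongrightarrow> B i"
  shows "(\<lambda>k. kernel_form \<rho> (A k) N x) \<longlonglongrightarrow> kernel_form \<rho> B N x"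
proof -
  have w: "(\<lambda>k. word_op (A k) \<gamma>) \<longlonglongrightarrow> word_op B \<gamma>" for \<gamma>
    by (induction \<gamma>)
      (auto intro!: bounded_bilinear.tendsto[OF bounded_bilinear_blinfun_compose] assms)
  have s: "(\<lambda>k. symbol \<rho> (A k) \<gamma>) \<longlonglongrightarrow> symbol \<rho> B \<gamma>" for \<gamma>
    by (auto simp: symbol_def w)
  have c: "(\<lambda>k. symbol \<rho> (A k) \<gamma> v) \<longlonglongrightarrow> symbol \<rho> B \<gamma> v" for \<gamma> v
    by (intro blinfun.tendsto s tendsto_const)
  show ?thesis
    unfolding toeplitz_form_def by (intro tendsto_intros tendsto_cinner c)
qed

section \<open>The hyperbolic metric\<close>

lemma complete_onI:
  assumes m: "metric_on M d"
    and lim: "\<And>\<sigma> :: nat \<Rightarrow> 'a. (\<And>n. \<sigma> n \<in> M) \<Longrightarrow>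
      (\<And>e. 0 < e \<Longrightarrow> \<exists>N. \<forall>m\<ge>N. \<forall>n\<ge>N. d (\<sigma> m) (\<sigma> n) < e) \<Longrightarrow>
      \<exists>x\<in>M. \<forall>e>0. \<exists>N. \<forall>n\<ge>N. d (\<sigma> n) x < e"
  shows "complete_on M d"
proof -
  interpret Metric_space M "dist_on M d" using m by (simp add: metric_on_def)
  show ?thesis
    unfolding complete_on_def mcomplete_def
  proof (intro allI impI)
    fix \<sigma> assume C: "MCauchy \<sigma>"
    then have \<sigma>: "\<sigma> n \<in> M" for n by (auto simp: MCauchy_def)
    have C': "\<exists>N. \<forall>m\<ge>N. \<forall>n\<ge>N. d (\<sigma> m) (\<sigma> n) < e" if "0 < e" for e
    proof -
      have "\<exists>N. \<forall>m n. N \<le> m \<longrightarrow> N \<le> n \<longrightarrow> dist_on M d (\<sigma> m) (\<sigma> n) < e"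
        using C that by (simp add: MCauchy_def)
      then show ?thesis using \<sigma> by (simp add: dist_on_def)
    qed
    from lim[OF \<sigma> C'] obtain x where x: "x \<in> M" "\<forall>e>0. \<exists>N. \<forall>n\<ge>N. d (\<sigma> n) x < e"
      by blast
    then have "limitin mtopology \<sigma> x sequentially"
      unfolding limitin_metric eventually_sequentially using \<sigma> by (auto simp: dist_on_def)
    then show "\<exists>x. limitin mtopology \<sigma> x sequentially" ..
  qed
qed

lemma complete_onD:
  fixes \<sigma> :: "nat \<Rightarrow> 'a"
  assumes m: "metric_on M d" and c: "complete_on M d" and \<sigma>: "\<And>n. \<sigma> n \<in> M"
    and C: "\<And>e. 0 < e \<Longrightarrow> \<exists>N. \<forall>m\<ge>N. \<forall>n\<ge>N. d (\<sigma> m) (\<sigma> n) < e"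
  obtains x where "x \<in> M" "\<And>e. 0 < e \<Longrightarrow> \<exists>N. \<forall>n\<ge>N. d (\<sigma> n) x < e"
proof -
  interpret Metric_space M "dist_on M d" using m by (simp add: metric_on_def)
  have "MCauchy \<sigma>"
    unfolding MCauchy_def using \<sigma> C by (auto simp: dist_on_def)
  then obtain x where x: "limitin mtopology \<sigma> x sequentially"
    using c unfolding complete_on_def mcomplete_def by blast
  then have "x \<in> M" by (simp add: limitin_metric)
  moreover have "\<exists>N. \<forall>n\<ge>N. d (\<sigma> n) x < e" if "0 < e" for e
    using x that \<sigma> unfolding limitin_metric eventually_sequentially by (auto simp: dist_on_def)
  ultimately show ?thesis using that by blast
qed

lemma topology_on_finer:
  assumes m1: "metric_on M d1" and m2: "metric_on M d2"
    and fine: "\<And>x e. x \<in> M \<Longrightarrow> 0 < e \<Longrightarrow> \<exists>r>0. \<forall>y\<in>M. d1 x y < r \<longrightarrow> d2 x y < e"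
    and U: "openin (topology_on M d2) U"
  shows "openin (topology_on M d1) U"
proof -
  interpret m1: Metric_space M "dist_on M d1" using m1 by (simp add: metric_on_def)
  interpret m2: Metric_space M "dist_on M d2" using m2 by (simp add: metric_on_def)
  have UM: "U \<subseteq> M" and balls: "\<And>x. x \<in> U \<Longrightarrow> \<exists>r>0. m2.mball x r \<subseteq> U"
    using U unfolding topology_on_def m2.openin_mtopology by auto
  show ?thesis
    unfolding topology_on_def m1.openin_mtopology
  proof (intro conjI allI impI UM)
    fix x assume x: "x \<in> U"
    then obtain e where e: "0 < e" "m2.mball x e \<subseteq> U" using balls by blast
    have xM: "x \<in> M" using x UM by blast
    obtain r where r: "0 < r" "\<forall>y\<in>M. d1 x y < r \<longrightarrow> d2 x y < e" using fine[OF xM e(1)] by blast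
    have "m1.mball x r \<subseteq> m2.mball x e"
      unfolding m1.mball_def m2.mball_def using r(2) by (auto simp: dist_on_def)
    then show "\<exists>r>0. m1.mball x r \<subseteq> U" using r(1) e(2) by blast
  qed
qed

section \<open>Kernel equivalence and Harnack parts\<close>

definition kernel_dom ::
  "real \<Rightarrow> real \<Rightarrow> ('n::finite \<Rightarrow> ('h::complex_hilbert_space \<Rightarrow>\<^sub>L 'h)) \<Rightarrow> ('n \<Rightarrow> ('h \<Rightarrow>\<^sub>L 'h)) \<Rightarrow> bool" where
  "kernel_dom \<rho> c A B \<longleftrightarrow> (\<forall>N x. supported N x \<longrightarrow> kernel_form \<rho> A N x \<le> c\<^sup>2 * kernel_form \<rho> B N x)"

definition kernel_equiv ::
  "real \<Rightarrow> real \<Rightarrow> ('n::finite \<Rightarrow> ('h::complex_hilbert_space \<Rightarrow>\<^sub>L 'h)) \<Rightarrow> ('n \<Rightarrow> ('h \<Rightarrow>\<^sub>L 'h)) \<Rightarrow> bool" where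
  "kernel_equiv \<rho> c A B \<longleftrightarrow> kernel_dom \<rho> c A B \<and> kernel_dom \<rho> c B A"

lemma kernel_equiv_sym: "kernel_equiv \<rho> c A B \<longleftrightarrow> kernel_equiv \<rho> c B A"
  by (auto simp: kernel_equiv_def)

lemma kernel_dom_trans: "kernel_dom \<rho> c A B \<Longrightarrow> kernel_dom \<rho> d B C \<Longrightarrow> kernel_dom \<rho> (c * d) A C"
  unfolding kernel_dom_def
proof (intro allI impI)
  fix N and x :: "'a list \<Rightarrow> 'b"
  assume AB: "\<forall>N x. supported N x \<longrightarrow> kernel_form \<rho> A N x \<le> c\<^sup>2 * kernel_form \<rho> B N x"
    and BC: "\<forall>N x. supported N x \<longrightarrow> kernel_form \<rho> B N x \<le> d\<^sup>2 * kernel_form \<rho> C N x"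
    and x: "supported N x"
  have "kernel_form \<rho> A N x \<le> c\<^sup>2 * kernel_form \<rho> B N x" using AB x by blast
  also have "\<dots> \<le> c\<^sup>2 * (d\<^sup>2 * kernel_form \<rho> C N x)" using BC x by (intro mult_left_mono) auto
  finally show "kernel_form \<rho> A N x \<le> (c * d)\<^sup>2 * kernel_form \<rho> C N x"
    by (simp add: power_mult_distrib mult.assoc)
qed

lemma kernel_equiv_trans: "kernel_equiv \<rho> c A B \<Longrightarrow> kernel_equiv \<rho> d B C \<Longrightarrow> kernel_equiv \<rho> (c * d) A C"
  unfolding kernel_equiv_def using kernel_dom_trans by (metis mult.commute)

lemma kernel_dom_mono:
  assumes "kernel_dom \<rho> c A B" "B \<in> C_class \<rho>" "0 < \<rho>" "0 \<le> c" "c \<le> d"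
  shows "kernel_dom \<rho> d A B"
  unfolding kernel_dom_def
proof (intro allI impI)
  fix N and x :: "'a list \<Rightarrow> 'b"
  assume x: "supported N x"
  have "c\<^sup>2 * kernel_form \<rho> B N x \<le> d\<^sup>2 * kernel_form \<rho> B N x"
    using assms by (intro mult_right_mono power_mono C_class_kernel_nonneg x) auto
  then show "kernel_form \<rho> A N x \<le> d\<^sup>2 * kernel_form \<rho> B N x"
    using assms(1) x unfolding kernel_dom_def by (meson order_trans)
qed

lemma kernel_equiv_mono:
  "kernel_equiv \<rho> c A B \<Longrightarrow> A \<in> C_class \<rho> \<Longrightarrow> B \<in> C_class \<rho> \<Longrightarrow> 0 < \<rho> \<Longrightarrow> 0 \<le> c \<Longrightarrow> c \<le> d \<Longrightarrow>
    kernel_equiv \<rho> d A B"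
  by (auto simp: kernel_equiv_def intro: kernel_dom_mono)

lemma kernel_equiv_refl1: "kernel_equiv \<rho> 1 A A"
  by (simp add: kernel_equiv_def kernel_dom_def)

text \<open>Eliminates polynomials and test space from the equivalence relation and hence from the
  hyperbolic distance.\<close>

lemma harnack_equiv_iff:
  fixes A B :: "'n::finite \<Rightarrow> ('h::complex_hilbert_space \<Rightarrow>\<^sub>L 'h)"
  assumes "infinite_dimensional TYPE('k::complex_hilbert_space)" "A \<in> BH" "B \<in> BH"
  shows "harnack_equiv TYPE('k) \<rho> c A B \<longleftrightarrow> kernel_equiv \<rho> c A B"
  using assms by (simp add: harnack_equiv_def kernel_equiv_def kernel_dom_def harnack_dom_iff)

text \<open>What is used of a Harnack part: membership in the class, mutual equivalence, closure
  under equivalence. In this form it applies to a quotient class and to the open ball alike.\<close>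

definition is_part :: "real \<Rightarrow> ('n::finite \<Rightarrow> ('h::complex_hilbert_space \<Rightarrow>\<^sub>L 'h)) set \<Rightarrow> bool" where
  "is_part \<rho> \<Delta> \<longleftrightarrow> \<Delta> \<subseteq> C_class \<rho> \<and> (\<forall>A\<in>\<Delta>. \<forall>B\<in>\<Delta>. \<exists>c\<ge>1. kernel_equiv \<rho> c A B) \<and>
    (\<forall>A\<in>\<Delta>. \<forall>B\<in>C_class \<rho>. \<forall>c\<ge>1. kernel_equiv \<rho> c A B \<longrightarrow> B \<in> \<Delta>)"

lemma harnack_parts_is_part:
  fixes \<Delta> :: "('n::finite \<Rightarrow> ('h::complex_hilbert_space \<Rightarrow>\<^sub>L 'h)) set"
  assumes inf: "infinite_dimensional TYPE('k::complex_hilbert_space)"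
    and \<Delta>: "\<Delta> \<in> harnack_parts TYPE('k) \<rho>"
  shows "is_part \<rho> \<Delta>"
proof -
  obtain A0 where A0: "\<Delta> = harnack_rel TYPE('k) \<rho> `` {A0}" "A0 \<in> C_class \<rho>"
    using \<Delta> unfolding harnack_parts_def by (rule quotientE)
  have \<Delta>_iff: "A \<in> \<Delta> \<longleftrightarrow> A \<in> C_class \<rho> \<and> (\<exists>c\<ge>1. kernel_equiv \<rho> c A0 A)" for A
    using A0 by (auto simp: harnack_rel_def harnack_equiv_iff[OF inf C_class_BH C_class_BH])
  have mult1: "1 \<le> c * d" if "1 \<le> c" "1 \<le> d" for c d :: real
    using mult_mono[OF that] that by simp
  show ?thesis
    unfolding is_part_def
  proof (intro conjI ballI allI impI)
    show "\<Delta> \<subseteq> C_class \<rho>" by (simp add: subset_iff \<Delta>_iff)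
    fix A assume "A \<in> \<Delta>"
    then obtain c where c: "1 \<le> c" "kernel_equiv \<rho> c A0 A" unfolding \<Delta>_iff by blast
    show "\<exists>c\<ge>1. kernel_equiv \<rho> c A B" if B: "B \<in> \<Delta>" for B
    proof -
      obtain d where d: "1 \<le> d" "kernel_equiv \<rho> d A0 B" using B unfolding \<Delta>_iff by blast
      have "kernel_equiv \<rho> (c * d) A B"
        by (rule kernel_equiv_trans[OF kernel_equiv_sym[THEN iffD1, OF c(2)] d(2)])
      then show ?thesis using mult1[OF c(1) d(1)] by blast
    qed
    show "B \<in> \<Delta>" if "B \<in> C_class \<rho>" "1 \<le> d" "kernel_equiv \<rho> d A B" for B d
      unfolding \<Delta>_iff using kernel_equiv_trans[OF c(2) that(3)] mult1[OF c(1) that(2)] that(1) by blast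
  qed
qed

lemma exp_square: "(exp (e :: real))\<^sup>2 = exp (2 * e)"
  by (simp add: exp_double)

text \<open>From multiplicative to additive closeness: if \<open>a \<le> E b\<close> and
  \<open>b \<le> E a\<close> with \<open>E \<ge> 1\<close>, then \<open>a\<close> and
  \<open>b\<close> differ by at most \<open>(E - 1) * E * b\<close>.\<close>

lemma kernel_equiv_diff_le:
  assumes eq: "kernel_equiv \<rho> (exp e) A B" and e: "0 \<le> e"
    and B: "kernel_form \<rho> B N x \<le> b" "0 \<le> kernel_form \<rho> B N x" and x: "supported N x"
  shows "\<bar>kernel_form \<rho> A N x - kernel_form \<rho> B N x\<bar> \<le> (exp (2 * e) - 1) * exp (2 * e) * b"
proof -
  let ?E = "exp (2 * e)"
  have E: "1 \<le> ?E" using e by simp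
  have AB: "kernel_form \<rho> A N x \<le> ?E * kernel_form \<rho> B N x" "kernel_form \<rho> B N x \<le> ?E * kernel_form \<rho> A N x"
    using eq x unfolding kernel_equiv_def kernel_dom_def exp_square by auto
  have b: "(?E - 1) * (?E * kernel_form \<rho> B N x) \<le> (?E - 1) * (?E * b)"
    using E B by (intro mult_left_mono) auto
  have "kernel_form \<rho> A N x - kernel_form \<rho> B N x \<le> (?E - 1) * kernel_form \<rho> B N x"
    using AB(1) by (simp add: algebra_simps)
  also have "\<dots> \<le> (?E - 1) * (?E * kernel_form \<rho> B N x)"
    using E B mult_right_mono[OF E B(2)] by (intro mult_left_mono) auto
  finally have 1: "kernel_form \<rho> A N x - kernel_form \<rho> B N x \<le> (?E - 1) * (?E * b)" using b by linarith
  have "kernel_form \<rho> B N x - kernel_form \<rho> A N x \<le> (?E - 1) * kernel_form \<rho> A N x"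
    using AB(2) by (simp add: algebra_simps)
  also have "\<dots> \<le> (?E - 1) * (?E * kernel_form \<rho> B N x)"
    using E AB(1) by (intro mult_left_mono) auto
  finally have 2: "kernel_form \<rho> B N x - kernel_form \<rho> A N x \<le> (?E - 1) * (?E * b)" using b by linarith
  show ?thesis using 1 2 by (simp add: mult.assoc)
qed

lemma small_exp:
  assumes "0 < \<epsilon>"
  obtains e where "0 < e" "(exp (2 * e) - 1) * exp (2 * e) * b < (\<epsilon> :: real)"
proof -
  have "((\<lambda>e. (exp (2 * e) - 1) * exp (2 * e) * b) \<longlongrightarrow> (exp (2 * 0) - 1) * exp (2 * 0) * b) (at_right (0::real))"
    by (intro tendsto_intros)
  then have "\<forall>\<^sub>F e in at_right (0::real). (exp (2 * e) - 1) * exp (2 * e) * b < \<epsilon>"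
    by (rule order_tendstoD) (use assms in simp)
  then obtain d where d: "0 < d" "\<And>e. 0 < e \<Longrightarrow> e < d \<Longrightarrow> (exp (2 * e) - 1) * exp (2 * e) * b < \<epsilon>"
    by (auto simp: eventually_at_right_field)
  show ?thesis using that[of "d / 2"] d(2)[of "d / 2"] d(1) by simp
qed

section \<open>The hyperbolic metric of a part and its completeness\<close>

context
  fixes \<rho> :: real and \<Delta> :: "('n::finite \<Rightarrow> ('h::complex_hilbert_space \<Rightarrow>\<^sub>L 'h)) set"
    and \<delta> :: "('n \<Rightarrow> ('h \<Rightarrow>\<^sub>L 'h)) \<Rightarrow> ('n \<Rightarrow> ('h \<Rightarrow>\<^sub>L 'h)) \<Rightarrow> real"
  assumes infh: "infinite_dimensional TYPE('h)"
    and infk: "infinite_dimensional TYPE('k::complex_hilbert_space)"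
    and \<rho>: "0 < \<rho>" and part: "is_part \<rho> \<Delta>"
    and \<delta>: "\<delta> = hyperbolic_dist TYPE('k) \<rho>"
begin

lemma part_C_class: "A \<in> \<Delta> \<Longrightarrow> A \<in> C_class \<rho>"
  using part by (auto simp: is_part_def)

lemma part_BH: "A \<in> \<Delta> \<Longrightarrow> A \<in> BH"
  using part_C_class C_class_BH by blast

lemma part_nonneg: "A \<in> \<Delta> \<Longrightarrow> supported N x \<Longrightarrow> 0 \<le> kernel_form \<rho> A N x"
  using C_class_kernel_nonneg[OF part_C_class \<rho>] by blast

lemma hyperbolic_dist_eq:
  "A \<in> \<Delta> \<Longrightarrow> B \<in> \<Delta> \<Longrightarrow> \<delta> A B = ln (Inf {c. c > 1 \<and> kernel_equiv \<rho> c A B})"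
  by (simp add: \<delta> hyperbolic_dist_def harnack_equiv_iff[OF infk part_BH part_BH])

lemma equiv_set:
  assumes "A \<in> \<Delta>" "B \<in> \<Delta>"
  shows "{c. c > 1 \<and> kernel_equiv \<rho> c A B} \<noteq> {}" "1 \<le> Inf {c. c > 1 \<and> kernel_equiv \<rho> c A B}"
    "bdd_below {c. c > 1 \<and> kernel_equiv \<rho> c A B}"
proof -
  obtain c where c: "1 \<le> c" "kernel_equiv \<rho> c A B"
    using part assms unfolding is_part_def by blast
  \<comment> \<open>The set under the infimum asks for constants strictly above 1, whereas
    \<open>c\<close> may equal 1.\<close>
  then have "kernel_equiv \<rho> (c + 1) A B"
    using kernel_equiv_mono[OF c(2) part_C_class part_C_class \<rho>, of "c + 1"] assms by simp
  then show ne: "{c. c > 1 \<and> kernel_equiv \<rho> c A B} \<noteq> {}" using c(1) by (auto intro!: exI[of _ "c + 1"])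
  show "1 \<le> Inf {c. c > 1 \<and> kernel_equiv \<rho> c A B}" by (rule cInf_greatest[OF ne]) auto
  show "bdd_below {c. c > 1 \<and> kernel_equiv \<rho> c A B}" by (rule bdd_belowI[of _ 1]) auto
qed

lemma hyperbolic_dist_nonneg: "A \<in> \<Delta> \<Longrightarrow> B \<in> \<Delta> \<Longrightarrow> 0 \<le> \<delta> A B"
  using equiv_set(2)[of A B] by (simp add: hyperbolic_dist_eq)

lemma hyperbolic_dist_less_imp:
  assumes "A \<in> \<Delta>" "B \<in> \<Delta>" "\<delta> A B < e"
  shows "kernel_equiv \<rho> (exp e) A B"
proof -
  let ?S = "{c. c > 1 \<and> kernel_equiv \<rho> c A B}"
  have "ln (Inf ?S) < e" using assms by (simp add: hyperbolic_dist_eq)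
  then have "Inf ?S < exp e"
    using equiv_set(2)[OF assms(1,2)] by (metis exp_less_mono exp_ln less_le_trans zero_less_one)
  then obtain c where c: "c \<in> ?S" "c < exp e"
    using cInf_lessD[OF equiv_set(1)[OF assms(1,2)]] by blast
  then show ?thesis
    using kernel_equiv_mono[OF _ part_C_class part_C_class \<rho>, of c A B "exp e"] assms by simp
qed

lemma hyperbolic_dist_le:
  assumes "A \<in> \<Delta>" "B \<in> \<Delta>" "0 < e" "kernel_equiv \<rho> (exp e) A B"
  shows "\<delta> A B \<le> e"
proof -
  let ?S = "{c. c > 1 \<and> kernel_equiv \<rho> c A B}"
  have "Inf ?S \<le> exp e"
    by (rule cInf_lower[OF _ equiv_set(3)[OF assms(1,2)]]) (use assms in simp)
  then have "ln (Inf ?S) \<le> ln (exp e)"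
    using equiv_set(2)[OF assms(1,2)] by (subst ln_le_cancel_iff) auto
  then show ?thesis using assms by (simp add: hyperbolic_dist_eq)
qed

lemma metric_on_hyperbolic_dist: "metric_on \<Delta> \<delta>"
  unfolding metric_on_iff
proof (intro conjI ballI)
  fix A B assume AB: "A \<in> \<Delta>" "B \<in> \<Delta>"
  show "0 \<le> \<delta> A B" using hyperbolic_dist_nonneg AB by blast
  show "\<delta> A B = \<delta> B A"
    using AB by (simp add: hyperbolic_dist_eq kernel_equiv_sym[of \<rho> _ A B])
  show "\<delta> A B = 0 \<longleftrightarrow> A = B"
  proof
    assume z: "\<delta> A B = 0"
    \<comment> \<open>Distance 0 only yields domination with every constant above 1; the constant 1
      is reached as a limit.\<close>
    have le: "kernel_form \<rho> C N x \<le> kernel_form \<rho> D N x"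
      if CD: "\<And>e. 0 < e \<Longrightarrow> kernel_equiv \<rho> (exp e) C D" and x: "supported N x" for C D N x
    proof -
      have lim: "((\<lambda>e. (exp e)\<^sup>2 * kernel_form \<rho> D N x) \<longlongrightarrow> (exp 0)\<^sup>2 * kernel_form \<rho> D N x) (at_right (0::real))"
        by (intro tendsto_intros)
      have "\<forall>\<^sub>F e in at_right (0::real). kernel_form \<rho> C N x \<le> (exp e)\<^sup>2 * kernel_form \<rho> D N x"
        using CD x unfolding kernel_equiv_def kernel_dom_def
        by (auto simp: eventually_at_right_field intro!: exI[of _ 1])
      from tendsto_lowerbound[OF lim this] show ?thesis by simp
    qed
    have 1: "kernel_equiv \<rho> (exp e) A B" "kernel_equiv \<rho> (exp e) B A" if "0 < e" for e
      using hyperbolic_dist_less_imp[OF AB, of e] z that kernel_equiv_sym by auto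
    show "A = B"
      by (rule kernel_form_eq_imp_eq[of \<rho>]) (intro antisym le 1)
  next
    assume "A = B"
    have "\<delta> A A \<le> 0 + e" if "0 < e" for e
      using hyperbolic_dist_le[OF AB(1) AB(1) that] that
        kernel_equiv_mono[OF kernel_equiv_refl1 part_C_class part_C_class \<rho>, of A "exp e"] AB by simp
    then have "\<delta> A A \<le> 0" by (rule field_le_epsilon)
    then show "\<delta> A B = 0" using hyperbolic_dist_nonneg[OF AB(1) AB(1)] \<open>A = B\<close> by simp
  qed
next
  fix A B C assume ABC: "A \<in> \<Delta>" "B \<in> \<Delta>" "C \<in> \<Delta>"
  show "\<delta> A C \<le> \<delta> A B + \<delta> B C"
  \<comment> \<open>Half of the slack \<open>e\<close> goes to each distance, since domination is
    available for strictly larger exponents only.\<close>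
  proof (rule field_le_epsilon)
    fix e :: real assume e: "0 < e"
    have "kernel_equiv \<rho> (exp (\<delta> A B + e / 2) * exp (\<delta> B C + e / 2)) A C"
      by (rule kernel_equiv_trans[where B = B]; rule hyperbolic_dist_less_imp) (use ABC e in auto)
    then have "kernel_equiv \<rho> (exp (\<delta> A B + \<delta> B C + e)) A C"
      by (simp add: exp_add[symmetric] algebra_simps)
    then show "\<delta> A C \<le> \<delta> A B + \<delta> B C + e"
      using hyperbolic_dist_nonneg ABC e by (intro hyperbolic_dist_le) (auto simp: add_nonneg_pos)
  qed
qed

lemma complete_on_hyperbolic_dist: "complete_on \<Delta> \<delta>"
proof (rule complete_onI[OF metric_on_hyperbolic_dist])
  fix \<sigma> :: "nat \<Rightarrow> 'n \<Rightarrow> ('h \<Rightarrow>\<^sub>L 'h)"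
  assume \<sigma>: "\<And>n. \<sigma> n \<in> \<Delta>"
    and C: "\<And>e. 0 < e \<Longrightarrow> \<exists>N. \<forall>m\<ge>N. \<forall>n\<ge>N. \<delta> (\<sigma> m) (\<sigma> n) < e"
  have Ceq: "\<exists>N. \<forall>m\<ge>N. \<forall>n\<ge>N. kernel_equiv \<rho> (exp e) (\<sigma> m) (\<sigma> n)" if e: "0 < e" for e
    using C[OF e] hyperbolic_dist_less_imp[OF \<sigma> \<sigma>] by blast
  \<comment> \<open>Distance 1 to one fixed member bounds the forms of all later members on words of
    length at most one.\<close>
  obtain N0 where N0: "\<And>m n. m \<ge> N0 \<Longrightarrow> n \<ge> N0 \<Longrightarrow> kernel_equiv \<rho> (exp 1) (\<sigma> m) (\<sigma> n)"
    using Ceq[of 1] by auto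
  obtain b where b: "0 \<le> b" "\<And>x. supported (Suc 0) x \<Longrightarrow> kernel_form \<rho> (\<sigma> N0) (Suc 0) x \<le> b * sqnorm (Suc 0) x"
    using kernel_form_bound_1[OF part_BH[OF \<sigma>[of N0]]] by blast
  have bound: "kernel_form \<rho> (\<sigma> n) (Suc 0) x \<le> exp 2 * b"
    if "n \<ge> N0" "supported (Suc 0) x" "sqnorm (Suc 0) x \<le> 1" for n x
  proof -
    have "kernel_form \<rho> (\<sigma> n) (Suc 0) x \<le> (exp 1)\<^sup>2 * kernel_form \<rho> (\<sigma> N0) (Suc 0) x"
      using N0[of n N0] that unfolding kernel_equiv_def kernel_dom_def by blast
    also have "\<dots> \<le> (exp 1)\<^sup>2 * (b * 1)"
      using b(2)[OF that(2)] mult_left_mono[OF that(3) b(1)] by (intro mult_left_mono) auto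
    finally show ?thesis by (simp add: exp_square)
  qed
  have "Cauchy (\<lambda>n. \<sigma> n i)" for i
  proof (rule metric_CauchyI)
    fix \<epsilon> :: real assume \<epsilon>: "0 < \<epsilon>"
    then have "0 < \<epsilon> / 4" by simp
    then obtain e where e: "0 < e" "(exp (2 * e) - 1) * exp (2 * e) * (exp 2 * b) < \<epsilon> / 4"
      using small_exp by blast
    obtain N where N: "\<And>m n. m \<ge> N \<Longrightarrow> n \<ge> N \<Longrightarrow> kernel_equiv \<rho> (exp e) (\<sigma> m) (\<sigma> n)"
      using Ceq[OF e(1)] by blast
    have "dist (\<sigma> m i) (\<sigma> n i) < \<epsilon>" if "m \<ge> max N N0" "n \<ge> max N N0" for m n
    proof -
      have "norm (\<sigma> m i - \<sigma> n i) \<le> 2 * (\<epsilon> / 4)"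
      proof (rule norm_diff_le_of_kernel_form[of \<rho>])
        fix x :: "'n list \<Rightarrow> 'h" assume x: "supported (Suc 0) x" "sqnorm (Suc 0) x \<le> 1"
        have "\<bar>kernel_form \<rho> (\<sigma> m) (Suc 0) x - kernel_form \<rho> (\<sigma> n) (Suc 0) x\<bar>
          \<le> (exp (2 * e) - 1) * exp (2 * e) * (exp 2 * b)"
          by (rule kernel_equiv_diff_le)
            (use N that e x bound part_nonneg[OF \<sigma>] in \<open>auto intro: less_imp_le\<close>)
        then show "kernel_form \<rho> (\<sigma> m) (Suc 0) x - kernel_form \<rho> (\<sigma> n) (Suc 0) x \<le> \<epsilon> / 4"
          using e(2) by linarith
      qed
      then show ?thesis using \<epsilon> by (simp add: dist_norm)
    qed
    then show "\<exists>M. \<forall>m\<ge>M. \<forall>n\<ge>M. dist (\<sigma> m i) (\<sigma> n i) < \<epsilon>" by blast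
  qed
  then have "\<forall>i. \<exists>L. (\<lambda>n. \<sigma> n i) \<longlonglongrightarrow> L" using Cauchy_convergent convergent_def by blast
  then obtain A where A: "\<And>i. (\<lambda>n. \<sigma> n i) \<longlonglongrightarrow> A i" by metis
  have ABH: "A \<in> BH"
    unfolding BH_def complex_linear_def
  proof (intro CollectI allI)
    fix i c and x :: 'h
    have "(\<lambda>n. \<sigma> n i (c *\<^sub>C x)) \<longlonglongrightarrow> A i (c *\<^sub>C x)" by (intro blinfun.tendsto A tendsto_const)
    moreover have "(\<lambda>n. c *\<^sub>C \<sigma> n i x) \<longlonglongrightarrow> c *\<^sub>C A i x"
      by (intro bounded_linear.tendsto[OF bounded_linear_scaleC] blinfun.tendsto A tendsto_const)
    moreover have "\<sigma> n i (c *\<^sub>C x) = c *\<^sub>C \<sigma> n i x" for n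
      by (rule complex_linearD[OF BH_D[OF part_BH[OF \<sigma>]]])
    ultimately show "A i (c *\<^sub>C x) = c *\<^sub>C A i x" using LIMSEQ_unique by simp
  qed
  have lim: "(\<lambda>n. kernel_form \<rho> (\<sigma> n) N x) \<longlonglongrightarrow> kernel_form \<rho> A N x" for N x
    by (rule kernel_form_tendsto[OF A])
  \<comment> \<open>Positivity of the kernel is a closed condition on each finite section, so the
    norm limit again has a dilation.\<close>
  have AC: "A \<in> C_class \<rho>"
  proof (rule kernel_nonneg_C_class[OF infh ABH \<rho>])
    fix N and x :: "'n list \<Rightarrow> 'h" assume "supported N x"
    then show "0 \<le> kernel_form \<rho> A N x"
      by (intro LIMSEQ_le_const[OF lim] exI[of _ 0] allI impI part_nonneg \<sigma>)
  qed
  have eqA: "\<exists>N. \<forall>n\<ge>N. kernel_equiv \<rho> (exp e) (\<sigma> n) A" if e: "0 < e" for e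
  proof -
    obtain N where N: "\<And>m n. m \<ge> N \<Longrightarrow> n \<ge> N \<Longrightarrow> kernel_equiv \<rho> (exp e) (\<sigma> m) (\<sigma> n)"
      using Ceq[OF e] by blast
    have "kernel_equiv \<rho> (exp e) (\<sigma> n) A" if n: "n \<ge> N" for n
      unfolding kernel_equiv_def kernel_dom_def
    proof (intro conjI allI impI)
      fix M and x :: "'n list \<Rightarrow> 'h" assume x: "supported M x"
      have "kernel_form \<rho> (\<sigma> n) M x \<le> (exp e)\<^sup>2 * kernel_form \<rho> (\<sigma> m) M x"
        "kernel_form \<rho> (\<sigma> m) M x \<le> (exp e)\<^sup>2 * kernel_form \<rho> (\<sigma> n) M x" if "m \<ge> N" for m
        using N[OF n that] x unfolding kernel_equiv_def kernel_dom_def by blast+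
      note 1 = this
      have l: "(\<lambda>m. (exp e)\<^sup>2 * kernel_form \<rho> (\<sigma> m) M x) \<longlonglongrightarrow> (exp e)\<^sup>2 * kernel_form \<rho> A M x"
        by (intro tendsto_intros lim)
      show "kernel_form \<rho> (\<sigma> n) M x \<le> (exp e)\<^sup>2 * kernel_form \<rho> A M x"
        by (rule LIMSEQ_le_const[OF l]) (use 1(1) in blast)
      show "kernel_form \<rho> A M x \<le> (exp e)\<^sup>2 * kernel_form \<rho> (\<sigma> n) M x"
        by (rule LIMSEQ_le_const2[OF lim]) (use 1(2) in blast)
    qed
    then show ?thesis by blast
  qed
  \<comment> \<open>The limit is kernel equivalent to a member of the sequence, hence lies in the
    same part.\<close>
  have A\<Delta>: "A \<in> \<Delta>"
  proof -
    obtain N where "kernel_equiv \<rho> (exp 1) (\<sigma> N) A" using eqA[of 1] by auto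
    moreover have "1 \<le> exp (1::real)" by simp
    ultimately show ?thesis using part \<sigma>[of N] AC unfolding is_part_def by blast
  qed
  have "\<exists>N. \<forall>n\<ge>N. \<delta> (\<sigma> n) A < e" if e: "0 < e" for e
  proof -
    have e2: "0 < e / 2" using e by simp
    obtain N where N: "\<And>n. n \<ge> N \<Longrightarrow> kernel_equiv \<rho> (exp (e / 2)) (\<sigma> n) A"
      using eqA[OF e2] by blast
    have "\<delta> (\<sigma> n) A < e" if "n \<ge> N" for n
      using hyperbolic_dist_le[OF \<sigma> A\<Delta> e2 N[OF that]] e by simp
    then show ?thesis by blast
  qed
  then show "\<exists>x\<in>\<Delta>. \<forall>e>0. \<exists>N. \<forall>n\<ge>N. \<delta> (\<sigma> n) x < e" using A\<Delta> by blast
qed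

end

section \<open>The Caratheodory metric\<close>

text \<open>Additive closeness relative to the identity kernel, uniform in \<open>N\<close>. It is
  to the Caratheodory metric what \<open>kernel_equiv\<close> is to the hyperbolic one.\<close>

definition kernel_close ::
  "real \<Rightarrow> real \<Rightarrow> ('n::finite \<Rightarrow> ('h::complex_hilbert_space \<Rightarrow>\<^sub>L 'h)) \<Rightarrow> ('n \<Rightarrow> ('h \<Rightarrow>\<^sub>L 'h)) \<Rightarrow> bool" where
  "kernel_close \<rho> \<eta> A B \<longleftrightarrow>
    (\<forall>N x. supported N x \<longrightarrow> \<bar>kernel_form \<rho> A N x - kernel_form \<rho> B N x\<bar> \<le> \<eta> * sqnorm N x)"

lemma kernel_close_sym: "kernel_close \<rho> \<eta> A B \<Longrightarrow> kernel_close \<rho> \<eta> B A"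
  by (simp add: kernel_close_def abs_minus_commute)

text \<open>The kernel \<eta> times the identity minus the difference of the two kernels is
  positive, and \<open>symbol 1\<close> of the zero tuple is the symbol of the identity
  kernel.\<close>

lemma poly_form_diff_le:
  fixes A B :: "'n::finite \<Rightarrow> ('h::complex_hilbert_space \<Rightarrow>\<^sub>L 'h)"
  assumes inf: "infinite_dimensional TYPE('k::complex_hilbert_space)"
    and A: "A \<in> BH" and B: "B \<in> BH" and p: "re_nonneg_poly TYPE('k) m p"
    and close: "kernel_close \<rho> \<eta> A B"
  shows "poly_form m p (word_op A) x - poly_form m p (word_op B) x \<le> \<eta> * poly_form m p (word_op (\<lambda>_. 0)) x"
proof -
  let ?\<Phi> = "\<lambda>\<gamma>. \<eta> *\<^sub>R symbol 1 (\<lambda>_. 0) \<gamma> - (symbol \<rho> A \<gamma> - symbol \<rho> B \<gamma>)"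
  have "0 \<le> poly_form m p ?\<Phi> x"
  proof (rule poly_form_nonneg[OF inf _ _ _ p, where t = \<eta>])
    show "?\<Phi> [] = \<eta> *\<^sub>R id_blinfun" by (simp add: symbol_Nil)
    show "complex_linear (?\<Phi> \<gamma>)" for \<gamma>
      by (intro complex_linear_diff complex_linear_scaleR complex_linear_symbol A B BH_zero)
    show "0 \<le> toeplitz_form ?\<Phi> N x" if "supported N x" for N x
      using close that unfolding toeplitz_form_diff toeplitz_form_scaleR kernel_form_zero kernel_close_def
      by (auto dest!: spec[of _ N] spec[of _ x])
  qed
  then show ?thesis by (simp add: poly_form_diff poly_form_scaleR poly_form_symbol)
qed

definition block_pairing :: "nat \<Rightarrow> 'h::complex_inner_space block_op \<Rightarrow> (nat \<Rightarrow> 'h) \<Rightarrow> (nat \<Rightarrow> 'h) \<Rightarrow> real" where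
  "block_pairing m P x y = Re (\<Sum>i<m. cinner (block_apply m P x i) (y i))"

lemma block_pairing_self: "block_pairing m P x x = Re (block_form m P x)"
  by (simp add: block_pairing_def block_form_def)

lemma block_pairing_diff: "block_pairing m (\<lambda>i j. P i j - Q i j) x y = block_pairing m P x y - block_pairing m Q x y"
  by (simp add: block_pairing_def block_apply_def blinfun.diff_left sum_subtractf cinner_diff_left)

lemma block_pairing_Re_sym:
  fixes Q :: "'h::complex_hilbert_space block_op"
  assumes lin: "\<And>i j. complex_linear (Q i j)"
  shows "block_pairing m (block_Re Q) x y = block_pairing m (block_Re Q) y x"
proof -
  define S where "S = (\<lambda>x y. \<Sum>i<m. \<Sum>j<m. Re (cinner (Q i j (x j)) (y i)))"
  have e: "block_pairing m (block_Re Q) x y = 1 / 2 * (S y x + S x y)" for x y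
  proof -
    have "block_pairing m (block_Re Q) x y
      = (\<Sum>i<m. \<Sum>j<m. 1 / 2 * (Re (cinner (Q j i (y i)) (x j)) + Re (cinner (Q i j (x j)) (y i))))"
    proof -
      have "Re (cinner (block_Re Q i j (x j)) (y i))
        = 1 / 2 * (Re (cinner (Q j i (y i)) (x j)) + Re (cinner (Q i j (x j)) (y i)))" for i j
        using cinner_commute[of "x j" "Q j i (y i)"]
        by (simp add: block_Re_def block_adj_def blinfun.scaleR_left blinfun.add_left
            cinner_scaleR_left cinner_add_left adj_eq'[OF lin])
      then show ?thesis by (simp only: block_pairing_def block_apply_def cinner_sum_left Re_sum)
    qed
    also have "\<dots> = 1 / 2 * ((\<Sum>i<m. \<Sum>j<m. Re (cinner (Q j i (y i)) (x j))) + S x y)"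
      by (simp add: S_def sum.distrib sum_distrib_left distrib_left)
    also have "(\<Sum>i<m. \<Sum>j<m. Re (cinner (Q j i (y i)) (x j))) = S y x"
      unfolding S_def by (rule sum.swap)
    finally show ?thesis .
  qed
  show ?thesis unfolding e by simp
qed

section \<open>Norms of block operators\<close>

lemma block_apply_bound:
  assumes x: "L2_set (\<lambda>j. norm (x j)) {..<m} \<le> 1"
  shows "L2_set (\<lambda>i. norm (block_apply m P x i)) {..<m} \<le> (\<Sum>i<m. \<Sum>j<m. norm (P i j))"
proof -
  have "norm (x j) \<le> 1" if "j < m" for j
    using member_le_L2_set[of "{..<m}" j "\<lambda>j. norm (x j)"] x that by simp
  then have "norm (P i j (x j)) \<le> norm (P i j)" if "j < m" for i j
    using norm_blinfun[of "P i j" "x j"] mult_left_mono[of "norm (x j)" 1 "norm (P i j)"] that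
    by (simp add: order_trans)
  then have "norm (block_apply m P x i) \<le> (\<Sum>j<m. norm (P i j))" for i
    unfolding block_apply_def by (intro order_trans[OF norm_sum] sum_mono) auto
  then have "(\<Sum>i<m. norm (block_apply m P x i)) \<le> (\<Sum>i<m. \<Sum>j<m. norm (P i j))"
    by (intro sum_mono)
  then show ?thesis
    by (intro order_trans[OF L2_set_le_sum]) auto
qed

text \<open>The crude bound by the sum of the entry norms makes the supremum finite, so its values
  can be compared with it.\<close>

lemma block_norm_upper:
  assumes "L2_set (\<lambda>j. norm (x j)) {..<m} \<le> 1"
  shows "L2_set (\<lambda>i. norm (block_apply m P x i)) {..<m} \<le> block_norm m P"
  unfolding block_norm_def
  by (rule cSUP_upper) (use assms block_apply_bound in \<open>auto intro!: bdd_aboveI2\<close>)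

lemma block_norm_leI:
  fixes P :: "'h::real_normed_vector block_op"
  assumes "\<And>x. L2_set (\<lambda>j. norm (x j)) {..<m} \<le> 1 \<Longrightarrow>
    L2_set (\<lambda>i. norm (block_apply m P x i)) {..<m} \<le> c"
  shows "block_norm m P \<le> c"
  unfolding block_norm_def
proof (rule cSUP_least)
  show "{x :: nat \<Rightarrow> 'h. L2_set (\<lambda>j. norm (x j)) {..<m} \<le> 1} \<noteq> {}"
    by (auto simp: L2_set_def intro!: exI[of _ "\<lambda>_. 0"])
qed (use assms in auto)

lemma block_norm_nonneg: "0 \<le> block_norm m P"
  using block_norm_upper[of "\<lambda>_. 0" m P] by (simp add: L2_set_def block_apply_def blinfun.zero_right)

lemma block_norm_minus_commute:
  "block_norm m (\<lambda>i j. P i j - Q i j) = block_norm m (\<lambda>i j. Q i j - P i j)"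
proof -
  have "block_apply m (\<lambda>i j. P i j - Q i j) x i = - block_apply m (\<lambda>i j. Q i j - P i j) x i" for x i
    by (simp add: block_apply_def blinfun.diff_left flip: sum_negf)
  then show ?thesis by (simp add: block_norm_def)
qed

lemma block_norm_triangle:
  "block_norm m (\<lambda>i j. P i j - R i j) \<le> block_norm m (\<lambda>i j. P i j - Q i j) + block_norm m (\<lambda>i j. Q i j - R i j)"
proof (rule block_norm_leI)
  fix x :: "nat \<Rightarrow> 'a"
  assume x: "L2_set (\<lambda>j. norm (x j)) {..<m} \<le> 1"
  let ?a = "\<lambda>P Q i. block_apply m (\<lambda>i j. P i j - Q i j) x i"
  have "?a P R i = ?a P Q i + ?a Q R i" for i
    by (simp add: block_apply_def blinfun.diff_left flip: sum.distrib)
  then have "L2_set (\<lambda>i. norm (?a P R i)) {..<m} \<le> L2_set (\<lambda>i. norm (?a P Q i) + norm (?a Q R i)) {..<m}"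
    by (intro L2_set_mono) (auto simp: norm_triangle_ineq)
  also have "\<dots> \<le> L2_set (\<lambda>i. norm (?a P Q i)) {..<m} + L2_set (\<lambda>i. norm (?a Q R i)) {..<m}"
    by (rule L2_set_triangle_ineq)
  also have "\<dots> \<le> block_norm m (\<lambda>i j. P i j - Q i j) + block_norm m (\<lambda>i j. Q i j - R i j)"
    by (intro add_mono block_norm_upper x)
  finally show "L2_set (\<lambda>i. norm (?a P R i)) {..<m} \<le> block_norm m (\<lambda>i j. P i j - Q i j) + block_norm m (\<lambda>i j. Q i j - R i j)" .
qed

text \<open>A symmetric operator has its norm controlled by its quadratic form: polarisation at
  \<open>x\<close> and the normalised image \<open>z\<close> of \<open>x\<close>, then the
  parallelogram law.\<close>

lemma block_norm_le_of_form:
  fixes P :: "'h::complex_hilbert_space block_op"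
  assumes sym: "\<And>x y. block_pairing m P x y = block_pairing m P y x" and \<eta>: "0 \<le> \<eta>"
    and form: "\<And>x. \<bar>block_pairing m P x x\<bar> \<le> \<eta> * (\<Sum>i<m. (norm (x i))\<^sup>2)"
  shows "block_norm m P \<le> \<eta>"
proof (rule block_norm_leI)
  fix x :: "nat \<Rightarrow> 'h"
  assume "L2_set (\<lambda>j. norm (x j)) {..<m} \<le> 1"
  then have x: "(\<Sum>i<m. (norm (x i))\<^sup>2) \<le> 1" by (simp add: L2_set_def)
  let ?y = "block_apply m P x"
  define Y where "Y = L2_set (\<lambda>i. norm (?y i)) {..<m}"
  have Y2: "(\<Sum>i<m. (norm (?y i))\<^sup>2) = Y\<^sup>2" by (simp add: Y_def L2_set_def sum_nonneg)
  show "Y \<le> \<eta>"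
  proof (cases "Y = 0")
    case False
    then have Y: "0 < Y" by (simp add: Y_def order_less_le)
    define z where "z = (\<lambda>i. (1 / Y) *\<^sub>R ?y i)"
    have z: "(\<Sum>i<m. (norm (z i))\<^sup>2) = 1"
      using Y by (simp add: z_def power_mult_distrib power_divide Y2 flip: sum_divide_distrib)
    have "block_pairing m P x z = 1 / Y * (\<Sum>i<m. (norm (?y i))\<^sup>2)"
      by (simp add: block_pairing_def z_def cinner_scaleR_right cinner_self sum_distrib_left flip: of_real_power)
    then have xz: "block_pairing m P x z = Y" unfolding Y2 using Y by (simp add: power2_eq_square)
    have lin: "block_apply m P (\<lambda>i. u i + v i) k = block_apply m P u k + block_apply m P v k"
      "block_apply m P (\<lambda>i. u i - v i) k = block_apply m P u k - block_apply m P v k" for u v k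
      by (simp_all add: block_apply_def blinfun.add_right blinfun.diff_right sum.distrib sum_subtractf)
    have "4 * Y = 2 * (block_pairing m P x z + block_pairing m P z x)"
      using xz sym[of z x] by simp
    also have "\<dots> = block_pairing m P (\<lambda>i. x i + z i) (\<lambda>i. x i + z i) - block_pairing m P (\<lambda>i. x i - z i) (\<lambda>i. x i - z i)"
      by (simp add: block_pairing_def lin cinner_add_left cinner_add_right cinner_diff_left
          cinner_diff_right sum.distrib sum_subtractf)
    also have "\<dots> \<le> \<eta> * (\<Sum>i<m. (norm (x i + z i))\<^sup>2) + \<eta> * (\<Sum>i<m. (norm (x i - z i))\<^sup>2)"
      using form[of "\<lambda>i. x i + z i"] form[of "\<lambda>i. x i - z i"] by linarith
    also have "\<dots> = \<eta> * (\<Sum>i<m. (norm (x i + z i))\<^sup>2 + (norm (x i - z i))\<^sup>2)"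
      by (simp add: sum.distrib distrib_left)
    also have "(\<Sum>i<m. (norm (x i + z i))\<^sup>2 + (norm (x i - z i))\<^sup>2) = (\<Sum>i<m. 2 * (norm (x i))\<^sup>2 + 2 * (norm (z i))\<^sup>2)"
      by (intro sum.cong refl)
        (simp add: power2_norm_eq_inner inner_add_left inner_add_right inner_diff_left inner_diff_right)
    also have "\<dots> = 2 * (\<Sum>i<m. (norm (x i))\<^sup>2) + 2" by (simp add: sum.distrib z flip: sum_distrib_left)
    also have "\<eta> * \<dots> \<le> \<eta> * 4" using x \<eta> by (intro mult_left_mono) auto
    finally show ?thesis by simp
  qed (use \<eta> in simp)
qed

section \<open>Bounds for the Caratheodory distance\<close>

abbreviation poly_diff ::
  "'n ncpoly \<Rightarrow> ('n \<Rightarrow> ('h::complex_hilbert_space \<Rightarrow>\<^sub>L 'h)) \<Rightarrow> ('n \<Rightarrow> ('h \<Rightarrow>\<^sub>L 'h)) \<Rightarrow> 'h block_op" where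
  "poly_diff p A B \<equiv> \<lambda>i j. block_Re (poly_op p A) i j - block_Re (poly_op p B) i j"

definition unital :: "'h::complex_hilbert_space itself \<Rightarrow> nat \<Rightarrow> 'n ncpoly \<Rightarrow> bool" where
  "unital _ m p \<longleftrightarrow>
    (\<forall>i<m. \<forall>j<m. block_Re (poly_op p (\<lambda>_. 0 :: 'h \<Rightarrow>\<^sub>L 'h)) i j = (if i = j then id_blinfun else 0))"

lemma unital_form:
  fixes x :: "nat \<Rightarrow> 'h::complex_hilbert_space"
  assumes "unital TYPE('h) m p"
  shows "poly_form m p (word_op (\<lambda>_. 0)) x = (\<Sum>i<m. (norm (x i))\<^sup>2)"
proof -
  let ?P = "block_Re (poly_op p (\<lambda>_. 0 :: 'h \<Rightarrow>\<^sub>L 'h))"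
  have "block_apply m ?P x i = x i" if i: "i < m" for i
  proof -
    have "block_apply m ?P x i = (\<Sum>j<m. if j = i then x i else 0)"
      unfolding block_apply_def
      by (intro sum.cong) (use assms i in \<open>auto simp: unital_def\<close>)
    then show ?thesis using i by simp
  qed
  then have "block_form m ?P x = of_real (\<Sum>i<m. (norm (x i))\<^sup>2)"
    by (simp add: block_form_def cinner_self)
  then show ?thesis by (simp only: block_form_Re_poly[OF BH_zero] of_real_eq_iff)
qed

lemma block_pairing_poly_diff:
  fixes A B :: "'n::finite \<Rightarrow> ('h::complex_hilbert_space \<Rightarrow>\<^sub>L 'h)"
  assumes "A \<in> BH" "B \<in> BH"
  shows "block_pairing m (poly_diff p A B) x x = poly_form m p (word_op A) x - poly_form m p (word_op B) x"
    and "block_pairing m (poly_diff p A B) x y = block_pairing m (poly_diff p A B) y x"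
proof -
  show "block_pairing m (poly_diff p A B) x x = poly_form m p (word_op A) x - poly_form m p (word_op B) x"
    unfolding block_pairing_diff block_pairing_self by (simp add: block_form_Re_poly assms)
  have lin: "complex_linear (poly_op p X i j)" if "X \<in> BH" for X :: "'n \<Rightarrow> ('h \<Rightarrow>\<^sub>L 'h)" and i j
    unfolding poly_op_def by (intro complex_linear_sum complex_linear_scaleC_op complex_linear_word_op that)
  show "block_pairing m (poly_diff p A B) x y = block_pairing m (poly_diff p A B) y x"
    unfolding block_pairing_diff
    using block_pairing_Re_sym[where Q = "poly_op p A" and m = m and x = x and y = y, OF lin[OF assms(1)]]
      block_pairing_Re_sym[where Q = "poly_op p B" and m = m and x = x and y = y, OF lin[OF assms(2)]]
    by simp
qed

text \<open>For a normalised polynomial the form of \<open>p(0)\<close> is the squared norm, so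
  closeness of kernels bounds every matrix size and every polynomial by the same \<eta>.\<close>

lemma block_norm_poly_diff_le:
  fixes A B :: "'n::finite \<Rightarrow> ('h::complex_hilbert_space \<Rightarrow>\<^sub>L 'h)"
  assumes inf: "infinite_dimensional TYPE('k::complex_hilbert_space)"
    and A: "A \<in> BH" and B: "B \<in> BH" and p: "re_nonneg_poly TYPE('k) m p" "unital TYPE('h) m p"
    and close: "kernel_close \<rho> \<eta> A B" and \<eta>: "0 \<le> \<eta>"
  shows "block_norm m (poly_diff p A B) \<le> \<eta>"
proof (rule block_norm_le_of_form[OF block_pairing_poly_diff(2)[OF A B] \<eta>])
  fix x :: "nat \<Rightarrow> 'h"
  show "\<bar>block_pairing m (poly_diff p A B) x x\<bar> \<le> \<eta> * (\<Sum>i<m. (norm (x i))\<^sup>2)"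
    using poly_form_diff_le[OF inf A B p(1) close, of x]
      poly_form_diff_le[OF inf B A p(1) kernel_close_sym[OF close], of x]
    unfolding block_pairing_poly_diff(1)[OF A B] unital_form[OF p(2)] by simp
qed

lemma unital_kernel_poly:
  fixes e :: "nat \<Rightarrow> 'n::finite list"
  assumes e: "bij_betw e {..<m} (words N)"
  shows "unital TYPE('h::complex_hilbert_space) m (kernel_poly e)"
  unfolding unital_def
proof (intro allI impI)
  fix i j assume ij: "i < m" "j < m"
  have op: "poly_op (kernel_poly e) (\<lambda>_. 0 :: 'h \<Rightarrow>\<^sub>L 'h) a b = (if a = b then id_blinfun else 0)"
    if "a < m" "b < m" for a b
  proof -
    have inj: "e b = e a \<longleftrightarrow> a = b" using e that by (auto simp: bij_betw_def inj_on_def)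
    have fin: "finite {\<alpha>. kernel_poly e \<alpha> a b \<noteq> 0}"
      by (rule finite_subset[OF _ is_ncpoly_kernel_poly[OF e, unfolded is_ncpoly_def]]) (use that in auto)
    \<comment> \<open>The empty word is inserted because \<open>poly_op\<close> sums over nonzero
      coefficients only, which for \<open>a \<noteq> b\<close> excludes it.\<close>
    have "poly_op (kernel_poly e) (\<lambda>_. 0 :: 'h \<Rightarrow>\<^sub>L 'h) a b
      = (\<Sum>\<alpha>\<in>insert [] {\<alpha>. kernel_poly e \<alpha> a b \<noteq> 0}.
          scaleC_op (kernel_poly e \<alpha> a b) (word_op (\<lambda>_. 0 :: 'h \<Rightarrow>\<^sub>L 'h) \<alpha>))"
      unfolding poly_op_def using fin
      by (intro sum.mono_neutral_left) (auto intro!: blinfun_eqI)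
    also have "\<dots> = scaleC_op (kernel_poly e [] a b) (word_op (\<lambda>_ :: 'n. 0 :: 'h \<Rightarrow>\<^sub>L 'h) [])"
      by (rule sum_single[where a = "[]"]) (use fin in \<open>auto simp: word_op_zero intro!: blinfun_eqI\<close>)
    also have "\<dots> = (if a = b then id_blinfun else 0)"
      using inj by (auto simp: kernel_poly_def intro!: blinfun_eqI)
    finally show ?thesis .
  qed
  have adj: "adj (id_blinfun :: 'h \<Rightarrow>\<^sub>L 'h) = id_blinfun" "adj (0 :: 'h \<Rightarrow>\<^sub>L 'h) = 0"
    by (rule adj_unique; simp)+
  have half: "(1 / 2) *\<^sub>R (v + v) = (v :: 'h \<Rightarrow>\<^sub>L 'h)" for v
    by (simp flip: scaleR_left_distrib scaleR_2)
  show "block_Re (poly_op (kernel_poly e) (\<lambda>_. 0 :: 'h \<Rightarrow>\<^sub>L 'h)) i j = (if i = j then id_blinfun else 0)"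
    unfolding block_Re_def block_adj_def op[OF ij] op[OF ij(2,1)]
    by (cases "i = j") (simp_all add: adj half)
qed

definition carath_set ::
  "'k::complex_hilbert_space itself \<Rightarrow> ('n::finite \<Rightarrow> ('h::complex_hilbert_space \<Rightarrow>\<^sub>L 'h)) \<Rightarrow> ('n \<Rightarrow> ('h \<Rightarrow>\<^sub>L 'h)) \<Rightarrow> real set" where
  "carath_set K A B = {block_norm m (poly_diff p A B) | m p. re_nonneg_poly K m p \<and> unital TYPE('h) m p}"

lemma caratheodory_dist_eq: "caratheodory_dist K A B = Sup (carath_set K A B)"
  by (simp add: caratheodory_dist_def carath_set_def unital_def)

text \<open>Needed to bound the supremum from above; a kernel polynomial is a normalised
  competitor.\<close>

lemma carath_set_nonempty:
  fixes A :: "'n::finite \<Rightarrow> ('h::complex_hilbert_space \<Rightarrow>\<^sub>L 'h)"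
  shows "carath_set TYPE('k::complex_hilbert_space) A B \<noteq> {}"
proof -
  obtain m and e :: "nat \<Rightarrow> 'n list" where e: "bij_betw e {..<m} (words 0)"
    "re_nonneg_poly TYPE('k) m (kernel_poly e)"
    using obtain_kernel_poly by blast
  then show ?thesis using unital_kernel_poly[OF e(1), where 'h = 'h] by (auto simp: carath_set_def)
qed

lemma caratheodory_dist_sym: "caratheodory_dist K A B = caratheodory_dist K B A"
  unfolding caratheodory_dist_eq carath_set_def
  by (rule arg_cong[where f = Sup]) (use block_norm_minus_commute in blast)

text \<open>Closeness with some \<eta> makes the set of competitors bounded above, so that
  \<open>Sup\<close> is a true supremum. The norm estimate tests the kernel polynomial of the words
  of length at most one, whose form determines the tuple.\<close>

lemma
  fixes A B :: "'n::finite \<Rightarrow> ('h::complex_hilbert_space \<Rightarrow>\<^sub>L 'h)"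
  assumes inf: "infinite_dimensional TYPE('k::complex_hilbert_space)"
    and A: "A \<in> BH" and B: "B \<in> BH"
    and close: "kernel_close \<rho> \<eta> A B" and \<eta>: "0 \<le> \<eta>"
  shows caratheodory_dist_le: "caratheodory_dist TYPE('k) A B \<le> \<eta>"
    and block_norm_le_caratheodory_dist:
      "re_nonneg_poly TYPE('k) m p \<Longrightarrow> unital TYPE('h) m p \<Longrightarrow>
        block_norm m (poly_diff p A B) \<le> caratheodory_dist TYPE('k) A B"
    and caratheodory_dist_nonneg: "0 \<le> caratheodory_dist TYPE('k) A B"
    and norm_le_caratheodory_dist: "norm (A i - B i) \<le> 2 * caratheodory_dist TYPE('k) A B"
proof -
  have le: "v \<le> \<eta>" if "v \<in> carath_set TYPE('k) A B" for v
    using that block_norm_poly_diff_le[OF inf A B _ _ close \<eta>] by (auto simp: carath_set_def)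
  then show "caratheodory_dist TYPE('k) A B \<le> \<eta>"
    unfolding caratheodory_dist_eq by (intro cSup_least carath_set_nonempty)
  have bdd: "bdd_above (carath_set TYPE('k) A B)" using le by (rule bdd_aboveI)
  have up: "block_norm m (poly_diff p A B) \<le> caratheodory_dist TYPE('k) A B"
    if "re_nonneg_poly TYPE('k) m p" "unital TYPE('h) m p" for m p
    unfolding caratheodory_dist_eq
    by (rule cSup_upper[OF _ bdd]) (use that in \<open>auto simp: carath_set_def\<close>)
  then show "re_nonneg_poly TYPE('k) m p \<Longrightarrow> unital TYPE('h) m p \<Longrightarrow>
        block_norm m (poly_diff p A B) \<le> caratheodory_dist TYPE('k) A B" .
  obtain m and e :: "nat \<Rightarrow> 'n list" where e: "bij_betw e {..<m} (words (Suc 0))"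
    "re_nonneg_poly TYPE('k) m (kernel_poly e)"
    using obtain_kernel_poly by blast
  let ?P = "poly_diff (kernel_poly e) A B"
  have up': "block_norm m ?P \<le> caratheodory_dist TYPE('k) A B"
    by (rule up[OF e(2) unital_kernel_poly[OF e(1)]])
  then show "0 \<le> caratheodory_dist TYPE('k) A B" using block_norm_nonneg order_trans by blast
  show "norm (A i - B i) \<le> 2 * caratheodory_dist TYPE('k) A B"
  proof (rule norm_diff_le_of_kernel_form[of \<rho>])
    fix x :: "'n list \<Rightarrow> 'h" assume x: "supported (Suc 0) x" "sqnorm (Suc 0) x \<le> 1"
    let ?\<xi> = "\<lambda>j. x (e j)"
    have "(\<Sum>j<m. (norm (?\<xi> j))\<^sup>2) = sqnorm (Suc 0) x"
      unfolding sqnorm_def by (rule sum.reindex_bij_betw[OF e(1)])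
    then have \<xi>: "L2_set (\<lambda>j. norm (?\<xi> j)) {..<m} \<le> 1" using x(2) by (simp add: L2_set_def)
    \<comment> \<open>\<rho> contributes the same multiple of \<open>sqnorm\<close> to both forms,
      so in the difference it may be replaced by 1, as the polynomial requires.\<close>
    have "kernel_form \<rho> A (Suc 0) x - kernel_form \<rho> B (Suc 0) x
      = kernel_form 1 A (Suc 0) x - kernel_form 1 B (Suc 0) x"
      by (simp add: kernel_form_eq algebra_simps)
    also have "\<dots> = block_pairing m ?P ?\<xi> ?\<xi>"
      unfolding block_pairing_poly_diff(1)[OF A B]
      by (simp only: symbol_1[symmetric] poly_form_kernel_poly[OF e(1) x(1)])
    also have "\<dots> \<le> (\<Sum>j<m. norm (block_apply m ?P ?\<xi> j) * norm (?\<xi> j))"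
      unfolding block_pairing_def Re_sum
      by (intro sum_mono) (use complex_Re_le_cmod cinner_Cauchy_Schwarz order_trans in blast)
    also have "\<dots> \<le> L2_set (\<lambda>j. norm (block_apply m ?P ?\<xi> j)) {..<m} * L2_set (\<lambda>j. norm (?\<xi> j)) {..<m}"
      using L2_set_mult_ineq[of "\<lambda>j. norm (block_apply m ?P ?\<xi> j)" "\<lambda>j. norm (?\<xi> j)" "{..<m}"] by simp
    also have "\<dots> \<le> L2_set (\<lambda>j. norm (block_apply m ?P ?\<xi> j)) {..<m} * 1"
      by (intro mult_left_mono \<xi> L2_set_nonneg)
    also have "\<dots> \<le> block_norm m ?P" using block_norm_upper[OF \<xi>] by simp
    also note up'
    finally show "kernel_form \<rho> A (Suc 0) x - kernel_form \<rho> B (Suc 0) x \<le> caratheodory_dist TYPE('k) A B" .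
  qed
qed

lemma metric_on_caratheodory_dist:
  fixes M :: "('n::finite \<Rightarrow> ('h::complex_hilbert_space \<Rightarrow>\<^sub>L 'h)) set"
  assumes inf: "infinite_dimensional TYPE('k::complex_hilbert_space)" and M: "M \<subseteq> BH"
    and close: "\<And>A B. A \<in> M \<Longrightarrow> B \<in> M \<Longrightarrow> \<exists>\<eta>\<ge>0. kernel_close \<rho> \<eta> A B"
  shows "metric_on M (caratheodory_dist TYPE('k))"
  unfolding metric_on_iff
proof (intro conjI ballI)
  let ?d = "caratheodory_dist TYPE('k) :: ('n \<Rightarrow> ('h \<Rightarrow>\<^sub>L 'h)) \<Rightarrow> _"
  fix A B assume AB: "A \<in> M" "B \<in> M"
  then have BH: "A \<in> BH" "B \<in> BH" using M by auto
  obtain \<eta> where \<eta>: "0 \<le> \<eta>" "kernel_close \<rho> \<eta> A B" using close[OF AB] by blast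
  show nn: "0 \<le> ?d A B" by (rule caratheodory_dist_nonneg[OF inf BH \<eta>(2,1)])
  show "?d A B = ?d B A" by (rule caratheodory_dist_sym)
  show "?d A B = 0 \<longleftrightarrow> A = B"
  proof
    assume z: "?d A B = 0"
    show "A = B"
    proof
      show "A i = B i" for i
        using norm_le_caratheodory_dist[OF inf BH \<eta>(2,1), of i] z by simp
    qed
  next
    assume "A = B"
    then have "?d A B \<le> 0"
      by (intro caratheodory_dist_le[OF inf BH, of \<rho>]) (auto simp: kernel_close_def)
    then show "?d A B = 0" using nn by simp
  qed
next
  let ?d = "caratheodory_dist TYPE('k) :: ('n \<Rightarrow> ('h \<Rightarrow>\<^sub>L 'h)) \<Rightarrow> _"
  fix A B C assume ABC: "A \<in> M" "B \<in> M" "C \<in> M"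
  then have BH: "A \<in> BH" "B \<in> BH" "C \<in> BH" using M by auto
  obtain \<eta> where \<eta>: "0 \<le> \<eta>" "kernel_close \<rho> \<eta> A B" using close[OF ABC(1,2)] by blast
  obtain \<eta>' where \<eta>': "0 \<le> \<eta>'" "kernel_close \<rho> \<eta>' B C" using close[OF ABC(2,3)] by blast
  have "v \<le> ?d A B + ?d B C" if v: "v \<in> carath_set TYPE('k) A C" for v
  proof -
    obtain m p where p: "v = block_norm m (poly_diff p A C)" "re_nonneg_poly TYPE('k) m p" "unital TYPE('h) m p"
      using v unfolding carath_set_def by blast
    have "v \<le> block_norm m (poly_diff p A B) + block_norm m (poly_diff p B C)"
      unfolding p(1) by (rule block_norm_triangle)
    also have "\<dots> \<le> ?d A B + ?d B C"
      by (intro add_mono block_norm_le_caratheodory_dist[OF inf BH(1,2) \<eta>(2,1)]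
          block_norm_le_caratheodory_dist[OF inf BH(2,3) \<eta>'(2,1)] p)
    finally show ?thesis .
  qed
  then show "?d A C \<le> ?d A B + ?d B C"
    unfolding caratheodory_dist_eq[of _ A C] by (intro cSup_least carath_set_nonempty)
qed

section \<open>Comparison of the metrics\<close>

lemma kernel_close_of_bounds:
  assumes "\<And>N x. supported N x \<Longrightarrow> 0 \<le> kernel_form \<rho> A N x \<and> kernel_form \<rho> A N x \<le> a * sqnorm N x"
    and "\<And>N x. supported N x \<Longrightarrow> 0 \<le> kernel_form \<rho> B N x \<and> kernel_form \<rho> B N x \<le> b * sqnorm N x"
  shows "kernel_close \<rho> (\<bar>a\<bar> + \<bar>b\<bar>) A B"
  unfolding kernel_close_def
proof (intro allI impI)
  fix N and x :: "'a list \<Rightarrow> 'b" assume x: "supported N x"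
  have "a * sqnorm N x \<le> \<bar>a\<bar> * sqnorm N x" "b * sqnorm N x \<le> \<bar>b\<bar> * sqnorm N x"
    by (intro mult_right_mono; simp)+
  then show "\<bar>kernel_form \<rho> A N x - kernel_form \<rho> B N x\<bar> \<le> (\<bar>a\<bar> + \<bar>b\<bar>) * sqnorm N x"
    using assms(1)[OF x] assms(2)[OF x] unfolding distrib_right by linarith
qed

lemma part_kernel_close:
  fixes \<Delta> :: "('n::finite \<Rightarrow> ('h::complex_hilbert_space \<Rightarrow>\<^sub>L 'h)) set"
  assumes \<rho>: "0 < \<rho>" and part: "is_part \<rho> \<Delta>"
    and upper: "\<And>A. A \<in> \<Delta> \<Longrightarrow> \<exists>C. \<forall>N x. supported N x \<longrightarrow> kernel_form \<rho> A N x \<le> C * sqnorm N x"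
    and AB: "A \<in> \<Delta>" "B \<in> \<Delta>"
  shows "\<exists>\<eta>\<ge>0. kernel_close \<rho> \<eta> A B"
proof -
  have nn: "0 \<le> kernel_form \<rho> A N x" if "A \<in> \<Delta>" "supported N x" for A N x
    using part that C_class_kernel_nonneg[OF _ \<rho>] by (auto simp: is_part_def)
  obtain a where a: "\<And>N x. supported N x \<Longrightarrow> kernel_form \<rho> A N x \<le> a * sqnorm N x"
    using upper[OF AB(1)] by blast
  obtain b where b: "\<And>N x. supported N x \<Longrightarrow> kernel_form \<rho> B N x \<le> b * sqnorm N x"
    using upper[OF AB(2)] by blast
  have "kernel_close \<rho> (\<bar>a\<bar> + \<bar>b\<bar>) A B"
    by (rule kernel_close_of_bounds) (use nn AB a b in auto)
  then show ?thesis by (intro exI[of _ "\<bar>a\<bar> + \<bar>b\<bar>"]) simp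
qed

lemma row_dist_le_of_norm:
  fixes A B :: "'n::finite \<Rightarrow> ('h::complex_hilbert_space \<Rightarrow>\<^sub>L 'h)"
  assumes "A \<in> BH" "B \<in> BH" "\<And>i. norm (A i - B i) \<le> c"
  shows "row_dist A B \<le> real CARD('n) * c"
proof -
  have "row_dist A B \<le> (\<Sum>i\<in>UNIV. norm (A i - B i))"
    unfolding row_dist_def by (rule row_norm_le_sum[OF BH_diff[OF assms(1,2)]])
  also have "\<dots> \<le> (\<Sum>i\<in>(UNIV :: 'n set). c)" by (intro sum_mono assms(3))
  finally show ?thesis by simp
qed

text \<open>The upper bound \<open>a\<close> of the form of \<open>A\<close> converts the factor
  \<open>exp (2 e)\<close> into an additive error \<open>(exp (2 e) - 1) * exp (2 e) * a\<close>.
  The radius depends on \<open>A\<close> through \<open>a\<close>, so topologies are compared and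
  not uniform structures.\<close>

lemma hyperbolic_finer_than_caratheodory:
  fixes \<Delta> :: "('n::finite \<Rightarrow> ('h::complex_hilbert_space \<Rightarrow>\<^sub>L 'h)) set"
  assumes infh: "infinite_dimensional TYPE('h)"
    and infk: "infinite_dimensional TYPE('k::complex_hilbert_space)"
    and \<rho>: "0 < \<rho>" and part: "is_part \<rho> \<Delta>"
    and upper: "\<And>A. A \<in> \<Delta> \<Longrightarrow> \<exists>C. \<forall>N x. supported N x \<longrightarrow> kernel_form \<rho> A N x \<le> C * sqnorm N x"
  shows "metric_on \<Delta> (caratheodory_dist TYPE('k))"
    and "openin (topology_on \<Delta> (caratheodory_dist TYPE('k))) U \<Longrightarrow>
      openin (topology_on \<Delta> (hyperbolic_dist TYPE('k) \<rho>)) U"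
proof -
  note ctx = infh infk \<rho> part refl[of "hyperbolic_dist TYPE('k) \<rho>"]
  have BH: "A \<in> BH" if "A \<in> \<Delta>" for A
    using part that C_class_BH by (auto simp: is_part_def)
  have nn: "0 \<le> kernel_form \<rho> A N x" if "A \<in> \<Delta>" "supported N x" for A N x
    using part that C_class_kernel_nonneg[OF _ \<rho>] by (auto simp: is_part_def)
  show m: "metric_on \<Delta> (caratheodory_dist TYPE('k))"
  proof (rule metric_on_caratheodory_dist[OF infk, of _ \<rho>])
    show "\<Delta> \<subseteq> BH" using BH by blast
  qed (rule part_kernel_close[OF \<rho> part upper])
  have fine: "\<exists>r>0. \<forall>B\<in>\<Delta>. hyperbolic_dist TYPE('k) \<rho> A B < r \<longrightarrow> caratheodory_dist TYPE('k) A B < \<epsilon>"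
    if A: "A \<in> \<Delta>" and \<epsilon>: "0 < \<epsilon>" for A \<epsilon>
  proof -
    obtain a0 where a0: "\<And>N x. supported N x \<Longrightarrow> kernel_form \<rho> A N x \<le> a0 * sqnorm N x"
      using upper[OF A] by blast
    define a where "a = \<bar>a0\<bar>"
    have a: "0 \<le> a" "kernel_form \<rho> A N x \<le> a * sqnorm N x" if "supported N x" for N x
      using a0[OF that] mult_right_mono[OF abs_ge_self[of a0] sqnorm_nonneg[of N x]] by (auto simp: a_def)
    obtain e where e: "0 < e" "(exp (2 * e) - 1) * exp (2 * e) * a < \<epsilon>"
      using small_exp[OF \<epsilon>] by blast
    have "caratheodory_dist TYPE('k) A B < \<epsilon>" if B: "B \<in> \<Delta>" "hyperbolic_dist TYPE('k) \<rho> A B < e" for B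
    proof -
      have eq: "kernel_equiv \<rho> (exp e) B A"
        using hyperbolic_dist_less_imp[OF ctx A B] kernel_equiv_sym[of \<rho> "exp e" A B] by simp
      have "kernel_close \<rho> ((exp (2 * e) - 1) * exp (2 * e) * a) A B"
        unfolding kernel_close_def
      proof (intro allI impI)
        fix N and x :: "'n list \<Rightarrow> 'h" assume x: "supported N x"
        have "\<bar>kernel_form \<rho> B N x - kernel_form \<rho> A N x\<bar> \<le> (exp (2 * e) - 1) * exp (2 * e) * (a * sqnorm N x)"
          by (rule kernel_equiv_diff_le[OF eq _ a(2)[OF x] nn[OF A x] x]) (use e in simp)
        then show "\<bar>kernel_form \<rho> A N x - kernel_form \<rho> B N x\<bar> \<le> (exp (2 * e) - 1) * exp (2 * e) * a * sqnorm N x"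
          by (simp add: abs_minus_commute mult.assoc)
      qed
      then have "caratheodory_dist TYPE('k) A B \<le> (exp (2 * e) - 1) * exp (2 * e) * a"
        by (rule caratheodory_dist_le[OF infk BH[OF A] BH[OF B(1)]]) (use e in \<open>simp add: a_def\<close>)
      then show ?thesis using e(2) by linarith
    qed
    then show ?thesis using e(1) by blast
  qed
  show "openin (topology_on \<Delta> (caratheodory_dist TYPE('k))) U \<Longrightarrow>
      openin (topology_on \<Delta> (hyperbolic_dist TYPE('k) \<rho>)) U"
    by (rule topology_on_finer[OF metric_on_hyperbolic_dist[OF ctx] m fine])
qed

lemma C_prec0_kernel_bounded:
  assumes "A \<in> C_prec0 \<rho>"
  shows "\<exists>C. \<forall>N x. supported N x \<longrightarrow> kernel_form \<rho> A N x \<le> C * sqnorm N x"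
proof -
  have "A \<in> C_infinity" using assms by (simp add: C_prec0_def)
  then obtain C where "\<And>N x. supported N x \<Longrightarrow> kernel_form \<rho> A N x \<le> C * sqnorm N x"
    using C_infinity_kernel_bounded by blast
  then show ?thesis by blast
qed

text \<open>Forms lying between positive multiples of \<open>sqnorm\<close> dominate one another,
  and domination in both directions preserves such bounds.\<close>

lemma C_ball_is_part:
  assumes inf: "infinite_dimensional TYPE('h::complex_hilbert_space)" and \<rho>: "0 < \<rho>"
  shows "is_part \<rho> (C_ball \<rho> :: ('n::finite \<Rightarrow> ('h \<Rightarrow>\<^sub>L 'h)) set)"
  unfolding is_part_def
proof (intro conjI ballI allI impI)
  note ball = C_ball_iff_kernel[OF inf \<rho>, where 'n = 'n]
  show "C_ball \<rho> \<subseteq> (C_class \<rho> :: ('n \<Rightarrow> ('h \<Rightarrow>\<^sub>L 'h)) set)"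
  proof
    fix A :: "'n \<Rightarrow> ('h \<Rightarrow>\<^sub>L 'h)" assume "A \<in> C_ball \<rho>"
    then obtain \<epsilon> C where A: "A \<in> BH" "0 < \<epsilon>"
      "\<And>N x. supported N x \<Longrightarrow> \<epsilon> * sqnorm N x \<le> kernel_form \<rho> A N x \<and> kernel_form \<rho> A N x \<le> C * sqnorm N x"
      unfolding ball by blast
    show "A \<in> C_class \<rho>"
    proof (rule kernel_nonneg_C_class[OF inf A(1) \<rho>])
      fix N and x :: "'n list \<Rightarrow> 'h" assume "supported N x"
      then show "0 \<le> kernel_form \<rho> A N x"
        using A(3)[of N x] mult_nonneg_nonneg[OF less_imp_le[OF A(2)] sqnorm_nonneg[of N x]] by linarith
    qed
  qed
  have dom: "\<exists>c\<ge>1. kernel_dom \<rho> c A B" if AB: "A \<in> C_ball \<rho>" "B \<in> C_ball \<rho>" for A B :: "'n \<Rightarrow> ('h \<Rightarrow>\<^sub>L 'h)"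
  proof -
    obtain C where C: "\<And>N x. supported N x \<Longrightarrow> kernel_form \<rho> A N x \<le> C * sqnorm N x"
      using AB(1) unfolding ball by blast
    obtain \<epsilon> where \<epsilon>: "0 < \<epsilon>" "\<And>N x. supported N x \<Longrightarrow> \<epsilon> * sqnorm N x \<le> kernel_form \<rho> B N x"
      using AB(2) unfolding ball by blast
    \<comment> \<open>The summand 1 gives \<open>c \<ge> 1\<close>, hence
      \<open>c \<le> c^2\<close>, so the square still exceeds the quotient of the two
      bounds.\<close>
    define c where "c = 1 + \<bar>C\<bar> / \<epsilon>"
    have c: "1 \<le> c" "\<bar>C\<bar> / \<epsilon> \<le> c\<^sup>2"
    proof -
      show 1: "1 \<le> c" using \<epsilon> by (simp add: c_def)
      have "\<bar>C\<bar> / \<epsilon> \<le> c" by (simp add: c_def)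
      also have "c \<le> c\<^sup>2" using mult_right_mono[OF 1, of c] 1 by (simp add: power2_eq_square)
      finally show "\<bar>C\<bar> / \<epsilon> \<le> c\<^sup>2" .
    qed
    have "kernel_form \<rho> A N x \<le> c\<^sup>2 * kernel_form \<rho> B N x" if x: "supported N x" for N x
    proof -
      have "kernel_form \<rho> A N x \<le> \<bar>C\<bar> * sqnorm N x"
        using C[OF x] mult_right_mono[OF abs_ge_self[of C] sqnorm_nonneg[of N x]] by linarith
      also have "\<dots> = \<bar>C\<bar> / \<epsilon> * (\<epsilon> * sqnorm N x)" using \<epsilon> by simp
      also have "\<dots> \<le> c\<^sup>2 * (\<epsilon> * sqnorm N x)"
        using \<epsilon> by (intro mult_right_mono c) auto
      also have "\<dots> \<le> c\<^sup>2 * kernel_form \<rho> B N x" using \<epsilon>(2)[OF x] by (intro mult_left_mono) auto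
      finally show ?thesis .
    qed
    then show ?thesis using c(1) unfolding kernel_dom_def by blast
  qed
  fix A :: "'n \<Rightarrow> ('h \<Rightarrow>\<^sub>L 'h)" assume A: "A \<in> C_ball \<rho>"
  show "\<exists>c\<ge>1. kernel_equiv \<rho> c A B" if B: "B \<in> C_ball \<rho>" for B
  proof -
    obtain c where c: "1 \<le> c" "kernel_dom \<rho> c A B" using dom[OF A B] by blast
    obtain d where d: "1 \<le> d" "kernel_dom \<rho> d B A" using dom[OF B A] by blast
    have "A \<in> C_class \<rho>" "B \<in> C_class \<rho>"
      using A B \<open>C_ball \<rho> \<subseteq> C_class \<rho>\<close> by auto
    then have "kernel_equiv \<rho> (max c d) A B"
      unfolding kernel_equiv_def
      using kernel_dom_mono[OF c(2) _ \<rho>, of "max c d"] kernel_dom_mono[OF d(2) _ \<rho>, of "max c d"] c(1) d(1) by auto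
    then show ?thesis using c(1) by (intro exI[of _ "max c d"]) auto
  qed
  fix B c assume B: "B \<in> C_class \<rho>" "1 \<le> c" "kernel_equiv \<rho> c A B"
  obtain \<epsilon> C where AA: "0 < \<epsilon>"
    "\<And>N x. supported N x \<Longrightarrow> \<epsilon> * sqnorm N x \<le> kernel_form \<rho> A N x \<and> kernel_form \<rho> A N x \<le> C * sqnorm N x"
    using A unfolding ball by blast
  have c2: "0 < c\<^sup>2" using B(2) by simp
  have "\<epsilon> / c\<^sup>2 * sqnorm N x \<le> kernel_form \<rho> B N x \<and> kernel_form \<rho> B N x \<le> c\<^sup>2 * C * sqnorm N x"
    if x: "supported N x" for N x
  proof
    have AB: "kernel_form \<rho> A N x \<le> c\<^sup>2 * kernel_form \<rho> B N x" "kernel_form \<rho> B N x \<le> c\<^sup>2 * kernel_form \<rho> A N x"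
      using B(3) x unfolding kernel_equiv_def kernel_dom_def by auto
    have "\<epsilon> * sqnorm N x \<le> c\<^sup>2 * kernel_form \<rho> B N x" using AA(2)[OF x] AB(1) by linarith
    then show "\<epsilon> / c\<^sup>2 * sqnorm N x \<le> kernel_form \<rho> B N x" using c2 by (simp add: divide_le_eq mult.commute)
    have "c\<^sup>2 * kernel_form \<rho> A N x \<le> c\<^sup>2 * (C * sqnorm N x)" using AA(2)[OF x] by (intro mult_left_mono) auto
    then show "kernel_form \<rho> B N x \<le> c\<^sup>2 * C * sqnorm N x" using AB(2) by (simp add: mult.assoc)
  qed
  moreover have "0 < \<epsilon> / c\<^sup>2" using AA(1) c2 by simp
  ultimately show "B \<in> C_ball \<rho>" using C_class_BH[OF B(1)] unfolding ball by blast
qed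

lemma C_ball_kernel_bounded:
  fixes A :: "'n::finite \<Rightarrow> ('h::complex_hilbert_space \<Rightarrow>\<^sub>L 'h)"
  assumes "infinite_dimensional TYPE('h)" "0 < \<rho>" "A \<in> C_ball \<rho>"
  shows "\<exists>C. \<forall>N x. supported N x \<longrightarrow> kernel_form \<rho> A N x \<le> C * sqnorm N x"
  using assms(3) unfolding C_ball_iff_kernel[OF assms(1,2)] by blast

text \<open>A small change in row norm changes the form by a small multiple of
  \<open>sqnorm\<close>; the lower bound \<epsilon> of \<open>A\<close> turns this into a small
  multiple of the form itself, that is, into domination in both directions.\<close>

lemma row_dist_finer_than_hyperbolic:
  fixes A :: "'n::finite \<Rightarrow> ('h::complex_hilbert_space \<Rightarrow>\<^sub>L 'h)"
  assumes infh: "infinite_dimensional TYPE('h)"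
    and infk: "infinite_dimensional TYPE('k::complex_hilbert_space)"
    and \<rho>: "0 < \<rho>" and A: "A \<in> C_ball \<rho>" and e: "0 < e"
  shows "\<exists>r>0. \<forall>B\<in>C_ball \<rho>. row_dist A B < r \<longrightarrow> hyperbolic_dist TYPE('k) \<rho> A B < e"
proof -
  let ?B = "C_ball \<rho> :: ('n \<Rightarrow> ('h \<Rightarrow>\<^sub>L 'h)) set"
  have part: "is_part \<rho> ?B" by (rule C_ball_is_part[OF infh \<rho>])
  note ctx = infh infk \<rho> part refl[of "hyperbolic_dist TYPE('k) \<rho>"]
  obtain \<epsilon> C where ABH: "A \<in> BH" and \<epsilon>: "0 < \<epsilon>"
    and AA: "\<And>N x. supported N x \<Longrightarrow> \<epsilon> * sqnorm N x \<le> kernel_form \<rho> A N x \<and> kernel_form \<rho> A N x \<le> C * sqnorm N x"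
    using A unfolding C_ball_iff_kernel[OF infh \<rho>] by blast
  obtain K where K: "0 < K" "\<And>N x. supported N x \<Longrightarrow> sqnorm N (resolvent A N x) \<le> K * sqnorm N x"
    using resolvent_bounded[OF ABH] AA by blast
  define d where "d = e / 2"
  \<comment> \<open>With \<open>E = exp (2 d)\<close> this makes \<open>1 - q = 1 / E\<close>
    exactly, and \<open>1 + q \<le> E\<close> because \<open>E + 1 / E \<ge> 2\<close>.\<close>
  define q where "q = 1 - exp (- (2 * d))"
  have d: "0 < d" using e by (simp add: d_def)
  have q: "0 < q" using d by (simp add: q_def)
  have \<epsilon>q: "0 < \<epsilon> * q" using \<epsilon> q by simp
  obtain \<tau> where \<tau>0: "0 < \<tau>" and \<tau>1: "4 * K * \<tau>\<^sup>2 \<le> 1" and \<tau>2: "(4 * K\<^sup>2 + 1) * \<tau> \<le> \<epsilon> * q"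
    using perturbation_radius[OF K(1) \<epsilon>q] by blast
  have "hyperbolic_dist TYPE('k) \<rho> A B < e" if B: "B \<in> ?B" "row_dist A B < \<tau>" for B
  proof -
    have BBH: "B \<in> BH" using B(1) by (simp add: C_ball_def)
    have "row_dist B A = row_dist A B"
      using metric_on_row_dist[of "BH :: ('n \<Rightarrow> ('h \<Rightarrow>\<^sub>L 'h)) set"] ABH BBH unfolding metric_on_iff by blast
    then have dist: "row_dist B A \<le> \<tau>" using B(2) by simp
    have "kernel_equiv \<rho> (exp d) A B"
      unfolding kernel_equiv_def kernel_dom_def exp_square
    proof (intro conjI allI impI)
      fix N and x :: "'n list \<Rightarrow> 'h" assume x: "supported N x"
      let ?a = "kernel_form \<rho> A N x" and ?b = "kernel_form \<rho> B N x"
      have "\<bar>?b - ?a\<bar> \<le> (4 * K\<^sup>2 + 1) * \<tau> * sqnorm N x"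
        by (rule kernel_form_perturb[OF ABH BBH K \<tau>0 dist \<tau>1 x])
      also have "\<dots> \<le> q * ?a"
      proof -
        have "(4 * K\<^sup>2 + 1) * \<tau> * sqnorm N x \<le> \<epsilon> * q * sqnorm N x" by (intro mult_right_mono \<tau>2) simp
        also have "\<dots> = q * (\<epsilon> * sqnorm N x)" by simp
        also have "\<dots> \<le> q * ?a" using AA[OF x] q by (intro mult_left_mono) auto
        finally show ?thesis .
      qed
      finally have ab: "?b \<le> (1 + q) * ?a" "(1 - q) * ?a \<le> ?b"
        by (simp_all add: abs_le_iff algebra_simps)
      have E: "1 + q \<le> exp (2 * d)"
      proof -
        define E where "E = exp (2 * d)"
        have E0: "0 < E" by (simp add: E_def)
        have "0 \<le> (E - 1)\<^sup>2 / E" using E0 by simp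
        also have "\<dots> = E - 2 + 1 / E" using E0 by (simp add: power2_eq_square field_simps)
        finally show ?thesis by (simp add: q_def E_def exp_minus inverse_eq_divide)
      qed
      have a0: "0 \<le> ?a" using AA[OF x] mult_nonneg_nonneg[OF less_imp_le[OF \<epsilon>] sqnorm_nonneg[of N x]] by linarith
      show "?b \<le> exp (2 * d) * ?a" using ab(1) mult_right_mono[OF E a0] by linarith
      have "exp (2 * d) * ((1 - q) * ?a) \<le> exp (2 * d) * ?b" using ab(2) by (intro mult_left_mono) auto
      moreover have "exp (2 * d) * (1 - q) = 1" by (simp add: q_def exp_minus)
      ultimately show "?a \<le> exp (2 * d) * ?b" by (simp flip: mult.assoc)
    qed
    then have "hyperbolic_dist TYPE('k) \<rho> A B \<le> d" by (rule hyperbolic_dist_le[OF ctx A B(1) d])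
    then show ?thesis using e by (simp add: d_def)
  qed
  then show ?thesis using \<tau>0 by blast
qed

text \<open>The line \<open>s \<mapsto> s T\<close> through a square zero operator \<open>T\<close> of norm \<open>\<rho>\<close> leaves the open ball
  at \<open>s = 1\<close>.\<close>

lemma C_ball_boundary_line:
  assumes inf: "infinite_dimensional TYPE('h::complex_hilbert_space)" and \<rho>: "0 < \<rho>"
  obtains T :: "'n::finite \<Rightarrow> ('h::complex_hilbert_space \<Rightarrow>\<^sub>L 'h)" where "T \<in> BH" "T \<notin> C_ball \<rho>"
    "\<And>s. 0 \<le> s \<Longrightarrow> s < 1 \<Longrightarrow> (\<lambda>i. s *\<^sub>R T i) \<in> C_ball \<rho>"
    "\<And>s t. kernel_close \<rho> (\<rho> * \<bar>s - t\<bar>) (\<lambda>i. s *\<^sub>R T i) (\<lambda>i. t *\<^sub>R T i)"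
proof -
  obtain e :: "nat \<Rightarrow> 'h" where e: "orthonormal_on {..<2} e"
    using infinite_dimensional_orthonormal[OF inf] by blast
  have e01: "cinner (e 0) (e 0) = 1" "cinner (e (Suc 0)) (e (Suc 0)) = 1" "cinner (e (Suc 0)) (e 0) = 0"
    using e by (auto simp: orthonormal_on_def)
  have norm_e: "norm (e 0) = 1" "norm (e (Suc 0)) = 1"
    using e01(1,2) by (simp_all add: norm_eq_sqrt_inner inner_eq_Re_cinner)
  fix i0 :: 'n
  \<comment> \<open>One slot carries \<rho> times the partial isometry from \<open>e 0\<close> to
    \<open>e 1\<close>; orthogonality of the two vectors makes its square 0.\<close>
  define T where "T = (\<lambda>i. if i = i0 then \<rho> *\<^sub>R rank_one (e 0) (e 1) else (0 :: 'h \<Rightarrow>\<^sub>L 'h))"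
  have T: "T \<in> BH" by (simp add: BH_def T_def complex_linear_scaleR complex_linear_rank_one)
  have TT: "T i (T j v) = 0" for i j v
    by (simp add: T_def blinfun.scaleR_left blinfun.zero_right cinner_scaleR_left cinner_scaleC_left e01)
  define Z where "Z = (\<lambda>N x. 2 * Re (\<Sum>\<alpha>\<in>words N. cinner (backshift T x \<alpha>) (x \<alpha> :: 'h)))"
  have bT: "backshift T x \<alpha> = (\<rho> * cinner (x (\<alpha> @ [i0])) (e 0)) *\<^sub>C e (Suc 0)" for x \<alpha>
  proof -
    have "backshift T x \<alpha> = (\<Sum>i\<in>UNIV. if i = i0 then (\<rho> * cinner (x (\<alpha> @ [i0])) (e 0)) *\<^sub>C e (Suc 0) else 0)"
      unfolding backshift_def
      by (intro sum.cong) (auto simp: T_def blinfun.scaleR_left scaleC_scaleC[symmetric] scaleC_of_real)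
    then show ?thesis by simp
  qed
  \<comment> \<open>Products of two shifts vanish, so the resolvent is \<open>x + s T x\<close> and
    the form is affine in \<open>s\<close>.\<close>
  have form: "kernel_form \<rho> (\<lambda>i. s *\<^sub>R T i) N x = \<rho> * sqnorm N x + s * Z N x" if x: "supported N x" for s N x
  proof -
    let ?A = "\<lambda>i. s *\<^sub>R T i"
    have b: "backshift ?A x \<alpha> = s *\<^sub>R backshift T x \<alpha>" for x \<alpha> by (rule backshift_scaleR)
    have "backshift ?A (\<lambda>\<alpha>. x \<alpha> + backshift ?A x \<alpha>) \<alpha> = backshift ?A x \<alpha>" for \<alpha>
      by (simp add: b bT cinner_add_left cinner_scaleR_left cinner_scaleC_left e01)
    then have "resolvent ?A N x = (\<lambda>\<alpha>. x \<alpha> + backshift ?A x \<alpha>)"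
      by (intro resolvent_unique) (use x supported_backshift[OF x, of ?A] in \<open>auto simp: supported_def\<close>)
    then show ?thesis
      by (simp add: kernel_form_eq b cinner_add_left cinner_scaleR_left sum.distrib sqnorm_of_real
          Z_def algebra_simps flip: sum_distrib_left Re_sum)
  qed
  \<comment> \<open>The sharp constant \<rho>, half of what the norm of \<open>T\<close> alone would
    give: each \<open>x \<beta>\<close> enters once through its \<open>e 0\<close> component and
    once through its \<open>e 1\<close> component, and Bessel's inequality bounds both
    together.\<close>
  have Z: "\<bar>Z N x\<bar> \<le> \<rho> * sqnorm N x" if x: "supported N x" for N x
  proof -
    let ?a = "\<lambda>\<beta>. (cmod (cinner (x \<beta>) (e 0)))\<^sup>2" and ?b = "\<lambda>\<beta>. (cmod (cinner (x \<beta>) (e (Suc 0))))\<^sup>2"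
    have bessel2: "?a \<beta> + ?b \<beta> \<le> (norm (x \<beta>))\<^sup>2" for \<beta>
      using bessel[OF e, of "x \<beta>"] by (simp add: numeral_2_eq_2)
    have pt: "\<bar>2 * Re (cinner (backshift T x \<alpha>) (x \<alpha>))\<bar> \<le> \<rho> * (?a (\<alpha> @ [i0]) + ?b \<alpha>)" for \<alpha>
    proof -
      have "\<bar>2 * Re (cinner (backshift T x \<alpha>) (x \<alpha>))\<bar> \<le> 2 * cmod (cinner (backshift T x \<alpha>) (x \<alpha>))"
        using abs_Re_le_cmod[of "cinner (backshift T x \<alpha>) (x \<alpha>)"] by (simp add: abs_mult)
      also have "\<dots> = \<rho> * (2 * cmod (cinner (x (\<alpha> @ [i0])) (e 0)) * cmod (cinner (x \<alpha>) (e (Suc 0))))"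
        using \<rho> by (simp add: bT cinner_scaleC_left norm_mult cinner_commute[of "e (Suc 0)" "x \<alpha>"])
      also have "\<dots> \<le> \<rho> * (?a (\<alpha> @ [i0]) + ?b \<alpha>)"
        using \<rho> by (intro mult_left_mono sum_squares_bound) auto
      finally show ?thesis .
    qed
    have "\<bar>Z N x\<bar> \<le> (\<Sum>\<alpha>\<in>words N. \<bar>2 * Re (cinner (backshift T x \<alpha>) (x \<alpha>))\<bar>)"
      unfolding Z_def Re_sum sum_distrib_left by (rule sum_abs)
    also have "\<dots> \<le> (\<Sum>\<alpha>\<in>words N. \<rho> * (?a (\<alpha> @ [i0]) + ?b \<alpha>))" by (intro sum_mono pt)
    also have "\<dots> = \<rho> * ((\<Sum>\<alpha>\<in>words N. \<Sum>\<gamma>\<in>{[i0]}. ?a (\<alpha> @ \<gamma>)) + (\<Sum>\<alpha>\<in>words N. ?b \<alpha>))"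
      by (simp add: sum.distrib flip: sum_distrib_left)
    also have "\<dots> \<le> \<rho> * ((\<Sum>\<alpha>\<in>words N. ?a \<alpha>) + (\<Sum>\<alpha>\<in>words N. ?b \<alpha>))"
      using \<rho> x by (intro mult_left_mono add_right_mono sum_append_le[where k = 1]) (auto simp: supported_def)
    also have "\<dots> \<le> \<rho> * sqnorm N x"
      unfolding sqnorm_def sum.distrib[symmetric] using \<rho> by (intro mult_left_mono sum_mono bessel2) auto
    finally show ?thesis .
  qed
  show ?thesis
  proof (rule that[OF T])
    show "T \<notin> C_ball \<rho>"
    proof
      assume "T \<in> C_ball \<rho>"
      then obtain \<epsilon> where \<epsilon>: "0 < \<epsilon>" "\<And>N x. supported N x \<Longrightarrow> \<epsilon> * sqnorm N x \<le> kernel_form \<rho> T N x"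
        unfolding C_ball_iff_kernel[OF inf \<rho>] by blast
      \<comment> \<open>The extremal family of the bound for \<open>Z\<close>: \<open>e 0\<close> at
        the letter and minus its image direction at the empty word, so that 2 \<rho> and the cross
        term cancel.\<close>
      have "kernel_form \<rho> T (Suc 0) (pair_family i0 (e 0) (- e (Suc 0))) = 0"
        by (simp add: kernel_form_pair_family T_def blinfun.scaleR_left cinner_scaleR_left
            cinner_minus_right e01 norm_e)
      then show False
        using \<epsilon>(2)[OF supported_pair_family[of i0 "e 0" "- e (Suc 0)"]] \<epsilon>(1)
        by (simp add: sqnorm_pair_family norm_e)
    qed
    fix s t :: real
    show "kernel_close \<rho> (\<rho> * \<bar>s - t\<bar>) (\<lambda>i. s *\<^sub>R T i) (\<lambda>i. t *\<^sub>R T i)"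
      unfolding kernel_close_def
    proof (intro allI impI)
      fix N and x :: "'n list \<Rightarrow> 'h" assume x: "supported N x"
      have "\<bar>s * Z N x - t * Z N x\<bar> = \<bar>s - t\<bar> * \<bar>Z N x\<bar>" by (simp flip: abs_mult left_diff_distrib)
      also have "\<dots> \<le> \<bar>s - t\<bar> * (\<rho> * sqnorm N x)" using Z[OF x] by (intro mult_left_mono) auto
      finally show "\<bar>kernel_form \<rho> (\<lambda>i. s *\<^sub>R T i) N x - kernel_form \<rho> (\<lambda>i. t *\<^sub>R T i) N x\<bar> \<le> \<rho> * \<bar>s - t\<bar> * sqnorm N x"
        by (simp add: form[OF x] mult_ac)
    qed
    assume s: "0 \<le> s" "s < 1"
    have "\<rho> * (1 - s) * sqnorm N x \<le> kernel_form \<rho> (\<lambda>i. s *\<^sub>R T i) N x \<and>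
        kernel_form \<rho> (\<lambda>i. s *\<^sub>R T i) N x \<le> \<rho> * (1 + s) * sqnorm N x" if x: "supported N x" for N x
    proof -
      have "\<bar>s * Z N x\<bar> \<le> s * (\<rho> * sqnorm N x)"
        using Z[OF x] s by (simp add: abs_mult mult_left_mono)
      then show ?thesis unfolding form[OF x] by (simp add: abs_le_iff algebra_simps)
    qed
    moreover have "0 < \<rho> * (1 - s)" using \<rho> s by simp
    ultimately show "(\<lambda>i. s *\<^sub>R T i) \<in> C_ball \<rho>"
      unfolding C_ball_iff_kernel[OF inf \<rho>] using BH_scaleR[OF T] by blast
  qed
qed

text \<open>Points \<open>s T\<close> with \<open>s\<close> tending to 1 are Cauchy by the Lipschitz
  bound. A limit in \<open>d\<close> would also be a norm limit, hence \<open>T\<close>, which is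
  outside. Stated for general \<open>d\<close> to serve both metrics.\<close>

lemma not_complete_on_line:
  fixes B :: "('n::finite \<Rightarrow> ('h::complex_hilbert_space \<Rightarrow>\<^sub>L 'h)) set"
  assumes m: "metric_on B d" and T: "T \<notin> B"
    and line: "\<And>s. 0 \<le> s \<Longrightarrow> s < 1 \<Longrightarrow> (\<lambda>i. s *\<^sub>R T i) \<in> B"
    and lip: "\<And>s t. 0 \<le> s \<Longrightarrow> s < 1 \<Longrightarrow> 0 \<le> t \<Longrightarrow> t < 1 \<Longrightarrow>
      d (\<lambda>i. s *\<^sub>R T i) (\<lambda>i. t *\<^sub>R T i) \<le> K * \<bar>s - t\<bar>"
    and norm_le: "\<And>X Y i. X \<in> B \<Longrightarrow> Y \<in> B \<Longrightarrow> norm (X i - Y i) \<le> 2 * d X Y"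
  shows "\<not> complete_on B d"
proof
  assume c: "complete_on B d"
  define s where "s = (\<lambda>n. 1 - inverse (real (Suc n)))"
  have s: "0 \<le> s n" "s n < 1" for n by (auto simp: s_def inverse_le_1_iff)
  have s_lim: "s \<longlonglongrightarrow> 1"
    unfolding s_def using tendsto_diff[OF tendsto_const LIMSEQ_inverse_real_of_nat, of 1] by simp
  define \<sigma> where "\<sigma> = (\<lambda>n i. s n *\<^sub>R T i)"
  have \<sigma>: "\<sigma> n \<in> B" for n unfolding \<sigma>_def by (rule line[OF s])
  have C: "\<exists>N. \<forall>m\<ge>N. \<forall>n\<ge>N. d (\<sigma> m) (\<sigma> n) < e" if e: "0 < e" for e
  proof -
    have K: "0 < \<bar>K\<bar> + 1" by simp
    then have "0 < e / (\<bar>K\<bar> + 1)" using e by simp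
    then obtain N where N: "\<And>m n. m \<ge> N \<Longrightarrow> n \<ge> N \<Longrightarrow> dist (s m) (s n) < e / (\<bar>K\<bar> + 1)"
      using metric_CauchyD[OF LIMSEQ_imp_Cauchy[OF s_lim]] by blast
    have "d (\<sigma> m) (\<sigma> n) < e" if "m \<ge> N" "n \<ge> N" for m n
    proof -
      have "d (\<sigma> m) (\<sigma> n) \<le> K * \<bar>s m - s n\<bar>" unfolding \<sigma>_def by (intro lip s)
      also have "\<dots> \<le> (\<bar>K\<bar> + 1) * \<bar>s m - s n\<bar>" by (intro mult_right_mono) auto
      also have "\<dots> < e" using N[OF that] K by (simp add: dist_real_def pos_less_divide_eq mult.commute)
      finally show ?thesis .
    qed
    then show ?thesis by blast
  qed
  obtain X where X: "X \<in> B" "\<And>e. 0 < e \<Longrightarrow> \<exists>N. \<forall>n\<ge>N. d (\<sigma> n) X < e"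
    using complete_onD[where \<sigma> = \<sigma>, OF m c \<sigma> C] by blast
  have "X i = T i" for i
  proof (rule LIMSEQ_unique)
    show "(\<lambda>n. \<sigma> n i) \<longlonglongrightarrow> T i"
      unfolding \<sigma>_def using tendsto_scaleR[OF s_lim tendsto_const[of "T i"]] by simp
    show "(\<lambda>n. \<sigma> n i) \<longlonglongrightarrow> X i"
    proof (rule LIMSEQ_I)
      fix e :: real assume "0 < e"
      then obtain N where N: "\<And>n. n \<ge> N \<Longrightarrow> d (\<sigma> n) X < e / 2" using X(2)[of "e / 2"] by auto
      have "norm (\<sigma> n i - X i) < e" if "n \<ge> N" for n
        using norm_le[OF \<sigma>[of n] X(1), of i] N[OF that] by simp
      then show "\<exists>N. \<forall>n\<ge>N. norm (\<sigma> n i - X i) < e" by blast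
    qed
  qed
  then have "X = T" by blast
  then show False using X(1) T by simp
qed

theorem theorem6p2:
  fixes \<rho> :: real
    and \<Delta> :: "('n::finite \<Rightarrow> ('h::complex_hilbert_space \<Rightarrow>\<^sub>L 'h)) set"
  defines "\<delta> \<equiv> (hyperbolic_dist TYPE('k::complex_hilbert_space) \<rho> ::
      ('n \<Rightarrow> ('h \<Rightarrow>\<^sub>L 'h)) \<Rightarrow> ('n \<Rightarrow> ('h \<Rightarrow>\<^sub>L 'h)) \<Rightarrow> real)"
    and "dK \<equiv> (caratheodory_dist TYPE('k) ::
      ('n \<Rightarrow> ('h \<Rightarrow>\<^sub>L 'h)) \<Rightarrow> ('n \<Rightarrow> ('h \<Rightarrow>\<^sub>L 'h)) \<Rightarrow> real)"
    and "B \<equiv> (C_ball \<rho> :: ('n \<Rightarrow> ('h \<Rightarrow>\<^sub>L 'h)) set)"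
  assumes "infinite_dimensional TYPE('h)"
    and "infinite_dimensional TYPE('k)"
    and "\<rho> > 0"
    and "\<Delta> \<in> harnack_parts TYPE('k) \<rho>"
    and "\<Delta> \<subseteq> C_prec0 \<rho>"
  shows "(metric_on \<Delta> \<delta> \<and> complete_on \<Delta> \<delta>)
    \<and> (metric_on \<Delta> dK \<and>
        (\<forall>U. openin (topology_on \<Delta> dK) U \<longrightarrow> openin (topology_on \<Delta> \<delta>) U))
    \<and> (metric_on B \<delta> \<and> metric_on B dK \<and> metric_on B row_dist \<and>
        topology_on B \<delta> = topology_on B dK \<and> topology_on B dK = topology_on B row_dist)
    \<and> (complete_on B \<delta> \<and> \<not> complete_on B dK \<and> \<not> complete_on B row_dist)"
proof -
  note infh = assms(4) and infk = assms(5) and \<rho> = assms(6)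
  have part: "is_part \<rho> \<Delta>" by (rule harnack_parts_is_part[OF infk assms(7)])
  have upper: "\<exists>C. \<forall>N x. supported N x \<longrightarrow> kernel_form \<rho> A N x \<le> C * sqnorm N x" if "A \<in> \<Delta>" for A
    using C_prec0_kernel_bounded assms(8) that by blast
  have partB: "is_part \<rho> B" unfolding B_def by (rule C_ball_is_part[OF infh \<rho>])
  have upperB: "\<exists>C. \<forall>N x. supported N x \<longrightarrow> kernel_form \<rho> A N x \<le> C * sqnorm N x" if "A \<in> B" for A
    using C_ball_kernel_bounded[OF infh \<rho>] that by (simp add: B_def)
  have \<delta>: "\<delta> = hyperbolic_dist TYPE('k) \<rho>" by (simp add: \<delta>_def)
  note ctx = infh infk \<rho> part \<delta> and ctxB = infh infk \<rho> partB \<delta>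
  have BBH: "B \<subseteq> BH" by (auto simp: B_def C_ball_def)
  have m\<delta>: "metric_on B \<delta>" by (rule metric_on_hyperbolic_dist[OF ctxB])
  have mK: "metric_on B dK"
    unfolding dK_def by (rule hyperbolic_finer_than_caratheodory(1)[OF infh infk \<rho> partB upperB])
  have mr: "metric_on B row_dist" by (rule metric_on_row_dist[OF BBH])
  have norm_dK: "norm (X i - Y i) \<le> 2 * dK X Y" if XY: "X \<in> B" "Y \<in> B" for X Y i
  proof -
    obtain \<eta> where \<eta>: "0 \<le> \<eta>" "kernel_close \<rho> \<eta> X Y" using part_kernel_close[OF \<rho> partB upperB XY] by blast
    show ?thesis
      unfolding dK_def by (rule norm_le_caratheodory_dist[OF infk _ _ \<eta>(2,1)]) (use XY BBH in auto)
  qed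
  \<comment> \<open>Three inclusions in a cycle: hyperbolic finer than Caratheodory, Caratheodory
    finer than norm, norm finer than hyperbolic.\<close>
  have \<delta>_dK: "openin (topology_on B \<delta>) U" if "openin (topology_on B dK) U" for U
    using hyperbolic_finer_than_caratheodory(2)[OF infh infk \<rho> partB upperB] that
    unfolding \<delta>_def dK_def by blast
  have dK_row: "openin (topology_on B dK) U" if "openin (topology_on B row_dist) U" for U
  proof (rule topology_on_finer[OF mK mr _ that])
    fix X and e :: real assume X: "X \<in> B" and e: "0 < e"
    \<comment> \<open>Each of the \<open>CARD('n)\<close> components differs by at most twice the
      Caratheodory distance, and the row norm is at most the sum of the component norms.\<close>
    define r where "r = e / (2 * real CARD('n))"
    have r: "0 < r" using e by (simp add: r_def)
    have "row_dist X Y < e" if Y: "Y \<in> B" "dK X Y < r" for Y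
    proof -
      have "row_dist X Y \<le> real CARD('n) * (2 * dK X Y)"
        by (rule row_dist_le_of_norm) (use X Y BBH norm_dK in auto)
      also have "\<dots> < real CARD('n) * (2 * r)" using Y by (intro mult_strict_left_mono) auto
      also have "\<dots> = e" by (simp add: r_def)
      finally show ?thesis .
    qed
    then show "\<exists>r>0. \<forall>Y\<in>B. dK X Y < r \<longrightarrow> row_dist X Y < e" using r by blast
  qed
  have row_\<delta>: "openin (topology_on B row_dist) U" if "openin (topology_on B \<delta>) U" for U
    by (rule topology_on_finer[OF mr m\<delta> _ that])
      (use row_dist_finer_than_hyperbolic[OF infh infk \<rho>] in \<open>simp add: B_def \<delta>_def\<close>)
  have top: "topology_on B \<delta> = topology_on B dK" "topology_on B dK = topology_on B row_dist"
    unfolding topology_eq using \<delta>_dK dK_row row_\<delta> by blast+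
  obtain T :: "'n \<Rightarrow> ('h \<Rightarrow>\<^sub>L 'h)" where T: "T \<in> BH" "T \<notin> B"
    "\<And>s. 0 \<le> s \<Longrightarrow> s < 1 \<Longrightarrow> (\<lambda>i. s *\<^sub>R T i) \<in> B"
    "\<And>s t. kernel_close \<rho> (\<rho> * \<bar>s - t\<bar>) (\<lambda>i. s *\<^sub>R T i) (\<lambda>i. t *\<^sub>R T i)"
    unfolding B_def using C_ball_boundary_line[OF infh \<rho>] by blast
  have ncK: "\<not> complete_on B dK"
  proof (rule not_complete_on_line[OF mK T(2,3) _ norm_dK])
    show "dK (\<lambda>i. s *\<^sub>R T i) (\<lambda>i. t *\<^sub>R T i) \<le> \<rho> * \<bar>s - t\<bar>" for s t
      unfolding dK_def
      by (rule caratheodory_dist_le[OF infk BH_scaleR[OF T(1)] BH_scaleR[OF T(1)] T(4)]) (use \<rho> in simp)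
  qed
  have ncr: "\<not> complete_on B row_dist"
  proof (rule not_complete_on_line[OF mr T(2,3)])
    show "row_dist (\<lambda>i. s *\<^sub>R T i) (\<lambda>i. t *\<^sub>R T i) \<le> real CARD('n) * (\<Sum>i\<in>UNIV. norm (T i)) * \<bar>s - t\<bar>" for s t
      unfolding mult.assoc
    proof (rule row_dist_le_of_norm[OF BH_scaleR[OF T(1)] BH_scaleR[OF T(1)]])
      fix i
      have "norm (s *\<^sub>R T i - t *\<^sub>R T i) = norm (T i) * \<bar>s - t\<bar>"
        by (simp add: mult.commute flip: scaleR_left_diff_distrib)
      also have "\<dots> \<le> (\<Sum>i\<in>UNIV. norm (T i)) * \<bar>s - t\<bar>"
        by (intro mult_right_mono member_le_sum) auto
      finally show "norm (s *\<^sub>R T i - t *\<^sub>R T i) \<le> (\<Sum>i\<in>UNIV. norm (T i)) * \<bar>s - t\<bar>" .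
    qed
    show "norm (X i - Y i) \<le> 2 * row_dist X Y" if "X \<in> B" "Y \<in> B" for X Y i
    proof -
      have "norm (X i - Y i) \<le> row_dist X Y"
        unfolding row_dist_def by (rule norm_le_row_norm[OF BH_diff]) (use that BBH in auto)
      then show ?thesis using norm_ge_zero[of "X i - Y i"] by linarith
    qed
  qed
  show ?thesis
    using metric_on_hyperbolic_dist[OF ctx] complete_on_hyperbolic_dist[OF ctx]
      hyperbolic_finer_than_caratheodory[OF infh infk \<rho> part upper]
      complete_on_hyperbolic_dist[OF ctxB] m\<delta> mK mr top ncK ncr
    unfolding dK_def \<delta>_def by blast
qed

end
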